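(* The modular curve attached to $\Gamma(2)\cap\Gamma_1(7)$ has function field \[ \mathcal A_0(\Gamma(2)\cap\Gamma_1(7))=\mathbf C(\upsilon,g_1,g_2)=\mathbf C(g_1,g_2), \] and, with $Z_1=g_1$, $Z_2=g_2$, the plane model \[ (Z_1+Z_2)(Z_1+Z_2+2)Z_1^2Z_2^2+2(Z_1+Z_2+1)(Z_1+Z_2+2)Z_1Z_2-(Z_1+Z_2)^2(Z_1+Z_2+1)^2=0. \] It has genus $4$.
   Context: For a congruence subgroup $G\subset\mathrm{SL}_2(\mathbf Z)$, $\mathcal A_0(G)$ denotes the field of modular functions for $G$ over $\mathbf C$, i.e. the function field of the associated compact modular curve. For $k=1,2,3$ put $a_k(\tau)=\sum_{n\in\mathbf Z}(-1)^{n+k+1}q^{(14n+7-2k)^2/56}$, where $q^r=e^{2\pi i r\tau}$, and $\upsilon=a_2^2a_3/a_1^3$, $\phi_1=-a_3/a_2$, $\phi_2=-a_2/a_1$. One has $\mathcal A_0(\Gamma_1(7))=\mathbf C(\upsilon)$. Put $g_1(\tau)=\phi_1(\tau)^2/\phi_1(2\tau)$ and $g_2(\tau)=\phi_1(\tau)\phi_1(\tau/2)\phi_1(2\tau)-\phi_1(2\tau)/\phi_2(\tau)$; these are two of the three roots of $T^3+T^2-\frac{\upsilon^2-1}{\upsilon}T+\frac{(\upsilon-1)^2}{\upsilon}$. *)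

theory Defs
  imports
    "HOL-Complex_Analysis.Complex_Analysis"
    "HOL-Computational_Algebra.Computational_Algebra"
    "HOL-Number_Theory.Cong"
    "HOL.Hull"
begin

section \<open>The field of meromorphic functions on the upper half-plane\<close>

definition uhp :: "complex set" where
  "uhp = {\<tau>. Im \<tau> > 0}"

lemma open_uhp: "open uhp"
  unfolding uhp_def by (rule open_halfspace_Im_gt)

lemma connected_uhp: "connected uhp"
  unfolding uhp_def by (intro convex_connected convex_halfspace_Im_gt)

lemma uhp_nonempty: "uhp \<noteq> {}"
proof -
  have "\<i> \<in> uhp" by (simp add: uhp_def)
  thus ?thesis by blast
qed

text \<open>
  Meromorphic functions are total functions in HOL, with arbitrary values at the poles. Two of
  them are therefore identified if they agree away from a discrete set.
\<close>
definition mero_eq :: "(complex \<Rightarrow> complex) \<Rightarrow> (complex \<Rightarrow> complex) \<Rightarrow> bool" where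
  "mero_eq f g \<longleftrightarrow> f meromorphic_on uhp \<and> g meromorphic_on uhp \<and> (\<forall>\<^sub>\<approx>\<tau>\<in>uhp. f \<tau> = g \<tau>)"

quotient_type mero = "complex \<Rightarrow> complex" / partial: mero_eq
proof (rule part_equivpI)
  show "\<exists>f. mero_eq f f"
    by (rule exI[of _ "\<lambda>_. 0"]) (auto simp: mero_eq_def)
  show "symp mero_eq"
    by (auto intro!: sympI simp: mero_eq_def eq_commute)
  show "transp mero_eq"
    unfolding mero_eq_def by (intro transpI conjI) (auto elim!: eventually_rev_mp)
qed

instantiation mero :: field
begin

lift_definition zero_mero :: mero is "\<lambda>_. 0"
  by (auto simp: mero_eq_def)

lift_definition one_mero :: mero is "\<lambda>_. 1"
  by (auto simp: mero_eq_def)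

lift_definition plus_mero :: "mero \<Rightarrow> mero \<Rightarrow> mero" is "\<lambda>f g \<tau>. f \<tau> + g \<tau>"
  by (auto simp: mero_eq_def intro!: meromorphic_intros elim: eventually_elim2)

lift_definition uminus_mero :: "mero \<Rightarrow> mero" is "\<lambda>f \<tau>. - f \<tau>"
  by (auto simp: mero_eq_def intro!: meromorphic_intros elim: eventually_mono)

lift_definition minus_mero :: "mero \<Rightarrow> mero \<Rightarrow> mero" is "\<lambda>f g \<tau>. f \<tau> - g \<tau>"
  by (auto simp: mero_eq_def intro!: meromorphic_intros elim: eventually_elim2)

lift_definition times_mero :: "mero \<Rightarrow> mero \<Rightarrow> mero" is "\<lambda>f g \<tau>. f \<tau> * g \<tau>"
  by (auto simp: mero_eq_def intro!: meromorphic_intros elim: eventually_elim2)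

lift_definition inverse_mero :: "mero \<Rightarrow> mero" is "\<lambda>f \<tau>. inverse (f \<tau>)"
  by (auto simp: mero_eq_def intro!: meromorphic_intros elim: eventually_mono)

lift_definition divide_mero :: "mero \<Rightarrow> mero \<Rightarrow> mero" is "\<lambda>f g \<tau>. f \<tau> / g \<tau>"
  by (auto simp: mero_eq_def intro!: meromorphic_intros elim: eventually_elim2)

instance
proof
  fix a b c :: mero
  show "a * b * c = a * (b * c)"
    by transfer (auto simp: mero_eq_def mult.assoc intro!: meromorphic_intros)
  show "a * b = b * a"
    by transfer (auto simp: mero_eq_def mult.commute intro!: meromorphic_intros)
  show "1 * a = a"
    by transfer (auto simp: mero_eq_def)
  show "a + b + c = a + (b + c)"
    by transfer (auto simp: mero_eq_def add.assoc intro!: meromorphic_intros)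
  show "a + b = b + a"
    by transfer (auto simp: mero_eq_def add.commute intro!: meromorphic_intros)
  show "0 + a = a"
    by transfer (auto simp: mero_eq_def)
  show "- a + a = 0"
    by transfer (auto simp: mero_eq_def)
  show "a - b = a + - b"
    by transfer (auto simp: mero_eq_def intro!: meromorphic_intros)
  show "(a + b) * c = a * c + b * c"
    by transfer (auto simp: mero_eq_def ring_distribs intro!: meromorphic_intros)
  show "(0 :: mero) \<noteq> 1"
    by transfer (use uhp_nonempty in \<open>auto simp: mero_eq_def trivial_limit_def [symmetric]\<close>)
  show "a \<noteq> 0 \<Longrightarrow> inverse a * a = 1"
  proof transfer
    fix f assume f: "mero_eq f f" and nz: "\<not> mero_eq f (\<lambda>_. 0)"
    have mero: "f meromorphic_on uhp"
      using f by (simp add: mero_eq_def)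
    have "(\<forall>\<^sub>\<approx>\<tau>\<in>uhp. f \<tau> = 0) \<or> (\<forall>\<^sub>\<approx>\<tau>\<in>uhp. f \<tau> \<noteq> 0)"
      by (rule meromorphic_imp_constant_or_avoid[OF mero open_uhp connected_uhp])
    with nz mero have "\<forall>\<^sub>\<approx>\<tau>\<in>uhp. f \<tau> \<noteq> 0"
      by (auto simp: mero_eq_def)
    hence "\<forall>\<^sub>\<approx>\<tau>\<in>uhp. inverse (f \<tau>) * f \<tau> = 1"
      by eventually_elim simp
    with mero show "mero_eq (\<lambda>\<tau>. inverse (f \<tau>) * f \<tau>) (\<lambda>_. 1)"
      by (auto simp: mero_eq_def intro!: meromorphic_intros)
  qed
  show "a div b = a * inverse b"
    by transfer (auto simp: mero_eq_def field_simps intro!: meromorphic_intros)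
  show "inverse (0 :: mero) = 0"
    by transfer (auto simp: mero_eq_def)
qed

end

text \<open>The class of a function; only meaningful for functions that are meromorphic on \<^const>\<open>uhp\<close>.\<close>
definition mero_of :: "(complex \<Rightarrow> complex) \<Rightarrow> mero" where
  "mero_of f = (if f meromorphic_on uhp then abs_mero f else 0)"

lift_definition mero_const :: "complex \<Rightarrow> mero" is "\<lambda>c _. c"
  by (auto simp: mero_eq_def)

lemma mero_const_add: "mero_const (a + b) = mero_const a + mero_const b"
  by transfer (auto simp: mero_eq_def)

lemma mero_const_mult: "mero_const (a * b) = mero_const a * mero_const b"
  by transfer (auto simp: mero_eq_def)

lemma mero_const_1: "mero_const 1 = 1"
  by transfer (auto simp: mero_eq_def)

definition mero_scale :: "complex \<Rightarrow> mero \<Rightarrow> mero" where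
  "mero_scale c f = mero_const c * f"

interpretation mero: vector_space mero_scale
  by unfold_locales
     (auto simp: mero_scale_def mero_const_add mero_const_mult mero_const_1 algebra_simps)


section \<open>Modular functions\<close>

definition SL2Z :: "(int^2^2) set" where
  "SL2Z = {A. det A = 1}"

definition Gamma_principal :: "int \<Rightarrow> (int^2^2) set" where
  "Gamma_principal N = {A \<in> SL2Z. [A$1$1 = 1] (mod N) \<and> [A$1$2 = 0] (mod N) \<and>
                        [A$2$1 = 0] (mod N) \<and> [A$2$2 = 1] (mod N)}"

definition Gamma1 :: "int \<Rightarrow> (int^2^2) set" where
  "Gamma1 N = {A \<in> SL2Z. [A$1$1 = 1] (mod N) \<and> [A$2$1 = 0] (mod N) \<and> [A$2$2 = 1] (mod N)}"

definition moebius :: "int^2^2 \<Rightarrow> complex \<Rightarrow> complex" where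
  "moebius A \<tau> = (of_int (A$1$1) * \<tau> + of_int (A$1$2)) / (of_int (A$2$1) * \<tau> + of_int (A$2$2))"

text \<open>
  \<open>f\<close> is meromorphic at the cusp \<open>\<infinity>\<close> if, for \<open>Im \<tau>\<close> large, it is a function of
  $q^{1/N} = e^{2 \pi i \tau / N}$ that extends meromorphically to $q^{1/N} = 0$.
\<close>
definition meromorphic_at_infinity_cusp :: "(complex \<Rightarrow> complex) \<Rightarrow> bool" where
  "meromorphic_at_infinity_cusp f \<longleftrightarrow>
     (\<exists>N::nat. N > 0 \<and> (\<exists>h. h meromorphic_on {0} \<and>
        (\<exists>y>0. \<forall>\<^sub>\<approx>\<tau>\<in>{\<tau>. Im \<tau> > y}. f \<tau> = h (exp (2 * pi * \<i> * \<tau> / of_nat N)))))"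

definition modular_function :: "(int^2^2) set \<Rightarrow> (complex \<Rightarrow> complex) \<Rightarrow> bool" where
  "modular_function G f \<longleftrightarrow>
     f meromorphic_on uhp \<and>
     (\<forall>A\<in>G. \<forall>\<^sub>\<approx>\<tau>\<in>uhp. f (moebius A \<tau>) = f \<tau>) \<and>
     (\<forall>A\<in>SL2Z. meromorphic_at_infinity_cusp (\<lambda>\<tau>. f (moebius A \<tau>)))"

definition A0 :: "(int^2^2) set \<Rightarrow> mero set" where
  "A0 G = mero_of ` {f. modular_function G f}"


section \<open>Subfields, plane models and the genus\<close>

definition C_subfield :: "mero set \<Rightarrow> bool" where
  "C_subfield F \<longleftrightarrow>
     range mero_const \<subseteq> F \<and>
     (\<forall>x\<in>F. \<forall>y\<in>F. x + y \<in> F \<and> x * y \<in> F) \<and>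
     (\<forall>x\<in>F. - x \<in> F \<and> inverse x \<in> F)"

definition C_adjoin :: "mero set \<Rightarrow> mero set" where
  "C_adjoin S = C_subfield hull S"

text \<open>Polynomials over \<open>\<complex>\<close> in two variables are elements of \<open>\<complex>[Z\<^sub>1][Z\<^sub>2]\<close>.\<close>
definition Z1 :: "complex poly poly" where
  "Z1 = [:[:0, 1:]:]"

definition Z2 :: "complex poly poly" where
  "Z2 = [:0, 1:]"

definition eval2 :: "complex poly poly \<Rightarrow> mero \<Rightarrow> mero \<Rightarrow> mero" where
  "eval2 p x y = poly (map_poly (\<lambda>r. poly (map_poly mero_const r) x) p) y"

text \<open>
  \<open>p(Z\<^sub>1, Z\<^sub>2) = 0\<close> is a plane model of the curve with function field \<open>F\<close>, the coordinate
  functions being \<open>Z\<^sub>1 = x\<close> and \<open>Z\<^sub>2 = y\<close>: the map \<open>(x, y)\<close> is birational onto the irreducible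
  plane curve \<open>p = 0\<close>.
\<close>
definition plane_model :: "mero set \<Rightarrow> mero \<Rightarrow> mero \<Rightarrow> complex poly poly \<Rightarrow> bool" where
  "plane_model F x y p \<longleftrightarrow> F = C_adjoin {x, y} \<and> irreducible p \<and> eval2 p x y = 0"

text \<open>
  The genus of a function field \<open>F\<close> in one variable over \<open>\<complex>\<close> is
  $\max_D (\deg D - \ell(D) + 1)$, where \<open>D\<close> runs over the divisors of \<open>F\<close>. A place, that is, a
  point of the smooth projective model, is represented by its valuation ring.
  Since \<open>\<complex>\<close> is algebraically closed, every place has degree one.
\<close>
definition places :: "mero set \<Rightarrow> mero set set" where
  "places F = {R. range mero_const \<subset> R \<and> R \<subset> F \<and>
                  (\<forall>x\<in>R. \<forall>y\<in>R. x + y \<in> R \<and> x - y \<in> R \<and> x * y \<in> R) \<and>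
                  (\<forall>x\<in>F. x \<in> R \<or> inverse x \<in> R)}"

definition place_units :: "mero set \<Rightarrow> mero set" where
  "place_units R = {x \<in> R. x \<noteq> 0 \<and> inverse x \<in> R}"

definition uniformizer :: "mero set \<Rightarrow> mero \<Rightarrow> bool" where
  "uniformizer R t \<longleftrightarrow> R - place_units R = (\<lambda>x. t * x) ` R"

definition place_ord :: "mero set \<Rightarrow> mero \<Rightarrow> int" where
  "place_ord R x = (THE n. \<exists>t u. uniformizer R t \<and> u \<in> place_units R \<and> x = t powi n * u)"

definition divisors :: "mero set \<Rightarrow> (mero set \<Rightarrow> int) set" where
  "divisors F = {D. finite {R. D R \<noteq> 0} \<and> {R. D R \<noteq> 0} \<subseteq> places F}"

definition div_degree :: "(mero set \<Rightarrow> int) \<Rightarrow> int" where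
  "div_degree D = (\<Sum>R | D R \<noteq> 0. D R)"

definition RR_space :: "mero set \<Rightarrow> (mero set \<Rightarrow> int) \<Rightarrow> mero set" where
  "RR_space F D = {x \<in> F. x = 0 \<or> (\<forall>R\<in>places F. place_ord R x \<ge> - D R)}"

definition RR_dim :: "mero set \<Rightarrow> (mero set \<Rightarrow> int) \<Rightarrow> nat" where
  "RR_dim F D = mero.dim (RR_space F D)"

definition has_genus :: "mero set \<Rightarrow> nat \<Rightarrow> bool" where
  "has_genus F g \<longleftrightarrow>
     (\<exists>D\<in>divisors F. div_degree D - int (RR_dim F D) + 1 = int g) \<and>
     (\<forall>D\<in>divisors F. div_degree D - int (RR_dim F D) + 1 \<le> int g)"


section \<open>The generating functions\<close>

definition theta_a :: "nat \<Rightarrow> complex \<Rightarrow> complex" where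
  "theta_a k \<tau> = (\<Sum>\<^sub>\<infinity>n::int. (-1) powi (n + int k + 1) *
                     exp (2 * pi * \<i> * (of_int ((14 * n + 7 - 2 * int k)\<^sup>2) / 56) * \<tau>))"

definition upsilon_fun :: "complex \<Rightarrow> complex" where
  "upsilon_fun \<tau> = (theta_a 2 \<tau>)\<^sup>2 * theta_a 3 \<tau> / (theta_a 1 \<tau>) ^ 3"

definition phi1 :: "complex \<Rightarrow> complex" where
  "phi1 \<tau> = - theta_a 3 \<tau> / theta_a 2 \<tau>"

definition phi2 :: "complex \<Rightarrow> complex" where
  "phi2 \<tau> = - theta_a 2 \<tau> / theta_a 1 \<tau>"

definition g1_fun :: "complex \<Rightarrow> complex" where
  "g1_fun \<tau> = (phi1 \<tau>)\<^sup>2 / phi1 (2 * \<tau>)"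

definition g2_fun :: "complex \<Rightarrow> complex" where
  "g2_fun \<tau> = phi1 \<tau> * phi1 (\<tau> / 2) * phi1 (2 * \<tau>) - phi1 (2 * \<tau>) / phi2 \<tau>"

definition upsilon :: mero where
  "upsilon = mero_of upsilon_fun"

definition g1 :: mero where
  "g1 = mero_of g1_fun"

definition g2 :: mero where
  "g2 = mero_of g2_fun"

end

theory Submission
  imports Defs
begin

text \<open>
  The theta series are products of Klein forms, whose transformation behaviour makes \<open>upsilon\<close>, \<open>g1\<close>
  and the third root \<open>g0 = -1 - g1 - g2\<close> of the cubic modular; three-term theta relations give the cubic.
  Since \<open>upsilon\<close> is holomorphic on the upper half-plane with a single simple pole at the cusps of
  \<open>Gamma1 7\<close>, it generates the modular functions for that group. A combination of \<open>g1\<close> and \<open>g0\<close>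
  separates the cosets of the smaller group, so Lagrange interpolation yields its function field, and
  eliminating \<open>upsilon\<close> from the cubic gives the plane model.

  For the genus, the Lagrange resolvent of the cubic shows that the function field is \<open>\<complex>(u, v)\<close> with
  a relation bilinear in \<open>u\<^sup>3\<close> and \<open>v\<^sup>3\<close>. Moving one of its total ramification points to infinity turns it into
  \<open>y\<^sup>3 = f(x) g(x)\<^sup>2\<close> with \<open>f g\<close> squarefree, \<open>deg f = 3\<close>, \<open>deg g = 2\<close>. With \<open>w = y\<^sup>2 / g(x)\<close>, the functions
  regular away from infinity are the \<open>\<complex>[x]\<close>-combinations of \<open>1, y, w\<close>, which have pole orders \<open>0, 7, 8\<close> there while
  \<open>x\<close> has pole order \<open>3\<close>; the gaps are \<open>1, 2, 4, 5\<close>.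
\<close>

section \<open>Moebius transformations of the upper half-plane\<close>

abbreviation m11 :: "int^2^2 => int" where "m11 A == A $ 1 $ 1"
abbreviation m12 :: "int^2^2 => int" where "m12 A == A $ 1 $ 2"
abbreviation m21 :: "int^2^2 => int" where "m21 A == A $ 2 $ 1"
abbreviation m22 :: "int^2^2 => int" where "m22 A == A $ 2 $ 2"

definition mat2 :: "int => int => int => int => int^2^2" where
 "mat2 a b c d = vector [vector [a, b], vector [c, d]]"

lemma mat2_nth [simp]:
 "m11 (mat2 a b c d) = a" "m12 (mat2 a b c d) = b" "m21 (mat2 a b c d) = c" "m22 (mat2 a b c d) = d"
 unfolding mat2_def vector_2 by (rule refl)+

lemma mat2_eqI:
 "m11 A = m11 B ==> m12 A = m12 B ==> m21 A = m21 B ==> m22 A = m22 B ==> A = B" unfolding vec_eq_iff forall_2 by blast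

lemma SL2Z_iff: "A : SL2Z \<longleftrightarrow> m11 A * m22 A - m12 A * m21 A = 1" by (simp add: SL2Z_def det_2)

lemma mult_nth:
 fixes A B :: "int^2^2"
 shows "m11 (A ** B) = m11 A * m11 B + m12 A * m21 B" "m12 (A ** B) = m11 A * m12 B + m12 A * m22 B"
  "m21 (A ** B) = m21 A * m11 B + m22 A * m21 B" "m22 (A ** B) = m21 A * m12 B + m22 A * m22 B"
 by (simp_all add: matrix_matrix_mult_def sum_2)

lemma SL2Z_mult: "A : SL2Z ==> B : SL2Z ==> A ** B : SL2Z" by (simp add: SL2Z_def det_mul)

definition SL2_inv :: "int^2^2 => int^2^2" where
 "SL2_inv A = mat2 (m22 A) (- m12 A) (- m21 A) (m11 A)"

lemma SL2_inv_nth [simp]: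
 "m11 (SL2_inv A) = m22 A" "m12 (SL2_inv A) = - m12 A" "m21 (SL2_inv A) = - m21 A" "m22 (SL2_inv A) = m11 A" by (simp_all add: SL2_inv_def)

lemma SL2_inv_SL2Z: "A : SL2Z ==> SL2_inv A : SL2Z" by (simp add: SL2Z_iff mult.commute)

lemma SL2_inv_mult: "A : SL2Z ==> SL2_inv A ** A = mat 1" "A : SL2Z ==> A ** SL2_inv A = mat 1"
 by (rule mat2_eqI; simp add: mult_nth mat_def SL2Z_iff algebra_simps)+

lemma mat_1_SL2Z: "mat 1 : SL2Z" by (simp add: SL2Z_def)

definition automorphy :: "int^2^2 => complex => complex" where
 "automorphy A t = of_int (m21 A) * t + of_int (m22 A)"

lemma automorphy_nz:
 assumes "A : SL2Z" "t : uhp"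
 shows "automorphy A t ~= 0"
proof
 assume eq: "automorphy A t = 0"
 hence "of_int (m21 A) * Im t = 0" by (simp add: complex_eq_iff automorphy_def)
 hence "m21 A = 0" using assms(2) by (simp add: uhp_def)
 moreover from this have "m22 A = 0" using eq by (simp add: automorphy_def)
 ultimately show False using assms(1) by (simp add: SL2Z_iff)
qed

lemma moebius_times_automorphy:
 "A : SL2Z ==> t : uhp ==> moebius A t * automorphy A t = of_int (m11 A) * t + of_int (m12 A)"
 using automorphy_nz[of A t] by (simp add: moebius_def automorphy_def)

lemma moebius_in_uhp:
 assumes "A : SL2Z" "t : uhp"
 shows "moebius A t : uhp"
proof -
 have "Im (moebius A t) = of_int (m11 A * m22 A - m12 A * m21 A) * Im t / norm (automorphy A t) ^ 2"
  by (simp add: moebius_def automorphy_def Im_divide cmod_power2 algebra_simps)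
 also have "... = Im t / norm (automorphy A t) ^ 2" using assms(1) by (simp add: SL2Z_iff)
 finally show ?thesis using assms automorphy_nz[OF assms] by (simp add: uhp_def)
qed

lemma moebius_1 [simp]: "moebius (mat 1) t = t" by (simp add: moebius_def mat_def)

lemma moebius_mult:
 assumes "A : SL2Z" "B : SL2Z" "t : uhp"
 shows "moebius (A ** B) t = moebius A (moebius B t)"
proof -
 have row: "of_int (p * m11 B + q * m21 B) * t + of_int (p * m12 B + q * m22 B) =
  (of_int p * moebius B t + of_int q) * automorphy B t" for p q
  using moebius_times_automorphy[OF assms(2,3)] by (simp add: algebra_simps) (simp add: automorphy_def algebra_simps)
 show ?thesis unfolding moebius_def[of "A ** B"] mult_nth row using automorphy_nz[OF assms(2,3)] by (simp add: moebius_def[of A])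
qed

lemma moebius_SL2_inv:
 assumes "A : SL2Z" "t : uhp"
 shows "moebius A (moebius (SL2_inv A) t) = t" "moebius (SL2_inv A) (moebius A t) = t"
 using assms by (simp_all add: moebius_mult[symmetric] SL2_inv_SL2Z SL2_inv_mult)

lemma moebius_translation: "moebius (mat2 1 n 0 1) t = t + of_int n" by (simp add: moebius_def)

lemma moebius_holomorphic: "A : SL2Z ==> moebius A holomorphic_on uhp"
 unfolding moebius_def by (intro holomorphic_intros) (auto simp: automorphy_nz simp flip: automorphy_def)

section \<open>Theta functions\<close>

subsection \<open>Infinite q-products\<close>

definition qpoch :: "complex => complex => complex" where
 "qpoch x p = (\<Prod>n. 1 - x * p ^ n)"

lemma convergent_prod_qpoch:
 fixes p :: complex
 assumes "norm p < 1"
 shows "convergent_prod (%n. 1 - x * p ^ n)"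
proof -
 have "summable (%n. norm x * norm p ^ n)" using assms by (intro summable_mult summable_geometric) auto
 hence "summable (%n. norm ((1 - x * p ^ n) - 1))" by (simp add: norm_mult norm_power del: summable_cmult_iff)
 thus ?thesis by (intro abs_convergent_prod_imp_convergent_prod summable_imp_abs_convergent_prod)
qed

lemma qpoch_LIMSEQ:
 assumes "norm p < 1"
 shows "(%N. PROD n<N. 1 - x * p ^ n) \<longlonglongrightarrow> qpoch x p"
proof -
 have "(%N. PROD n<=N. 1 - x * p ^ n) \<longlonglongrightarrow> qpoch x p"
  unfolding qpoch_def by (rule convergent_prod_LIMSEQ[OF convergent_prod_qpoch[OF assms]])
 hence "(%N. PROD n<Suc N. 1 - x * p ^ n) \<longlonglongrightarrow> qpoch x p" by (simp only: lessThan_Suc_atMost)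
 thus ?thesis by (rule LIMSEQ_imp_Suc)
qed

lemma qpoch_rec:
 assumes "norm p < 1"
 shows "qpoch x p = (1 - x) * qpoch (x * p) p"
proof (rule LIMSEQ_unique)
 show "(%N. PROD n<Suc N. 1 - x * p ^ n) \<longlonglongrightarrow> qpoch x p" using qpoch_LIMSEQ[OF assms, of x] by (rule LIMSEQ_Suc)
 have "(PROD n<Suc N. 1 - x * p ^ n) = (1 - x) * (PROD n<N. 1 - x * p * p ^ n)" for N
  by (subst prod.lessThan_Suc_shift) (simp add: mult.assoc)
 thus "(%N. PROD n<Suc N. 1 - x * p ^ n) \<longlonglongrightarrow> (1 - x) * qpoch (x * p) p"
  using tendsto_mult[OF tendsto_const qpoch_LIMSEQ[OF assms, of "x * p"]] by simp
qed

lemma qpoch_nonzero: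
 assumes "norm p < 1" "!!n. x * p ^ n ~= 1"
 shows "qpoch x p ~= 0" unfolding qpoch_def
 by (rule prodinf_nonzero[OF convergent_prod_qpoch]) (use assms in \<open>auto simp: eq_diff_eq\<close>)

lemma qpoch_square:
 assumes "norm p < 1"
 shows "qpoch (x\<^sup>2) (p\<^sup>2) = qpoch x p * qpoch (- x) p"
proof (rule LIMSEQ_unique)
 have p2: "norm (p\<^sup>2) < 1" using assms by (simp add: norm_power power_less_one_iff)
 show "(%N. PROD n<N. 1 - x\<^sup>2 * (p\<^sup>2) ^ n) \<longlonglongrightarrow> qpoch (x\<^sup>2) (p\<^sup>2)"
  by (rule qpoch_LIMSEQ[OF p2])
 have "(1 - x * p ^ n) * (1 - - x * p ^ n) = 1 - x\<^sup>2 * (p\<^sup>2) ^ n" for n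
  by (simp add: algebra_simps power2_eq_square power_mult_distrib)
 hence "(PROD n<N. 1 - x * p ^ n) * (PROD n<N. 1 - - x * p ^ n) = (PROD n<N. 1 - x\<^sup>2 * (p\<^sup>2) ^ n)" for N
  by (simp only: prod.distrib[symmetric])
 thus "(%N. PROD n<N. 1 - x\<^sup>2 * (p\<^sup>2) ^ n) \<longlonglongrightarrow> qpoch x p * qpoch (- x) p"
  using tendsto_mult[OF qpoch_LIMSEQ[OF assms, of x] qpoch_LIMSEQ[OF assms, of "- x"]] by simp
qed

lemma qpoch_even_odd:
 assumes "norm p < 1"
 shows "qpoch x p = qpoch x (p\<^sup>2) * qpoch (x * p) (p\<^sup>2)"
proof (rule LIMSEQ_unique)
 have p2: "norm (p\<^sup>2) < 1" using assms by (simp add: norm_power power_less_one_iff)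
 have "strict_mono (%N::nat. 2 * N)" by (auto simp: strict_mono_def)
 from LIMSEQ_subseq_LIMSEQ[OF qpoch_LIMSEQ[OF assms, of x] this]
 show "(%N. PROD n<2*N. 1 - x * p ^ n) \<longlonglongrightarrow> qpoch x p" by (simp add: o_def)
 have "(PROD n<2*N. 1 - x * p ^ n) = (PROD n<N. 1 - x * (p\<^sup>2) ^ n) * (PROD n<N. 1 - x * p * (p\<^sup>2) ^ n)" for N
  by (induction N) (simp_all add: power_mult[symmetric] mult.assoc mult.left_commute)
 thus "(%N. PROD n<2*N. 1 - x * p ^ n) \<longlonglongrightarrow> qpoch x (p\<^sup>2) * qpoch (x * p) (p\<^sup>2)"
  using tendsto_mult[OF qpoch_LIMSEQ[OF p2, of x] qpoch_LIMSEQ[OF p2, of "x * p"]] by simp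
qed

lemma norm_qpoch_minus_1_le:
 assumes "norm p < 1"
 shows "norm (qpoch x p - 1) <= exp (norm x / (1 - norm p)) - 1"
proof (rule tendsto_upperbound)
 show "(%N. norm ((PROD n<N. 1 - x * p ^ n) - 1)) \<longlonglongrightarrow> norm (qpoch x p - 1)"
  by (intro tendsto_intros qpoch_LIMSEQ assms)
 have "norm ((PROD n<N. 1 - x * p ^ n) - 1) <= exp (norm x / (1 - norm p)) - 1" for N proof -
  have "norm ((PROD n<N. 1 + (- x * p ^ n)) - 1) <= (PROD n<N. 1 + norm (- x * p ^ n)) - 1" by (rule norm_prod_minus1_le_prod_minus1)
  also have "(PROD n<N. 1 + norm (- x * p ^ n)) <= exp (SUM n<N. norm (- x * p ^ n))" by (rule prod_le_exp_sum) auto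
  also have "(SUM n<N. norm (- x * p ^ n)) <= (\<Sum>n. norm x * norm p ^ n)" using assms by (simp add: norm_mult norm_power)
    (intro sum_le_suminf summable_mult summable_geometric; simp)
  also have "... = norm x / (1 - norm p)" using assms by (subst suminf_mult) (auto simp: suminf_geometric summable_geometric divide_simps)
  finally show ?thesis by simp
 qed
 thus "\<forall>\<^sub>F N in sequentially. norm ((PROD n<N. 1 - x * p ^ n) - 1) <= exp (norm x / (1 - norm p)) - 1" by simp
qed simp

lemma tendsto_qpoch_1:
 assumes "(f \<longlongrightarrow> 0) F" "(g \<longlongrightarrow> 0) F"
 shows "((%t. qpoch (f t) (g t)) \<longlongrightarrow> 1) F"
proof -
 have "((%t. qpoch (f t) (g t) - 1) \<longlongrightarrow> 0) F" proof (rule Lim_null_comparison)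
  have "\<forall>\<^sub>F t in F. norm (g t) < 1" using tendstoD[OF assms(2), of 1] by simp
  thus "\<forall>\<^sub>F t in F. norm (qpoch (f t) (g t) - 1) <= exp (norm (f t) / (1 - norm (g t))) - 1"
   by eventually_elim (rule norm_qpoch_minus_1_le)
  have "((%t. exp (norm (f t) / (1 - norm (g t))) - 1) \<longlongrightarrow> exp (norm (0::complex) / (1 - norm (0::complex))) - 1) F"
   by (intro tendsto_intros assms) auto
  thus "((%t. exp (norm (f t) / (1 - norm (g t))) - 1) \<longlongrightarrow> 0) F" by simp
 qed
 thus ?thesis by (simp add: LIM_zero_iff)
qed

lemma uniform_limit_qpoch:
 assumes "compact K" "continuous_on K f" "continuous_on K g" "!!t. t : K ==> norm (g t) < 1"
 shows "uniform_limit K (%N t. PROD n<N. 1 - f t * g t ^ n) (%t. qpoch (f t) (g t)) sequentially"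
proof (cases "K = {}")
 case False
 have "compact (f ` K)" using assms by (intro compact_continuous_image)
 then obtain M where M: "!!t. t : K ==> norm (f t) <= M" using compact_imp_bounded[of "f ` K"] by (auto simp: bounded_iff)
 obtain t0 where t0: "t0 : K" "!!t. t : K ==> norm (g t) <= norm (g t0)"
  using continuous_attains_sup[of K "%t. norm (g t)"] assms False continuous_on_norm by blast
 have "0 <= M" using M[OF t0(1)] norm_ge_zero[of "f t0"] by linarith
 have "uniformly_convergent_on K (%N t. SUM n<N. norm (- f t * g t ^ n))" proof (rule Weierstrass_m_test')
  fix n t assume t: "t : K"
  show "norm (norm (- f t * g t ^ n)) <= M * norm (g t0) ^ n" using M[OF t] t0(2)[OF t] \<open>0 <= M\<close>
   by (auto simp: norm_mult norm_power intro!: mult_mono power_mono)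
 qed (use assms(4)[OF t0(1)] in \<open>intro summable_mult summable_geometric; simp\<close>)
 hence "uniformly_convergent_on K (%N t. PROD n<N. 1 + (- f t * g t ^ n))"
  by (rule uniformly_convergent_on_prod[rotated 2]) (use assms in \<open>auto intro!: continuous_intros\<close>)
 hence "uniform_limit K (%N t. PROD n<N. 1 - f t * g t ^ n) (%t. lim (%N. PROD n<N. 1 - f t * g t ^ n)) sequentially"
  by (simp add: uniformly_convergent_uniform_limit_iff)
 moreover have "lim (%N. PROD n<N. 1 - f t * g t ^ n) = qpoch (f t) (g t)" if "t : K" for t
  by (intro limI qpoch_LIMSEQ assms that)
 ultimately show ?thesis by (subst uniform_limit_cong'[where g = "%N t. PROD n<N. 1 - f t * g t ^ n"]) auto
qed (simp add: uniform_limit_iff)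

lemma holomorphic_on_qpoch [holomorphic_intros]:
 assumes "open S" "f holomorphic_on S" "g holomorphic_on S" "!!t. t : S ==> norm (g t) < 1"
 shows "(%t. qpoch (f t) (g t)) holomorphic_on S"
proof (rule holomorphic_uniform_sequence[OF \<open>open S\<close>])
 show "(%t. PROD n<N. 1 - f t * g t ^ n) holomorphic_on S" for N by (intro holomorphic_intros assms)
next
 fix x assume "x : S"
 then obtain d where d: "d > 0" "cball x d <= S" using \<open>open S\<close> open_contains_cball by blast
 have "uniform_limit (cball x d) (%N t. PROD n<N. 1 - f t * g t ^ n) (%t. qpoch (f t) (g t)) sequentially"
  using assms d(2) by (intro uniform_limit_qpoch) (auto intro: continuous_on_subset holomorphic_on_imp_continuous_on)
 thus "EX d>0. cball x d <= S & uniform_limit (cball x d) (%N t. PROD n<N. 1 - f t * g t ^ n)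
     (%t. qpoch (f t) (g t)) sequentially" using d by blast
qed

subsection \<open>A Liouville theorem for quotients of theta functions\<close>

lemma int_shift_invariant:
 fixes P :: "'a :: ring_1 => 'b"
 assumes "!!z. P (z + w) = P z"
 shows "P (z + of_int k * w) = P z"
proof (induction k rule: int_induct[where k = 0])
 case (step1 i) thus ?case using assms[of "z + of_int i * w"] by (simp add: algebra_simps)
next
 case (step2 i) thus ?case using assms[of "z + of_int (i - 1) * w"] by (simp add: algebra_simps)
qed simp

lemma holomorphic_quotient_simple_zeros:
 assumes "open S" "F holomorphic_on S" "G holomorphic_on S"
  and zero: "!!z. z : S ==> G z = 0 ==> F z = 0 & deriv G z ~= 0"
 shows "(%z. if G z = 0 then deriv F z / deriv G z else F z / G z) holomorphic_on S"
  (is "?H holomorphic_on S") unfolding holomorphic_on_open[OF \<open>open S\<close>]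
proof (intro ballI)
 fix a assume a: "a : S"
 have "EX T H1. open T & a : T & T <= S & H1 holomorphic_on T & (ALL z:T. ?H z = H1 z)" proof (cases "G a = 0")
  case False
  define T where "T = S \<inter> G -` (-{0})"
  have "open T" unfolding T_def using assms(1,3) by (intro continuous_open_preimage holomorphic_on_imp_continuous_on) auto
  moreover have "(%z. F z / G z) holomorphic_on T"
   by (rule holomorphic_on_divide) (use assms in \<open>auto simp: T_def intro: holomorphic_on_subset\<close>)
  ultimately show ?thesis using a False by (intro exI[of _ T] exI[of _ "%z. F z / G z"]) (auto simp: T_def)
 next
  case True
  define F1 where "F1 = (%z. if z = a then deriv F a else (F z - F a) / (z - a))"
  define G1 where "G1 = (%z. if z = a then deriv G a else (G z - G a) / (z - a))"
  have hol: "F1 holomorphic_on S" "G1 holomorphic_on S" unfolding F1_def G1_def by (intro pole_lemma_open assms)+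
  define T where "T = S \<inter> G1 -` (-{0})"
  have "open T" unfolding T_def using assms(1) hol by (intro continuous_open_preimage holomorphic_on_imp_continuous_on) auto
  moreover have "(%z. F1 z / G1 z) holomorphic_on T"
   by (rule holomorphic_on_divide) (use hol in \<open>auto simp: T_def intro: holomorphic_on_subset\<close>)
  moreover have "a : T" using a zero[OF a True] by (auto simp: T_def G1_def)
  moreover have "?H z = F1 z / G1 z" if "z : T" for z using that True zero[OF a True] by (auto simp: T_def F1_def G1_def)
  ultimately show ?thesis by (intro exI[of _ T] exI[of _ "%z. F1 z / G1 z"]) (auto simp: T_def)
 qed
 then obtain T H1 where T: "open T" "a : T" "T <= S" "H1 holomorphic_on T" "!!z. z : T ==> ?H z = H1 z" by blast
 have "?H holomorphic_on T" by (rule holomorphic_transform[OF T(4)]) (simp add: T(5))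
 thus "EX f'. (?H has_field_derivative f') (at a)" using T holomorphic_on_open by blast
qed

lemma period_parallelogram:
 assumes "t : uhp"
 obtains m n :: int and x y where "0 <= x" "x <= 1" "0 <= y" "y <= 1"
  "z + of_int m + of_int n * t = complex_of_real x + complex_of_real y * t"
proof -
 define v where "v = Im z / Im t"
 define u where "u = Re z - v * Re t"
 have z: "z = complex_of_real u + complex_of_real v * t"
  using assms by (auto simp: complex_eq_iff u_def v_def uhp_def)
 have "frac r <= 1" for r :: real using frac_lt_1[of r] by simp
 thus ?thesis by (intro that[of "frac u" "frac v" "- \<lfloor>u\<rfloor>" "- \<lfloor>v\<rfloor>"]) (auto simp: z frac_def algebra_simps)
qed

lemma doubly_periodic_entire_const:
 assumes "t : uhp" "H holomorphic_on UNIV" "!!z. H (z + 1) = H z" "!!z. H (z + t) = H z"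
 shows "EX c. ALL z. H z = c"
proof -
 define K where "K = (%(x, y). complex_of_real x + complex_of_real y * t) ` ({0..1} \<times> {0..1})"
 have "compact K" unfolding K_def by (intro compact_continuous_image compact_Times)
   (auto intro!: continuous_intros simp: case_prod_beta)
 have "H z : H ` K" for z proof -
  obtain m n :: int and x y where "0 <= x" "x <= 1" "0 <= y" "y <= 1"
   "z + of_int m + of_int n * t = complex_of_real x + complex_of_real y * t" by (rule period_parallelogram[OF assms(1)])
  moreover have "H (z + of_int m + of_int n * t) = H z"
   using int_shift_invariant[of H t] int_shift_invariant[of H 1 z m] assms(3,4) by simp
  ultimately show ?thesis unfolding K_def by (force simp: image_iff)
 qed
 hence "range H <= H ` K" by blast
 moreover have "compact (H ` K)" using \<open>compact K\<close> assms(2)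
  by (intro compact_continuous_image) (auto intro: holomorphic_on_imp_continuous_on holomorphic_on_subset)
 ultimately have "bounded (range H)" using compact_imp_bounded bounded_subset by blast
 thus ?thesis using Liouville_theorem[OF assms(2)] by (auto simp: constant_on_def)
qed

lemma quasiperiodic_proportional:
 assumes "t : uhp" and F: "F holomorphic_on UNIV" and G: "G holomorphic_on UNIV"
  and zero: "!!z. G z = 0 ==> F z = 0 & deriv G z ~= 0"
  and shift_1: "!!z. F (z + 1) = e1 z * F z" "!!z. G (z + 1) = e1 z * G z" "!!z. e1 z ~= 0"
  and shift_t: "!!z. F (z + t) = e2 z * F z" "!!z. G (z + t) = e2 z * G z" "!!z. e2 z ~= 0"
 shows "EX c. ALL z. F z = c * G z"
proof -
 define H where "H = (%z. if G z = 0 then deriv F z / deriv G z else F z / G z)"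
 have hol: "H holomorphic_on UNIV" unfolding H_def by (rule holomorphic_quotient_simple_zeros) (use F G zero in auto)
 have FH: "F z = H z * G z" for z using zero by (auto simp: H_def)
 have per: "H (z + w) = H z"
  if e: "!!z. F (z + w) = e z * F z" "!!z. G (z + w) = e z * G z" "!!z. e z ~= 0" for z w e proof -
  have off_zeros: "H (z + w) = H z" if "G z ~= 0" for z using that FH[of z] FH[of "z + w"] e[of z] by simp
  show ?thesis proof (cases "G z = 0")
   case True
   have "(G has_field_derivative deriv G z) (at z)" using G by (auto intro!: holomorphic_derivI)
   hence lim: "((%y. (G y - G z) / (y - z)) \<longlongrightarrow> deriv G z) (at z)" by (simp add: has_field_derivative_iff)
   have "\<forall>\<^sub>F y in at z. (G y - G z) / (y - z) ~= 0" using tendsto_imp_eventually_ne[OF lim] zero[OF True] by blast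
   hence near: "\<forall>\<^sub>F y in at z. H (y + w) = H y" by eventually_elim (use True off_zeros in auto)
   have cont: "isCont H y" for y using hol by (meson UNIV_I continuous_on_eq_continuous_at holomorphic_on_imp_continuous_on open_UNIV)
   have "((%y. H (y + w)) \<longlongrightarrow> H (z + w)) (at z)" by (rule isCont_tendsto_compose[OF cont]) (intro tendsto_intros)
   hence "(H \<longlongrightarrow> H (z + w)) (at z)" by (rule Lim_transform_eventually) (use near in eventually_elim, auto)
   moreover have "(H \<longlongrightarrow> H z) (at z)" using cont[of z] by (simp add: isCont_def)
   ultimately show ?thesis using tendsto_unique[of "at z"] by auto
  qed (use off_zeros in auto)
 qed
 have "EX c. ALL z. H z = c" by (rule doubly_periodic_entire_const[OF assms(1) hol]) (use per shift_1 shift_t in blast)+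
 thus ?thesis using FH by metis
qed

subsection \<open>The theta function\<close>

definition e2pi :: "complex => complex" where
 "e2pi z = exp (2 * pi * \<i> * z)"

definition epi :: "complex => complex" where
 "epi z = exp (pi * \<i> * z)"

lemma epi_add: "epi (x + y) = epi x * epi y" by (simp add: epi_def exp_add algebra_simps)

lemma epi_diff: "epi (x - y) = epi x / epi y" by (simp add: epi_def exp_diff algebra_simps)

lemma epi_minus: "epi (- x) = inverse (epi x)" by (simp add: epi_def exp_minus)

lemma epi_nz [simp]: "epi x ~= 0" by (simp add: epi_def)

lemma epi_0 [simp]: "epi 0 = 1" by (simp add: epi_def)

lemma e2pi_eq_epi: "e2pi x = epi (2 * x)" by (simp add: e2pi_def epi_def algebra_simps)

lemma e2pi_add: "e2pi (x + y) = e2pi x * e2pi y" by (simp add: e2pi_def exp_add algebra_simps)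

lemma e2pi_diff: "e2pi (x - y) = e2pi x / e2pi y" by (simp add: e2pi_def exp_diff algebra_simps)

lemma e2pi_nz [simp]: "e2pi x ~= 0" by (simp add: e2pi_def)

lemma epi_1 [simp]: "epi 1 = -1" by (simp add: epi_def)

lemma epi_of_int: "epi (of_int k) = (if even k then 1 else -1)"
proof -
 have even: "epi (2 * of_int j) = 1" for j :: int
  using exp_integer_2pi[of "of_int j"] by (simp add: epi_def algebra_simps)
 show ?thesis proof (cases "even k")
  case True
  thus ?thesis using even by auto
 next
  case False
  then obtain j where "k = 2 * j + 1" by (elim oddE)
  thus ?thesis using even[of j] by (simp add: epi_add)
 qed
qed

lemma e2pi_of_int [simp]: "e2pi (of_int k) = 1" using epi_of_int[of "2 * k"] by (simp add: e2pi_eq_epi)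

lemma e2pi_1 [simp]: "e2pi 1 = 1" using e2pi_of_int[of 1] by (simp del: e2pi_of_int)

lemma e2pi_0 [simp]: "e2pi 0 = 1" by (simp add: e2pi_def)

lemma e2pi_eq_1_iff: "e2pi z = 1 \<longleftrightarrow> z : \<int>"
proof
 assume "e2pi z = 1"
 then obtain n :: int where n: "Re (2 * pi * \<i> * z) = 0" "Im (2 * pi * \<i> * z) = of_int (2 * n) * pi"
  unfolding e2pi_def exp_eq_1 by blast
 hence "z = of_int n" by (simp add: complex_eq_iff)
 thus "z : \<int>" by simp
next
 assume "z : \<int>"
 thus "e2pi z = 1" by (auto elim!: Ints_cases)
qed

lemma norm_e2pi: "norm (e2pi z) = exp (- 2 * pi * Im z)" by (simp add: e2pi_def)

lemma norm_e2pi_less_1: "t : uhp ==> norm (e2pi t) < 1" by (simp add: norm_e2pi uhp_def)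

lemma e2pi_power: "e2pi z ^ n = e2pi (of_nat n * z)" by (simp add: e2pi_def exp_of_nat_mult[symmetric] algebra_simps)

definition theta :: "complex => complex => complex" where
 "theta z t = epi (- z) * qpoch (e2pi z) (e2pi t) * qpoch (e2pi (t - z)) (e2pi t)"

lemma e2pi_holomorphic [holomorphic_intros]:
 "f holomorphic_on S ==> (%t. e2pi (f t)) holomorphic_on S" unfolding e2pi_def by (intro holomorphic_intros)

lemma epi_holomorphic [holomorphic_intros]:
 "f holomorphic_on S ==> (%t. epi (f t)) holomorphic_on S" unfolding epi_def by (intro holomorphic_intros)

lemma theta_holomorphic:
 assumes "open S" "f holomorphic_on S" "g holomorphic_on S" "!!t. t : S ==> g t : uhp"
 shows "(%t. theta (f t) (g t)) holomorphic_on S" unfolding theta_def by (intro holomorphic_intros assms norm_e2pi_less_1)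

lemma theta_rewrite:
 assumes "t : uhp"
 shows "theta z t = (1 - e2pi z) * (epi (- z) * qpoch (e2pi (z + t)) (e2pi t) * qpoch (e2pi (t - z)) (e2pi t))"
 by (simp add: theta_def qpoch_rec[OF norm_e2pi_less_1[OF assms], of "e2pi z"] e2pi_add)

lemma theta_add_1: "theta (z + 1) t = - theta z t" by (simp add: theta_def e2pi_add e2pi_diff epi_diff epi_minus)

lemma theta_add_tau:
 assumes "t : uhp"
 shows "theta (z + t) t = - epi (- t - 2 * z) * theta z t"
proof -
 have q: "qpoch (e2pi (- z)) (e2pi t) = (1 - e2pi (- z)) * qpoch (e2pi (t - z)) (e2pi t)"
  using qpoch_rec[OF norm_e2pi_less_1[OF assms], of "e2pi (- z)"] e2pi_add[of "- z" t] by simp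
 have "- (z + t) = - z - t" "t - (z + t) = - z" by simp_all
 hence "theta (z + t) t = epi (- z - t) * qpoch (e2pi (z + t)) (e2pi t) * qpoch (e2pi (- z)) (e2pi t)" unfolding theta_def by simp
 also have "... = epi (- z - t) * (1 - e2pi (- z)) * qpoch (e2pi (z + t)) (e2pi t) * qpoch (e2pi (t - z)) (e2pi t)"
  unfolding q by (simp add: algebra_simps)
 also have "epi (- z - t) * (1 - e2pi (- z)) = - epi (- t - 2 * z) * ((1 - e2pi z) * epi (- z))"
  by (simp add: e2pi_eq_epi epi_diff epi_minus divide_simps epi_add[symmetric])
 finally show ?thesis unfolding theta_rewrite[OF assms] by (simp add: algebra_simps)
qed

lemma theta_minus:
 assumes "t : uhp"
 shows "theta (- z) t = - theta z t"
proof -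
 have q: "qpoch (e2pi (- z)) (e2pi t) = (1 - e2pi (- z)) * qpoch (e2pi (t - z)) (e2pi t)"
  using qpoch_rec[OF norm_e2pi_less_1[OF assms], of "e2pi (- z)"] e2pi_add[of "- z" t] by simp
 have "theta (- z) t = epi z * qpoch (e2pi (- z)) (e2pi t) * qpoch (e2pi (z + t)) (e2pi t)" by (simp add: theta_def algebra_simps)
 also have "... = (epi z * (1 - e2pi (- z))) * qpoch (e2pi (z + t)) (e2pi t) * qpoch (e2pi (t - z)) (e2pi t)" unfolding q
  by (simp add: algebra_simps)
 also have "epi z * (1 - e2pi (- z)) = - ((1 - e2pi z) * epi (- z))" by (simp add: e2pi_eq_epi epi_minus divide_simps epi_add[symmetric])
 finally show ?thesis unfolding theta_rewrite[OF assms] by (simp add: algebra_simps)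
qed

lemma theta_lattice:
 assumes "t : uhp"
 shows "theta (z + of_int m + of_int n * t) t =
     epi (of_int m + of_int n - of_int n ^ 2 * t - 2 * of_int n * z) * theta z t"
proof -
 have "theta (z + 1) t * epi (- (z + 1)) = theta z t * epi (- z)" for z by (simp add: theta_add_1 epi_diff)
 from int_shift_invariant[of "%z. theta z t * epi (- z)", OF this]
 have "theta (z + of_int m) t = epi (of_int m) * theta z t" for z
  by (simp add: epi_diff epi_minus field_simps)
 moreover have "theta (z + of_int n * t) t = epi (of_int n - of_int n ^ 2 * t - 2 * of_int n * z) * theta z t" for z proof -
  define P where "P k = theta (z + of_int k * t) t * epi (- (of_int k - of_int k ^ 2 * t - 2 * of_int k * z))" for k :: int
  have "P (k + 1) = P k" for k proof -
   have "P (k + 1) = theta (z + of_int k * t + t) t * epi (- (of_int (k + 1) - of_int (k + 1) ^ 2 * t - 2 * of_int (k + 1) * z))"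
    by (simp add: P_def algebra_simps)
   also have "... = theta (z + of_int k * t) t * (epi 1 * epi (- t - 2 * (z + of_int k * t)) *
     epi (- (of_int (k + 1) - of_int (k + 1) ^ 2 * t - 2 * of_int (k + 1) * z)))" by (subst theta_add_tau[OF assms]) simp
   also have "... = P k" unfolding P_def epi_add[symmetric] by (simp add: algebra_simps power2_eq_square)
   finally show ?thesis .
  qed
  hence "P n = P 0" using int_shift_invariant[of P 1 0 n] by simp
  thus ?thesis unfolding P_def epi_minus by (simp add: field_simps)
 qed
 moreover have "epi (of_int n - of_int n ^ 2 * t - 2 * of_int n * (z + of_int m)) =
    epi (of_int n - of_int n ^ 2 * t - 2 * of_int n * z)"
  using epi_of_int[of "2 * n * m"] by (simp add: algebra_simps epi_diff epi_add)
 ultimately show ?thesis by (simp add: epi_add epi_diff)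
qed

subsection \<open>Zeros of the theta function\<close>

definition periods :: "complex => complex set" where
 "periods t = {of_int m + of_int n * t |m n. True}"

lemma theta_eq_0_iff:
 assumes "t : uhp"
 shows "theta z t = 0 \<longleftrightarrow> z : periods t"
proof
 assume "theta z t = 0"
 hence "qpoch (e2pi z) (e2pi t) = 0 | qpoch (e2pi (t - z)) (e2pi t) = 0" by (simp add: theta_def)
 then obtain n :: nat where "e2pi z * e2pi t ^ n = 1 | e2pi (t - z) * e2pi t ^ n = 1" using qpoch_nonzero[OF norm_e2pi_less_1[OF assms]]
  by blast
 hence "z + of_nat n * t : \<int> | t - z + of_nat n * t : \<int>" by (simp add: e2pi_power e2pi_add[symmetric] e2pi_eq_1_iff)
 thus "z : periods t" proof
  assume "z + of_nat n * t : \<int>"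
  then obtain m where "z + of_nat n * t = of_int m" by (auto elim: Ints_cases)
  hence "z = of_int m + of_int (- int n) * t" by (simp add: algebra_simps)
  thus ?thesis unfolding periods_def by blast
 next
  assume "t - z + of_nat n * t : \<int>"
  then obtain m where "t - z + of_nat n * t = of_int m" by (auto elim: Ints_cases)
  hence "z = of_int (- m) + of_int (1 + int n) * t" by (simp add: algebra_simps)
  thus ?thesis unfolding periods_def by blast
 qed
next
 assume "z : periods t"
 then obtain m n where z: "z = 0 + of_int m + of_int n * t" by (auto simp: periods_def)
 show "theta z t = 0" unfolding z theta_lattice[OF assms] by (simp add: theta_rewrite[OF assms])
qed

lemma theta_deriv_0:
 assumes "t : uhp"
 shows "deriv (%z. theta z t) 0 ~= 0"
proof -
 define R where "R = (%z. epi (- z) * qpoch (e2pi (z + t)) (e2pi t) * qpoch (e2pi (t - z)) (e2pi t))"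
 have "R holomorphic_on UNIV" unfolding R_def by (intro holomorphic_intros norm_e2pi_less_1 assms) auto
 hence R: "(R has_field_derivative deriv R 0) (at 0)" by (intro holomorphic_derivI[of _ UNIV]) auto
 have "((%z. (1 - e2pi z) * R z) has_field_derivative - (2 * pi * \<i>) * R 0) (at 0)"
  unfolding e2pi_def by (auto intro!: derivative_eq_intros R)
 hence "deriv (%z. theta z t) 0 = - (2 * pi * \<i>) * R 0" unfolding theta_rewrite[OF assms] R_def by (rule DERIV_imp_deriv)
 moreover have "e2pi t * e2pi t ^ n ~= 1" for n proof -
  have "norm (e2pi t * e2pi t ^ n) = norm (e2pi t) ^ Suc n" by (simp add: norm_mult norm_power)
  also have "... < 1" using norm_e2pi_less_1[OF assms] by (intro power_Suc_less_one) auto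
  finally show ?thesis by auto
 qed
 hence "R 0 ~= 0" unfolding R_def using qpoch_nonzero[OF norm_e2pi_less_1[OF assms], of "e2pi t"] by simp
 ultimately show ?thesis by simp
qed

lemma theta_deriv_periods:
 assumes "t : uhp" "z : periods t"
 shows "deriv (%z. theta z t) z ~= 0"
proof -
 obtain m n where z: "z = of_int m + of_int n * t" using assms(2) by (auto simp: periods_def)
 define E where "E = (%y. epi (of_int m + of_int n - of_int n ^ 2 * t - 2 * of_int n * (y - z)))"
 have "(%y. theta y t) holomorphic_on UNIV" "E holomorphic_on UNIV"
  unfolding E_def by (intro theta_holomorphic holomorphic_intros assms; auto simp: assms)+
 hence D: "((%y. theta y t) has_field_derivative deriv (%y. theta y t) 0) (at 0)"
  and DE: "(E has_field_derivative deriv E z) (at z)" by (auto intro!: holomorphic_derivI[of _ UNIV])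
 have "((%y. E y * theta (y - z) t) has_field_derivative E z * deriv (%y. theta y t) 0) (at z)" using D theta_eq_0_iff[OF assms(1), of 0]
  by (auto intro!: derivative_eq_intros DE DERIV_chain2[of "%y. theta y t"] simp: periods_def)
   (metis add.right_neutral mult_zero_left of_int_0)
 moreover have "E y * theta (y - z) t = theta y t" for y using theta_lattice[OF assms(1), of "y - z" m n] by (simp add: E_def z)
 ultimately have "deriv (%y. theta y t) z = E z * deriv (%y. theta y t) 0" by (simp add: DERIV_imp_deriv)
 thus ?thesis using theta_deriv_0[OF assms(1)] by (simp add: E_def)
qed

lemma periods_real_iff:
 assumes "t : uhp"
 shows "complex_of_real u * t + complex_of_real v : periods t \<longleftrightarrow> u : \<int> & v : \<int>"
proof
 assume "complex_of_real u * t + complex_of_real v : periods t"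
 then obtain m n where eq: "complex_of_real u * t + complex_of_real v = of_int m + of_int n * t" by (auto simp: periods_def)
 hence "u * Im t = of_int n * Im t" by (auto simp: complex_eq_iff)
 hence u: "u = of_int n" using assms by (simp add: uhp_def)
 hence "v = of_int m" using eq by (auto simp: complex_eq_iff)
 thus "u : \<int> & v : \<int>" using u by simp
next
 assume "u : \<int> & v : \<int>"
 then obtain n m where "u = of_int n" "v = of_int m" by (auto elim!: Ints_cases)
 thus "complex_of_real u * t + complex_of_real v : periods t"
  unfolding periods_def mem_Collect_eq by (intro exI[of _ m] exI[of _ n]) (simp add: add.commute)
qed

lemma theta_0: "t : uhp ==> theta 0 t = 0" by (simp add: theta_rewrite)

lemma periods_diff: "x : periods t ==> y : periods t ==> x - y : periods t"
proof -
 assume "x : periods t" "y : periods t"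
 then obtain p q r s where "x = of_int p + of_int q * t" "y = of_int r + of_int s * t" unfolding periods_def by blast
 hence "x - y = of_int (p - r) + of_int (q - s) * t" by (simp add: algebra_simps)
 thus "x - y : periods t" unfolding periods_def by blast
qed

lemma half_not_Int: "(1 / 2 :: real) ~: \<int>"
 using of_int_div_of_int_in_Ints_iff[of 1 2, where 'a = real] by simp

subsection \<open>Modular transformation\<close>

lemma theta_transform_lattice:
 fixes m n :: int
 assumes A: "A : SL2Z" and s: "s : uhp"
 defines "F == %z. epi (- (of_int (m21 A) * z\<^sup>2 / automorphy A s)) * theta (z / automorphy A s) (moebius A s)"
 shows "F (z + of_int m + of_int n * s) = epi (of_int m + of_int n - of_int n ^ 2 * s - 2 * of_int n * z) * F z"
proof -
 define a b c d where "a = m11 A" and "b = m12 A" and "c = m21 A" and "d = m22 A"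
 define j g where "j = automorphy A s" and "g = moebius A s"
 have j: "j ~= 0" "j = of_int c * s + of_int d" and g: "g : uhp" "g * j = of_int a * s + of_int b"
  using automorphy_nz[OF A s] moebius_in_uhp[OF A s] moebius_times_automorphy[OF A s]
  by (auto simp: j_def g_def automorphy_def a_def b_def c_def d_def)
 have det: "a * d - b * c = 1" using A by (simp add: SL2Z_iff a_def b_def c_def d_def)
 define M N where "M = m * a - n * b" and "N = n * d - m * c"
 have mn: "m = M * d + N * b" "n = M * c + N * a" unfolding M_def N_def using det by algebra+
 define w p where "w = z / j" and "p = of_int M + of_int N * g"
 have "p * j = of_int M * j + of_int N * (g * j)" by (simp add: p_def algebra_simps)
 hence pj: "p * j = of_int m + of_int n * s" unfolding g(2) unfolding j(2) mn by (simp add: algebra_simps)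
 have Nj: "of_int N = of_int n * j - of_int c * (p * j)" unfolding pj unfolding N_def j(2) by (simp add: algebra_simps)
 have z: "z = w * j" "z + of_int m + of_int n * s = (w + p) * j" using j(1) pj by (simp_all add: w_def algebra_simps)
 have exponent: "- (of_int c * j * (w + p)\<^sup>2) + (of_int M + of_int N - of_int N ^ 2 * g - 2 * of_int N * w) =
   - (of_int c * j * w\<^sup>2) + (of_int m + of_int n - of_int n ^ 2 * s - 2 * of_int n * (w * j)) +
   of_int (M + N + M * N - m * n - m - n)"
 proof -
  have "of_int N ^ 2 * g = of_int N * (p - of_int M)" by (simp add: p_def power2_eq_square)
  moreover have "of_int N * p = of_int n * (of_int m + of_int n * s) - of_int c * j * p ^ 2"
   unfolding pj[symmetric] by (subst Nj) (simp add: algebra_simps power2_eq_square)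
  moreover have "of_int N * w = of_int n * (w * j) - of_int c * j * p * w" by (subst Nj) (simp add: algebra_simps)
  ultimately show ?thesis unfolding of_int_add of_int_diff of_int_mult by algebra
 qed
 have "even M & even N \<longleftrightarrow> even m & even n" using mn by (metis M_def N_def dvd_add dvd_diff dvd_mult2)
 hence "even (M + N + M * N - m * n - m - n)" by auto
 hence parity: "epi (of_int (M + N + M * N - m * n - m - n)) = 1" unfolding epi_of_int by simp
 have "(w + p) * j / j = w + of_int M + of_int N * g" using j(1) by (simp add: p_def)
 hence "F ((w + p) * j) = epi (- (of_int c * ((w + p) * j)\<^sup>2 / j)) * theta (w + of_int M + of_int N * g) g"
  by (simp only: F_def c_def flip: j_def g_def)
 also have "- (of_int c * ((w + p) * j)\<^sup>2 / j) = - (of_int c * j * (w + p)\<^sup>2)" using j(1) by (simp add: power2_eq_square)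
 also have "epi (- (of_int c * j * (w + p)\<^sup>2)) * theta (w + of_int M + of_int N * g) g =
   epi (- (of_int c * j * (w + p)\<^sup>2) + (of_int M + of_int N - of_int N ^ 2 * g - 2 * of_int N * w)) * theta w g"
  by (simp only: theta_lattice[OF g(1)] epi_add mult.assoc)
 also have "... = epi (of_int m + of_int n - of_int n ^ 2 * s - 2 * of_int n * (w * j)) *
   (epi (- (of_int c * j * w\<^sup>2)) * theta w g)"
  unfolding exponent epi_add[of _ "of_int (_ - _)"] parity mult_1_right epi_add[of "- (of_int c * j * w\<^sup>2)"] by (simp only: mult_ac)
 also have "epi (- (of_int c * j * w\<^sup>2)) * theta w g = F z"
  using j(1) by (simp add: F_def c_def power2_eq_square mult_ac z(1) flip: j_def g_def)
 finally show ?thesis unfolding z(2) by (simp add: z(1))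
qed

lemma theta_transform:
 assumes A: "A : SL2Z" and s: "s : uhp"
 shows "EX C. C ~= 0 & (ALL z. epi (- (of_int (m21 A) * z\<^sup>2 / automorphy A s)) *
   theta (z / automorphy A s) (moebius A s) = C * theta z s)"
proof -
 define F where "F = (%z. epi (- (of_int (m21 A) * z\<^sup>2 / automorphy A s)) * theta (z / automorphy A s) (moebius A s))"
 have shift: "F (z + of_int m + of_int n * s) = epi (of_int m + of_int n - of_int n ^ 2 * s - 2 * of_int n * z) * F z"
  for z and m n :: int unfolding F_def by (rule theta_transform_lattice[OF A s])
 have j: "automorphy A s ~= 0" and g: "moebius A s : uhp" by (rule automorphy_nz moebius_in_uhp, rule A, rule s)+
 have "EX C. ALL z. F z = C * theta z s"
 proof (rule quasiperiodic_proportional[OF s, where ?e1.0 = "%_. -1" and ?e2.0 = "%z. - epi (- s - 2 * z)"])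
  show "F holomorphic_on UNIV" unfolding F_def by (intro holomorphic_intros theta_holomorphic) (auto simp: j g)
  show "(%z. theta z s) holomorphic_on UNIV" by (intro holomorphic_intros theta_holomorphic) (auto simp: s)
  show "F z = 0 & deriv (%z. theta z s) z ~= 0" if "theta z s = 0" for z proof
   have z: "z : periods s" using that theta_eq_0_iff[OF s] by blast
   thus "deriv (%z. theta z s) z ~= 0" by (rule theta_deriv_periods[OF s])
   obtain m n where "z = 0 + of_int m + of_int n * s" using z by (auto simp: periods_def)
   moreover have "F 0 = 0" by (simp add: F_def theta_0[OF g])
   ultimately show "F z = 0" using shift[of 0 m n] by simp
  qed
  show "F (z + 1) = -1 * F z" for z using shift[of z 1 0] by simp
  show "F (z + s) = - epi (- s - 2 * z) * F z" for z using shift[of z 0 1] epi_add[of 1 "- s - 2 * z"] by (simp add: algebra_simps)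
 qed (auto simp: theta_add_1 theta_add_tau[OF s])
 then obtain C where C: "!!z. F z = C * theta z s" by blast
 have "theta (of_real 0 * moebius A s + of_real (1 / 2)) (moebius A s) ~= 0"
  using half_not_Int unfolding theta_eq_0_iff[OF g] periods_real_iff[OF g] by blast
 hence "F (automorphy A s / 2) ~= 0" using j by (simp add: F_def)
 hence "C ~= 0" using C by auto
 thus ?thesis using C unfolding F_def by blast
qed

subsection \<open>Weierstrass' three-term relation\<close>

definition theta_pair :: "complex => complex => complex => complex" where
 "theta_pair x y t = theta (x + y) t * theta (x - y) t"

lemma theta_pair_swap: "t : uhp ==> theta_pair y x t = - theta_pair x y t"
 using theta_minus[of t "x - y"] by (simp add: theta_pair_def add.commute)

lemma theta_pair_minus: "t : uhp ==> theta_pair (- x) y t = theta_pair x y t"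
 using theta_minus[of t "x - y"] theta_minus[of t "x + y"] by (simp add: theta_pair_def add.commute)

lemma theta_pair_self: "t : uhp ==> theta_pair x x t = 0" by (simp add: theta_pair_def theta_0)

lemma theta_pair_add_1: "theta_pair (x + 1) y t = theta_pair x y t"
 using theta_add_1[of "x + y" t] theta_add_1[of "x - y" t] by (simp add: theta_pair_def algebra_simps)

lemma theta_pair_add_tau:
 assumes "t : uhp"
 shows "theta_pair (x + t) y t = epi (- 2 * t - 4 * x) * theta_pair x y t"
proof -
 have "theta_pair (x + t) y t = (epi (- t - 2 * (x + y)) * epi (- t - 2 * (x - y))) * theta_pair x y t"
  using theta_add_tau[OF assms, of "x + y"] theta_add_tau[OF assms, of "x - y"] by (simp add: theta_pair_def algebra_simps)
 thus ?thesis unfolding epi_add[symmetric] by (simp add: algebra_simps)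
qed

lemma theta_pair_holomorphic: "t : uhp ==> (%x. theta_pair x y t) holomorphic_on UNIV"
 unfolding theta_pair_def by (intro holomorphic_intros theta_holomorphic) auto

lemma theta_pair_zero_simple:
 assumes t: "t : uhp" and y: "2 * y ~: periods t" and zero: "theta_pair x y t = 0"
 shows "deriv (%x. theta_pair x y t) x ~= 0"
proof -
 have "(%z. theta z t) holomorphic_on UNIV" by (intro theta_holomorphic holomorphic_intros) (auto simp: t)
 hence D: "((%z. theta z t) has_field_derivative deriv (%z. theta z t) z) (at z)" for z by (auto intro: holomorphic_derivI)
 have "((%x. theta_pair x y t) has_field_derivative
   deriv (%z. theta z t) (x + y) * theta (x - y) t + theta (x + y) t * deriv (%z. theta z t) (x - y)) (at x)"
  unfolding theta_pair_def by (rule derivative_eq_intros DERIV_chain2[OF D] refl | simp)+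
 hence deriv: "deriv (%x. theta_pair x y t) x =
   deriv (%z. theta z t) (x + y) * theta (x - y) t + theta (x + y) t * deriv (%z. theta z t) (x - y)" by (rule DERIV_imp_deriv)
 have "~ (x + y : periods t & x - y : periods t)" using periods_diff[of "x + y" t "x - y"] y by auto
 moreover have "x + y : periods t | x - y : periods t" using zero theta_eq_0_iff[OF t] by (simp add: theta_pair_def)
 ultimately show ?thesis using theta_deriv_periods[OF t, of "x + y"] theta_deriv_periods[OF t, of "x - y"]
  theta_eq_0_iff[OF t, of "x + y"] theta_eq_0_iff[OF t, of "x - y"] unfolding deriv by auto
qed

lemma theta_three_term:
 assumes t: "t : uhp" and nz: "theta (2 * b) t ~= 0" "theta_pair b c t ~= 0"
 shows "theta_pair a b t * theta_pair c d t + theta_pair b c t * theta_pair a d t + theta_pair c a t * theta_pair b d t = 0"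
proof -
 define F where "F x = theta_pair b c t * theta_pair x d t - theta_pair b d t * theta_pair x c t" for x
 have F_shift: "F (z + 1) = 1 * F z" "F (z + t) = epi (- 2 * t - 4 * z) * F z" for z
  unfolding F_def theta_pair_add_1 theta_pair_add_tau[OF t] by (simp_all add: algebra_simps)
 have "EX k. ALL z. F z = k * theta_pair z b t"
 proof (rule quasiperiodic_proportional[OF t _ theta_pair_holomorphic[OF t] _ F_shift(1) _ _ F_shift(2)])
  show "F holomorphic_on UNIV" unfolding F_def by (intro holomorphic_intros theta_pair_holomorphic t)
  fix z assume zero: "theta_pair z b t = 0"
  hence "z + b : periods t | z - b : periods t" using theta_eq_0_iff[OF t] by (simp add: theta_pair_def)
  then obtain x m n where x: "x = b | x = - b" and z: "z = x + of_int m * 1 + of_int n * t"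
   unfolding periods_def by (force simp: algebra_simps)
  have "F x = 0" using x by (auto simp: F_def theta_pair_minus[OF t])
  hence "F z = 0" unfolding z
   using int_shift_invariant[of "%z. F z = 0" 1 x m] int_shift_invariant[of "%z. F z = 0" t "x + of_int m" n] F_shift by simp
  moreover have "2 * b ~: periods t" using nz(1) theta_eq_0_iff[OF t] by blast
  ultimately show "F z = 0 & deriv (%z. theta_pair z b t) z ~= 0" using theta_pair_zero_simple[OF t _ zero] by blast
 qed (simp_all add: theta_pair_add_1 theta_pair_add_tau[OF t])
 then obtain k where k: "!!z. F z = k * theta_pair z b t" by blast
 have "theta_pair b c t * theta_pair c d t = - k * theta_pair b c t"
  using k[of c] theta_pair_swap[OF t, of b c] by (simp add: F_def theta_pair_self[OF t])
 hence "k = - theta_pair c d t" using nz(2) by (metis mult.commute mult_minus_left mult_right_cancel minus_minus)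
 thus ?thesis using k[of a] theta_pair_swap[OF t, of a c] by (simp add: F_def algebra_simps)
qed

subsection \<open>Klein forms\<close>

text \<open>
  The factor \<open>epi (u * (u * t + v))\<close> makes the behaviour under \<open>SL\<^sub>2(\<int>)\<close> uniform in \<open>(u, v)\<close>, so that
  it cancels in quotients.
\<close>
definition klein :: "real => real => complex => complex" where
 "klein u v t = epi (of_real u * (of_real u * t + of_real v)) * theta (of_real u * t + of_real v) t"

lemma klein_eq_0_iff: "t : uhp ==> klein u v t = 0 \<longleftrightarrow> u : \<int> & v : \<int>" by (simp add: klein_def theta_eq_0_iff periods_real_iff)

lemma klein_minus: "t : uhp ==> klein (- u) (- v) t = - klein u v t"
 using theta_minus[of t "of_real u * t + of_real v"] by (simp add: klein_def algebra_simps)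

lemma klein_shift:
 assumes "t : uhp"
 shows "klein (u + of_int m) (v + of_int n) t =
     epi (of_int (m + n + m * n) + of_int n * of_real u - of_int m * of_real v) * klein u v t"
proof -
 define z where "z = of_real u * t + of_real v"
 have zz: "of_real (u + of_int m) * t + of_real (v + of_int n) = z + of_int n + of_int m * t" by (simp add: z_def algebra_simps)
 have "klein (u + of_int m) (v + of_int n) t =
  (epi (of_real (u + of_int m) * (z + of_int n + of_int m * t)) *
    epi (of_int n + of_int m - of_int m ^ 2 * t - 2 * of_int m * z)) * theta z t"
  unfolding klein_def zz theta_lattice[OF assms] by (simp only: mult.assoc)
 also have "epi (of_real (u + of_int m) * (z + of_int n + of_int m * t)) *
    epi (of_int n + of_int m - of_int m ^ 2 * t - 2 * of_int m * z) =
   epi ((of_int (m + n + m * n) + of_int n * of_real u - of_int m * of_real v) + of_real u * z)" unfolding epi_add[symmetric]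
  by (rule arg_cong[of _ _ epi]) (simp add: z_def algebra_simps power2_eq_square)
 finally show ?thesis unfolding klein_def z_def[symmetric] by (simp add: epi_add)
qed

lemma klein_transform:
 assumes A: "A : SL2Z" and t: "t : uhp"
 shows "EX C. C ~= 0 & (ALL u v. klein u v (moebius A t) =
   C * klein (u * of_int (m11 A) + v * of_int (m21 A)) (u * of_int (m12 A) + v * of_int (m22 A)) t)"
proof -
 define a b c d where "a = m11 A" and "b = m12 A" and "c = m21 A" and "d = m22 A"
 define j where "j = automorphy A t"
 have j: "j ~= 0" "j = of_int c * t + of_int d" using automorphy_nz[OF A t] by (simp_all add: j_def automorphy_def c_def d_def)
 have gj: "moebius A t * j = of_int a * t + of_int b"
  using moebius_times_automorphy[OF A t] by (simp add: j_def a_def b_def)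
 obtain C where C: "C ~= 0" "!!z. epi (- (of_int c * z\<^sup>2 / j)) * theta (z / j) (moebius A t) = C * theta z t"
  using theta_transform[OF A t] unfolding c_def j_def by blast
 have "klein u v (moebius A t) = C * klein (u * of_int a + v * of_int c) (u * of_int b + v * of_int d) t" for u v proof -
  define U V where "U = u * of_int a + v * of_int c" and "V = u * of_int b + v * of_int d"
  define z where "z = of_real U * t + of_real V"
  have "(of_real u * moebius A t + of_real v) * j = of_real u * (moebius A t * j) + of_real v * j" by (simp add: algebra_simps)
  also have "... = z" unfolding gj by (simp add: z_def U_def V_def j(2) algebra_simps)
  finally have zj: "of_real u * moebius A t + of_real v = z / j" using j(1) by (simp add: eq_divide_eq)
  have "real_of_int a * of_int d - of_int b * of_int c = 1"
   using A arg_cong[of _ _ real_of_int] by (simp add: SL2Z_iff a_def b_def c_def d_def flip: of_int_mult of_int_diff)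
  hence "u = U * of_int d - of_int c * V" unfolding U_def V_def by algebra
  hence "complex_of_real u = of_real U * of_int d - of_int c * of_real V"
   by (metis of_real_diff of_real_mult of_real_of_int_eq)
  hence "complex_of_real u + of_int c * z = of_real U * j" by (simp add: z_def j(2) algebra_simps)
  hence "of_real u * z + of_int c * z\<^sup>2 = of_real U * z * j" by algebra
  hence "of_real u * (z / j) = of_real U * z + - (of_int c * z\<^sup>2 / j)" using j(1) by (simp add: field_simps)
  hence "klein u v (moebius A t) = epi (of_real U * z) * (epi (- (of_int c * z\<^sup>2 / j)) * theta (z / j) (moebius A t))"
   unfolding klein_def zj by (simp only: epi_add mult.assoc)
  thus ?thesis unfolding C(2) U_def[symmetric] V_def[symmetric] klein_def z_def[symmetric] by (simp add: mult_ac)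
 qed
 thus ?thesis using C(1) unfolding a_def b_def c_def d_def by blast
qed

definition klein_pair :: "real => real => real => real => complex => complex" where
 "klein_pair x x' y y' t = klein (x + y) (x' + y') t * klein (x - y) (x' - y') t"

lemma klein_three_term:
 assumes t: "t : uhp" and nz: "klein (2 * b) (2 * b') t ~= 0" "klein_pair b b' c c' t ~= 0"
 shows "klein_pair a a' b b' t * klein_pair c c' d d' t + klein_pair b b' c c' t * klein_pair a a' d d' t
   + klein_pair c c' a a' t * klein_pair b b' d d' t = 0"
proof -
 define arg where "arg u u' = of_real u * t + of_real u'" for u u'
 define e where "e u u' = epi (2 * (of_real u * arg u u'))" for u u'
 have pair: "klein_pair x x' y y' t = e x x' * e y y' * theta_pair (arg x x') (arg y y') t" for x x' y y' proof -
  define X Y where "X = arg x x'" and "Y = arg y y'"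
  have args: "of_real (x + y) * t + of_real (x' + y') = X + Y" "of_real (x - y) * t + of_real (x' - y') = X - Y"
   by (simp_all add: X_def Y_def arg_def algebra_simps)
  have "klein_pair x x' y y' t =
   (epi (of_real (x + y) * (X + Y)) * epi (of_real (x - y) * (X - Y))) * theta_pair X Y t"
   unfolding klein_pair_def klein_def theta_pair_def args by (simp only: mult_ac)
  also have "epi (of_real (x + y) * (X + Y)) * epi (of_real (x - y) * (X - Y)) = e x x' * e y y'"
   unfolding e_def epi_add[symmetric] by (rule arg_cong[of _ _ epi]) (simp add: algebra_simps flip: X_def Y_def)
  finally show ?thesis by (simp add: X_def Y_def)
 qed
 have "theta (2 * arg b b') t ~= 0" "theta_pair (arg b b') (arg c c') t ~= 0"
  using nz unfolding pair by (simp_all add: klein_def arg_def algebra_simps)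
 from arg_cong[OF theta_three_term[OF t this, of "arg a a'" "arg d d'"], of "%x. e a a' * e b b' * e c c' * e d d' * x"]
 show ?thesis unfolding pair by (simp add: algebra_simps)
qed

lemma klein_holomorphic [holomorphic_intros]:
 assumes "open S" "f holomorphic_on S" "!!t. t : S ==> f t : uhp"
 shows "(%t. klein u v (f t)) holomorphic_on S" unfolding klein_def by (intro holomorphic_intros theta_holomorphic assms)

subsection \<open>Asymptotics at the cusp\<close>

definition at_cusp :: "complex filter" where
 "at_cusp = filtercomap Im at_top"

lemma eventually_at_cusp: "eventually P at_cusp \<longleftrightarrow> (EX y. ALL t. Im t > y --> P t)"
 unfolding at_cusp_def eventually_filtercomap eventually_at_top_dense by blast

lemma at_cusp_neq_bot [simp]: "at_cusp ~= bot" unfolding trivial_limit_def eventually_at_cusp by (metis complex.sel(2) gt_ex)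

lemma Im_at_cusp: "filterlim Im at_top at_cusp" unfolding at_cusp_def by (rule filterlim_filtercomap)

lemma e2pi_tendsto_0:
 assumes "r > 0"
 shows "((%t. e2pi (of_real r * t + c)) \<longlongrightarrow> 0) at_cusp"
proof -
 have "filterlim (%t. 2 * pi * (r * Im t + Im c)) at_top at_cusp" using assms by (intro filterlim_tendsto_pos_mult_at_top[OF tendsto_const]
    filterlim_at_top_add_at_top[THEN filterlim_compose, rotated] filterlim_tendsto_add_at_top[where f = "%_. Im c", unfolded add.commute[of
     "Im c"]] Im_at_cusp)
   auto
 hence "((%t. exp (- (2 * pi * (r * Im t + Im c)))) \<longlongrightarrow> 0) at_cusp"
  by (intro filterlim_compose[OF exp_at_bot] filterlim_compose[OF filterlim_uminus_at_bot_at_top])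
 hence "((%t. norm (e2pi (of_real r * t + c))) \<longlongrightarrow> 0) at_cusp" by (simp add: norm_e2pi algebra_simps)
 thus ?thesis by (rule tendsto_norm_zero_cancel)
qed

lemma eventually_uhp_at_cusp: "\<forall>\<^sub>F t in at_cusp. t : uhp" unfolding eventually_at_cusp uhp_def by auto

definition q_asymp :: "(complex => complex) => real => complex => bool" where
 "q_asymp f r c \<longleftrightarrow> ((%t. f t * e2pi (- (of_real r * t))) \<longlongrightarrow> c) at_cusp"

lemma q_asymp_0_iff: "q_asymp f 0 c \<longleftrightarrow> (f \<longlongrightarrow> c) at_cusp" by (simp add: q_asymp_def)

lemma q_asymp_cong_eventually:
 assumes "q_asymp f r c" "\<forall>\<^sub>F t in at_cusp. f t = g t"
 shows "q_asymp g r c"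
proof -
 have "\<forall>\<^sub>F t in at_cusp. f t * e2pi (- (of_real r * t)) = g t * e2pi (- (of_real r * t))"
  using assms(2) by eventually_elim simp
 thus ?thesis using assms(1) unfolding q_asymp_def by (rule Lim_transform_eventually[rotated])
qed

lemma q_asymp_cong: "q_asymp f r c ==> (!!t. t : uhp ==> f t = g t) ==> q_asymp g r c"
 by (rule q_asymp_cong_eventually) (auto intro: eventually_mono[OF eventually_uhp_at_cusp])

lemma q_asymp_const: "q_asymp (%_. c) 0 c" by (simp add: q_asymp_0_iff)

lemma q_asymp_diff: "q_asymp f r c ==> q_asymp g r d ==> q_asymp (%t. f t - g t) r (c - d)"
 unfolding q_asymp_def left_diff_distrib by (rule tendsto_diff)

lemma q_asymp_mult:
 assumes "q_asymp f r c" "q_asymp g s d"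
 shows "q_asymp (%t. f t * g t) (r + s) (c * d)"
proof -
 have "e2pi (- (of_real (r + s) * t)) = e2pi (- (of_real r * t)) * e2pi (- (of_real s * t))" for t
  unfolding e2pi_add[symmetric] by (simp add: algebra_simps)
 thus ?thesis using tendsto_mult[OF assms[unfolded q_asymp_def]] unfolding q_asymp_def by (simp add: mult_ac)
qed

lemma q_asymp_cmult: "q_asymp f r c ==> q_asymp (%t. k * f t) r (k * c)"
 using q_asymp_mult[OF q_asymp_const] by fastforce

lemma q_asymp_divide:
 assumes "q_asymp f r c" "q_asymp g s d" "d ~= 0"
 shows "q_asymp (%t. f t / g t) (r - s) (c / d)"
proof -
 have "e2pi (- (of_real (r - s) * t)) = e2pi (- (of_real r * t)) / e2pi (- (of_real s * t))" for t
  unfolding e2pi_diff[symmetric] by (simp add: algebra_simps)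
 thus ?thesis using tendsto_divide[OF assms(1,2)[unfolded q_asymp_def] assms(3)] unfolding q_asymp_def by simp
qed

lemma q_asymp_affine:
 assumes "q_asymp f r c" "a > 0"
 shows "q_asymp (%t. f (of_real a * t + b)) (a * r) (c * e2pi (of_real r * b))"
proof -
 have "filterlim (%t. a * Im t) at_top at_cusp"
  using assms(2) by (intro filterlim_tendsto_pos_mult_at_top[OF tendsto_const] Im_at_cusp) auto
 hence "filterlim (%t. Im b + a * Im t) at_top at_cusp"
  by (rule filterlim_tendsto_add_at_top[OF tendsto_const])
 hence "filterlim (Im \<circ> (%t. of_real a * t + b)) at_top at_cusp" by (simp add: o_def add.commute)
 hence "filterlim (%t. of_real a * t + b) at_cusp at_cusp" unfolding at_cusp_def filterlim_filtercomap_iff .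
 from filterlim_compose[OF assms(1)[unfolded q_asymp_def] this]
 have "((%t. (f (of_real a * t + b) * e2pi (- (of_real r * (of_real a * t + b)))) * e2pi (of_real r * b)) \<longlongrightarrow> c
  * e2pi (of_real r * b)) at_cusp"
  by (rule tendsto_mult[OF _ tendsto_const])
 moreover have "e2pi (- (of_real r * (of_real a * t + b))) * e2pi (of_real r * b) = e2pi (- (of_real (a * r) * t))" for t
  unfolding e2pi_add[symmetric] by (simp add: algebra_simps)
 ultimately show ?thesis unfolding q_asymp_def by (simp only: mult.assoc)
qed

lemma q_asymp_lower_exponent:
 assumes "q_asymp f r c" "s < r"
 shows "q_asymp f s 0"
proof -
 have "((%t. (f t * e2pi (- (of_real r * t))) * e2pi (of_real (r - s) * t + 0)) \<longlongrightarrow> c * 0) at_cusp"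
  using assms unfolding q_asymp_def by (intro tendsto_mult e2pi_tendsto_0) auto
 moreover have "e2pi (- (of_real r * t)) * e2pi (of_real (r - s) * t + 0) = e2pi (- (of_real s * t))" for t
  unfolding e2pi_add[symmetric] by (simp add: algebra_simps)
 ultimately show ?thesis unfolding q_asymp_def by (simp only: mult.assoc mult_zero_right)
qed

lemma q_asymp_coeff_unique: "q_asymp f r c ==> q_asymp f r d ==> c = d"
 unfolding q_asymp_def by (rule tendsto_unique[OF at_cusp_neq_bot])

lemma q_asymp_less:
 assumes "q_asymp f r c" "c ~= 0" "q_asymp f s 0"
 shows "s < r"
proof (rule ccontr)
 assume "~ s < r"
 hence "q_asymp f r 0" using q_asymp_lower_exponent[OF assms(3), of r] assms(3) by (cases "s = r") auto
 thus False using assms(1,2) q_asymp_coeff_unique by blast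
qed

lemma q_asymp_exponent_unique:
 assumes "q_asymp f r c" "c ~= 0" "q_asymp f s d" "d ~= 0"
 shows "r = s"
proof (rule linorder_cases[of r s])
 assume "r < s"
 from q_asymp_less[OF assms(1,2) q_asymp_lower_exponent[OF assms(3) this]] show ?thesis by simp
next
 assume "s < r"
 from q_asymp_less[OF assms(3,4) q_asymp_lower_exponent[OF assms(1) this]] show ?thesis by simp
qed

lemma q_asymp_integral_exponent:
 assumes f: "q_asymp f r c" "c ~= 0" and per: "!!t. t : uhp ==> f (t + 1) = f t"
 shows "r : \<int>"
proof -
 have "q_asymp (%t. f (t + 1)) r (c * e2pi (of_real r))" using q_asymp_affine[OF f(1), of 1 1] by simp
 hence "q_asymp f r (c * e2pi (of_real r))" by (rule q_asymp_cong) (rule per)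
 hence "c = c * e2pi (of_real r)" by (rule q_asymp_coeff_unique[OF f(1)])
 hence "e2pi (of_real r) = 1" using f(2) by simp
 then obtain k where "complex_of_real r = of_int k" unfolding e2pi_eq_1_iff by (rule Ints_cases)
 hence "complex_of_real r = of_real (of_int k)" by simp
 hence "r = of_int k" by (simp only: of_real_eq_iff)
 thus ?thesis by simp
qed

subsection \<open>Klein forms at the cusp\<close>

definition klein_ord :: "real => real" where
 "klein_ord u = (frac u ^ 2 - frac u) / 2"

lemma qpoch_at_cusp:
 assumes "0 <= u" "u < 1"
 shows "((%t. qpoch (e2pi (of_real u * t + of_real v)) (e2pi t)) \<longlongrightarrow> (if u = 0 then 1 - e2pi (of_real v) else 1)) at_cusp"
  "((%t. qpoch (e2pi (t - (of_real u * t + of_real v))) (e2pi t)) \<longlongrightarrow> 1) at_cusp"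
proof -
 have q: "(e2pi \<longlongrightarrow> 0) at_cusp" using e2pi_tendsto_0[of 1 0] by simp
 show "((%t. qpoch (e2pi (t - (of_real u * t + of_real v))) (e2pi t)) \<longlongrightarrow> 1) at_cusp"
  using tendsto_qpoch_1[OF e2pi_tendsto_0[of "1 - u" "- of_real v"] q] assms by (simp add: algebra_simps)
 show "((%t. qpoch (e2pi (of_real u * t + of_real v)) (e2pi t)) \<longlongrightarrow> (if u = 0 then 1 - e2pi (of_real v) else 1)) at_cusp"
 proof (cases "u = 0")
  case False
  thus ?thesis using tendsto_qpoch_1[OF e2pi_tendsto_0[of u "of_real v"] q] assms(1) by simp
 next
  case True
  have "((%t. (1 - e2pi (of_real v)) * qpoch (e2pi (1 * t + of_real v)) (e2pi t)) \<longlongrightarrow> (1 - e2pi (of_real v)) * 1) at_cusp"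
   using tendsto_qpoch_1[OF e2pi_tendsto_0[of 1 "of_real v"] q] by (intro tendsto_mult tendsto_const) simp
  moreover have "\<forall>\<^sub>F t in at_cusp. (1 - e2pi (of_real v)) * qpoch (e2pi (1 * t + of_real v)) (e2pi t) = qpoch (e2pi (of_real v)) (e2pi t)"
   using eventually_uhp_at_cusp
   by eventually_elim (simp add: qpoch_rec[OF norm_e2pi_less_1, of _ "e2pi (of_real v)"] e2pi_add[symmetric] add.commute)
  ultimately show ?thesis using True by (auto intro: Lim_transform_eventually)
 qed
qed

lemma klein_q_asymp_frac:
 assumes "0 <= u" "u < 1" "~ (u : \<int> & v : \<int>)"
 shows "EX c. c ~= 0 & q_asymp (klein u v) ((u ^ 2 - u) / 2) c"
proof -
 define k where "k = epi (of_real (u * v - v))"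
 define l where "l = (if u = 0 then 1 - e2pi (of_real v) else 1)"
 have "klein u v t * e2pi (- (of_real ((u ^ 2 - u) / 2) * t)) =
  k * qpoch (e2pi (of_real u * t + of_real v)) (e2pi t) * qpoch (e2pi (t - (of_real u * t + of_real v))) (e2pi t)" for t proof -
  have "epi (of_real u * (of_real u * t + of_real v)) * epi (- (of_real u * t + of_real v)) *
   e2pi (- (of_real ((u ^ 2 - u) / 2) * t)) = k" unfolding e2pi_eq_epi epi_add[symmetric] k_def
   by (rule arg_cong[of _ _ epi]) (simp add: algebra_simps power2_eq_square diff_divide_distrib)
  thus ?thesis unfolding klein_def theta_def by (simp add: algebra_simps)
 qed
 moreover have "((%t. k * qpoch (e2pi (of_real u * t + of_real v)) (e2pi t) *
   qpoch (e2pi (t - (of_real u * t + of_real v))) (e2pi t)) \<longlongrightarrow> k * l * 1) at_cusp"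
  unfolding l_def by (intro tendsto_mult tendsto_const qpoch_at_cusp assms(1,2))
 ultimately have "q_asymp (klein u v) ((u ^ 2 - u) / 2) (k * l)" unfolding q_asymp_def by simp
 moreover have "complex_of_real v ~: \<int>" if "v ~: \<int>"
  using that by (metis Ints_cases Ints_of_int of_real_eq_iff of_real_of_int_eq)
 hence "l ~= 0" using assms(3) by (auto simp: l_def e2pi_eq_1_iff)
 moreover have "k ~= 0" by (simp add: k_def)
 ultimately show ?thesis by (intro exI[of _ "k * l"]) simp
qed

lemma klein_q_asymp:
 assumes "~ (u : \<int> & v : \<int>)"
 shows "EX c. c ~= 0 & q_asymp (klein u v) (klein_ord u) c"
proof -
 have "~ (frac u : \<int> & v : \<int>)" using assms by (metis frac_def Ints_add Ints_of_int diff_add_cancel)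
 from klein_q_asymp_frac[OF _ _ this] obtain c where c: "c ~= 0" "q_asymp (klein (frac u) v) (klein_ord u) c"
  by (auto simp: klein_ord_def frac_lt_1)
 define e where "e = epi (of_int \<lfloor>u\<rfloor> - of_int \<lfloor>u\<rfloor> * of_real v)"
 have "e * klein (frac u) v t = klein u v t" if "t : uhp" for t
  using klein_shift[OF that, of "frac u" "\<lfloor>u\<rfloor>" v 0] by (simp add: frac_def e_def)
 hence "q_asymp (klein u v) (klein_ord u) (e * c)" using q_asymp_cong[OF q_asymp_cmult[OF c(2)]] by blast
 thus ?thesis using c(1) by (intro exI[of _ "e * c"]) (simp add: e_def)
qed

subsection \<open>The theta series\<close>

definition theta_term :: "complex => int => complex => complex" where
 "theta_term t n z = epi (of_int n + of_int (n\<^sup>2 + n) * t - 2 * of_int n * z)"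

definition theta_series :: "complex => complex => complex" where
 "theta_series t z = (\<Sum>\<^sub>\<infinity>n. theta_term t n z)"

lemma exp_neg_abs_summable: "(%n::int. exp (- \<bar>of_int n\<bar>) :: real) summable_on UNIV"
proof -
 have nat: "(%n::nat. exp (- real n)) summable_on UNIV" proof (rule norm_summable_imp_summable_on)
  have "summable (%n. exp (- 1 :: real) ^ n)" by (rule summable_geometric) simp
  thus "summable (%n. norm (exp (- real n)))" by (simp add: exp_of_nat_mult[symmetric])
 qed
 have nonneg: "(%n::int. exp (- \<bar>of_int n\<bar>) :: real) summable_on (range int)"
  by (subst summable_on_reindex) (use nat in \<open>auto simp: o_def\<close>)
 have nonpos: "(%n::int. exp (- \<bar>of_int n\<bar>) :: real) summable_on (range (%k. - int k))"
  by (subst summable_on_reindex) (use nat in \<open>auto simp: o_def inj_def\<close>)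
 have "range int \<union> range (%k. - int k) = UNIV" proof -
  have "n : range int \<union> range (%k. - int k)" for n by (cases n rule: int_cases2) auto
  thus ?thesis by blast
 qed
 thus ?thesis using summable_on_union[OF nonneg nonpos] by simp
qed

lemma theta_term_summable_bound:
 assumes "s : uhp"
 obtains M where "M summable_on UNIV" "!!n z. norm z <= R ==> norm (theta_term s n z) <= M n"
proof -
 define y where "y = Im s"
 have y: "y > 0" using assms by (simp add: uhp_def y_def)
 define B where "B = pi * y + 2 * pi * R + 1"
 define D where "D = B\<^sup>2 / (4 * pi * y)"
 show ?thesis proof (rule that[of "%n. exp D * exp (- \<bar>of_int n\<bar>)"])
  show "(%n. exp D * exp (- \<bar>real_of_int n\<bar>)) summable_on UNIV" by (intro summable_on_cmult_right exp_neg_abs_summable)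
  fix n :: int and z :: complex assume z: "norm z <= R"
  define t where "t = \<bar>real_of_int n\<bar>"
  have t: "t >= 0" "real_of_int n ^ 2 = t ^ 2" "- real_of_int n <= t" by (auto simp: t_def)
  define c where "c = pi * y"
  have c: "c > 0" using y by (simp add: c_def)
  have nrm: "norm (theta_term s n z) = exp (2 * pi * (real_of_int n * Im z) - c * (real_of_int n ^ 2 + real_of_int n))"
   unfolding theta_term_def epi_def c_def by (simp add: y_def algebra_simps)
  have "real_of_int n * Im z <= \<bar>real_of_int n\<bar> * \<bar>Im z\<bar>" by (metis abs_ge_self abs_mult)
  also have "... <= t * R" unfolding t_def using z abs_Im_le_cmod[of z] by (intro mult_left_mono) auto
  finally have "2 * pi * (real_of_int n * Im z) <= 2 * pi * (t * R)" by (intro mult_left_mono) auto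
  moreover have "c * (t\<^sup>2 - t) <= c * (real_of_int n ^ 2 + real_of_int n)" using t c by (intro mult_left_mono) auto
  moreover have "c * (t - B / (2 * c))\<^sup>2 = c * t\<^sup>2 - t * B + D"
   using y unfolding D_def by (simp add: power2_eq_square field_simps c_def)
  moreover have "c * (t - B / (2 * c))\<^sup>2 >= 0" using c by simp
  moreover have "2 * pi * (t * R) - c * (t\<^sup>2 - t) = - c * t\<^sup>2 + t * B - t" unfolding B_def c_def by (simp add: algebra_simps)
  ultimately have "2 * pi * (real_of_int n * Im z) - c * (real_of_int n ^ 2 + real_of_int n) <= D - t" by linarith
  hence "norm (theta_term s n z) <= exp (D - t)" unfolding nrm by simp
  thus "norm (theta_term s n z) <= exp D * exp (- \<bar>real_of_int n\<bar>)" by (simp add: t_def exp_diff exp_minus divide_inverse)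
 qed
qed

lemma theta_series_uniform:
 assumes "t : uhp"
 shows "uniform_limit (cball 0 R) (%A z. SUM n:A. theta_term t n z) (theta_series t) (finite_subsets_at_top UNIV)"
proof -
 obtain M where "M summable_on UNIV" "!!n y. norm y <= R ==> norm (theta_term t n y) <= M n" using theta_term_summable_bound[OF assms]
  by blast
 thus ?thesis unfolding theta_series_def by (intro Weierstrass_m_test_general[where M = M]) auto
qed

lemma theta_series_holomorphic:
 assumes "t : uhp"
 shows "theta_series t holomorphic_on UNIV"
proof -
 have "theta_series t holomorphic_on ball 0 R" for R proof (rule holomorphic_uniform_limit[OF _ theta_series_uniform[OF assms]])
  show "\<forall>\<^sub>F A in finite_subsets_at_top UNIV. continuous_on (cball 0 R) (%z. SUM n:A. theta_term t n z) &
      (%z. SUM n:A. theta_term t n z) holomorphic_on ball 0 R" unfolding theta_term_def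
   by (intro always_eventually allI conjI holomorphic_on_imp_continuous_on holomorphic_intros)
 qed auto
 hence "theta_series t holomorphic_on (UN R. ball 0 R)" by (intro holomorphic_on_UN_open) auto
 also have "(UN R. ball (0::complex) R) = UNIV" by (auto intro: gt_ex)
 finally show ?thesis .
qed

lemma theta_series_shift:
 assumes "t : uhp"
 shows "theta_series t (z + 1) = theta_series t z" "theta_series t (z + t) = - epi (- 2 * z) * theta_series t z"
  "theta_series t 0 = 0"
proof -
 have "theta_term t n (z + 1) = theta_term t n z" for n proof -
  have "theta_term t n (z + 1) = epi (of_int n + of_int (n\<^sup>2 + n) * t - 2 * of_int n * z + of_int (- 2 * n))"
   unfolding theta_term_def by (rule arg_cong[of _ _ epi]) (simp add: algebra_simps)
  thus ?thesis unfolding epi_add[of _ "of_int (- 2 * n)"] epi_of_int theta_term_def by simp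
 qed
 thus "theta_series t (z + 1) = theta_series t z" by (simp add: theta_series_def)
 have "theta_term t (n + 1) (z + t) = - epi (- 2 * z) * theta_term t n z" for n proof -
  have "theta_term t (n + 1) (z + t) = epi (1 + (- 2 * z + (of_int n + of_int (n\<^sup>2 + n) * t - 2 * of_int n * z)))"
   unfolding theta_term_def by (rule arg_cong[of _ _ epi]) (simp add: algebra_simps power2_eq_square)
  thus ?thesis unfolding epi_add theta_term_def by simp
 qed
 moreover have "(\<Sum>\<^sub>\<infinity>n. theta_term t (n + 1) (z + t)) = theta_series t (z + t)" unfolding theta_series_def
  by (rule infsum_reindex_bij_witness[of _ "%n. n - 1" "%n. n + 1"]) auto
 ultimately have "theta_series t (z + t) = (\<Sum>\<^sub>\<infinity>n. - epi (- 2 * z) * theta_term t n z)" by simp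
 thus "theta_series t (z + t) = - epi (- 2 * z) * theta_series t z" by (simp only: infsum_cmult_right' theta_series_def)
 have "theta_term t (- 1 - n) 0 = - theta_term t n 0" for n proof -
  have "theta_term t (- 1 - n) 0 = epi (of_int (- 1 - 2 * n) + (of_int n + of_int (n\<^sup>2 + n) * t))"
   unfolding theta_term_def by (rule arg_cong[of _ _ epi]) (simp add: algebra_simps power2_eq_square)
  thus ?thesis unfolding epi_add[of "of_int (- 1 - 2 * n)"] epi_of_int theta_term_def by simp
 qed
 moreover have "(\<Sum>\<^sub>\<infinity>n. theta_term t (- 1 - n) 0) = theta_series t 0" unfolding theta_series_def
  by (rule infsum_reindex_bij_witness[of _ "%n. - 1 - n" "%n. - 1 - n"]) auto
 ultimately have "theta_series t 0 = - theta_series t 0" by (simp add: theta_series_def infsum_uminus)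
 thus "theta_series t 0 = 0" by simp
qed

lemma theta_term_has_integral:
 "((%x::real. theta_term t n (of_real x)) has_integral (if n = 0 then 1 else 0)) {0..1}"
proof (cases "n = 0")
 case True
 thus ?thesis using has_integral_const_real[of "1::complex" 0 1] by (simp add: theta_term_def)
next
 case False
 define a where "a = - 2 * pi * \<i> * of_int n"
 have a: "a ~= 0" using False by (simp add: a_def)
 define F where "F z = theta_term t n z / a" for z
 have exp: "theta_term t n z = theta_term t n 0 * exp (a * z)" for z
  unfolding theta_term_def epi_def a_def exp_add[symmetric] by (rule arg_cong[of _ _ exp]) (simp add: algebra_simps)
 have "((%z. theta_term t n 0 * exp (a * z) / a) has_field_derivative theta_term t n 0 * exp (a * z)) (at z)" for z
  using a by (auto intro!: derivative_eq_intros)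
 hence "(F has_field_derivative theta_term t n z) (at z)" for z unfolding F_def exp[symmetric] .
 hence "((%x. F (of_real x)) has_vector_derivative theta_term t n (of_real x)) (at x within {0..1})" for x :: real
  by (rule has_vector_derivative_at_within[OF has_vector_derivative_real_field])
 hence "((%x::real. theta_term t n (of_real x)) has_integral F (of_real 1) - F (of_real 0)) {0..1}"
  by (intro fundamental_theorem_of_calculus) auto
 moreover have "exp a = 1" using exp_integer_2pi[of "of_int (- n)"] by (simp add: a_def mult_ac)
 hence "F 1 = F 0" using exp[of 1] by (simp add: F_def)
 ultimately show ?thesis using False by simp
qed

text \<open>The \<open>0\<close>-th Fourier coefficient of the series is \<open>1\<close>.\<close>
lemma theta_series_nonzero:
 assumes "t : uhp"
 shows "EX z. theta_series t z ~= 0"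
proof (rule ccontr)
 assume "~ ?thesis"
 hence zero: "theta_series t z = 0" for z by auto
 have "uniform_limit {0..1} (%A x. SUM n:A. theta_term t n (of_real x)) (%x::real. theta_series t (of_real x)) (finite_subsets_at_top UNIV)"
  by (rule uniform_limit_compose'[OF theta_series_uniform[OF assms, of 1]]) auto
 moreover have "continuous_on {0..1} (%x::real. SUM n:A. theta_term t n (of_real x))" for A
  unfolding theta_term_def epi_def by (intro continuous_on_sum continuous_on_exp continuous_on_mult
   continuous_on_diff continuous_on_const continuous_on_of_real continuous_on_id)
 ultimately obtain I J where IJ: "!!A. ((%x::real. SUM n:A. theta_term t n (of_real x)) has_integral I A) {0..1}"
  "((%x::real. theta_series t (of_real x)) has_integral J) {0..1}" "(I \<longlongrightarrow> J) (finite_subsets_at_top UNIV)"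
  by (rule uniform_limit_integral) auto
 have "I A = 1" if A: "finite A" "0 : A" for A proof -
  have "((%x::real. SUM n:A. theta_term t n (of_real x)) has_integral (SUM n:A. if n = 0 then 1 else 0)) {0..1}"
   by (intro has_integral_sum theta_term_has_integral A)
  from has_integral_unique[OF IJ(1) this] show ?thesis using A by simp
 qed
 hence "\<forall>\<^sub>F A in finite_subsets_at_top UNIV. I A = 1"
  unfolding eventually_finite_subsets_at_top by (intro exI[of _ "{0}"]) auto
 hence "(I \<longlongrightarrow> 1) (finite_subsets_at_top UNIV)" by (rule tendsto_eventually)
 hence "J = 1" using IJ(3) tendsto_unique[OF finite_subsets_at_top_neq_bot] by blast
 moreover have "J = 0" using IJ(2) unfolding zero by (rule has_integral_unique[OF _ has_integral_0])
 ultimately show False by simp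
qed

lemma theta_series_eq_theta:
 assumes "t : uhp"
 shows "EX C. C ~= 0 & (ALL z. theta_series t z = C * (epi z * theta z t))"
proof -
 have "EX C. ALL z. theta_series t z = C * (epi z * theta z t)"
 proof (rule quasiperiodic_proportional[OF assms, where ?e1.0 = "%_. 1" and ?e2.0 = "%z. - epi (- 2 * z)"])
  have hol: "(%z. theta z t) holomorphic_on UNIV" by (intro holomorphic_intros theta_holomorphic) (auto simp: assms)
  thus "(%z. epi z * theta z t) holomorphic_on UNIV" by (intro holomorphic_intros)
  show "epi (z + t) * theta (z + t) t = - epi (- 2 * z) * (epi z * theta z t)" for z
   unfolding theta_add_tau[OF assms] by (simp add: epi_add epi_diff epi_minus field_simps)
  show "theta_series t z = 0 & deriv (%z. epi z * theta z t) z ~= 0" if zero: "epi z * theta z t = 0" for z proof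
   have z: "z : periods t" using zero theta_eq_0_iff[OF assms] by simp
   then obtain m n where mn: "z = of_int m + of_int n * t" unfolding periods_def by auto
   show "theta_series t z = 0" unfolding mn using theta_series_shift[OF assms]
    int_shift_invariant[of "%z. theta_series t z = 0" 1 0 m] int_shift_invariant[of "%z. theta_series t z = 0" t "of_int m" n] by simp
   have "((%z. epi z * theta z t) has_field_derivative deriv epi z * theta z t + deriv (%z. theta z t) z * epi z) (at z)"
    by (intro DERIV_mult holomorphic_derivI[of _ UNIV] hol) (auto intro!: holomorphic_intros)
   hence "deriv (%z. epi z * theta z t) z = deriv (%z. theta z t) z * epi z" using zero by (simp add: DERIV_imp_deriv)
   thus "deriv (%z. epi z * theta z t) z ~= 0" using theta_deriv_periods[OF assms z] by simp
  qed
 qed (use theta_series_shift[OF assms] theta_series_holomorphic[OF assms] in \<open>auto simp: theta_add_1 epi_add\<close>)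
 then obtain C where C: "!!z. theta_series t z = C * (epi z * theta z t)" by blast
 moreover have "C ~= 0" using theta_series_nonzero[OF assms] C by auto
 ultimately show ?thesis by blast
qed

lemma theta_a_eq_klein:
 assumes "t : uhp"
 shows "EX C. C ~= 0 & (ALL k. theta_a k t = C * ((-1) ^ (k + 1) * klein (of_nat k / 7) 0 (7 * t)))"
proof -
 have seven: "7 * t : uhp" using assms by (simp add: uhp_def)
 obtain C where C: "C ~= 0" "!!z. theta_series (7 * t) z = C * (epi z * theta z (7 * t))" using theta_series_eq_theta[OF seven] by blast
 have "theta_a k t = (C * epi (7 / 4 * t)) * ((-1) ^ (k + 1) * klein (of_nat k / 7) 0 (7 * t))" for k proof -
  define E where "E = epi (of_int ((7 - 2 * int k)\<^sup>2) / 28 * t)"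
  have "(-1) powi (n + int k + 1) * exp (2 * pi * \<i> * (of_int ((14 * n + 7 - 2 * int k)\<^sup>2) / 56) * t) =
     ((-1) ^ (k + 1) * E) * theta_term (7 * t) n (of_nat k * t)" for n proof -
   have "(-1 :: complex) powi (n + int k + 1) = (-1) powi n * (-1) powi (int (k + 1))"
    by (simp add: power_int_add add.assoc del: of_nat_add)
   also have "(-1 :: complex) powi n = epi (of_int n)" by (simp add: epi_of_int power_int_minus_one_minus power_int_minus_left)
   also have "(-1 :: complex) powi (int (k + 1)) = (-1) ^ (k + 1)" by (rule power_int_of_nat)
   finally have sign: "(-1 :: complex) powi (n + int k + 1) = (-1) ^ (k + 1) * epi (of_int n)" by simp
   have exponent: "exp (2 * pi * \<i> * (of_int ((14 * n + 7 - 2 * int k)\<^sup>2) / 56) * t) =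
    epi (of_int ((14 * n + 7 - 2 * int k)\<^sup>2) / 28 * t)" unfolding epi_def by (rule arg_cong[of _ _ exp]) (simp add: field_simps)
   have "epi (of_int n) * epi (of_int ((14 * n + 7 - 2 * int k)\<^sup>2) / 28 * t) = E * theta_term (7 * t) n (of_nat k * t)"
    unfolding E_def theta_term_def epi_add[symmetric] by (rule arg_cong[of _ _ epi]) (simp add: field_simps power2_eq_square)
   thus ?thesis unfolding sign exponent by (simp add: mult.assoc)
  qed
  hence "theta_a k t = ((-1) ^ (k + 1) * E) * theta_series (7 * t) (of_nat k * t)"
   unfolding theta_a_def theta_series_def by (simp only: infsum_cmult_right')
  also have "... = C * (-1) ^ (k + 1) * (E * epi (of_nat k * t)) * theta (of_nat k * t) (7 * t)" unfolding C(2) by (simp add: mult_ac)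
  also have "E * epi (of_nat k * t) = epi (7 / 4 * t) * epi (of_nat k / 7 * (of_nat k * t))" unfolding E_def epi_add[symmetric]
   by (rule arg_cong[of _ _ epi]) (simp add: field_simps power2_eq_square)
  finally show ?thesis unfolding klein_def by (simp add: mult_ac)
 qed
 thus ?thesis using C(1) by (intro exI[of _ "C * epi (7 / 4 * t)"]) auto
qed

section \<open>The generators in terms of Klein forms\<close>

subsection \<open>Klein forms of level 7\<close>

definition klein7 :: "real => real => real => int => complex => complex" where
 "klein7 a u v k t = epi (of_real a * of_int k) * klein (of_int k / 7 + u) v (7 * t)"

text \<open>The twists make \<open>Sk\<close> odd, \<open>Tk\<close> and \<open>Uk\<close> even, and all three 7-periodic in \<open>k\<close>.\<close>

abbreviation "Sk == klein7 1 0 0"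
abbreviation "Tk == klein7 (- 1 / 14) 0 (1 / 2)"
abbreviation "Uk == klein7 1 (1 / 2) 0"

lemma uhp_7: "t : uhp ==> 7 * t : uhp" by (simp add: uhp_def)

lemma klein7_minus:
 assumes t: "t : uhp" and uv: "2 * u = of_int m" "2 * v = of_int n"
 shows "klein7 a u v (- k) t = - epi (- (2 * of_real a * of_int k + of_int (m + n + m * n) + of_int n * of_int k / 7)) * klein7 a u v k t"
proof -
 have u: "u = of_int m / 2" and v: "v = of_int n / 2" using uv by simp_all
 define x where "x = (of_int k / 7 - u :: real)"
 have "klein (of_int (- k) / 7 + u) v (7 * t) = - klein x (- v) (7 * t)"
  using klein_minus[OF uhp_7[OF t], of x "- v"] by (simp add: x_def)
 moreover have "klein (of_int k / 7 + u) v (7 * t) =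
   epi (of_int (m + n + m * n) + of_int n * of_int k / 7) * klein x (- v) (7 * t)" proof -
  have exponent: "of_int (m + n + m * n) + of_int n * of_real x - of_int m * of_real (- v) =
    of_int (m + n + m * n) + of_int n * of_int k / (7 :: complex)" by (simp add: x_def u v field_simps)
  have "x + of_int m = of_int k / 7 + u" "- v + of_int n = v" by (simp_all add: x_def u v)
  thus ?thesis using klein_shift[OF uhp_7[OF t], of x m "- v" n] unfolding exponent by simp
 qed
 moreover have "epi (of_real a * of_int (- k)) = epi (- (2 * of_real a * of_int k + of_int (m + n + m * n) + of_int n * of_int k / 7)) *
   (epi (of_real a * of_int k) * epi (of_int (m + n + m * n) + of_int n * of_int k / 7))"
  unfolding epi_add[symmetric] by (rule arg_cong[of _ _ epi]) (simp add: algebra_simps)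
 ultimately show ?thesis by (simp add: klein7_def)
qed

lemma klein7_add_7:
 assumes "t : uhp"
 shows "klein7 a u v (k + 7) t = epi (7 * of_real a + 1 - of_real v) * klein7 a u v k t"
proof -
 have "klein (of_int (k + 7) / 7 + u) v (7 * t) = epi (1 - of_real v) * klein (of_int k / 7 + u) v (7 * t)"
  using klein_shift[OF uhp_7[OF assms], of "of_int k / 7 + u" 1 v 0] by (simp add: add_divide_distrib add_ac)
 moreover have "epi (of_real a * of_int (k + 7)) * epi (1 - of_real v) = epi (7 * of_real a + 1 - of_real v) * epi (of_real a * of_int k)"
  unfolding epi_add[symmetric] by (rule arg_cong[of _ _ epi]) (simp add: algebra_simps)
 ultimately show ?thesis unfolding klein7_def by (simp add: mult.assoc[symmetric])
qed

lemma klein7_eq_0_iff: "t : uhp ==> klein7 a u v k t = 0 \<longleftrightarrow> of_int k / 7 + u : \<int> & v : \<int>"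
 by (simp add: klein7_def klein_eq_0_iff uhp_7)

lemma
 assumes "t : uhp"
 shows Sk_minus: "Sk (- k) t = - Sk k t" and Sk_7: "Sk (k + 7) t = Sk k t"
  and Tk_minus: "Tk (- k) t = Tk k t" and Tk_7: "Tk (k + 7) t = Tk k t"
  and Uk_minus: "Uk (- k) t = Uk k t" and Uk_7: "Uk (k + 7) t = Uk k t"
 using klein7_minus[OF assms, of 0 0 0 0 1 k] klein7_minus[OF assms, of 0 0 "1/2" 1 "-1/14" k]
  klein7_minus[OF assms, of "1/2" 1 0 0 1 k] epi_of_int[of "- (2 * k)"] epi_of_int[of "- (2 * k + 1)"] epi_of_int[of 8] epi_of_int[of "- 1"]
 by (simp_all add: klein7_add_7[OF assms])

lemma Sk_nonzero: "t : uhp ==> ~ 7 dvd k ==> Sk k t ~= 0"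
 using of_int_div_of_int_in_Ints_iff[of k 7, where 'a = real] by (simp add: klein7_eq_0_iff)

lemma Tk_nonzero: "t : uhp ==> Tk k t ~= 0" using half_not_Int by (simp add: klein7_eq_0_iff)

lemma Uk_nonzero:
 assumes "t : uhp"
 shows "Uk k t ~= 0"
proof -
 have quotient: "of_int k / 7 + 1 / 2 = of_int (2 * k + 7) / (of_int 14 :: real)" by simp
 have "~ 14 dvd 2 * k + 7" by presburger
 thus ?thesis unfolding klein7_eq_0_iff[OF assms] quotient of_int_div_of_int_in_Ints_iff by simp
qed

lemma klein7_pair:
 "klein7 a u v (x + y) t * klein7 a u v (x - y) t =
   epi (2 * of_real a * of_int x) * klein_pair (of_int x / 7 + u) v (of_int y / 7) 0 (7 * t)"
proof -
 have "of_int (x + y) / 7 + u = of_int x / 7 + u + of_int y / 7" "of_int (x - y) / 7 + u = of_int x / 7 + u - of_int y / 7"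
  by (simp_all add: add_divide_distrib diff_divide_distrib)
 hence "klein7 a u v (x + y) t * klein7 a u v (x - y) t =
   (epi (of_real a * of_int (x + y)) * epi (of_real a * of_int (x - y))) * klein_pair (of_int x / 7 + u) v (of_int y / 7) 0 (7 * t)"
  unfolding klein7_def klein_pair_def by (simp only: mult_ac add_0_right diff_0_right)
 also have "epi (of_real a * of_int (x + y)) * epi (of_real a * of_int (x - y)) = epi (2 * of_real a * of_int x)"
  unfolding epi_add[symmetric] by (rule arg_cong[of _ _ epi]) (simp add: algebra_simps)
 finally show ?thesis .
qed

lemma klein7_three_term:
 fixes \<alpha> u v :: real
 assumes t: "t : uhp" and ndvd: "~ 7 dvd 2 * b" "~ 7 dvd b + c" "~ 7 dvd b - c"
 defines "W == klein7 \<alpha> u v"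
 shows "W (a + b) t * W (a - b) t * (Sk (c + d) t * Sk (c - d) t) + Sk (b + c) t * Sk (b - c) t * (W (a + d) t * W (a - d) t)
   - W (a + c) t * W (a - c) t * (Sk (b + d) t * Sk (b - d) t) = 0"
proof -
 let ?KP = "%x x' y. klein_pair x x' (of_int y / 7) 0 (7 * t)"
 have S: "Sk (x + y) t * Sk (x - y) t = ?KP (of_int x / 7) 0 y" for x y
  using epi_of_int[of "2 * x"] by (simp add: klein7_pair)
 have swap: "klein_pair y y' x x' (7 * t) = - klein_pair x x' y y' (7 * t)" for x x' y y'
  using klein_minus[OF uhp_7[OF t], of "x - y" "x' - y'"] by (simp add: klein_pair_def add.commute)
 have "Sk (2 * b) t ~= 0" "Sk (b + c) t * Sk (b - c) t ~= 0" using Sk_nonzero[OF t] ndvd by auto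
 hence "klein (2 * (of_int b / 7)) (2 * 0) (7 * t) ~= 0" "?KP (of_int b / 7) 0 c ~= 0" unfolding S by (auto simp: klein7_def)
 from klein_three_term[OF uhp_7[OF t] this, of "of_int a / 7 + u" v "of_int d / 7" 0]
 have "epi (2 * of_real \<alpha> * of_int a) * (?KP (of_int a / 7 + u) v b * ?KP (of_int c / 7) 0 d
   + ?KP (of_int b / 7) 0 c * ?KP (of_int a / 7 + u) v d - ?KP (of_int a / 7 + u) v c * ?KP (of_int b / 7) 0 d) = 0"
  unfolding swap[of "of_int c / 7" 0] by simp
 thus ?thesis unfolding W_def klein7_pair[of \<alpha>] S by (simp add: algebra_simps)
qed

subsection \<open>The cubic equation\<close>

lemma Sk_values:
 assumes "t : uhp"
 shows "Sk 4 t = - Sk 3 t" "Sk 5 t = - Sk 2 t" "Sk 6 t = - Sk 1 t" "Sk 8 t = Sk 1 t"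
  "Sk (- 2) t = - Sk 2 t" "Sk (- 4) t = Sk 3 t"
 using Sk_7[OF assms, of "-3"] Sk_7[OF assms, of "-2"] Sk_7[OF assms, of "-1"] Sk_7[OF assms, of 1]
  Sk_minus[OF assms, of 3] Sk_minus[OF assms, of 2] Sk_minus[OF assms, of 1] Sk_minus[OF assms, of 4] by simp_all

lemma even_periodic_values:
 fixes T :: "int => complex"
 assumes e: "!!k. T (- k) = T k" and p: "!!k. T (k + 7) = T k"
 shows "T 4 = T 3" "T 5 = T 2" "T 6 = T 1" "T 8 = T 1" "T 10 = T 3" "T 12 = T 2" "T 16 = T 2"
 using p[of "-3"] e[of 3] p[of "-2"] e[of 2] p[of "-1"] e[of 1] p[of 1] p[of 3] p[of 5] p[of 9] p[of 2] by simp_all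

lemma Klein_quartic:
 assumes "t : uhp"
 shows "Sk 1 t * Sk 3 t ^ 3 = Sk 1 t ^ 3 * Sk 2 t - Sk 2 t ^ 3 * Sk 3 t"
 using klein7_three_term[OF assms, where a = 3 and b = 2 and c = 1 and d = 0 and \<alpha> = 1 and u = 0 and v = 0]
 by (simp add: Sk_values[OF assms] power3_eq_cube) (simp add: algebra_simps)

lemma two_torsion_relations:
 assumes t: "t : uhp" and W: "!!k. klein7 \<alpha> u v (- k) t = klein7 \<alpha> u v k t" "!!k. klein7 \<alpha> u v (k + 7) t = klein7 \<alpha> u v k t"
 defines "T k == klein7 \<alpha> u v k t"
 shows "Sk 2 t * Sk 3 t * T 2 ^ 2 - Sk 1 t ^ 2 * T 1 * T 2 + Sk 3 t ^ 2 * T 1 * T 3 = 0"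
  "Sk 1 t * Sk 3 t * T 3 ^ 2 - Sk 2 t ^ 2 * T 2 * T 3 + Sk 1 t ^ 2 * T 1 * T 2 = 0"
proof -
 note period = W(1) even_periodic_values[of "%k. klein7 \<alpha> u v k t", OF W] Sk_values[OF t]
 show "Sk 2 t * Sk 3 t * T 2 ^ 2 - Sk 1 t ^ 2 * T 1 * T 2 + Sk 3 t ^ 2 * T 1 * T 3 = 0"
  using klein7_three_term[OF t, where a = 5 and b = 1 and c = 3 and d = 0 and \<alpha> = \<alpha> and u = u and v = v]
   by (simp add: T_def period power2_eq_square) (simp add: algebra_simps)
 show "Sk 1 t * Sk 3 t * T 3 ^ 2 - Sk 2 t ^ 2 * T 2 * T 3 + Sk 1 t ^ 2 * T 1 * T 2 = 0"
  using klein7_three_term[OF t, where a = 10 and b = 2 and c = 6 and d = 0 and \<alpha> = \<alpha> and u = u and v = v]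
   by (simp add: T_def period power2_eq_square) (simp add: algebra_simps)
qed

lemma Klein_quartic_minus_1:
 fixes X Y Z :: "'a :: field"
 assumes "X ~= 0" "Y ~= 0" "X * Z ^ 3 = X ^ 3 * Y - Y ^ 3 * Z"
 shows "Y ^ 2 * Z / X ^ 3 - 1 = - (Z ^ 3) / (X ^ 2 * Y)"
proof -
 have "(Y ^ 2 * Z / X ^ 3 - 1) * (X ^ 3 * Y) = - (X * Z ^ 3)"
  unfolding assms(3) using assms(1) by (simp add: field_simps power2_eq_square power3_eq_cube)
 hence "Y ^ 2 * Z / X ^ 3 - 1 = - (X * Z ^ 3) / (X ^ 3 * Y)" using assms(1,2) by (intro eq_divide_imp) auto
 thus ?thesis using assms(1) by (simp add: power2_eq_square power3_eq_cube mult.assoc)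
qed

lemma cubic_root:
 fixes X Y Z r :: "'a :: field"
 assumes nz: "X ~= 0" "Y ~= 0" "Z ~= 0" "r ~= 0" and quartic: "X * Z ^ 3 = X ^ 3 * Y - Y ^ 3 * Z"
  and r: "(X * Z * r ^ 2 - Y ^ 2 * r) * (X ^ 2 - Z ^ 2 * r) + X ^ 2 * Y * Z = 0"
 defines "g == - (Z / (Y * r))" and "u == Y ^ 2 * Z / X ^ 3"
 shows "u * g ^ 3 + u * g ^ 2 - (u ^ 2 - 1) * g + (u - 1) ^ 2 = 0"
proof -
 have u_minus_1: "u - 1 = - (Z ^ 3) / (X ^ 2 * Y)" unfolding u_def by (rule Klein_quartic_minus_1[OF nz(1,2) quartic])
 have "u + 1 = (X ^ 3 + Y ^ 2 * Z) / X ^ 3" using nz by (simp add: u_def field_simps)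
 hence "(u + 1) * (u - 1) = - ((X ^ 3 + Y ^ 2 * Z) * Z ^ 3) / (X ^ 5 * Y)"
  unfolding u_minus_1 using nz by (simp add: field_simps eval_nat_numeral)
 hence u2: "u ^ 2 - 1 = - ((X ^ 3 + Y ^ 2 * Z) * Z ^ 3) / (X ^ 5 * Y)" by (simp add: power2_eq_square algebra_simps)
 define M where "M = X ^ 5 * Y ^ 2 * r ^ 3"
 have terms: "u * g ^ 3 * M = - (Z ^ 3) * (X ^ 2 * Y * Z)" "u * g ^ 2 * M = Z ^ 3 * (X ^ 2 * Y ^ 2 * r)"
  "(u ^ 2 - 1) * g * M = Z ^ 3 * ((X ^ 3 + Y ^ 2 * Z) * Z * r ^ 2)" "(u - 1) ^ 2 * M = Z ^ 3 * (X * Z ^ 3 * r ^ 3)"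
  unfolding M_def u2 u_minus_1 unfolding g_def u_def using nz by (simp_all add: field_simps eval_nat_numeral)
 have dist: "(a + b - c + d) * M = a * M + b * M - c * M + d * M" for a b c d :: 'a by (simp add: algebra_simps)
 have "(u * g ^ 3 + u * g ^ 2 - (u ^ 2 - 1) * g + (u - 1) ^ 2) * M =
   - (Z ^ 3) * ((X * Z * r ^ 2 - Y ^ 2 * r) * (X ^ 2 - Z ^ 2 * r) + X ^ 2 * Y * Z)"
  unfolding dist terms by (simp add: algebra_simps eval_nat_numeral)
 thus ?thesis using nz unfolding r M_def by simp
qed

lemma cubic_root_of_two_torsion_values:
 fixes X Y Z T1 T2 T3 :: "'a :: field"
 assumes nz: "X ~= 0" "Y ~= 0" "Z ~= 0" "T1 ~= 0" "T2 ~= 0" "T3 ~= 0"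
  and quartic: "X * Z ^ 3 = X ^ 3 * Y - Y ^ 3 * Z"
  and torsion: "Y * Z * T2 ^ 2 - X ^ 2 * T1 * T2 + Z ^ 2 * T1 * T3 = 0" "X * Z * T3 ^ 2 - Y ^ 2 * T2 * T3 + X ^ 2 * T1 * T2 = 0"
 defines "g == - (Z / Y) * (T2 / T3)" and "u == Y ^ 2 * Z / X ^ 3"
 shows "u * g ^ 3 + u * g ^ 2 - (u ^ 2 - 1) * g + (u - 1) ^ 2 = 0"
  "(Z ^ 2 / Y ^ 2) * (X / Y - (Z / Y) * (Y / X * (T2 / T1))) * g = - ((u - 1) ^ 2 / u)"
proof -
 define r p where "r = T3 / T2" and "p = T2 / T1"
 have rp: "r ~= 0" "p ~= 0" "T2 = p * T1" "T3 = r * p * T1" using nz by (auto simp: r_def p_def)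
 have "p * T1 ^ 2 * (Y * Z * p - X ^ 2 + Z ^ 2 * r) = 0" "p * T1 ^ 2 * (X * Z * r ^ 2 * p - Y ^ 2 * p * r + X ^ 2) = 0"
  using torsion unfolding rp(3,4) by algebra+
 hence "Y * Z * p - X ^ 2 + Z ^ 2 * r = 0" "X * Z * r ^ 2 * p - Y ^ 2 * p * r + X ^ 2 = 0" using nz rp by simp_all
 hence p: "Y * Z * p = X ^ 2 - Z ^ 2 * r" and "(X * Z * r ^ 2 - Y ^ 2 * r) * (Y * Z * p) + X ^ 2 * Y * Z = 0" by algebra+
 hence r: "(X * Z * r ^ 2 - Y ^ 2 * r) * (X ^ 2 - Z ^ 2 * r) + X ^ 2 * Y * Z = 0" by simp
 have g: "g = - (Z / (Y * r))" using nz by (simp add: g_def r_def)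
 show "u * g ^ 3 + u * g ^ 2 - (u ^ 2 - 1) * g + (u - 1) ^ 2 = 0"
  unfolding g u_def by (rule cubic_root[OF nz(1-3) rp(1) quartic r])
 have "X / Y - (Z / Y) * (Y / X * (T2 / T1)) = (X ^ 2 - Y * Z * p) / (X * Y)"
  unfolding p_def[symmetric] using nz by (simp add: field_simps power2_eq_square)
 also have "... = Z ^ 2 * r / (X * Y)" unfolding p by simp
 finally have factor: "X / Y - (Z / Y) * (Y / X * (T2 / T1)) = Z ^ 2 * r / (X * Y)" .
 have "(Z ^ 2 / Y ^ 2) * (X / Y - (Z / Y) * (Y / X * (T2 / T1))) * g = - (Z ^ 5 / (X * Y ^ 4))"
  unfolding factor g using nz rp(1) by (simp add: field_simps eval_nat_numeral)
 also have "Z ^ 5 / (X * Y ^ 4) = (u - 1) ^ 2 / u"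
  unfolding u_def Klein_quartic_minus_1[OF nz(1,2) quartic] using nz by (simp add: field_simps eval_nat_numeral)
 finally show "(Z ^ 2 / Y ^ 2) * (X / Y - (Z / Y) * (Y / X * (T2 / T1))) * g = - ((u - 1) ^ 2 / u)" .
qed

subsection \<open>The functions \<open>phi1\<close>, \<open>g1\<close> and the third root\<close>

lemma theta_double:
 assumes "t : uhp"
 shows "theta (2 * z) (2 * t) = epi (1 / 2) * (theta z t * theta (z + 1 / 2) t)"
proof -
 have sq: "e2pi (2 * x) = (e2pi x)\<^sup>2" for x by (simp add: e2pi_power)
 have half: "e2pi (x + 1 / 2) = - e2pi x" for x by (simp add: e2pi_add) (simp add: e2pi_eq_epi)
 have "e2pi (t - (z + 1 / 2)) = - e2pi (t - z)" using half[of "t - z - 1"] e2pi_add[of "t - z - 1" 1] by (simp add: algebra_simps)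
 hence "epi (1 / 2) * (theta z t * theta (z + 1 / 2) t) = (epi (1 / 2) * epi (- z) * epi (- (z + 1 / 2))) *
  (qpoch (e2pi z) (e2pi t) * qpoch (- e2pi z) (e2pi t)) * (qpoch (e2pi (t - z)) (e2pi t) * qpoch (- e2pi (t - z)) (e2pi t))"
  unfolding theta_def half by (simp add: mult_ac)
 also have "epi (1 / 2) * epi (- z) * epi (- (z + 1 / 2)) = epi (- (2 * z))" unfolding epi_add[symmetric]
  by (rule arg_cong[of _ _ epi]) simp
 finally show ?thesis unfolding qpoch_square[OF norm_e2pi_less_1[OF assms], symmetric] sq[symmetric] theta_def by (simp add: algebra_simps)
qed

lemma theta_halve:
 assumes "t : uhp"
 shows "theta z t = epi (z + t) * (theta z (2 * t) * theta (z + t) (2 * t))"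
proof -
 have sq: "e2pi (2 * x) = (e2pi x)\<^sup>2" for x by (simp add: e2pi_power)
 have eo: "qpoch (e2pi x) (e2pi t) = qpoch (e2pi x) (e2pi (2 * t)) * qpoch (e2pi (x + t)) (e2pi (2 * t))" for x
  using qpoch_even_odd[OF norm_e2pi_less_1[OF assms], of "e2pi x"] by (simp add: sq e2pi_add)
 have "epi (z + t) * (theta z (2 * t) * theta (z + t) (2 * t)) = (epi (z + t) * epi (- z) * epi (- (z + t))) *
   (qpoch (e2pi z) (e2pi (2 * t)) * qpoch (e2pi (z + t)) (e2pi (2 * t))) *
   (qpoch (e2pi (2 * t - (z + t))) (e2pi (2 * t)) * qpoch (e2pi (2 * t - z)) (e2pi (2 * t)))" unfolding theta_def by (simp add: mult_ac)
 also have "epi (z + t) * epi (- z) * epi (- (z + t)) = epi (- z)" unfolding epi_add[symmetric] by (rule arg_cong[of _ _ epi]) simp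
 also have "2 * t - (z + t) = t - z" by simp
 also have "2 * t - z = t - z + t" by simp
 finally show ?thesis unfolding eo[symmetric] by (simp add: theta_def)
qed

lemma phi_values:
 assumes "t : uhp"
 shows "upsilon_fun t = Sk 2 t ^ 2 * Sk 3 t / Sk 1 t ^ 3"
  "phi1 t = - Sk 3 t / Sk 2 t" "phi2 t = - Sk 2 t / Sk 1 t"
  "phi1 t = klein (3 / 7) 0 (7 * t) / klein (2 / 7) 0 (7 * t)"
proof -
 obtain C where C: "C ~= 0" "!!k. theta_a k t = C * ((-1) ^ (k + 1) * klein (of_nat k / 7) 0 (7 * t))"
  using theta_a_eq_klein[OF assms] by blast
 have "theta_a k t = - C * Sk (int k) t" for k using epi_of_int[of "int k"] by (simp add: C(2) klein7_def)
 from this[of 1] this[of 2] this[of 3]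
 have a: "theta_a 1 t = - C * Sk 1 t" "theta_a 2 t = - C * Sk 2 t" "theta_a 3 t = - C * Sk 3 t" by auto
 have nz: "Sk 1 t ~= 0" "Sk 2 t ~= 0" "Sk 3 t ~= 0" using Sk_nonzero[OF assms] by auto
 show "upsilon_fun t = Sk 2 t ^ 2 * Sk 3 t / Sk 1 t ^ 3"
  unfolding upsilon_fun_def a using nz C(1) by (simp add: field_simps eval_nat_numeral)
 show p1: "phi1 t = - Sk 3 t / Sk 2 t" unfolding phi1_def a using nz C(1) by simp
 show "phi2 t = - Sk 2 t / Sk 1 t" unfolding phi2_def a using nz C(1) by simp
 show "phi1 t = klein (3 / 7) 0 (7 * t) / klein (2 / 7) 0 (7 * t)"
  unfolding p1 klein7_def using epi_of_int[of 3] epi_of_int[of 2] by simp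
qed

lemma klein_double:
 assumes "t : uhp"
 shows "klein u 0 (2 * t) = epi (1 / 2) * (klein u 0 t * (epi (- (of_real u / 2)) * klein u (1 / 2) t))"
proof -
 have "klein u 0 (2 * t) = epi (of_real u * (of_real u * (2 * t))) * theta (2 * (of_real u * t)) (2 * t)"
  unfolding klein_def by (simp add: mult_ac)
 also have "... = (epi (of_real u * (of_real u * (2 * t))) * epi (1 / 2)) * (theta (of_real u * t) t * theta (of_real u * t + 1 / 2) t)"
  unfolding theta_double[OF assms] by simp
 also have "epi (of_real u * (of_real u * (2 * t))) * epi (1 / 2) = epi (1 / 2) * epi (of_real u * (of_real u * t)) *
   (epi (- (of_real u / 2)) * epi (of_real u * (of_real u * t + 1 / 2)))"
  unfolding epi_add[symmetric] by (rule arg_cong[of _ _ epi]) (simp add: field_simps)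
 finally show ?thesis unfolding klein_def by (simp add: mult_ac)
qed

lemma klein_halve:
 assumes "t : uhp"
 shows "klein u 0 (t / 2) = epi (t / 4) * (klein (u / 2) 0 t * klein ((u + 1) / 2) 0 t)"
proof -
 have "t / 2 : uhp" using assms by (simp add: uhp_def)
 hence "klein u 0 (t / 2) = epi (of_real u * (of_real u * (t / 2))) * epi (of_real u * (t / 2) + t / 2) *
   (theta (of_real u * (t / 2)) t * theta (of_real u * (t / 2) + t / 2) t)"
  unfolding klein_def using theta_halve[of "t / 2" "of_real u * (t / 2)"] by (simp add: mult.assoc)
 also have "epi (of_real u * (of_real u * (t / 2))) * epi (of_real u * (t / 2) + t / 2) =
  epi (t / 4) * (epi (of_real (u / 2) * (of_real (u / 2) * t)) * epi (of_real ((u + 1) / 2) * (of_real ((u + 1) / 2) * t)))"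
  unfolding epi_add[symmetric] by (rule arg_cong[of _ _ epi]) (simp add: field_simps)
 finally show ?thesis unfolding klein_def by (simp add: mult_ac add_divide_distrib distrib_left)
qed

lemma phi1_double:
 assumes "t : uhp"
 shows "phi1 (2 * t) = - Sk 3 t / Sk 2 t * (Tk 3 t / Tk 2 t)"
proof -
 have "2 * t : uhp" using assms by (simp add: uhp_def)
 moreover have "klein (of_int k / 7) 0 (2 * (7 * t)) = epi (1 / 2) * (klein (of_int k / 7) 0 (7 * t) * Tk k t)" for k
  unfolding klein_double[OF uhp_7[OF assms]] by (simp add: klein7_def)
 from this[of 3] this[of 2] have "klein (3 / 7) 0 (7 * (2 * t)) / klein (2 / 7) 0 (7 * (2 * t)) = - Sk 3 t / Sk 2 t * (Tk 3 t / Tk 2 t)"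
  using epi_of_int[of 3] epi_of_int[of 2] by (simp add: klein7_def[of 1] mult.left_commute)
 ultimately show ?thesis using phi_values(4) by simp
qed

lemma phi1_halve:
 assumes "t : uhp"
 shows "phi1 (t / 2) = Sk 2 t / Sk 1 t * (Uk 2 t / Uk 1 t)"
proof -
 have "7 * t : uhp" "t / 2 : uhp" using assms by (simp_all add: uhp_def)
 hence "phi1 (t / 2) = klein (3 / 7) 0 (7 * t / 2) / klein (2 / 7) 0 (7 * t / 2)" by (simp add: phi_values(4))
 also have "... = (klein (3 / 14) 0 (7 * t) * klein (5 / 7) 0 (7 * t)) / (klein (1 / 7) 0 (7 * t) * klein (9 / 14) 0 (7 * t))"
  by (simp add: klein_halve \<open>7 * t : uhp\<close>)
 also have "klein (3 / 14) 0 (7 * t) = Uk 2 t"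
  using Uk_minus[OF assms, of 2] epi_of_int[of "- 2"] by (simp add: klein7_def)
 also have "klein (5 / 7) 0 (7 * t) = Sk 2 t"
  using Sk_7[OF assms, of "- 2"] Sk_minus[OF assms, of 2] epi_of_int[of 5] by (simp add: klein7_def)
 also have "klein (1 / 7) 0 (7 * t) = - Sk 1 t" by (simp add: klein7_def)
 also have "klein (9 / 14) 0 (7 * t) = - Uk 1 t" by (simp add: klein7_def)
 finally show ?thesis by (simp add: mult.commute)
qed

definition g0_fun :: "complex => complex" where
 "g0_fun t = - (Sk 3 t / Sk 2 t) * (Uk 2 t / Uk 3 t)"

lemma g1_fun_eq:
 assumes "t : uhp"
 shows "g1_fun t = - (Sk 3 t / Sk 2 t) * (Tk 2 t / Tk 3 t)" unfolding g1_fun_def phi1_double[OF assms] phi_values(2)[OF assms]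
 using Sk_nonzero[OF assms, of 2] Sk_nonzero[OF assms, of 3] Tk_nonzero[OF assms] by (simp add: field_simps power2_eq_square)

lemma upsilon_nonzero: "t : uhp ==> upsilon_fun t ~= 0" using Sk_nonzero[of t] by (simp add: phi_values)

theorem root_relations:
 assumes t: "t : uhp"
 defines "u == upsilon_fun t"
 shows "u * g1_fun t ^ 3 + u * g1_fun t ^ 2 - (u ^ 2 - 1) * g1_fun t + (u - 1) ^ 2 = 0"
  "u * g0_fun t ^ 3 + u * g0_fun t ^ 2 - (u ^ 2 - 1) * g0_fun t + (u - 1) ^ 2 = 0"
  "g1_fun t * g2_fun t * g0_fun t = - ((u - 1) ^ 2 / u)"
proof -
 have nz: "Sk 1 t ~= 0" "Sk 2 t ~= 0" "Sk 3 t ~= 0" using Sk_nonzero[OF t] by auto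
 note torsion_T = cubic_root_of_two_torsion_values[OF nz Tk_nonzero[OF t] Tk_nonzero[OF t] Tk_nonzero[OF t]
   Klein_quartic[OF t] two_torsion_relations[OF t Tk_minus[OF t] Tk_7[OF t]]]
 note torsion_U = cubic_root_of_two_torsion_values[OF nz Uk_nonzero[OF t] Uk_nonzero[OF t] Uk_nonzero[OF t]
   Klein_quartic[OF t] two_torsion_relations[OF t Uk_minus[OF t] Uk_7[OF t]]]
 have u: "u = Sk 2 t ^ 2 * Sk 3 t / Sk 1 t ^ 3" unfolding u_def by (rule phi_values[OF t])
 show "u * g1_fun t ^ 3 + u * g1_fun t ^ 2 - (u ^ 2 - 1) * g1_fun t + (u - 1) ^ 2 = 0"
  using torsion_T(1) unfolding u g1_fun_eq[OF t] .
 show "u * g0_fun t ^ 3 + u * g0_fun t ^ 2 - (u ^ 2 - 1) * g0_fun t + (u - 1) ^ 2 = 0"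
  using torsion_U(1) unfolding u g0_fun_def .
 have "phi1 (2 * t) ~= 0" unfolding phi1_double[OF t] using nz Tk_nonzero[OF t] by simp
 hence "g1_fun t * g2_fun t = (phi1 t)\<^sup>2 * (phi1 t * phi1 (t / 2) - 1 / phi2 t)"
  unfolding g1_fun_def g2_fun_def by (simp add: field_simps)
 also have "... = (Sk 3 t ^ 2 / Sk 2 t ^ 2) * (Sk 1 t / Sk 2 t - (Sk 3 t / Sk 2 t) * (Sk 2 t / Sk 1 t * (Uk 2 t / Uk 1 t)))"
  unfolding phi_values[OF t] phi1_halve[OF t] by (simp add: power_divide)
 finally show "g1_fun t * g2_fun t * g0_fun t = - ((u - 1) ^ 2 / u)" using torsion_U(2) unfolding u g0_fun_def by simp
qed

section \<open>The action of the modular group on meromorphic functions\<close>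

subsection \<open>Normal forms of meromorphic functions\<close>

lemma cosparse_uhpI: "(!!t. t : uhp ==> P t) ==> \<forall>\<^sub>\<approx>t\<in>uhp. P t"
 by (rule eventually_mono[OF eventually_in_cosparse[OF order_refl open_uhp]]) simp

lemma mero_of_eq_iff:
 assumes "f meromorphic_on uhp" "g meromorphic_on uhp"
 shows "mero_of f = mero_of g \<longleftrightarrow> (\<forall>\<^sub>\<approx>t\<in>uhp. f t = g t)"
proof -
 have "mero_of f = mero_of g \<longleftrightarrow> mero_eq f g" unfolding mero_of_def using assms Quotient3_rel[OF Quotient3_mero, of f g]
  by (auto simp: mero_eq_def)
 thus ?thesis using assms by (simp add: mero_eq_def)
qed

lemma rep_mero_meromorphic: "rep_mero x meromorphic_on uhp" using Quotient3_rep_reflp[OF Quotient3_mero, of x] by (simp add: mero_eq_def)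

lemma mero_of_rep: "mero_of (rep_mero x) = x" unfolding mero_of_def using rep_mero_meromorphic Quotient3_abs_rep[OF Quotient3_mero] by simp

definition mero_fun :: "mero => complex => complex" where
 "mero_fun x = remove_sings (rep_mero x)"

lemma mero_fun_nicely: "mero_fun x nicely_meromorphic_on uhp" unfolding mero_fun_def
 by (rule remove_sings_nicely_meromorphic[OF rep_mero_meromorphic])

lemma mero_fun_meromorphic [meromorphic_intros]: "mero_fun x meromorphic_on uhp" using mero_fun_nicely
 by (simp add: nicely_meromorphic_on_def)

lemma mero_of_nf [simp]: "mero_of (mero_fun x) = x"
proof -
 have "mero_of (mero_fun x) = mero_of (rep_mero x)" unfolding mero_of_eq_iff[OF mero_fun_meromorphic rep_mero_meromorphic]
  unfolding mero_fun_def by (rule eventually_remove_sings_eq[OF rep_mero_meromorphic])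
 thus ?thesis by (simp add: mero_of_rep)
qed

lemma nicely_eq:
 assumes "f nicely_meromorphic_on uhp" "g nicely_meromorphic_on uhp" "\<forall>\<^sub>\<approx>t\<in>uhp. f t = g t" "t : uhp"
 shows "f t = g t"
proof -
 have ev: "\<forall>\<^sub>F y in at t. f y = g y" using assms(3,4) by (simp add: eventually_cosparse_open_eq[OF open_uhp])
 have pole: "is_pole f t \<longleftrightarrow> is_pole g t" by (rule is_pole_cong[OF ev refl])
 show ?thesis proof (cases "is_pole f t")
  case True
  hence "~ f \<midarrow>t\<rightarrow> f t" "~ g \<midarrow>t\<rightarrow> g t"
   using pole not_tendsto_and_filterlim_at_infinity[of "at t"] by (auto simp: is_pole_def)
  hence "f t = 0" "g t = 0" using assms(1,2,4) unfolding nicely_meromorphic_on_def by blast+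
  thus ?thesis by simp
 next
  case False
  hence "f \<midarrow>t\<rightarrow> f t" "g \<midarrow>t\<rightarrow> g t" using assms(1,2,4) pole by (auto simp: nicely_meromorphic_on_def)
  moreover have "f \<midarrow>t\<rightarrow> g t"
   using \<open>g \<midarrow>t\<rightarrow> g t\<close> by (rule Lim_transform_eventually) (use ev in eventually_elim, auto)
  ultimately show ?thesis using tendsto_unique[of "at t" f] by auto
 qed
qed

lemma mero_fun_mero_of_cosparse: "f meromorphic_on uhp ==> \<forall>\<^sub>\<approx>t\<in>uhp. mero_fun (mero_of f) t = f t"
 using mero_of_eq_iff[OF mero_fun_meromorphic, of f "mero_of f"] by simp

lemma mero_fun_mero_of:
 assumes "f nicely_meromorphic_on uhp" "t : uhp"
 shows "mero_fun (mero_of f) t = f t"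
 using nicely_eq[OF mero_fun_nicely assms(1) _ assms(2)] mero_fun_mero_of_cosparse assms(1) by (simp add: nicely_meromorphic_on_def)

lemma holomorphic_nicely: "f holomorphic_on uhp ==> f nicely_meromorphic_on uhp"
 by (rule analytic_on_imp_nicely_meromorphic_on) (simp add: analytic_on_open[OF open_uhp])

lemma holomorphic_meromorphic: "f holomorphic_on uhp ==> f meromorphic_on uhp"
 using holomorphic_nicely by (simp add: nicely_meromorphic_on_def)

lemma mero_eq_refl: "f meromorphic_on uhp ==> mero_eq f f" by (simp add: mero_eq_def)

lemma mero_of_add:
 assumes "f meromorphic_on uhp" "g meromorphic_on uhp"
 shows "mero_of (%t. f t + g t) = mero_of f + mero_of g" using plus_mero.abs_eq[OF mero_eq_refl mero_eq_refl, OF assms] assms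
 by (simp add: mero_of_def meromorphic_intros)

lemma mero_of_mult:
 assumes "f meromorphic_on uhp" "g meromorphic_on uhp"
 shows "mero_of (%t. f t * g t) = mero_of f * mero_of g" using times_mero.abs_eq[OF mero_eq_refl mero_eq_refl, OF assms] assms
 by (simp add: mero_of_def meromorphic_intros)

lemma mero_of_inverse:
 assumes "f meromorphic_on uhp"
 shows "mero_of (%t. inverse (f t)) = inverse (mero_of f)" using inverse_mero.abs_eq[OF mero_eq_refl, OF assms] assms
 by (simp add: mero_of_def meromorphic_intros)

lemma mero_of_const: "mero_of (%_. c) = mero_const c" by (simp add: mero_of_def mero_const_def meromorphic_on_const)

lemma mero_const_0: "mero_const 0 = 0" by (simp add: mero_const_def zero_mero_def)

lemma mero_const_minus: "mero_const (- c) = - mero_const c"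
 using mero_const_add[of c "- c"] by (simp add: mero_const_0 eq_neg_iff_add_eq_0 add.commute)

lemma mero_const_diff: "mero_const (a - b) = mero_const a - mero_const b" using mero_const_add[of a "- b"] by (simp add: mero_const_minus)

lemma mero_const_inverse: "mero_const (inverse c) = inverse (mero_const c)"
proof (cases "c = 0")
 case False
 hence "mero_const (inverse c) * mero_const c = 1" by (simp add: mero_const_mult[symmetric] mero_const_1)
 thus ?thesis by (metis inverse_unique mult.commute)
qed (simp add: mero_const_0)

lemma mero_const_divide: "mero_const (a / b) = mero_const a / mero_const b" by (simp add: divide_inverse mero_const_mult mero_const_inverse)

lemma mero_const_power: "mero_const (a ^ n) = mero_const a ^ n" by (induction n) (simp_all add: mero_const_1 mero_const_mult)

lemma mero_const_of_nat: "mero_const (of_nat n) = of_nat n" by (induction n) (simp_all add: mero_const_0 mero_const_1 mero_const_add)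

lemma mero_const_numeral: "mero_const (numeral n) = numeral n" using mero_const_of_nat[of "numeral n"] by simp

lemma mero_fun_const: "t : uhp ==> mero_fun (mero_const c) t = c" unfolding mero_of_const[symmetric]
 by (rule mero_fun_mero_of[OF holomorphic_nicely]) auto

lemma mero_const_eq_iff: "mero_const a = mero_const b \<longleftrightarrow> a = b"
 using mero_fun_const[of \<i>] by (metis complex_i_not_zero imaginary_unit.sel(2) mem_Collect_eq uhp_def zero_less_one)

lemma mero_const_eq_0_iff: "mero_const a = 0 \<longleftrightarrow> a = 0" using mero_const_eq_iff[of a 0] by (simp add: mero_const_0)

lemma mero_eqI:
 assumes "!!t. t : uhp ==> mero_fun x t = mero_fun y t"
 shows "x = y"
 using cosparse_uhpI[OF assms] mero_of_eq_iff[OF mero_fun_meromorphic mero_fun_meromorphic, of x y] by simp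

lemma mero_eq_0I: "(!!t. t : uhp ==> mero_fun x t = 0) ==> x = 0"
 using mero_eqI[of x 0] mero_fun_const[of _ 0] by (simp add: mero_const_0)

lemma mero_fun_nonzero_cosparse: "x ~= 0 ==> \<forall>\<^sub>\<approx>t\<in>uhp. mero_fun x t ~= 0"
 using nicely_meromorphic_imp_constant_or_avoid[OF mero_fun_nicely open_uhp connected_uhp, of x 0] mero_eq_0I by blast

definition reg_at :: "mero => complex => bool" where
 "reg_at x t \<longleftrightarrow> t : uhp & mero_fun x analytic_on {t}"

lemma mero_fun_eq_at:
 assumes "f analytic_on {t}" "t : uhp" and ev: "\<forall>\<^sub>F y in at t. f y = mero_fun x y"
 shows "reg_at x t" "mero_fun x t = f t"
proof -
 have "isCont f t" using analytic_at_imp_isCont assms(1) by blast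
 hence "f \<midarrow>t\<rightarrow> f t" by (simp add: isCont_def)
 hence lim: "mero_fun x \<midarrow>t\<rightarrow> f t" by (rule Lim_transform_eventually) (rule ev)
 hence np: "~ is_pole (mero_fun x) t" using not_tendsto_and_filterlim_at_infinity[of "at t"] by (auto simp: is_pole_def)
 show "reg_at x t" unfolding reg_at_def using nicely_meromorphic_on_imp_analytic_at[OF mero_fun_nicely assms(2) np] assms(2) by simp
 have "mero_fun x \<midarrow>t\<rightarrow> mero_fun x t" using mero_fun_nicely[of x] np assms(2) by (auto simp: nicely_meromorphic_on_def)
 thus "mero_fun x t = f t" using lim tendsto_unique[of "at t" "mero_fun x"] by auto
qed

lemma mero_fun_eqI:
 assumes "f analytic_on {t}" "t : uhp" "f meromorphic_on uhp" "mero_of f = x"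
 shows "reg_at x t" "mero_fun x t = f t"
proof -
 have "\<forall>\<^sub>\<approx>t\<in>uhp. f t = mero_fun x t" using mero_of_eq_iff[OF assms(3) mero_fun_meromorphic[of x]] assms(4) by simp
 hence ev: "\<forall>\<^sub>F y in at t. f y = mero_fun x y" using assms(2) by (simp add: eventually_cosparse_open_eq[OF open_uhp])
 show "reg_at x t" "mero_fun x t = f t" using mero_fun_eq_at[OF assms(1,2) ev] by auto
qed

lemma reg_at_iff: "t : uhp ==> reg_at x t \<longleftrightarrow> ~ is_pole (mero_fun x) t"
 using nicely_meromorphic_on_imp_analytic_at[OF mero_fun_nicely[of x]] analytic_at_imp_no_pole by (auto simp: reg_at_def)

lemma mero_fun_add:
 assumes "reg_at x t" "reg_at y t"
 shows "reg_at (x + y) t" "mero_fun (x + y) t = mero_fun x t + mero_fun y t" by (rule mero_fun_eqI[of "%t. mero_fun x t + mero_fun y t"];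
   use assms in \<open>auto simp: reg_at_def mero_of_add mero_fun_meromorphic intro!: analytic_intros meromorphic_intros\<close>)+

lemma mero_fun_mult:
 assumes "reg_at x t" "reg_at y t"
 shows "reg_at (x * y) t" "mero_fun (x * y) t = mero_fun x t * mero_fun y t" by (rule mero_fun_eqI[of "%t. mero_fun x t * mero_fun y t"];
   use assms in \<open>auto simp: reg_at_def mero_of_mult mero_fun_meromorphic intro!: analytic_intros meromorphic_intros\<close>)+

lemma reg_at_const: "t : uhp ==> reg_at (mero_const c) t" by (rule mero_fun_eqI[of "%_. c"]) (auto simp: mero_of_const)

lemma mero_fun_diff:
 assumes "reg_at x t" "reg_at y t"
 shows "reg_at (x - y) t" "mero_fun (x - y) t = mero_fun x t - mero_fun y t"
proof -
 have eq: "x - y = x + mero_const (- 1) * y" by (simp add: mero_const_minus mero_const_1)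
 have u: "t : uhp" using assms by (simp add: reg_at_def)
 show "reg_at (x - y) t" "mero_fun (x - y) t = mero_fun x t - mero_fun y t"
  unfolding eq using assms by (simp_all add: mero_fun_add mero_fun_mult reg_at_const[OF u] mero_fun_const[OF u])
qed

lemma mero_fun_power:
 assumes "reg_at x t"
 shows "reg_at (x ^ n) t" "mero_fun (x ^ n) t = mero_fun x t ^ n"
proof -
 have u: "t : uhp" using assms by (simp add: reg_at_def)
 have "reg_at (x ^ n) t & mero_fun (x ^ n) t = mero_fun x t ^ n" using assms reg_at_const[OF u, of 1] mero_fun_const[OF u, of 1]
  by (induction n) (auto simp: mero_fun_mult mero_const_1)
 thus "reg_at (x ^ n) t" "mero_fun (x ^ n) t = mero_fun x t ^ n" by auto
qed

lemma mero_fun_prod: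
 assumes "!!i. i : I ==> reg_at (f i) t" "t : uhp"
 shows "reg_at (PROD i:I. f i) t" "mero_fun (PROD i:I. f i) t = (PROD i:I. mero_fun (f i) t)"
proof -
 have "reg_at (PROD i:I. f i) t & mero_fun (PROD i:I. f i) t = (PROD i:I. mero_fun (f i) t)"
  using assms reg_at_const[OF assms(2), of 1] mero_fun_const[OF assms(2), of 1]
  by (induction I rule: infinite_finite_induct) (auto simp: mero_fun_mult mero_const_1)
 thus "reg_at (PROD i:I. f i) t" "mero_fun (PROD i:I. f i) t = (PROD i:I. mero_fun (f i) t)" by auto
qed

subsection \<open>The action\<close>

lemma moebius_filterlim:
 assumes "A : SL2Z" "x : uhp"
 shows "filterlim (moebius A) (at (moebius A x)) (at x)" unfolding filterlim_at
proof (intro conjI)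
 have "isCont (moebius A) x" using moebius_holomorphic[OF assms(1)] assms(2) open_uhp
  by (meson continuous_on_eq_continuous_at holomorphic_on_imp_continuous_on)
 thus "(moebius A \<longlongrightarrow> moebius A x) (at x)" by (simp add: isCont_def)
 have "\<forall>\<^sub>F y in at x. y : uhp - {x}" by (rule eventually_at_in_open[OF open_uhp assms(2)])
 thus "\<forall>\<^sub>F y in at x. moebius A y : UNIV & moebius A y ~= moebius A x" proof eventually_elim
  case (elim y)
  thus ?case using moebius_SL2_inv(2)[OF assms(1), of y] moebius_SL2_inv(2)[OF assms] by auto
 qed
qed

lemma cosparse_moebius:
 assumes "A : SL2Z" "\<forall>\<^sub>\<approx>t\<in>uhp. P t"
 shows "\<forall>\<^sub>\<approx>t\<in>uhp. P (moebius A t)" unfolding eventually_cosparse_open_eq[OF open_uhp]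
proof
 fix x assume x: "x : uhp"
 have "\<forall>\<^sub>F y in at (moebius A x). P y"
  using assms(2) moebius_in_uhp[OF assms(1) x] unfolding eventually_cosparse_open_eq[OF open_uhp] by blast
 thus "\<forall>\<^sub>F y in at x. P (moebius A y)" using moebius_filterlim[OF assms(1) x] by (rule eventually_compose_filterlim)
qed

lemma meromorphic_moebius:
 assumes "A : SL2Z" "f meromorphic_on uhp"
 shows "(%t. f (moebius A t)) meromorphic_on uhp"
proof (rule meromorphic_on_compose[OF assms(2)])
 show "moebius A analytic_on uhp" using moebius_holomorphic[OF assms(1)] open_uhp by (simp add: analytic_on_open)
qed (use moebius_in_uhp[OF assms(1)] in auto)

definition slash :: "int^2^2 => mero => mero" where
 "slash A x = mero_of (%t. mero_fun x (moebius A t))"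

lemma slash_mero_of:
 assumes "A : SL2Z" "f meromorphic_on uhp"
 shows "slash A (mero_of f) = mero_of (%t. f (moebius A t))"
 unfolding slash_def using cosparse_moebius[OF assms(1) mero_fun_mero_of_cosparse[OF assms(2)]]
 by (subst mero_of_eq_iff) (auto intro!: meromorphic_moebius assms mero_fun_meromorphic)

lemma slash_mat1 [simp]: "slash (mat 1) x = x" by (simp add: slash_def)

lemma slash_slash:
 assumes A: "A : SL2Z" and B: "B : SL2Z"
 shows "slash B (slash A x) = slash (A ** B) x"
proof -
 have "slash B (slash A x) = mero_of (%t. mero_fun x (moebius A (moebius B t)))"
  unfolding slash_def[of A] by (intro slash_mero_of meromorphic_moebius mero_fun_meromorphic A B)
 also have "... = slash (A ** B) x" unfolding slash_def
  by (subst mero_of_eq_iff) (auto intro!: meromorphic_moebius[OF _ meromorphic_moebius] meromorphic_moebius mero_fun_meromorphic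
   cosparse_uhpI SL2Z_mult simp: A B moebius_mult)
 finally show ?thesis .
qed

lemma slash_inj: "A : SL2Z ==> slash A x = slash A y \<longleftrightarrow> x = y"
 by (metis slash_slash slash_mat1 SL2_inv_SL2Z SL2_inv_mult(2))

lemma reg_at_slash:
 assumes "A : SL2Z" "t : uhp"
 shows "reg_at (slash A x) t \<longleftrightarrow> reg_at x (moebius A t)"
  and "reg_at x (moebius A t) ==> mero_fun (slash A x) t = mero_fun x (moebius A t)"
proof -
 have transport: "reg_at (slash A x) t & mero_fun (slash A x) t = mero_fun x (moebius A t)"
  if "reg_at x (moebius A t)" "A : SL2Z" "t : uhp" for A x t proof -
  have "moebius A analytic_on {t}" using moebius_holomorphic[OF that(2)] that(3) open_uhp analytic_at by blast
  hence "(mero_fun x \<circ> moebius A) analytic_on {t}"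
   by (rule analytic_on_compose_gen[of _ _ _ "{moebius A t}"]) (use that(1) in \<open>auto simp: reg_at_def\<close>)
  hence "(%t. mero_fun x (moebius A t)) analytic_on {t}" by (simp add: o_def)
  from mero_fun_eqI[OF this that(3) meromorphic_moebius[OF that(2) mero_fun_meromorphic] slash_def[symmetric]]
  show ?thesis by blast
 qed
 show "reg_at x (moebius A t) ==> mero_fun (slash A x) t = mero_fun x (moebius A t)" using transport assms by blast
 have "reg_at x (moebius A t)" if "reg_at (slash A x) t"
  using transport[of "slash A x" "SL2_inv A" "moebius A t"] that assms
  by (simp add: moebius_SL2_inv slash_slash SL2_inv_SL2Z SL2_inv_mult moebius_in_uhp)
 thus "reg_at (slash A x) t \<longleftrightarrow> reg_at x (moebius A t)" using transport assms by blast
qed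

lemma mero_fun_pole: "t : uhp ==> ~ reg_at x t ==> mero_fun x t = 0"
 using mero_fun_nicely[of x] reg_at_iff[of t x] not_tendsto_and_filterlim_at_infinity[of "at t"]
 unfolding nicely_meromorphic_on_def is_pole_def by (metis at_neq_bot)

lemma mero_fun_slash: "A : SL2Z ==> t : uhp ==> mero_fun (slash A x) t = mero_fun x (moebius A t)"
 using reg_at_slash[of A t x] mero_fun_pole[of t "slash A x"] mero_fun_pole[of "moebius A t" x] moebius_in_uhp by metis

lemma slash_add: "A : SL2Z ==> slash A (x + y) = slash A x + slash A y" using slash_mero_of[of A "%t. mero_fun x t + mero_fun y t"]
 by (simp add: mero_of_add mero_fun_meromorphic meromorphic_intros meromorphic_moebius slash_def[symmetric])

lemma slash_mult: "A : SL2Z ==> slash A (x * y) = slash A x * slash A y" using slash_mero_of[of A "%t. mero_fun x t * mero_fun y t"]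
 by (simp add: mero_of_mult mero_fun_meromorphic meromorphic_intros meromorphic_moebius slash_def[symmetric])

lemma slash_inverse: "A : SL2Z ==> slash A (inverse x) = inverse (slash A x)" using slash_mero_of[of A "%t. inverse (mero_fun x t)"]
 by (simp add: mero_of_inverse mero_fun_meromorphic meromorphic_intros meromorphic_moebius slash_def[symmetric])

lemma slash_const: "A : SL2Z ==> slash A (mero_const c) = mero_const c"
 using slash_mero_of[of A "%_. c"] by (simp add: mero_of_const meromorphic_on_const)

lemma slash_minus: "A : SL2Z ==> slash A (- x) = - slash A x"
 using slash_mult[of A "mero_const (-1)" x] slash_const[of A "-1"] by (simp add: mero_const_minus mero_const_1)

lemma slash_diff: "A : SL2Z ==> slash A (x - y) = slash A x - slash A y" using slash_add[of A x "- y"] by (simp add: slash_minus)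

lemma slash_0: "A : SL2Z ==> slash A 0 = 0" and slash_1: "A : SL2Z ==> slash A 1 = 1"
 using slash_const[of A 0] slash_const[of A 1] by (simp_all add: mero_const_0 mero_const_1)

lemma slash_power: "A : SL2Z ==> slash A (x ^ n) = slash A x ^ n" by (induction n) (simp_all add: slash_1 slash_mult)

lemma slash_prod: "A : SL2Z ==> slash A (PROD i:I. f i) = (PROD i:I. slash A (f i))"
 by (induction I rule: infinite_finite_induct) (simp_all add: slash_1 slash_mult)

lemma slash_sum: "A : SL2Z ==> slash A (SUM i:I. f i) = (SUM i:I. slash A (f i))"
 by (induction I rule: infinite_finite_induct) (simp_all add: slash_0 slash_add)

lemma slash_uminus_mat: "slash (- A) x = slash A x"
proof -
 have "moebius (- A) t = moebius A t" for t
  using minus_divide_divide[of "of_int (m11 A) * t + of_int (m12 A)" "of_int (m21 A) * t + of_int (m22 A)"] by (simp add: moebius_def)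
 thus ?thesis by (simp add: slash_def)
qed

subsection \<open>Behaviour at the cusps\<close>

lemma open_Im_gt: "open {t. Im t > y}" by (rule open_halfspace_Im_gt)

lemma meromorphic_at_infinity_cusp_iff:
 "meromorphic_at_infinity_cusp f \<longleftrightarrow> (EX N::nat. N > 0 & (EX h. h meromorphic_on {0} &
   (EX y>0. \<forall>\<^sub>\<approx>t\<in>{t. Im t > y}. f t = h (e2pi (t / of_nat N)))))"
 by (simp add: meromorphic_at_infinity_cusp_def e2pi_def)

lemma meromorphic_at_infinity_cusp_cong:
 assumes "meromorphic_at_infinity_cusp f" "\<forall>\<^sub>\<approx>t\<in>uhp. f t = g t"
 shows "meromorphic_at_infinity_cusp g"
proof -
 obtain N h y where cusp: "N > 0" "h meromorphic_on {0}" "y > 0" "\<forall>\<^sub>\<approx>t\<in>{t. Im t > y}. f t = h (e2pi (t / of_nat N))"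
  using assms(1) unfolding meromorphic_at_infinity_cusp_iff by blast
 have "\<forall>\<^sub>\<approx>t\<in>{t. Im t > y}. f t = g t" using assms(2) \<open>y > 0\<close>
  unfolding eventually_cosparse_open_eq[OF open_uhp] eventually_cosparse_open_eq[OF open_Im_gt] by (auto simp: uhp_def)
 with cusp(4) have "\<forall>\<^sub>\<approx>t\<in>{t. Im t > y}. g t = h (e2pi (t / of_nat N))" by eventually_elim simp
 thus ?thesis using cusp(1-3) unfolding meromorphic_at_infinity_cusp_iff by blast
qed

definition mero_cusp :: "mero => bool" where
 "mero_cusp x \<longleftrightarrow> meromorphic_at_infinity_cusp (mero_fun x)"

lemma mero_cusp_mero_of:
 assumes "f meromorphic_on uhp"
 shows "mero_cusp (mero_of f) \<longleftrightarrow> meromorphic_at_infinity_cusp f"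
proof -
 have "\<forall>\<^sub>\<approx>t\<in>uhp. mero_fun (mero_of f) t = f t" using mero_of_eq_iff[OF mero_fun_meromorphic assms, of "mero_of f"] by simp
 moreover from this have "\<forall>\<^sub>\<approx>t\<in>uhp. f t = mero_fun (mero_of f) t" by eventually_elim simp
 ultimately show ?thesis unfolding mero_cusp_def using meromorphic_at_infinity_cusp_cong by blast
qed

lemma mero_cusp_const: "mero_cusp (mero_const c)"
proof -
 have "meromorphic_at_infinity_cusp (%_. c)" unfolding meromorphic_at_infinity_cusp_def
  by (intro exI[of _ "1::nat"] conjI exI[of _ "%_. c"] exI[of _ "1::real"]) auto
 thus ?thesis using mero_cusp_mero_of[of "%_. c"] by (simp add: mero_of_const meromorphic_on_const)
qed

lemma mero_cuspE:
 assumes "mero_cusp x"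
 obtains N h y where "N > 0" "h meromorphic_on {0}" "y > 0" "\<forall>\<^sub>\<approx>t\<in>{t. Im t > y}. mero_fun x t = h (e2pi (t / of_nat N))"
 using assms unfolding mero_cusp_def meromorphic_at_infinity_cusp_iff by blast

lemma mero_cusp_mero_ofI:
 assumes "f meromorphic_on uhp" "N > 0" "h meromorphic_on {0}" "y > 0" "\<forall>\<^sub>\<approx>t\<in>{t. Im t > y}. f t = h (e2pi (t / of_nat N))"
 shows "mero_cusp (mero_of f)"
 unfolding mero_cusp_mero_of[OF assms(1)] meromorphic_at_infinity_cusp_iff using assms(2-5) by blast

lemma mero_cusp_inverse:
 assumes "mero_cusp x"
 shows "mero_cusp (inverse x)"
proof -
 obtain N h y where cusp: "N > 0" "h meromorphic_on {0}" "y > 0" "\<forall>\<^sub>\<approx>t\<in>{t. Im t > y}. mero_fun x t = h (e2pi (t / of_nat N))"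
  using assms by (rule mero_cuspE)
 have "mero_cusp (mero_of (%t. inverse (mero_fun x t)))"
  by (rule mero_cusp_mero_ofI[OF _ cusp(1) _ cusp(3), where h = "%w. inverse (h w)"])
   (use cusp(2,4) in \<open>auto intro!: meromorphic_intros elim: eventually_mono\<close>)
 thus ?thesis by (simp add: mero_of_inverse mero_fun_meromorphic)
qed

lemma common_cusp_parameter:
 assumes "mero_cusp x" "mero_cusp y"
 obtains N h k c where "N > 0" "h meromorphic_on {0}" "k meromorphic_on {0}" "c > 0"
  "\<forall>\<^sub>\<approx>t\<in>{t. Im t > c}. mero_fun x t = h (e2pi (t / of_nat N)) & mero_fun y t = k (e2pi (t / of_nat N))"
proof -
 obtain N h a where x: "N > 0" "h meromorphic_on {0}" "a > 0" "\<forall>\<^sub>\<approx>t\<in>{t. Im t > a}. mero_fun x t = h (e2pi (t / of_nat N))"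
  using assms(1) by (rule mero_cuspE)
 obtain M k b where y: "M > 0" "k meromorphic_on {0}" "b > 0" "\<forall>\<^sub>\<approx>t\<in>{t. Im t > b}. mero_fun y t = k (e2pi (t / of_nat M))"
  using assms(2) by (rule mero_cuspE)
 show ?thesis proof (rule that)
  show "(%w. h (w ^ M)) meromorphic_on {0}"
   by (rule meromorphic_on_compose[OF x(2)]) (use y(1) in \<open>auto intro!: analytic_intros\<close>)
  show "(%w. k (w ^ N)) meromorphic_on {0}"
   by (rule meromorphic_on_compose[OF y(2)]) (use x(1) in \<open>auto intro!: analytic_intros\<close>)
  have powers: "e2pi (t / of_nat N) = e2pi (t / of_nat (N * M)) ^ M" "e2pi (t / of_nat M) = e2pi (t / of_nat (N * M)) ^ N" for t
   using x(1) y(1) by (simp_all add: e2pi_power)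
  have "\<forall>\<^sub>\<approx>t\<in>{t. Im t > max a b}. mero_fun x t = h (e2pi (t / of_nat N))"
   "\<forall>\<^sub>\<approx>t\<in>{t. Im t > max a b}. mero_fun y t = k (e2pi (t / of_nat M))"
   using x(4) y(4) unfolding eventually_cosparse_open_eq[OF open_Im_gt] by auto
  thus "\<forall>\<^sub>\<approx>t\<in>{t. Im t > max a b}. mero_fun x t = h (e2pi (t / of_nat (N * M)) ^ M) &
    mero_fun y t = k (e2pi (t / of_nat (N * M)) ^ N)" by eventually_elim (simp only: powers)
 qed (use x(1,3) y(1) in auto)
qed

lemma mero_cusp_add: "mero_cusp x ==> mero_cusp y ==> mero_cusp (x + y)"
 and mero_cusp_mult: "mero_cusp x ==> mero_cusp y ==> mero_cusp (x * y)"
proof -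
 assume "mero_cusp x" "mero_cusp y"
 then obtain N h k c where cusp: "N > 0" "h meromorphic_on {0}" "k meromorphic_on {0}" "c > 0"
  "\<forall>\<^sub>\<approx>t\<in>{t. Im t > c}. mero_fun x t = h (e2pi (t / of_nat N)) & mero_fun y t = k (e2pi (t / of_nat N))"
  by (rule common_cusp_parameter)
 have "mero_cusp (mero_of (%t. mero_fun x t + mero_fun y t))"
  by (rule mero_cusp_mero_ofI[OF _ cusp(1) _ cusp(4), where h = "%w. h w + k w"])
   (use cusp(2,3,5) in \<open>auto intro!: meromorphic_intros elim: eventually_mono\<close>)
 thus "mero_cusp (x + y)" by (simp add: mero_of_add mero_fun_meromorphic)
 have "mero_cusp (mero_of (%t. mero_fun x t * mero_fun y t))"
  by (rule mero_cusp_mero_ofI[OF _ cusp(1) _ cusp(4), where h = "%w. h w * k w"])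
   (use cusp(2,3,5) in \<open>auto intro!: meromorphic_intros elim: eventually_mono\<close>)
 thus "mero_cusp (x * y)" by (simp add: mero_of_mult mero_fun_meromorphic)
qed

lemma mero_cusp_minus: "mero_cusp x ==> mero_cusp (- x)"
 using mero_cusp_mult[OF mero_cusp_const[of "- 1"], of x] by (simp add: mero_const_minus mero_const_1)

lemma A0_altdef:
 assumes "G <= SL2Z"
 shows "A0 G = {x. (ALL A:G. slash A x = x) & (ALL A:SL2Z. mero_cusp (slash A x))}"
proof -
 have iff: "modular_function G f \<longleftrightarrow>
  (ALL A:G. slash A (mero_of f) = mero_of f) & (ALL A:SL2Z. mero_cusp (slash A (mero_of f)))"
  if f: "f meromorphic_on uhp" for f proof -
  have "(\<forall>\<^sub>\<approx>t\<in>uhp. f (moebius A t) = f t) \<longleftrightarrow> slash A (mero_of f) = mero_of f" if "A : SL2Z" for A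
   using slash_mero_of[OF that f] mero_of_eq_iff[OF meromorphic_moebius[OF that f] f] by simp
  moreover have "meromorphic_at_infinity_cusp (%t. f (moebius A t)) \<longleftrightarrow> mero_cusp (slash A (mero_of f))" if "A : SL2Z" for A
   using slash_mero_of[OF that f] mero_cusp_mero_of[OF meromorphic_moebius[OF that f]] by simp
  ultimately show ?thesis unfolding modular_function_def using assms f by blast
 qed
 show ?thesis proof (intro equalityI subsetI)
  fix x assume "x : A0 G"
  then obtain f where "modular_function G f" "x = mero_of f" by (auto simp: A0_def)
  thus "x : {x. (ALL A:G. slash A x = x) & (ALL A:SL2Z. mero_cusp (slash A x))}" using iff[of f] by (simp add: modular_function_def)
 next
  fix x assume "x : {x. (ALL A:G. slash A x = x) & (ALL A:SL2Z. mero_cusp (slash A x))}"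
  hence "modular_function G (mero_fun x)" using iff[OF mero_fun_meromorphic] by simp
  thus "x : A0 G" unfolding A0_def by (metis image_eqI mem_Collect_eq mero_of_nf)
 qed
qed

lemma A0_subfield:
 assumes "G <= SL2Z"
 shows "C_subfield (A0 G)"
 unfolding C_subfield_def A0_altdef[OF assms] using subsetD[OF assms]
 by (auto simp: slash_const mero_cusp_const slash_add slash_mult slash_minus slash_inverse mero_cusp_add mero_cusp_mult mero_cusp_minus mero_cusp_inverse)

subsection \<open>Expansions at the cusp\<close>

lemma e2pi_norm_small:
 assumes "N > 0" "d > 0"
 obtains y where "y >= a" "!!t. Im t > y ==> norm (e2pi (t / of_nat N)) < d"
proof -
 have "((%t. e2pi (of_real (1 / real N) * t + 0)) \<longlongrightarrow> 0) at_cusp" using assms(1) by (intro e2pi_tendsto_0) simp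
 from tendstoD[OF this assms(2)] have "\<forall>\<^sub>F t in at_cusp. norm (e2pi (t / of_nat N)) < d" by simp
 then obtain y where "ALL t. Im t > y --> norm (e2pi (t / of_nat N)) < d" unfolding eventually_at_cusp by blast
 thus ?thesis by (intro that[of "max a y"]) auto
qed

lemma cusp_expansion_frequently_nonzero:
 assumes "x ~= 0" and N: "N > 0" and y: "y > 0" "\<forall>\<^sub>\<approx>t\<in>{t. Im t > y}. mero_fun x t = h (e2pi (t / of_nat N))"
 shows "\<exists>\<^sub>F w in at 0. h w ~= 0"
proof (rule ccontr)
 assume "~ ?thesis"
 hence "\<forall>\<^sub>F w in at 0. h w = 0" by (simp add: frequently_def)
 then obtain d where d: "d > 0" "!!w. w ~= 0 ==> norm w < d ==> h w = 0" by (auto simp: eventually_at)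
 obtain y1 where y1: "y1 >= y" "!!t. Im t > y1 ==> norm (e2pi (t / of_nat N)) < d" using e2pi_norm_small[OF N d(1)] by blast
 define t0 where "t0 = Complex 0 (y1 + 1)"
 have t0: "Im t0 > y1" "Im t0 > y" "t0 : uhp" using y1(1) y(1) by (auto simp: t0_def uhp_def)
 have "\<forall>\<^sub>F t in at t0. mero_fun x t = h (e2pi (t / of_nat N))"
  using y(2) t0(2) unfolding eventually_cosparse_open_eq[OF open_Im_gt] by auto
 moreover have "\<forall>\<^sub>F t in at t0. t : {t. Im t > y1}" by (rule eventually_at_in_open'[OF open_Im_gt]) (use t0 in auto)
 moreover have "\<forall>\<^sub>F t in at t0. mero_fun x t ~= 0"
  using mero_fun_nonzero_cosparse[OF assms(1)] t0(3) by (simp add: eventually_cosparse_open_eq[OF open_uhp])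
 ultimately have "\<forall>\<^sub>F t in at t0. False" by eventually_elim (simp add: d(2) y1(2))
 thus False by simp
qed

lemma cusp_expansion:
 assumes "mero_cusp x" "x ~= 0"
 obtains N :: nat and d g y k where "N > 0" "d > 0" "g holomorphic_on cball 0 d" "g 0 ~= 0"
  "!!t. Im t > y ==> reg_at x t & mero_fun x t = g (e2pi (t / of_nat N)) * e2pi (t / of_nat N) powi k"
proof -
 obtain N h y where cusp: "N > 0" "h meromorphic_on {0}" "y > 0" "\<forall>\<^sub>\<approx>t\<in>{t. Im t > y}. mero_fun x t = h (e2pi (t / of_nat N))"
  using assms(1) by (rule mero_cuspE)
 define q where "q t = e2pi (t / of_nat N)" for t
 have q_nz: "q t ~= 0" for t by (simp add: q_def)
 define g k where "g = zor_poly h 0" and "k = zorder h 0"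
 have "isolated_singularity_at h 0" "not_essential h 0" using cusp(2) meromorphic_at_iff by auto
 from zorder_exist[OF this cusp_expansion_frequently_nonzero[OF assms(2) cusp(1,3,4)]]
 obtain d where d: "g 0 ~= 0" "d > 0" "g holomorphic_on cball 0 d"
  "!!w. w : cball 0 d - {0} ==> h w = g w * w powi k" unfolding g_def k_def by auto
 obtain y1 where y1: "y1 >= y" "!!t. Im t > y1 ==> norm (q t) < d" unfolding q_def using e2pi_norm_small[OF cusp(1) d(2)] by blast
 have "q holomorphic_on {t. Im t > y1}" unfolding q_def by (intro holomorphic_intros) (use cusp(1) in simp)
 moreover from this have "(g \<circ> q) holomorphic_on {t. Im t > y1}"
  by (rule holomorphic_on_compose_gen[of _ _ _ "ball 0 d"]) (use d(3) y1(2) in \<open>auto intro: holomorphic_on_subset\<close>)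
 ultimately have hol: "(%t. g (q t) * q t powi k) holomorphic_on {t. Im t > y1}"
  by (intro holomorphic_intros) (auto simp: o_def q_nz)
 have "reg_at x t & mero_fun x t = g (q t) * q t powi k" if "Im t > y1" for t proof -
  have t: "t : uhp" using that y1(1) cusp(3) by (simp add: uhp_def)
  have analytic: "(%t. g (q t) * q t powi k) analytic_on {t}" using hol that open_Im_gt analytic_at by blast
  have "\<forall>\<^sub>F s in at t. mero_fun x s = h (q s)"
   using cusp(4) that y1(1) unfolding eventually_cosparse_open_eq[OF open_Im_gt] q_def by auto
  moreover have "\<forall>\<^sub>F s in at t. s : {s. Im s > y1}" by (rule eventually_at_in_open'[OF open_Im_gt]) (use that in auto)
  ultimately have "\<forall>\<^sub>F s in at t. g (q s) * q s powi k = mero_fun x s" proof eventually_elim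
   case (elim s)
   hence "q s : cball 0 d - {0}" using y1(2)[of s] by (simp add: q_def)
   thus ?case using d(4) elim(1) by simp
  qed
  from mero_fun_eq_at[OF analytic t this] show ?thesis by simp
 qed
 thus ?thesis using that[OF cusp(1) d(2,3,1)] unfolding q_def by blast
qed

lemma mero_cusp_q_asymp:
 assumes "mero_cusp x" "x ~= 0"
 obtains r c where "c ~= 0" "q_asymp (mero_fun x) r c" "eventually (reg_at x) at_cusp"
proof -
 obtain N :: nat and d g y k where g: "N > 0" "d > 0" "g holomorphic_on cball 0 d" "g 0 ~= 0"
  and exp: "!!t. Im t > y ==> reg_at x t & mero_fun x t = g (e2pi (t / of_nat N)) * e2pi (t / of_nat N) powi k"
  using cusp_expansion[OF assms] by blast
 have "((%t. e2pi (of_real (1 / real N) * t + 0)) \<longlongrightarrow> 0) at_cusp" using g(1) by (intro e2pi_tendsto_0) simp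
 hence "((%t. e2pi (t / of_nat N)) \<longlongrightarrow> 0) at_cusp" by simp
 moreover have "isCont g 0"
  by (rule continuous_on_interior[OF holomorphic_on_imp_continuous_on[OF g(3)]]) (use g(2) in simp)
 ultimately have "((%t. g (e2pi (t / of_nat N))) \<longlongrightarrow> g 0) at_cusp" by (intro isCont_tendsto_compose[of 0 g])
 moreover have "e2pi (t / of_nat N) powi k * e2pi (- (of_real (of_int k / real N) * t)) = 1" for t proof -
  have "e2pi (t / of_nat N) powi k = e2pi (of_real (of_int k / real N) * t)" by (simp add: e2pi_def exp_power_int mult_ac)
  thus ?thesis by (simp add: e2pi_add[symmetric])
 qed
 hence "mero_fun x t * e2pi (- (of_real (of_int k / real N) * t)) = g (e2pi (t / of_nat N))" if "Im t > y" for t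
  using exp[OF that] by (simp add: mult.assoc)
 hence "\<forall>\<^sub>F t in at_cusp. g (e2pi (t / of_nat N)) = mero_fun x t * e2pi (- (of_real (of_int k / real N) * t))"
  unfolding eventually_at_cusp by (intro exI[of _ y]) simp
 ultimately have "q_asymp (mero_fun x) (of_int k / real N) (g 0)" unfolding q_asymp_def by (rule Lim_transform_eventually)
 moreover have "eventually (reg_at x) at_cusp" unfolding eventually_at_cusp using exp by blast
 ultimately show ?thesis using that g(4) by blast
qed

lemma periodic_factors_through_e2pi:
 assumes hol: "f holomorphic_on uhp" and N: "N > 0" and per: "!!t. t : uhp ==> f (t + of_nat N) = f t"
 obtains h where "h holomorphic_on ball 0 1 - {0}" "!!t. t : uhp ==> f t = h (e2pi (t / of_nat N))"
proof -
 have in_uhp: "z : uhp" if "norm (e2pi (z / of_nat N)) < 1" for z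
  using that N by (auto simp: norm_e2pi uhp_def Im_divide_of_nat zero_less_divide_iff zero_less_mult_iff)
 have fibre: "f s = f t" if "e2pi (s / of_nat N) = e2pi (t / of_nat N)" "t : uhp" for s t proof -
  have "e2pi (s / of_nat N - t / of_nat N) = 1" using that(1) by (simp add: e2pi_diff)
  then obtain k where "s / of_nat N - t / of_nat N = of_int k" unfolding e2pi_eq_1_iff by (rule Ints_cases)
  hence s: "s = t + of_int k * of_nat N" using N by (simp add: field_simps)
  define P where "P z \<longleftrightarrow> z : uhp & f z = f t" for z
  have "P (z + of_nat N) = P z" for z using per[of z] by (auto simp: P_def uhp_def)
  from int_shift_invariant[of P, OF this, of t k] show ?thesis using that(2) by (simp add: P_def s)
 qed
 define branch where "branch w0 w = of_nat N * (Ln w0 + Ln (w / w0)) / (2 * pi * \<i>)" for w0 w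
 have branch: "e2pi (branch w0 w / of_nat N) = w" if "w0 ~= 0" "w ~= 0" for w0 w
  using that N by (simp add: branch_def e2pi_def exp_add)
 define h where "h w = f (branch 1 w)" for w
 have h: "h w = f (branch w0 w)" "branch w0 w : uhp" if "w0 ~= 0" "w : ball 0 1 - {0}" for w0 w
  using that branch[of 1 w] branch[of w0 w] by (auto simp: h_def intro!: fibre in_uhp)
 have "h analytic_on ball 0 1 - {0}" unfolding analytic_on_analytic_at[of h] analytic_at
 proof
  fix w0 :: complex assume w0: "w0 : ball 0 1 - {0}"
  define T where "T = {w. Re (w / w0) > 0} \<inter> (ball 0 1 - {0})"
  have "open T" unfolding T_def by (intro open_Int open_Collect_less open_Diff continuous_intros) (use w0 in auto)
  moreover have "branch w0 holomorphic_on T" unfolding branch_def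
   by (intro holomorphic_intros) (use w0 in \<open>auto simp: T_def complex_nonpos_Reals_iff\<close>)
  hence "(f \<circ> branch w0) holomorphic_on T" by (rule holomorphic_on_compose_gen[OF _ hol]) (use w0 in \<open>auto simp: T_def intro!: h(2)\<close>)
  hence "h holomorphic_on T" by (rule holomorphic_transform) (use h(1) w0 in \<open>auto simp: T_def\<close>)
  ultimately show "EX T. open T & w0 : T & h holomorphic_on T" using w0 by (intro exI[of _ T]) (auto simp: T_def)
 qed
 moreover have "f t = h (e2pi (t / of_nat N))" if "t : uhp" for t
  unfolding h_def by (rule fibre[symmetric]) (use branch[of 1 "e2pi (t / of_nat N)"] that in auto)
 ultimately show ?thesis using that analytic_imp_holomorphic by blast
qed

lemma meromorphic_at_infinity_cuspI:
 assumes hol: "f holomorphic_on uhp" and N: "N > 0" and per: "!!t. t : uhp ==> f (t + of_nat N) = f t" and f: "q_asymp f r c"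
 shows "meromorphic_at_infinity_cusp f"
proof -
 obtain h where h: "h holomorphic_on ball 0 1 - {0}" "!!t. t : uhp ==> f t = h (e2pi (t / of_nat N))"
  using periodic_factors_through_e2pi[OF hol N per] by blast
 obtain m :: nat where "- r * real N < real m" using reals_Archimedean2 by blast
 hence m: "r + real m / real N > 0" using N by (simp add: field_simps)
 have "q_asymp (%t. e2pi (t / of_nat N) ^ m) (real m / real N) 1" by (simp add: q_asymp_def e2pi_power flip: e2pi_add)
 from q_asymp_lower_exponent[OF q_asymp_mult[OF f this] m]
 have "((%t. f t * e2pi (t / of_nat N) ^ m) \<longlongrightarrow> 0) at_cusp" by (simp add: q_asymp_0_iff)
 from tendstoD[OF this, of 1] have "\<forall>\<^sub>F t in at_cusp. norm (f t * e2pi (t / of_nat N) ^ m) < 1" by simp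
 then obtain y where y: "!!t. Im t > y ==> norm (f t * e2pi (t / of_nat N) ^ m) < 1" unfolding eventually_at_cusp by blast
 define d where "d = min 1 (exp (- 2 * pi * y / real N))"
 have "norm (h w * w ^ m) <= 1" if w: "w ~= 0" "norm w < d" for w proof -
  define t where "t = of_nat N * Ln w / (2 * pi * \<i>)"
  have tw: "e2pi (t / of_nat N) = w" using w N by (simp add: t_def e2pi_def)
  have "exp (- 2 * pi * Im t / real N) < d" using w(2) unfolding tw[symmetric] norm_e2pi by (simp add: Im_divide_of_nat)
  hence "Im t > 0" "Im t > y" using N by (auto simp: d_def field_simps zero_less_mult_iff)
  thus ?thesis using y[of t] h(2)[of t] by (simp add: tw uhp_def)
 qed
 hence "\<forall>\<^sub>F w in at 0. norm (h w * w ^ m) <= 1" unfolding eventually_at by (intro exI[of _ d]) (auto simp: d_def)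
 moreover have "(%w. h w * w ^ m) holomorphic_on ball 0 1 - {0}" using h(1) by (intro holomorphic_intros)
 ultimately obtain H where H: "H holomorphic_on ball 0 1" "!!w. w : ball 0 1 - {0} ==> H w = h w * w ^ m"
  using holomorphic_on_extend_bounded[of "%w. h w * w ^ m" "ball 0 1" 0] by auto
 have "H analytic_on {0}" using H(1) unfolding analytic_at by (intro exI[of _ "ball 0 1"]) auto
 hence "(%w. H w / w ^ m) meromorphic_on {0}" by (intro meromorphic_intros analytic_on_imp_meromorphic_on)
 moreover have "f t = H (e2pi (t / of_nat N)) / e2pi (t / of_nat N) ^ m" if "t : uhp" for t
  using h(2)[OF that] H(2)[of "e2pi (t / of_nat N)"] that N by (simp add: norm_e2pi uhp_def Im_divide_of_nat)
 hence "\<forall>\<^sub>F t in at s. f t = H (e2pi (t / of_nat N)) / e2pi (t / of_nat N) ^ m" if "Im s > 1" for s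
  using eventually_at_in_open'[OF open_uhp, of s] that by (auto simp: uhp_def elim: eventually_mono)
 hence "\<forall>\<^sub>\<approx>t\<in>{t. Im t > 1}. f t = H (e2pi (t / of_nat N)) / e2pi (t / of_nat N) ^ m"
  unfolding eventually_cosparse_open_eq[OF open_Im_gt] by simp
 ultimately show ?thesis unfolding meromorphic_at_infinity_cusp_iff using N
  by (intro exI[of _ N] conjI exI[of _ "%w. H w / w ^ m"] exI[of _ "1::real"]) auto
qed

subsection \<open>Leading terms at the cusp\<close>

definition mero_asymp :: "mero => real => complex => bool" where
 "mero_asymp x r c \<longleftrightarrow> q_asymp (mero_fun x) r c & eventually (reg_at x) at_cusp"

definition finite_at_cusp :: "mero => bool" where
 "finite_at_cusp x \<longleftrightarrow> (EX c. mero_asymp x 0 c)"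

lemma mero_asympI:
 assumes "q_asymp f r c" "\<forall>\<^sub>F t in at_cusp. reg_at x t & mero_fun x t = f t"
 shows "mero_asymp x r c"
proof -
 have "q_asymp (mero_fun x) r c" by (rule q_asymp_cong_eventually[OF assms(1)]) (use assms(2) in \<open>auto elim: eventually_mono\<close>)
 thus ?thesis using assms(2) by (auto simp: mero_asymp_def elim: eventually_mono)
qed

lemma mero_asymp_const: "mero_asymp (mero_const c) 0 c"
 by (rule mero_asympI[OF q_asymp_const], use eventually_uhp_at_cusp in eventually_elim) (simp add: reg_at_const mero_fun_const)

lemma mero_asymp_mult:
 assumes "mero_asymp x r c" "mero_asymp y s d"
 shows "mero_asymp (x * y) (r + s) (c * d)"
proof (rule mero_asympI)
 show "q_asymp (%t. mero_fun x t * mero_fun y t) (r + s) (c * d)" using assms by (auto simp: mero_asymp_def intro: q_asymp_mult)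
 have "eventually (reg_at x) at_cusp" "eventually (reg_at y) at_cusp" using assms by (simp_all add: mero_asymp_def)
 thus "\<forall>\<^sub>F t in at_cusp. reg_at (x * y) t & mero_fun (x * y) t = mero_fun x t * mero_fun y t"
  by eventually_elim (simp add: mero_fun_mult)
qed

lemma mero_asymp_diff:
 assumes "mero_asymp x r c" "mero_asymp y r d"
 shows "mero_asymp (x - y) r (c - d)"
proof (rule mero_asympI)
 show "q_asymp (%t. mero_fun x t - mero_fun y t) r (c - d)" using assms by (auto simp: mero_asymp_def intro: q_asymp_diff)
 have "eventually (reg_at x) at_cusp" "eventually (reg_at y) at_cusp" using assms by (simp_all add: mero_asymp_def)
 thus "\<forall>\<^sub>F t in at_cusp. reg_at (x - y) t & mero_fun (x - y) t = mero_fun x t - mero_fun y t"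
  by eventually_elim (simp add: mero_fun_diff)
qed

lemma mero_asymp_1: "mero_asymp 1 0 1" using mero_asymp_const[of 1] by (simp add: mero_const_1)

lemma mero_asymp_power: "mero_asymp x r c ==> mero_asymp (x ^ m) (real m * r) (c ^ m)"
 by (induction m) (auto simp: mero_asymp_1 algebra_simps dest: mero_asymp_mult)

lemma mero_asymp_prod: "(!!i. i : I ==> mero_asymp (f i) (r i) (c i)) ==> mero_asymp (PROD i:I. f i) (SUM i:I. r i) (PROD i:I. c i)"
 by (induction I rule: infinite_finite_induct) (auto simp: mero_asymp_1 intro: mero_asymp_mult)

lemma mero_asymp_lower_exponent: "mero_asymp x r c ==> s < r ==> mero_asymp x s 0"
 by (auto simp: mero_asymp_def intro: q_asymp_lower_exponent)

lemma mero_asymp_weaken: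
 assumes "mero_asymp x r c" "s <= r"
 shows "EX d. mero_asymp x s d"
 using assms mero_asymp_lower_exponent[OF assms(1), of s] by (cases "s = r") auto

lemma mero_asymp_less: "mero_asymp x r c ==> c ~= 0 ==> mero_asymp x s 0 ==> s < r" by (auto simp: mero_asymp_def intro: q_asymp_less)

lemma mero_cusp_asymp_nonzero:
 assumes "mero_cusp x" "x ~= 0"
 obtains r c where "c ~= 0" "mero_asymp x r c"
 using mero_cusp_q_asymp[OF assms] unfolding mero_asymp_def by metis

lemma mero_cusp_asymp:
 assumes "mero_cusp x"
 shows "EX r c. mero_asymp x r c"
proof (cases "x = 0")
 case True
 thus ?thesis using mero_asymp_const[of 0] by (auto simp: mero_const_0)
next
 case False
 thus ?thesis using mero_cusp_asymp_nonzero[OF assms] by blast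
qed

lemma finite_at_cusp_const: "finite_at_cusp (mero_const c)" using mero_asymp_const by (auto simp: finite_at_cusp_def)

lemma finite_at_cusp_diff: "finite_at_cusp x ==> finite_at_cusp y ==> finite_at_cusp (x - y)" unfolding finite_at_cusp_def
 by (blast dest: mero_asymp_diff)

lemma finite_at_cusp_mult:
 assumes "finite_at_cusp x" "finite_at_cusp y"
 shows "finite_at_cusp (x * y)"
 using assms mero_asymp_mult[of x 0 _ y 0] by (auto simp: finite_at_cusp_def)

lemma cusp_pole_cleared_by_zero:
 assumes w: "mero_cusp w" "mero_asymp w 0 0" and z: "mero_cusp z"
 shows "EX n. finite_at_cusp (w ^ n * z)"
proof (cases "w = 0")
 case True
 thus ?thesis using finite_at_cusp_const[of 0] by (intro exI[of _ 1]) (simp add: mero_const_0)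
next
 case False
 then obtain r c where r: "c ~= 0" "mero_asymp w r c" using mero_cusp_asymp_nonzero[OF w(1)] by blast
 hence "r > 0" using mero_asymp_less w(2) by blast
 obtain s d where s: "mero_asymp z s d" using mero_cusp_asymp[OF z] by blast
 obtain n :: nat where "- s / r < real n" using reals_Archimedean2 by blast
 hence "0 <= real n * r + s" using \<open>r > 0\<close> by (simp add: field_simps)
 from mero_asymp_weaken[OF mero_asymp_mult[OF mero_asymp_power[OF r(2)] s] this] show ?thesis by (auto simp: finite_at_cusp_def)
qed

section \<open>Hauptmoduln\<close>

subsection \<open>Reduction theory\<close>

lemma finite_short_lattice_vectors:
 assumes "t : uhp"
 shows "finite {p :: int \<times> int. norm (of_int (fst p) * t + of_int (snd p)) <= 1}"
proof (rule finite_subset)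
 have im: "Im t > 0" using assms by (simp add: uhp_def)
 define k where "k = \<lceil>1 / Im t\<rceil>"
 define l where "l = \<lceil>1 + of_int k * norm t\<rceil>"
 show "{p. norm (of_int (fst p) * t + of_int (snd p)) <= 1} <= {-k..k} \<times> {-l..l}" proof clarsimp
  fix c d :: int
  assume norm: "norm (of_int c * t + of_int d) <= 1"
  have "\<bar>real_of_int c\<bar> * Im t <= 1" using abs_Im_le_cmod[of "of_int c * t + of_int d"] norm im by (simp add: abs_mult)
  hence "\<bar>real_of_int c\<bar> <= 1 / Im t" using im by (simp add: field_simps)
  hence "real_of_int \<bar>c\<bar> <= of_int k" unfolding k_def by linarith
  hence c: "\<bar>c\<bar> <= k" by (simp only: of_int_le_iff)
  have "\<bar>real_of_int d\<bar> = norm ((of_int c * t + of_int d) - of_int c * t :: complex)" by simp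
  also have "... <= norm (of_int c * t + of_int d) + norm (of_int c * t)" by (rule norm_triangle_ineq4)
  also have "... <= 1 + of_int k * norm t" using norm c by (auto simp: norm_mult intro!: add_mono mult_right_mono)
  finally have "real_of_int \<bar>d\<bar> <= of_int l" unfolding l_def by linarith
  hence "\<bar>d\<bar> <= l" by (simp only: of_int_le_iff)
  thus "- k <= c & c <= k & - l <= d & d <= l" using c by auto
 qed
qed auto

lemma lattice_vector_nonzero: "t : uhp ==> (a, b) ~= (0, 0) ==> of_int a * t + of_int b ~= (0::complex)"
 by (auto simp: complex_eq_iff uhp_def)

lemma shortest_lattice_vector:
 assumes t: "t : uhp"
 obtains c d :: int where "coprime c d" "!!a b :: int. (a, b) ~= (0, 0) ==> norm (of_int c * t + of_int d) <= norm (of_int a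
  * t + of_int b)"
proof -
 define len where "len p = norm (of_int (fst p) * t + of_int (snd p))" for p :: "int \<times> int"
 define S where "S = {p. p ~= (0, 0) & len p <= 1}"
 have "finite S" by (rule finite_subset[OF _ finite_short_lattice_vectors[OF t]]) (auto simp: S_def len_def)
 moreover have "(0, 1) : S" by (simp add: S_def len_def)
 ultimately obtain p where "is_arg_min len (%p. p : S) p" using ex_is_arg_min_if_finite[of S len] by blast
 then obtain c d where S: "(c, d) : S" and min_S: "!!q. q : S ==> len (c, d) <= len q" by (cases p) (auto simp: is_arg_min_linorder)
 have min: "len (c, d) <= len q" if "q ~= (0, 0)" for q using S min_S[of q] that by (cases "q : S") (auto simp: S_def)
 define g where "g = gcd c d"
 have g: "g > 0" "c = g * (c div g)" "d = g * (d div g)" using S by (auto simp: g_def S_def)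
 have primitive: "(c div g, d div g) ~= (0, 0)" using S g by (auto simp: S_def)
 have "real_of_int g * len (c div g, d div g) = norm (of_int g * (of_int (c div g) * t + of_int (d div g)))"
  using g(1) by (simp add: len_def norm_mult)
 also have "of_int g * (of_int (c div g) * t + of_int (d div g)) = of_int (g * (c div g)) * t + of_int (g * (d div g))"
  by (simp add: algebra_simps)
 also have "norm ... = len (c, d)" by (simp add: len_def flip: g(2,3))
 also have "... <= 1 * len (c div g, d div g)" using min[OF primitive] by simp
 finally have "real_of_int g <= 1" using lattice_vector_nonzero[OF t primitive] by (simp add: len_def)
 hence "coprime c d" using g(1) by (simp add: coprime_iff_gcd_eq_1 flip: g_def)
 moreover have "norm (of_int c * t + of_int d) <= norm (of_int a * t + of_int b)" if "(a, b) ~= (0, 0)" for a b :: int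
  using min[OF that] by (simp add: len_def)
 ultimately show ?thesis by (rule that)
qed

lemma uhp_reduction:
 assumes t: "t : uhp"
 obtains A where "A : SL2Z" "\<bar>Re (moebius A t)\<bar> <= 1 / 2" "Im (moebius A t) >= 1 / 2"
proof -
 obtain c d where cd: "coprime c d" "!!a b :: int. (a, b) ~= (0, 0) ==> norm (of_int c * t + of_int d) <= norm (of_int a * t + of_int b)"
  using shortest_lattice_vector[OF t] by blast
 obtain u v where "u * c + v * d = 1" using cd(1) bezout_int[of c d] by auto
 hence A0: "mat2 v (- u) c d : SL2Z" by (simp add: SL2Z_iff algebra_simps)
 define k where "k = round (Re (moebius (mat2 v (- u) c d) t))"
 have T: "mat2 1 (- k) 0 1 : SL2Z" by (simp add: SL2Z_iff)
 define A where "A = mat2 1 (- k) 0 1 ** mat2 v (- u) c d"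
 have A: "A : SL2Z" using T A0 by (simp add: A_def SL2Z_mult)
 have "moebius A t = moebius (mat2 v (- u) c d) t - of_int k"
  unfolding A_def moebius_mult[OF T A0 t] by (simp add: moebius_translation)
 hence re: "\<bar>Re (moebius A t)\<bar> <= 1 / 2"
  using of_int_round_abs_le[of "Re (moebius (mat2 v (- u) c d) t)"] by (simp add: k_def abs_minus_commute)
 have row: "m21 A = c" "m22 A = d" by (simp_all add: A_def mult_nth)
 have cd_nz: "(c, d) ~= (0, 0)" using A by (auto simp: SL2Z_iff row)
 have "(m11 A, m12 A) ~= (0, 0)" using A by (auto simp: SL2Z_iff)
 from cd(2)[OF this] have "norm (moebius A t) >= 1"
  using lattice_vector_nonzero[OF t cd_nz] by (simp add: moebius_def row norm_divide)
 hence "1 <= norm (moebius A t) ^ 2" by simp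
 also have "... = Re (moebius A t) ^ 2 + Im (moebius A t) ^ 2" by (rule cmod_power2)
 also have "Re (moebius A t) ^ 2 <= (1 / 2) ^ 2" using re by (metis abs_ge_zero power2_abs power_mono)
 finally have "(1 / 2) ^ 2 <= Im (moebius A t) ^ 2" by (simp add: power2_eq_square)
 moreover have "Im (moebius A t) >= 0" using moebius_in_uhp[OF A t] by (simp add: uhp_def)
 ultimately have "Im (moebius A t) >= 1 / 2" by (rule power2_le_imp_le)
 with A re show ?thesis by (rule that)
qed

subsection \<open>Functions of level \<open>N\<close>\<close>

definition mat_cong :: "int => int^2^2 => int^2^2 => bool" where
 "mat_cong N A B \<longleftrightarrow> [m11 A = m11 B] (mod N) & [m12 A = m12 B] (mod N) & [m21 A = m21 B] (mod N) & [m22 A = m22 B] (mod N)"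

lemma Gamma_principal_iff:
 "A : Gamma_principal N \<longleftrightarrow> A : SL2Z & [m11 A = 1] (mod N) & [m12 A = 0] (mod N) &
  [m21 A = 0] (mod N) & [m22 A = 1] (mod N)" by (simp add: Gamma_principal_def)

lemma mat_cong_mult_SL2_inv:
 assumes "A : SL2Z" "B : SL2Z" and AB: "mat_cong N A B"
 shows "A ** SL2_inv B : Gamma_principal N"
proof -
 have det: "m11 B * m22 B - m12 B * m21 B = 1" using assms(2) by (simp add: SL2Z_iff)
 have "mat_cong N (A ** SL2_inv B) (B ** SL2_inv B)"
  using AB unfolding mat_cong_def mult_nth SL2_inv_nth by (intro conjI cong_add cong_mult cong_refl) auto
 thus ?thesis using SL2Z_mult[OF assms(1) SL2_inv_SL2Z[OF assms(2)]] det
  by (simp add: Gamma_principal_iff mat_cong_def SL2_inv_mult assms(2)) (simp add: mat_def)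
qed

definition has_level :: "int => mero => bool" where
 "has_level N x \<longleftrightarrow> (ALL A:Gamma_principal N. slash A x = x)"

lemma has_level_slash_cong:
 assumes x: "has_level N x" and AB: "A : SL2Z" "B : SL2Z" "mat_cong N A B"
 shows "slash A x = slash B x"
proof -
 have C: "A ** SL2_inv B : Gamma_principal N" by (rule mat_cong_mult_SL2_inv[OF AB])
 hence "A ** SL2_inv B : SL2Z" by (simp add: Gamma_principal_iff)
 moreover have "(A ** SL2_inv B) ** B = A" by (simp add: matrix_mul_assoc[symmetric] SL2_inv_mult AB)
 ultimately have "slash A x = slash B (slash (A ** SL2_inv B) x)" using slash_slash[of "A ** SL2_inv B" B] AB(2) by simp
 thus ?thesis using x C by (simp add: has_level_def)
qed

lemma level_representatives:
 assumes "N > 0"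
 obtains S where "finite S" "S <= SL2Z" "ALL A:SL2Z. EX B:S. ALL x. has_level N x --> slash A x = slash B x"
proof -
 define red where "red A = (m11 A mod N, m12 A mod N, m21 A mod N, m22 A mod N)" for A :: "int^2^2"
 have "red ` SL2Z <= {0..N} \<times> {0..N} \<times> {0..N} \<times> {0..N}"
  using assms pos_mod_sign[of N] pos_mod_bound[of N] by (force simp: red_def intro: less_imp_le)
 hence "finite (red ` SL2Z)" by (rule finite_subset) auto
 then obtain S where S: "S <= SL2Z" "finite S" "red ` SL2Z = red ` S" using finite_subset_image[of "red ` SL2Z" red SL2Z] by blast
 have "EX B:S. ALL x. has_level N x --> slash A x = slash B x" if A: "A : SL2Z" for A proof -
  have "red A : red ` S" unfolding S(3)[symmetric] by (rule imageI[OF A])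
  then obtain B where B: "B : S" "red A = red B" by (rule imageE)
  hence "mat_cong N A B" by (simp add: mat_cong_def red_def cong_def)
  thus ?thesis using has_level_slash_cong A B(1) S(1) by blast
 qed
 thus ?thesis using that S by blast
qed

lemma finite_orbit:
 assumes "N > 0" "has_level N x"
 shows "finite ((%A. slash A x) ` SL2Z)"
proof -
 obtain S where "finite S" "ALL A:SL2Z. EX B:S. ALL x. has_level N x --> slash A x = slash B x" using level_representatives[OF assms(1)]
  by metis
 hence "(%A. slash A x) ` SL2Z <= (%A. slash A x) ` S" using assms(2) by blast
 thus ?thesis using \<open>finite S\<close> finite_surj by blast
qed

lemma level_one_norm_attains_sup:
 assumes hol: "f holomorphic_on uhp"
  and inv: "!!A t. A : SL2Z ==> t : uhp ==> f (moebius A t) = f t"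
  and lim: "(f \<longlongrightarrow> 0) at_cusp" and t: "t : uhp" and nz: "f t ~= 0"
 obtains k where "k : uhp" "!!s. s : uhp ==> norm (f s) <= norm (f k)"
proof -
 have "\<forall>\<^sub>F s in at_cusp. norm (f s) < norm (f t)" using tendstoD[OF lim, of "norm (f t)"] nz by simp
 then obtain y where y: "!!s. Im s > y ==> norm (f s) < norm (f t)" unfolding eventually_at_cusp by blast
 define K where "K = cbox (Complex (- 1 / 2) (1 / 2)) (Complex (1 / 2) y)"
 have K_iff: "s : K \<longleftrightarrow> - 1 / 2 <= Re s & Re s <= 1 / 2 & 1 / 2 <= Im s & Im s <= y" for s
  by (auto simp: K_def in_cbox_complex_iff)
 have K_uhp: "K <= uhp" by (auto simp: K_iff uhp_def)
 have reduce: "EX s:uhp. norm (f s) = norm (f r) & (s : K | Im s > y)" if r: "r : uhp" for r proof -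
  obtain A where A: "A : SL2Z" "\<bar>Re (moebius A r)\<bar> <= 1 / 2" "Im (moebius A r) >= 1 / 2" using uhp_reduction[OF r] .
  thus ?thesis using inv[OF A(1) r] moebius_in_uhp[OF A(1) r] by (intro bexI[of _ "moebius A r"]) (auto simp: K_iff abs_le_iff)
 qed
 obtain t' where t': "norm (f t') = norm (f t)" "t' : K" using reduce[OF t] y by force
 have "continuous_on K (%s. norm (f s))"
  using holomorphic_on_imp_continuous_on[OF hol] K_uhp continuous_on_subset by (intro continuous_intros) auto
 moreover have "compact K" "K ~= {}" using t' by (auto simp: K_def)
 ultimately obtain k where k: "k : K" "!!s. s : K ==> norm (f s) <= norm (f k)"
  using continuous_attains_sup[of K "%s. norm (f s)"] by auto
 have "norm (f r) <= norm (f k)" if "r : uhp" for r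
  using reduce[OF that] y k(2) k(2)[OF t'(2)] t'(1) by (metis less_imp_le order_trans)
 thus ?thesis using that k(1) K_uhp by blast
qed

lemma level_one_zero:
 assumes hol: "f holomorphic_on uhp"
  and inv: "!!A t. A : SL2Z ==> t : uhp ==> f (moebius A t) = f t"
  and lim: "(f \<longlongrightarrow> 0) at_cusp" and t: "t : uhp"
 shows "f t = 0"
proof (rule ccontr)
 assume nz: "f t ~= 0"
 obtain k where "k : uhp" "!!s. s : uhp ==> norm (f s) <= norm (f k)"
  using level_one_norm_attains_sup[OF hol inv lim t nz] by blast
 hence "f constant_on uhp" using maximum_modulus_principle[OF hol open_uhp connected_uhp open_uhp order_refl, of k] by blast
 then obtain c where c: "!!s. s : uhp ==> f s = c" by (auto simp: constant_on_def)
 have "\<forall>\<^sub>F s in at_cusp. f s = c" using eventually_uhp_at_cusp by eventually_elim (rule c)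
 hence "(f \<longlongrightarrow> c) at_cusp" by (rule tendsto_eventually)
 hence "c = 0" using lim tendsto_unique[OF at_cusp_neq_bot] by blast
 thus False using c[OF t] nz by simp
qed

lemma mero_fun_holomorphic: "(!!t. t : uhp ==> reg_at x t) ==> mero_fun x holomorphic_on uhp"
 by (meson analytic_imp_holomorphic analytic_on_analytic_at reg_at_def)

lemma level_one_const:
 assumes inv: "!!A. A : SL2Z ==> slash A x = x" and reg: "!!t. t : uhp ==> reg_at x t" and lim: "mero_asymp x 0 0"
 shows "x = 0"
proof (rule mero_eq_0I)
 fix t assume "t : uhp"
 show "mero_fun x t = 0" proof (rule level_one_zero[OF mero_fun_holomorphic[OF reg] _ _ \<open>t : uhp\<close>])
  show "mero_fun x (moebius A s) = mero_fun x s" if "A : SL2Z" "s : uhp" for A s using mero_fun_slash[OF that, of x] inv[OF that(1)] by simp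
  show "(mero_fun x \<longlongrightarrow> 0) at_cusp" using lim by (simp add: mero_asymp_def q_asymp_0_iff)
 qed
qed

lemma bounded_modular_const:
 assumes N: "N > 0" "has_level N x" and reg: "!!t. t : uhp ==> reg_at x t"
  and lim: "!!A. A : SL2Z ==> finite_at_cusp (slash A x)"
 shows "EX c. x = mero_const c"
proof -
 define X where "X = (%A. slash A x) ` SL2Z"
 have fin: "finite X" unfolding X_def by (rule finite_orbit[OF N])
 have x: "x : X" unfolding X_def by (rule image_eqI[of _ _ "mat 1"]) (auto simp: mat_1_SL2Z)
 have reg_X: "reg_at z t" if "z : X" "t : uhp" for z t using that reg by (auto simp: X_def reg_at_slash moebius_in_uhp)
 have "ALL z:X. EX l. mero_asymp z 0 l" using lim by (auto simp: X_def finite_at_cusp_def)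
 then obtain l where l: "!!z. z : X ==> mero_asymp z 0 (l z)" by metis
 define P where "P = (PROD z:X. z - mero_const (l x))"
 have "P = 0" proof (rule level_one_const)
  show "slash B P = P" if B: "B : SL2Z" for B proof -
   have inj: "inj_on (slash B) X" by (auto intro!: inj_onI simp: slash_inj[OF B])
   moreover have "slash B ` X <= X" using B by (auto simp: X_def slash_slash SL2Z_mult)
   ultimately have "slash B ` X = X" using endo_inj_surj[OF fin] by blast
   moreover have "slash B P = (PROD z:X. slash B z - mero_const (l x))" unfolding P_def by (simp add: slash_prod slash_diff slash_const B)
   hence "slash B P = (PROD z:slash B ` X. z - mero_const (l x))" by (simp add: prod.reindex[OF inj])
   ultimately show ?thesis by (simp add: P_def)
  qed
  show "reg_at P t" if "t : uhp" for t unfolding P_def by (intro mero_fun_prod(1) mero_fun_diff(1) reg_X reg_at_const that)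
  have "mero_asymp P (SUM z:X. 0) (PROD z:X. l z - l x)" unfolding P_def by (intro mero_asymp_prod mero_asymp_diff l mero_asymp_const)
  moreover have "(PROD z:X. l z - l x) = 0" using fin x by (intro prod_zero) auto
  ultimately show "mero_asymp P 0 0" by simp
 qed
 then obtain A where A: "A : SL2Z" "slash A x = mero_const (l x)" using fin by (auto simp: P_def prod_zero_iff X_def)
 hence "slash A x = slash A (mero_const (l x))" by (simp add: slash_const)
 thus ?thesis using slash_inj[OF A(1)] by blast
qed

subsection \<open>Clearing poles\<close>

lemma mero_fun_mult_cosparse: "\<forall>\<^sub>\<approx>t\<in>uhp. mero_fun x t * mero_fun y t = mero_fun (x * y) t"
 using mero_of_eq_iff[of "%t. mero_fun x t * mero_fun y t" "mero_fun (x * y)"] by (simp add: mero_of_mult meromorphic_intros)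

lemma zorder_mero_fun_mult:
 assumes "x ~= 0" "y ~= 0" "t : uhp"
 shows "zorder (mero_fun (x * y)) t = zorder (mero_fun x) t + zorder (mero_fun y) t"
proof -
 have mer: "mero_fun z meromorphic_on {t}" for z using meromorphic_on_subset[OF mero_fun_meromorphic[of z], of "{t}"] assms(3) by simp
 have nz: "\<exists>\<^sub>F s in at t. mero_fun z s ~= 0" if "z ~= 0" for z
  using mero_fun_nonzero_cosparse[OF that] assms(3) by (intro eventually_frequently) (auto simp: eventually_cosparse_open_eq[OF open_uhp])
 have "\<forall>\<^sub>F s in at t. mero_fun x s * mero_fun y s = mero_fun (x * y) s"
  using mero_fun_mult_cosparse[of x y] assms(3) by (simp add: eventually_cosparse_open_eq[OF open_uhp])
 hence "zorder (%s. mero_fun x s * mero_fun y s) t = zorder (mero_fun (x * y)) t" by (rule zorder_cong) simp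
 thus ?thesis using zorder_mult[OF mer nz[OF assms(1)] mer nz[OF assms(2)]] by simp
qed

lemma pole_cleared_by_zero:
 assumes w: "reg_at w t" "mero_fun w t = 0"
 shows "EX n. reg_at (w ^ n * z) t"
proof (cases "w = 0 | z = 0")
 case True
 thus ?thesis using w(1) reg_at_const[of t 0] by (intro exI[of _ 1]) (auto simp: mero_const_0 reg_at_def)
next
 case False
 have t: "t : uhp" using w by (simp add: reg_at_def)
 have "\<exists>\<^sub>F s in at t. mero_fun w s ~= 0"
  using mero_fun_nonzero_cosparse[of w] False t by (intro eventually_frequently) (auto simp: eventually_cosparse_open_eq[OF open_uhp])
 hence pos: "zorder (mero_fun w) t > 0" using zorder_pos_iff'[of "mero_fun w" t] w by (simp add: reg_at_def)
 have order: "zorder (mero_fun (w ^ n * z)) t = int n * zorder (mero_fun w) t + zorder (mero_fun z) t" for n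
  by (induction n) (use False t in \<open>auto simp: mult.assoc zorder_mero_fun_mult algebra_simps\<close>)
 define n where "n = nat \<bar>zorder (mero_fun z) t\<bar>"
 have "\<bar>zorder (mero_fun z) t\<bar> * 1 <= \<bar>zorder (mero_fun z) t\<bar> * zorder (mero_fun w) t" using pos by (intro mult_left_mono) auto
 hence "zorder (mero_fun (w ^ n * z)) t >= 0" unfolding order n_def by simp
 moreover have "isolated_singularity_at (mero_fun (w ^ n * z)) t"
  using meromorphic_on_subset[OF mero_fun_meromorphic, of "{t}"] t by (auto simp: meromorphic_at_iff)
 ultimately have "~ is_pole (mero_fun (w ^ n * z)) t" using isolated_pole_imp_neg_zorder by fastforce
 thus ?thesis using reg_at_iff[OF t] by blast
qed

lemma finite_poles:
 assumes "mero_cusp z"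
 shows "finite {t. \<bar>Re t\<bar> <= 1 / 2 & Im t >= 1 / 2 & ~ reg_at z t}"
proof -
 obtain y where y: "!!t. Im t > y ==> reg_at z t" using mero_cusp_asymp[OF assms] unfolding mero_asymp_def eventually_at_cusp by metis
 define K where "K = cbox (Complex (- 1 / 2) (1 / 2)) (Complex (1 / 2) y)"
 have "K <= uhp" by (auto simp: K_def in_cbox_complex_iff uhp_def)
 moreover have "{t. ~ mero_fun z analytic_on {t}} sparse_in uhp"
  using meromorphic_on_imp_analytic_cosparse[OF mero_fun_meromorphic[of z]] by (simp add: eventually_cosparse)
 ultimately have "{t. ~ mero_fun z analytic_on {t}} sparse_in K" using sparse_in_subset by blast
 hence "finite (K \<inter> {t. ~ mero_fun z analytic_on {t}})" by (intro sparse_in_compact_finite) (simp_all add: K_def)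
 moreover have "{t. \<bar>Re t\<bar> <= 1 / 2 & Im t >= 1 / 2 & ~ reg_at z t} <= K \<inter> {t. ~ mero_fun z analytic_on {t}}"
  using y by (force simp: K_def in_cbox_complex_iff reg_at_def uhp_def abs_le_iff not_less)
 ultimately show ?thesis by (rule finite_subset[rotated])
qed

subsection \<open>Generation by a Hauptmodul\<close>

lemma C_subfield_hull: "C_subfield (C_adjoin S)" unfolding C_adjoin_def by (rule hull_in) (auto simp: C_subfield_def subset_iff)

lemma C_adjoin_subset: "S <= C_adjoin S" unfolding C_adjoin_def by (rule hull_subset)

lemma C_adjoin_minimal: "S <= F ==> C_subfield F ==> C_adjoin S <= F" unfolding C_adjoin_def by (rule hull_minimal)

lemma
 assumes "C_subfield F"
 shows C_subfield_const: "mero_const c : F" and C_subfield_0: "0 : F" and C_subfield_1: "1 : F" and C_subfield_numeral: "numeral k : F"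
  and C_subfield_add: "x : F ==> y : F ==> x + y : F" and C_subfield_mult: "x : F ==> y : F ==> x * y : F"
  and C_subfield_minus: "x : F ==> - x : F" and C_subfield_inverse: "x : F ==> inverse x : F"
  and C_subfield_diff: "x : F ==> y : F ==> x - y : F" and C_subfield_divide: "x : F ==> y : F ==> x / y : F"
  and C_subfield_power: "x : F ==> x ^ n : F"
proof -
 show const: "mero_const c : F" for c using assms unfolding C_subfield_def by blast
 show "0 : F" using const[of 0] by (simp add: mero_const_0)
 show one: "1 : F" using const[of 1] by (simp add: mero_const_1)
 show "numeral k : F" using const[of "numeral k"] by (simp add: mero_const_numeral)
 show add: "x : F ==> y : F ==> x + y : F" for x y using assms unfolding C_subfield_def by blast
 show mult: "x : F ==> y : F ==> x * y : F" for x y using assms unfolding C_subfield_def by blast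
 show minus: "x : F ==> - x : F" for x using assms unfolding C_subfield_def by blast
 show inv: "x : F ==> inverse x : F" for x using assms unfolding C_subfield_def by blast
 show "x : F ==> y : F ==> x - y : F" using add[of x "- y"] minus by simp
 show "x : F ==> y : F ==> x / y : F" using mult[of x "inverse y"] inv by (simp add: divide_inverse)
 show "x : F ==> x ^ n : F" by (induction n) (auto intro: one mult)
qed

lemmas C_subfield_closed = C_subfield_const C_subfield_0 C_subfield_1 C_subfield_numeral C_subfield_add C_subfield_mult
 C_subfield_minus C_subfield_inverse C_subfield_diff C_subfield_divide C_subfield_power

lemma C_subfield_sum: "C_subfield F ==> (!!i. i : I ==> f i : F) ==> (SUM i:I. f i) : F"
 by (induction I rule: infinite_finite_induct) (auto simp: C_subfield_closed)

lemma C_subfield_prod: "C_subfield F ==> (!!i. i : I ==> f i : F) ==> (PROD i:I. f i) : F"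
 by (induction I rule: infinite_finite_induct) (auto simp: C_subfield_closed)

locale hauptmodul =
 fixes G :: "(int^2^2) set" and N :: int and \<upsilon> :: mero and c0 :: complex
 assumes G: "G <= SL2Z" and N: "N > 0" "Gamma_principal N <= G" and T: "mat2 1 1 0 1 : G"
  and \<upsilon>: "\<upsilon> : A0 G" and \<upsilon>_reg: "!!t. t : uhp ==> reg_at \<upsilon> t"
  and \<upsilon>_asymp: "mero_asymp \<upsilon> (- 1) c0" and c0: "c0 ~= 0"
  and cusps: "!!A. A : SL2Z ==> finite_at_cusp (slash A \<upsilon>) | (ALL x:A0 G. slash A x = x)"
begin

lemma A0_level: "x : A0 G ==> has_level N x" using N(2) by (auto simp: A0_altdef[OF G] has_level_def)

lemma A0_cusp: "x : A0 G ==> A : SL2Z ==> mero_cusp (slash A x)" by (auto simp: A0_altdef[OF G])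

lemma A0_asymp_integral:
 assumes y: "y : A0 G" "mero_asymp y r c" "c ~= 0"
 shows "r : \<int>"
proof -
 have TS: "mat2 1 1 0 1 : SL2Z" using T G by blast
 have "slash (mat2 1 1 0 1) y = y" using y(1) T by (auto simp: A0_altdef[OF G])
 hence "mero_fun y (t + 1) = mero_fun y t" if "t : uhp" for t using mero_fun_slash[OF TS that, of y] by (simp add: moebius_translation)
 thus ?thesis using q_asymp_integral_exponent y(2,3) by (auto simp: mero_asymp_def)
qed

lemma A0_asymp_improve:
 assumes y: "y : A0 G" "mero_asymp y (- real (Suc m)) 0"
 shows "EX c. mero_asymp y (- real m) c"
proof (cases "y = 0")
 case True
 thus ?thesis using mero_asymp_weaken[OF mero_asymp_const[of 0], of "- real m"] by (simp add: mero_const_0)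
next
 case False
 then obtain r d where r: "d ~= 0" "mero_asymp y r d"
  using mero_cusp_asymp_nonzero[OF A0_cusp[OF y(1) mat_1_SL2Z, unfolded slash_mat1]] by blast
 obtain k where k: "r = of_int k" using A0_asymp_integral[OF y(1) r(2,1)] by (rule Ints_cases)
 have "- real (Suc m) < r" by (rule mero_asymp_less[OF r(2,1) y(2)])
 hence "real_of_int (- int m - 1) < of_int k" by (simp add: k)
 hence "real_of_int (- int m) <= of_int k" by (simp only: of_int_less_iff of_int_le_iff)
 hence "- real m <= r" by (simp add: k)
 thus ?thesis by (rule mero_asymp_weaken[OF r(2)])
qed

definition regular_off_infinity :: "mero => bool" where
 "regular_off_infinity y \<longleftrightarrow> y : A0 G & (ALL t:uhp. reg_at y t) & (ALL A:SL2Z. finite_at_cusp (slash A \<upsilon>) --> finite_at_cusp (slash A y))"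

lemma regular_off_infinity_const: "regular_off_infinity (mero_const c)"
 by (simp add: regular_off_infinity_def C_subfield_const[OF A0_subfield[OF G]] reg_at_const slash_const finite_at_cusp_const)

lemma regular_off_infinity_hauptmodul: "regular_off_infinity \<upsilon>" by (simp add: regular_off_infinity_def \<upsilon> \<upsilon>_reg)

lemma regular_off_infinity_diff: "regular_off_infinity x ==> regular_off_infinity y ==> regular_off_infinity (x - y)"
 by (auto simp: regular_off_infinity_def C_subfield_diff[OF A0_subfield[OF G]] mero_fun_diff slash_diff finite_at_cusp_diff)

lemma regular_off_infinity_mult: "regular_off_infinity x ==> regular_off_infinity y ==> regular_off_infinity (x * y)"
 by (auto simp: regular_off_infinity_def C_subfield_mult[OF A0_subfield[OF G]] mero_fun_mult slash_mult finite_at_cusp_mult)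

lemma regular_off_infinity_power: "regular_off_infinity x ==> regular_off_infinity (x ^ n)"
 using regular_off_infinity_const[of 1] by (induction n) (auto simp: mero_const_1 regular_off_infinity_mult)

lemma regular_off_infinity_prod: "(!!i. i : I ==> regular_off_infinity (f i)) ==> regular_off_infinity (PROD i:I. f i)"
 using regular_off_infinity_const[of 1] by (induction I rule: infinite_finite_induct) (auto simp: mero_const_1 regular_off_infinity_mult)

lemma hauptmodul_in_adjoin: "\<upsilon> : C_adjoin {\<upsilon>}" using C_adjoin_subset by blast

lemma regular_off_infinity_polynomial:
 assumes "regular_off_infinity y" "mero_asymp y (- real m) c"
 shows "y : C_adjoin {\<upsilon>}" using assms
proof (induction m arbitrary: y c)
 case 0
 have "finite_at_cusp y" using 0(2) by (auto simp: finite_at_cusp_def)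
 hence "finite_at_cusp (slash A y)" if "A : SL2Z" for A using cusps[OF that] 0(1) that by (auto simp: regular_off_infinity_def)
 hence "EX k. y = mero_const k" using bounded_modular_const[OF N(1) A0_level] 0(1) by (simp add: regular_off_infinity_def)
 thus ?case using C_subfield_const[OF C_subfield_hull] by auto
next
 case (Suc m y c)
 define k where "k = c / c0 ^ Suc m"
 define y' where "y' = y - mero_const k * \<upsilon> ^ Suc m"
 have y': "regular_off_infinity y'" unfolding y'_def
  by (intro regular_off_infinity_diff regular_off_infinity_mult regular_off_infinity_const regular_off_infinity_power regular_off_infinity_hauptmodul Suc.prems)
 have "mero_asymp (mero_const k * \<upsilon> ^ Suc m) (- real (Suc m)) (k * c0 ^ Suc m)"
  using mero_asymp_mult[OF mero_asymp_const mero_asymp_power[OF \<upsilon>_asymp]] by (simp only: mult_minus1_right add_0)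
 from mero_asymp_diff[OF Suc.prems(2) this] have "mero_asymp y' (- real (Suc m)) 0" using c0 by (simp add: y'_def k_def del: of_nat_Suc)
 then obtain c' where "mero_asymp y' (- real m) c'" using A0_asymp_improve y' unfolding regular_off_infinity_def by blast
 from Suc.IH[OF y' this] have "y' + mero_const k * \<upsilon> ^ Suc m : C_adjoin {\<upsilon>}"
  by (intro C_subfield_add C_subfield_mult C_subfield_power C_subfield_const C_subfield_hull hauptmodul_in_adjoin)
 thus ?case by (simp add: y'_def)
qed

lemma hauptmodul_not_const: "\<upsilon> ~= mero_const v"
proof
 assume "\<upsilon> = mero_const v"
 hence "mero_asymp \<upsilon> 0 v" using mero_asymp_const by simp
 hence "mero_asymp \<upsilon> (- 1) 0" using mero_asymp_lower_exponent by force
 thus False using mero_asymp_less[OF \<upsilon>_asymp c0] by blast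
qed

text \<open>A multiplier that clears poles: it vanishes at the points where \<open>\<upsilon>\<close> takes the values \<open>c i\<close>.\<close>
definition multiplier :: "'i set => ('i => complex) => ('i => nat) => mero" where
 "multiplier I c n = (PROD i:I. (\<upsilon> - mero_const (c i)) ^ n i)"

lemma multiplier_remove:
 "finite I ==> i : I ==> multiplier I c n * x = multiplier (I - {i}) c n * ((\<upsilon> - mero_const (c i)) ^ n i * x)"
 by (simp add: multiplier_def prod.remove[of I i] mult_ac)

lemma multiplier_nonzero: "finite I ==> multiplier I c n ~= 0" unfolding multiplier_def using hauptmodul_not_const by simp

lemma multiplier_in_adjoin: "multiplier I c n : C_adjoin {\<upsilon>}" unfolding multiplier_def
 by (intro C_subfield_prod C_subfield_power C_subfield_diff C_subfield_const C_subfield_hull hauptmodul_in_adjoin)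

lemma multiplier_regular: "regular_off_infinity (multiplier I c n)" unfolding multiplier_def
 by (intro regular_off_infinity_prod regular_off_infinity_power regular_off_infinity_diff regular_off_infinity_const regular_off_infinity_hauptmodul)

lemma regularity_at_finitely_many_points:
 assumes x: "x : A0 G"
 obtains P where "finite P" "P <= uhp"
  "ALL y:A0 G. (ALL t. reg_at x t --> reg_at y t) --> (ALL t:P. reg_at y t) --> (ALL t:uhp. reg_at y t)"
proof -
 obtain S where S: "finite S" "S <= SL2Z" "ALL A:SL2Z. EX B:S. ALL x. has_level N x --> slash A x = slash B x"
  using level_representatives[OF N(1)] by metis
 define Q where "Q = (SIGMA B:S. {t. \<bar>Re t\<bar> <= 1 / 2 & Im t >= 1 / 2 & ~ reg_at (slash B x) t})"
 have "finite Q" unfolding Q_def using finite_poles[OF A0_cusp[OF x]] S(1,2) by (intro finite_SigmaI) auto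
 define P where "P = (%(B, s). moebius B s) ` Q"
 have "moebius B s : uhp" if "(B, s) : Q" for B s using that S(2) by (intro moebius_in_uhp) (auto simp: Q_def uhp_def)
 hence "P <= uhp" by (auto simp: P_def)
 moreover have "reg_at y t" if y: "y : A0 G" "ALL t. reg_at x t --> reg_at y t" "ALL t:P. reg_at y t" and t: "t : uhp" for y t
 proof -
  obtain A where A: "A : SL2Z" "\<bar>Re (moebius A t)\<bar> <= 1 / 2" "Im (moebius A t) >= 1 / 2" using uhp_reduction[OF t] .
  define s where "s = moebius A t"
  have s: "s : uhp" "moebius (SL2_inv A) s = t" using A(1) t by (auto simp: s_def moebius_in_uhp moebius_SL2_inv)
  obtain B where B: "B : S" "ALL x. has_level N x --> slash (SL2_inv A) x = slash B x" using S(3) SL2_inv_SL2Z[OF A(1)] by blast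
  have BS: "B : SL2Z" using B(1) S(2) by blast
  have "reg_at y (moebius B s)" proof (cases "reg_at x (moebius B s)")
   case False
   hence "~ reg_at (slash B x) s" unfolding reg_at_slash(1)[OF BS s(1)] .
   hence "(B, s) : Q" using A(2,3)[folded s_def] B(1) unfolding Q_def by blast
   hence "moebius B s : P" unfolding P_def by (rule image_eqI[rotated]) simp
   thus ?thesis using y(3) by blast
  qed (use y(2) in blast)
  hence "reg_at (slash B y) s" unfolding reg_at_slash(1)[OF BS s(1)] .
  moreover have "slash (SL2_inv A) y = slash B y" using B(2) A0_level[OF y(1)] by blast
  ultimately have "reg_at (slash (SL2_inv A) y) s" by simp
  thus ?thesis unfolding reg_at_slash(1)[OF SL2_inv_SL2Z[OF A(1)] s(1)] s(2) .
 qed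
 ultimately have "ALL y:A0 G. (ALL t. reg_at x t --> reg_at y t) --> (ALL t:P. reg_at y t) --> (ALL t:uhp. reg_at y t)" "P <= uhp" by blast+
 moreover have "finite P" unfolding P_def using \<open>finite Q\<close> by (rule finite_imageI)
 ultimately show ?thesis using that by metis
qed

lemma poles_cleared:
 assumes x: "x : A0 G"
 obtains R where "R ~= 0" "R : C_adjoin {\<upsilon>}" "R * x : A0 G" "ALL t:uhp. reg_at (R * x) t"
proof -
 obtain P where P: "finite P" "P <= uhp"
   "ALL y:A0 G. (ALL t. reg_at x t --> reg_at y t) --> (ALL t:P. reg_at y t) --> (ALL t:uhp. reg_at y t)"
  using regularity_at_finitely_many_points[OF x] by metis
 have "EX n. reg_at ((\<upsilon> - mero_const (mero_fun \<upsilon> p)) ^ n * x) p" if "p : P" for p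
  using that P(2) \<upsilon>_reg reg_at_const by (intro pole_cleared_by_zero) (auto simp: mero_fun_diff mero_fun_const subset_iff)
 then obtain n where n: "!!p. p : P ==> reg_at ((\<upsilon> - mero_const (mero_fun \<upsilon> p)) ^ n p * x) p" by metis
 define R where "R I = multiplier I (mero_fun \<upsilon>) n" for I
 have reg_R: "reg_at (R I) t" if "t : uhp" for I t using multiplier_regular that by (auto simp: R_def regular_off_infinity_def)
 have "reg_at (R P * x) p" if "p : P" for p
  unfolding R_def multiplier_remove[OF P(1) that] by (intro mero_fun_mult(1) n that reg_R[unfolded R_def]) (use that P(2) in blast)
 moreover have A0: "R P * x : A0 G"
  using multiplier_regular x by (auto simp: R_def regular_off_infinity_def intro!: C_subfield_mult[OF A0_subfield[OF G]])
 moreover have "reg_at (R P * x) t" if "reg_at x t" for t using that reg_R by (intro mero_fun_mult(1)) (auto simp: reg_at_def)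
 ultimately have "ALL t:uhp. reg_at (R P * x) t" using P(3) by blast
 thus ?thesis using that A0 multiplier_nonzero[OF P(1)] multiplier_in_adjoin unfolding R_def by blast
qed

lemma cusp_poles_cleared:
 assumes x: "x : A0 G" "ALL t:uhp. reg_at x t"
 obtains R where "R ~= 0" "R : C_adjoin {\<upsilon>}" "regular_off_infinity (R * x)"
proof -
 obtain S0 where S0: "finite S0" "S0 <= SL2Z" "ALL A:SL2Z. EX B:S0. ALL x. has_level N x --> slash A x = slash B x"
  using level_representatives[OF N(1)] by metis
 define S where "S = {B : S0. finite_at_cusp (slash B \<upsilon>)}"
 have S: "finite S" "S <= SL2Z" using S0 by (auto simp: S_def)
 have "ALL B:S. EX l. mero_asymp (slash B \<upsilon>) 0 l" by (simp add: S_def finite_at_cusp_def)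
 then obtain l where l: "!!B. B : S ==> mero_asymp (slash B \<upsilon>) 0 (l B)" by metis
 have "EX n. finite_at_cusp (slash B ((\<upsilon> - mero_const (l B)) ^ n * x))" if B: "B : S" for B proof -
  have BS: "B : SL2Z" using B S(2) by blast
  have "mero_asymp (slash B \<upsilon> - mero_const (l B)) 0 0" using mero_asymp_diff[OF l[OF B] mero_asymp_const[of "l B"]] by simp
  hence "mero_asymp (slash B (\<upsilon> - mero_const (l B))) 0 0" by (simp add: slash_diff slash_const BS)
  moreover have "\<upsilon> - mero_const (l B) : A0 G" by (intro C_subfield_diff C_subfield_const A0_subfield G \<upsilon>)
  ultimately show ?thesis using cusp_pole_cleared_by_zero A0_cusp x(1) BS by (simp add: slash_mult slash_power)
 qed
 then obtain n where n: "!!B. B : S ==> finite_at_cusp (slash B ((\<upsilon> - mero_const (l B)) ^ n B * x))" by metis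
 define R where "R I = multiplier I l n" for I
 have reg_R: "regular_off_infinity (R I)" for I unfolding R_def by (rule multiplier_regular)
 have A0: "R S * x : A0 G" using reg_R x(1) by (auto simp: regular_off_infinity_def intro!: C_subfield_mult[OF A0_subfield[OF G]])
 have "finite_at_cusp (slash A (R S * x))" if A: "A : SL2Z" "finite_at_cusp (slash A \<upsilon>)" for A proof -
  obtain B where B: "B : S0" "ALL x. has_level N x --> slash A x = slash B x" using S0(3) A(1) by blast
  have BS: "B : S" "B : SL2Z" using B A A0_level[OF \<upsilon>] S0(2) by (auto simp: S_def)
  have "finite_at_cusp (slash B (R (S - {B})))" using reg_R BS by (auto simp: regular_off_infinity_def S_def)
  from finite_at_cusp_mult[OF this n[OF BS(1)]] have "finite_at_cusp (slash B (R S * x))"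
   using BS(2) by (simp add: R_def multiplier_remove[OF S(1) BS(1)] slash_mult)
  thus ?thesis using B(2) A0_level[OF A0] by simp
 qed
 moreover have "ALL t:uhp. reg_at (R S * x) t" using reg_R x(2) by (auto simp: regular_off_infinity_def mero_fun_mult)
 ultimately have "regular_off_infinity (R S * x)" using A0 by (simp add: regular_off_infinity_def)
 thus ?thesis using that multiplier_nonzero[OF S(1)] multiplier_in_adjoin unfolding R_def by blast
qed

theorem A0_eq_adjoin: "A0 G = C_adjoin {\<upsilon>}"
proof
 show "C_adjoin {\<upsilon>} <= A0 G" by (rule C_adjoin_minimal[OF _ A0_subfield[OF G]]) (use \<upsilon> in auto)
 show "A0 G <= C_adjoin {\<upsilon>}" proof
  fix x assume x: "x : A0 G"
  obtain R1 where R1: "R1 ~= 0" "R1 : C_adjoin {\<upsilon>}" "R1 * x : A0 G" "ALL t:uhp. reg_at (R1 * x) t" using poles_cleared[OF x] .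
  obtain R2 where R2: "R2 ~= 0" "R2 : C_adjoin {\<upsilon>}" "regular_off_infinity (R2 * (R1 * x))" using cusp_poles_cleared[OF R1(3,4)] .
  define y where "y = R2 * (R1 * x)"
  have "mero_cusp y" using A0_cusp[OF _ mat_1_SL2Z, of y] R2(3) by (simp add: regular_off_infinity_def y_def)
  then obtain r c where "mero_asymp y r c" using mero_cusp_asymp by blast
  moreover obtain m :: nat where "- r < real m" using reals_Archimedean2 by blast
  ultimately have "mero_asymp y (- real m) 0" using mero_asymp_lower_exponent[of y r c "- real m"] by simp
  hence "y : C_adjoin {\<upsilon>}" using regular_off_infinity_polynomial R2(3) by (simp add: y_def)
  hence "y / (R2 * R1) : C_adjoin {\<upsilon>}" by (intro C_subfield_divide C_subfield_mult C_subfield_hull R1(2) R2(2))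
  thus "x : C_adjoin {\<upsilon>}" using R1(1) R2(1) by (simp add: y_def)
 qed
qed

end

section \<open>Modularity of the generators\<close>

subsection \<open>Products and quotients of Klein forms\<close>

definition char_act :: "int^2^2 => real \<times> real => real \<times> real" where
 "char_act A = (%(u, v). (u * of_int (m11 A) + v * of_int (m21 A), u * of_int (m12 A) + v * of_int (m22 A)))"

definition klein_prod :: "(real \<times> real) list => complex => complex" where
 "klein_prod xs t = prod_list (map (%(u, v). klein u v t) xs)"

definition klein_ords :: "(real \<times> real) list => real" where
 "klein_ords xs = sum_list (map (%(u, v). klein_ord u) xs)"

definition nonint :: "(real \<times> real) list => bool" where
 "nonint xs \<longleftrightarrow> (ALL (u, v):set xs. ~ (u : \<int> & v : \<int>))"

definition klein_quot :: "(real \<times> real) list => (real \<times> real) list => complex => complex" where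
 "klein_quot xs ys t = klein_prod xs (7 * t) / klein_prod ys (7 * t)"

lemma klein_prod_nonzero: "nonint xs ==> t : uhp ==> klein_prod xs t ~= 0"
 by (induction xs) (auto simp: klein_prod_def nonint_def klein_eq_0_iff)

lemma klein_quot_nonzero: "nonint xs ==> nonint ys ==> t : uhp ==> klein_quot xs ys t ~= 0"
 by (simp add: klein_quot_def klein_prod_nonzero uhp_7)

lemma klein_prod_holomorphic:
 assumes "open S" "f holomorphic_on S" "!!t. t : S ==> f t : uhp"
 shows "(%t. klein_prod xs (f t)) holomorphic_on S"
proof (induction xs)
 case (Cons x xs)
 thus ?case unfolding klein_prod_def by (cases x) (auto intro!: holomorphic_intros assms)
qed (simp add: klein_prod_def)

lemma klein_quot_holomorphic: "nonint ys ==> klein_quot xs ys holomorphic_on uhp" unfolding klein_quot_def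
 by (intro holomorphic_intros klein_prod_holomorphic) (auto simp: open_uhp uhp_7 klein_prod_nonzero)

lemma char_act_SL2_inv:
 assumes "A : SL2Z"
 shows "char_act (SL2_inv A) (char_act A p) = p"
proof -
 have det: "real_of_int (m11 A) * of_int (m22 A) - of_int (m12 A) * of_int (m21 A) = 1"
  using arg_cong[of _ _ real_of_int, OF assms[unfolded SL2Z_iff]] by simp
 have "(u * of_int (m11 A) + v * of_int (m21 A)) * of_int (m22 A) - (u * of_int (m12 A) + v * of_int (m22 A)) * of_int (m21 A) =
   u * (real_of_int (m11 A) * of_int (m22 A) - of_int (m12 A) * of_int (m21 A))"
  "(u * of_int (m12 A) + v * of_int (m22 A)) * of_int (m11 A) - (u * of_int (m11 A) + v * of_int (m21 A)) * of_int (m12 A) =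
   v * (real_of_int (m11 A) * of_int (m22 A) - of_int (m12 A) * of_int (m21 A))" for u v by (simp_all add: algebra_simps)
 thus ?thesis by (cases p) (simp add: char_act_def det)
qed

lemma char_act_Ints:
 assumes "fst p : \<int>" "snd p : \<int>"
 shows "fst (char_act A p) : \<int>" "snd (char_act A p) : \<int>"
 using assms by (auto simp: char_act_def case_prod_unfold)

lemma nonint_char_act:
 assumes A: "A : SL2Z" and xs: "nonint xs"
 shows "nonint (map (char_act A) xs)"
proof -
 have "~ (fst (char_act A p) : \<int> & snd (char_act A p) : \<int>)" if "p : set xs" for p
  using char_act_Ints[of "char_act A p" "SL2_inv A"] xs that by (auto simp: char_act_SL2_inv[OF A] nonint_def)
 thus ?thesis by (auto simp: nonint_def case_prod_unfold)
qed

lemma klein_prod_transform: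
 assumes "A : SL2Z" "t : uhp"
 shows "EX C. C ~= 0 & (ALL xs. klein_prod xs (moebius A t) = C ^ length xs * klein_prod (map (char_act A) xs) t)"
proof -
 obtain C where C: "C ~= 0" "!!u v. klein u v (moebius A t) =
   C * klein (u * of_int (m11 A) + v * of_int (m21 A)) (u * of_int (m12 A) + v * of_int (m22 A)) t"
  using klein_transform[OF assms] by blast
 have "klein_prod xs (moebius A t) = C ^ length xs * klein_prod (map (char_act A) xs) t" for xs
  by (induction xs) (auto simp: klein_prod_def char_act_def C(2))
 thus ?thesis using C(1) by blast
qed

lemma klein_quot_transform:
 assumes "A : SL2Z" "t : uhp" "7 * s = moebius A t" and len: "length xs = length ys"
 shows "klein_quot xs ys s = klein_prod (map (char_act A) xs) t / klein_prod (map (char_act A) ys) t"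
proof -
 obtain C where "C ~= 0" "!!xs. klein_prod xs (7 * s) = C ^ length xs * klein_prod (map (char_act A) xs) t"
  using klein_prod_transform[OF assms(1,2)] unfolding assms(3) by blast
 thus ?thesis by (simp add: klein_quot_def len)
qed

lemma klein_prod_q_asymp:
 assumes "nonint xs"
 shows "EX c. c ~= 0 & q_asymp (klein_prod xs) (klein_ords xs) c" using assms
proof (induction xs)
 case Nil
 show ?case using q_asymp_const[of 1] by (intro exI[of _ 1]) (simp add: klein_prod_def[abs_def] klein_ords_def)
next
 case (Cons x xs)
 obtain u v where x: "x = (u, v)" by (cases x)
 obtain c where c: "c ~= 0" "q_asymp (klein_prod xs) (klein_ords xs) c" using Cons by (auto simp: nonint_def)
 obtain d where d: "d ~= 0" "q_asymp (klein u v) (klein_ord u) d" using klein_q_asymp[of u v] Cons.prems by (auto simp: nonint_def x)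
 have "q_asymp (klein_prod (x # xs)) (klein_ords (x # xs)) (d * c)"
  using q_asymp_mult[OF d(2) c(2)] by (simp add: klein_prod_def[abs_def] klein_ords_def x)
 thus ?case using c(1) d(1) by (intro exI[of _ "d * c"]) simp
qed

lemma klein_quot_q_asymp:
 assumes good: "nonint xs" "nonint ys" "length xs = length ys" and A: "A : SL2Z" and pos: "a > 0"
  and h: "!!s. s : uhp ==> 7 * h s = moebius A (of_real a * s + of_real b)"
 shows "EX k. k ~= 0 & q_asymp (%s. klein_quot xs ys (h s)) (a * (klein_ords (map (char_act A) xs) - klein_ords (map (char_act A) ys))) k"
proof -
 define xs' ys' where "xs' = map (char_act A) xs" and "ys' = map (char_act A) ys"
 have "nonint xs'" "nonint ys'" using good A by (auto simp: xs'_def ys'_def nonint_char_act)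
 then obtain k l where k: "k ~= 0" "q_asymp (klein_prod xs') (klein_ords xs') k"
  and l: "l ~= 0" "q_asymp (klein_prod ys') (klein_ords ys') l"
  using klein_prod_q_asymp by meson
 have "of_real a * s + of_real b : uhp" if "s : uhp" for s using that pos by (simp add: uhp_def)
 hence "klein_prod xs' (of_real a * s + of_real b) / klein_prod ys' (of_real a * s + of_real b) = klein_quot xs ys (h s)" if "s : uhp" for s
  using klein_quot_transform[OF A _ h[OF that] good(3)] that by (simp add: xs'_def ys'_def)
 with q_asymp_affine[OF q_asymp_divide[OF k(2) l(2,1)] pos]
 have "q_asymp (%s. klein_quot xs ys (h s)) (a * (klein_ords xs' - klein_ords ys')) (k / l
  * e2pi (of_real (klein_ords xs' - klein_ords ys') * of_real b))"
  by (rule q_asymp_cong)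
 thus ?thesis using k(1) l(1) by (intro exI[of _ "k / l * e2pi (of_real (klein_ords xs' - klein_ords ys')
  * of_real b)"]) (simp add: xs'_def ys'_def)
qed

subsection \<open>Multiplication of the argument by 7\<close>

definition conj7 :: "int^2^2 => int^2^2" where
 "conj7 A = mat2 (m11 A) (7 * m12 A) (m21 A div 7) (m22 A)"

lemma conj7:
 assumes "A : SL2Z" "7 dvd m21 A"
 shows conj7_SL2Z: "conj7 A : SL2Z" and moebius_conj7: "7 * moebius A t = moebius (conj7 A) (7 * t)"
proof -
 obtain c where c: "m21 A = 7 * c" using assms(2) by blast
 show "conj7 A : SL2Z" "7 * moebius A t = moebius (conj7 A) (7 * t)" using assms(1)
  by (simp_all add: conj7_def moebius_def SL2Z_iff c mult_ac)
qed

text \<open>\<open>diag(7, 1) A = B (1 b; 0 7)\<close>: the other double coset representative.\<close>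
lemma moebius_7:
 assumes A: "A : SL2Z" "~ 7 dvd m21 A"
 obtains B :: "int^2^2" and b :: int where "B : SL2Z" "7 dvd m11 B"
  "!!t. 7 * moebius A t = moebius B (of_real (1 / 7) * t + of_real (of_int b / 7))"
proof -
 have "prime (7::int)" by simp
 hence "coprime (m21 A) 7" using A(2) prime_imp_coprime[of 7 "m21 A"] by (simp add: coprime_commute)
 then obtain u where "[m21 A * u = 1] (mod 7)" using cong_solve_coprime_int by blast
 hence "[m21 A * u * m22 A = 1 * m22 A] (mod 7)" by (rule cong_mult) simp
 define b where "b = u * m22 A"
 have "[m22 A = m21 A * b] (mod 7)" using cong_sym[OF \<open>[m21 A * u * m22 A = 1 * m22 A] (mod 7)\<close>] by (simp add: b_def mult.assoc)
 then obtain d where d: "m22 A - m21 A * b = 7 * d" unfolding cong_iff_dvd_diff by (rule dvdE)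
 define B where "B = mat2 (7 * m11 A) (m12 A - m11 A * b) (m21 A) d"
 have "7 * (m11 A * d) = m11 A * (m22 A - m21 A * b)" using d by simp
 hence B: "B : SL2Z" using A(1) by (simp add: B_def SL2Z_iff algebra_simps)
 have "7 * of_int d = of_int (m22 A) - of_int (m21 A) * (of_int b :: complex)"
  using arg_cong[OF d, of "of_int :: int => complex"] by simp
 hence d': "of_int d = (of_int (m22 A) - of_int (m21 A) * (of_int b :: complex)) / 7" by (simp add: mult.commute)
 have "7 * moebius A t = moebius B (of_real (1 / 7) * t + of_real (of_int b / 7))" for t proof -
  have den: "of_int (m21 A) * (of_real (1 / 7) * t + of_real (of_int b / 7)) + of_int d = (of_int (m21 A) * t + of_int (m22 A)) / 7"
   unfolding d' by (simp add: field_simps)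
  have num: "of_int (7 * m11 A) * (of_real (1 / 7) * t + of_real (of_int b / 7)) + of_int (m12 A - m11 A * b)
   = of_int (m11 A) * t + of_int (m12 A)"
   by (simp add: field_simps)
  show ?thesis unfolding moebius_def[of B] unfolding B_def mat2_nth den num by (simp add: moebius_def)
 qed
 thus ?thesis using that B by (simp add: B_def)
qed

lemma klein_quot_q_asymp_conj7:
 assumes "A : SL2Z" "7 dvd m21 A" "nonint xs" "nonint ys" "length xs = length ys"
 shows "EX k. k ~= 0 & q_asymp (%t. klein_quot xs ys (moebius A t))
   (7 * (klein_ords (map (char_act (conj7 A)) xs) - klein_ords (map (char_act (conj7 A)) ys))) k"
 by (rule klein_quot_q_asymp[where b = 0, OF assms(3-5) conj7_SL2Z[OF assms(1,2)]]) (simp_all add: moebius_conj7 assms)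

lemma klein_quot_cusp_q_asymp:
 assumes "nonint xs" "nonint ys" "length xs = length ys" "A : SL2Z"
 shows "EX r k. q_asymp (%t. klein_quot xs ys (moebius A t)) r k"
proof (cases "7 dvd m21 A")
 case True
 thus ?thesis using klein_quot_q_asymp_conj7 assms by blast
next
 case False
 then obtain B b where B: "B : SL2Z" "!!t. 7 * moebius A t = moebius B (of_real (1 / 7) * t + of_real (of_int b / 7))"
  using moebius_7[OF assms(4)] by blast
 show ?thesis using klein_quot_q_asymp[OF assms(1-3) B(1) _ B(2)] by auto
qed

subsection \<open>Membership in \<open>A0\<close>\<close>

lemma periodic_at_cusps:
 assumes N: "Gamma_principal (int N) <= G" and inv: "!!A t. A : G ==> t : uhp ==> f (moebius A t) = f t"
  and A: "A : SL2Z" and t: "t : uhp"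
 shows "f (moebius A (t + of_nat N)) = f (moebius A t)"
proof -
 define T where "T = mat2 1 (int N) 0 1"
 have T: "T : SL2Z" by (simp add: T_def SL2Z_iff)
 have AT: "A ** T : SL2Z" by (rule SL2Z_mult[OF A T])
 have "mat_cong (int N) (A ** T) A" by (simp add: mat_cong_def mult_nth T_def cong_def)
 hence "(A ** T) ** SL2_inv A : G" using mat_cong_mult_SL2_inv[OF AT A] N by blast
 hence "f (moebius ((A ** T) ** SL2_inv A) (moebius A t)) = f (moebius A t)" by (rule inv) (rule moebius_in_uhp[OF A t])
 moreover have "((A ** T) ** SL2_inv A) ** A = A ** T" by (simp add: matrix_mul_assoc[symmetric] SL2_inv_mult A)
 moreover have "moebius (A ** T) t = moebius A (t + of_nat N)" using moebius_mult[OF A T t] by (simp add: T_def moebius_translation)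
 ultimately show ?thesis using moebius_mult[OF SL2Z_mult[OF AT SL2_inv_SL2Z[OF A]] A t] by simp
qed

lemma A0I:
 assumes G: "G <= SL2Z" and N: "N > 0" "Gamma_principal (int N) <= G" and hol: "f holomorphic_on uhp"
  and inv: "!!A t. A : G ==> t : uhp ==> f (moebius A t) = f t"
  and lim: "!!A. A : SL2Z ==> EX r c. q_asymp (%t. f (moebius A t)) r c"
 shows "mero_of f : A0 G"
proof -
 have mer: "f meromorphic_on uhp" by (rule holomorphic_meromorphic[OF hol])
 have "slash A (mero_of f) = mero_of f" if A: "A : G" for A proof -
  have AS: "A : SL2Z" using A G by blast
  have "\<forall>\<^sub>\<approx>t\<in>uhp. f (moebius A t) = f t" by (rule cosparse_uhpI) (rule inv[OF A])
  thus ?thesis using slash_mero_of[OF AS mer] mero_of_eq_iff[OF meromorphic_moebius[OF AS mer] mer] by simp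
 qed
 moreover have "mero_cusp (slash A (mero_of f))" if A: "A : SL2Z" for A proof -
  obtain r c where rc: "q_asymp (%t. f (moebius A t)) r c" using lim[OF A] by blast
  have "(f \<circ> moebius A) holomorphic_on uhp"
   by (rule holomorphic_on_compose_gen[OF moebius_holomorphic[OF A] hol]) (use moebius_in_uhp[OF A] in auto)
  hence "(%t. f (moebius A t)) holomorphic_on uhp" by (simp add: o_def)
  hence "meromorphic_at_infinity_cusp (%t. f (moebius A t))"
   by (rule meromorphic_at_infinity_cuspI[OF _ N(1) periodic_at_cusps[OF N(2) inv A] rc])
  thus ?thesis using slash_mero_of[OF A mer] mero_cusp_mero_of[OF meromorphic_moebius[OF A mer]] by simp
 qed
 ultimately show ?thesis by (simp add: A0_altdef[OF G])
qed

lemma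
 assumes eq: "!!t. t : uhp ==> f t = g t" and hol: "g holomorphic_on uhp"
 shows mero_of_cong: "mero_of f = mero_of g"
  and mero_fun_mero_of_cong: "t : uhp ==> mero_fun (mero_of f) t = g t"
  and reg_at_mero_of_cong: "t : uhp ==> reg_at (mero_of f) t"
proof -
 have f_eq_g: "\<forall>\<^sub>\<approx>t\<in>uhp. f t = g t" by (rule cosparse_uhpI[OF eq])
 have g: "g meromorphic_on uhp" by (rule holomorphic_meromorphic[OF hol])
 hence f: "f meromorphic_on uhp" using meromorphic_on_cong'[OF f_eq_g refl] by blast
 show mero_eq: "mero_of f = mero_of g" using mero_of_eq_iff[OF f g] f_eq_g by blast
 show "mero_fun (mero_of f) t = g t" if "t : uhp" unfolding mero_eq by (rule mero_fun_mero_of[OF holomorphic_nicely[OF hol] that])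
 show "reg_at (mero_of f) t" if "t : uhp" unfolding mero_eq by (rule mero_fun_eqI(1)[of g]) (use that hol g open_uhp analytic_at in auto)
qed

subsection \<open>The generators\<close>

abbreviation "upsilon_num == [(2 / 7, 0), (2 / 7, 0), (3 / 7, 0)]"
abbreviation "upsilon_den == [(1 / 7, 0), (1 / 7, 0), (1 / 7, 0)]"
abbreviation "upsilon_quot == klein_quot upsilon_num upsilon_den"

abbreviation "torsion_num a b == [(3 / 7, 0), (2 / 7 + of_int a / 2, of_int b / 2)]"
abbreviation "torsion_den a b == [(2 / 7, 0), (3 / 7 + of_int a / 2, of_int b / 2)]"
abbreviation "torsion_quot a b == klein_quot (torsion_num a b) (torsion_den a b)"

lemma sevenths_not_Int:
 assumes "~ 7 dvd k"
 shows "of_int k / 7 + of_int a / 2 ~: (\<int> :: real set)"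
proof
 assume "of_int k / 7 + of_int a / 2 : (\<int> :: real set)"
 then obtain n where "of_int k / 7 + of_int a / 2 = real_of_int n" by (rule Ints_cases)
 hence "real_of_int (2 * k + 7 * a) = of_int (14 * n)" by (simp add: field_simps)
 hence "2 * k + 7 * a = 14 * n" by (simp only: of_int_eq_iff)
 thus False using assms by presburger
qed

lemma nonint_upsilon: "nonint upsilon_num" "nonint upsilon_den"
 using sevenths_not_Int[of 1 0] sevenths_not_Int[of 2 0] sevenths_not_Int[of 3 0] by (auto simp: nonint_def)

lemma nonint_torsion: "nonint (torsion_num a b)" "nonint (torsion_den a b)"
 using sevenths_not_Int[of 2 0] sevenths_not_Int[of 3 0] sevenths_not_Int[of 2 a] sevenths_not_Int[of 3 a] by (auto simp: nonint_def)

lemma generators_eq_klein_quot: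
 assumes "t : uhp"
 shows "upsilon_fun t = upsilon_quot t" "g1_fun t = epi (1 / 14) * torsion_quot 0 1 t" "g0_fun t = - torsion_quot 1 0 t"
proof -
 have epi_values: "epi 2 = 1" "epi 3 = - 1" using epi_of_int[of 2] epi_of_int[of 3] by simp_all
 show "upsilon_fun t = upsilon_quot t"
  unfolding phi_values[OF assms] klein_quot_def klein_prod_def klein7_def
   by (simp add: epi_values power2_eq_square power3_eq_cube mult.assoc)
 have "epi (- (1 / 7)) = epi (1 / 14) * epi (- (3 / 14))" unfolding epi_add[symmetric] by simp
 thus "g1_fun t = epi (1 / 14) * torsion_quot 0 1 t" unfolding g1_fun_eq[OF assms] klein_quot_def klein_prod_def klein7_def
  by (simp add: epi_values)
 show "g0_fun t = - torsion_quot 1 0 t" unfolding g0_fun_def klein_quot_def klein_prod_def klein7_def by (simp add: epi_values)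
qed

definition g0 :: mero where
 "g0 = mero_of g0_fun"

lemma torsion_quot_holomorphic: "(%t. c * torsion_quot a b t) holomorphic_on uhp"
 by (intro holomorphic_intros klein_quot_holomorphic nonint_torsion)

lemma generators_eq_mero_of:
 "upsilon = mero_of upsilon_quot" "g1 = mero_of (%t. epi (1 / 14) * torsion_quot 0 1 t)" "g0 = mero_of (%t. - 1 * torsion_quot 1 0 t)"
 unfolding upsilon_def g1_def g0_def
 using mero_of_cong[OF generators_eq_klein_quot(1) klein_quot_holomorphic[OF nonint_upsilon(2)]]
  mero_of_cong[OF generators_eq_klein_quot(2) torsion_quot_holomorphic] mero_of_cong[OF generators_eq_klein_quot(3)] torsion_quot_holomorphic[of "- 1" 1 0] by auto

lemma
 assumes "t : uhp"
 shows mero_fun_upsilon: "mero_fun upsilon t = upsilon_quot t" and mero_fun_g1: "mero_fun g1 t = epi (1 / 14) * torsion_quot 0 1 t"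
  and mero_fun_g0: "mero_fun g0 t = - 1 * torsion_quot 1 0 t"
  and reg_at_upsilon: "reg_at upsilon t" and reg_at_g1: "reg_at g1 t" and reg_at_g0: "reg_at g0 t"
 unfolding generators_eq_mero_of
 by (rule mero_fun_mero_of_cong[OF refl] reg_at_mero_of_cong[OF refl]; intro torsion_quot_holomorphic klein_quot_holomorphic nonint_upsilon assms)+

subsection \<open>Invariance\<close>

abbreviation "Gamma_2_7 == Gamma_principal 2 \<inter> Gamma1 7"

lemma Gamma1_iff: "A : Gamma1 N \<longleftrightarrow> A : SL2Z & [m11 A = 1] (mod N) & [m21 A = 0] (mod N) & [m22 A = 1] (mod N)"
 by (simp add: Gamma1_def)

lemma Gamma1_subset: "Gamma1 N <= SL2Z" by (auto simp: Gamma1_iff)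

lemma Gamma_principal_subset_Gamma1: "Gamma_principal N <= Gamma1 N" by (auto simp: Gamma1_iff Gamma_principal_iff)

lemma Gamma_2_7_subset: "Gamma_2_7 <= SL2Z" using Gamma1_subset by blast

lemma Gamma_14_subset: "Gamma_principal 14 <= Gamma_2_7"
proof -
 have "[x = y] (mod 2) & [x = y] (mod 7)" if "[x = y] (mod 14)" for x y :: int by (auto intro: cong_dvd_modulus[OF that])
 thus ?thesis by (auto simp: Gamma1_iff Gamma_principal_iff)
qed

lemma cong_1_obtain: "[x = 1] (mod N) ==> EX k::int. x = 1 + N * k" by (metis cong_iff_dvd_diff dvd_def add.commute diff_add_cancel)

lemma Gamma1_7_dvd: "A : Gamma1 7 ==> 7 dvd m21 A" by (simp add: Gamma1_iff cong_0_iff)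

definition shift_phase :: "real => real => int => int => real" where
 "shift_phase u v m n = of_int (m + n + m * n) + of_int n * u - of_int m * v"

lemma klein_char_act:
 assumes "t : uhp" "char_act A (u, v) = (u + of_int m, v + of_int n)"
 shows "(case char_act A (u, v) of (u', v') => klein u' v' t) = epi (of_real (shift_phase u v m n)) * klein u v t"
 using klein_shift[OF assms(1), of u m v n] by (simp add: assms(2) shift_phase_def)

lemma epi_of_real_eqI:
 assumes "x = y + of_int (2 * k)"
 shows "epi (of_real x) = epi (of_real y)"
 unfolding assms by (simp only: of_real_add of_real_of_int_eq epi_add epi_of_int) simp

lemma upsilon_invariant:
 assumes A: "A : Gamma1 7" and s: "s : uhp"
 shows "upsilon_quot (moebius A s) = upsilon_quot s"
proof -
 have AS: "A : SL2Z" "7 dvd m21 A" using A Gamma1_subset Gamma1_7_dvd by auto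
 obtain m where m: "m11 A = 1 + 7 * m" using A cong_1_obtain by (auto simp: Gamma1_iff)
 define b where "b = m12 A"
 let ?act = "char_act (conj7 A)"
 define phase where "phase k = shift_phase (of_int k / 7) 0 (k * m) (k * b)" for k
 have klein: "(case ?act (of_int k / 7, 0) of (u, v) => klein u v (7 * s)) = epi (of_real (phase k)) * klein (of_int k / 7) 0 (7 * s)" for k
  unfolding phase_def by (rule klein_char_act[OF uhp_7[OF s]]) (simp add: char_act_def conj7_def m b_def field_simps)
 have "phase 2 + phase 2 + phase 3 = phase 1 + phase 1 + phase 1 + of_int (2 * (2 * m + 3 * b + 7 * (m * b)))"
  by (simp add: phase_def shift_phase_def field_simps)
 from epi_of_real_eqI[OF this] have phases: "epi (of_real (phase 2)) * epi (of_real (phase 2)) * epi (of_real (phase 3)) =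
   epi (of_real (phase 1)) * epi (of_real (phase 1)) * epi (of_real (phase 1))" unfolding of_real_add epi_add .
 have "upsilon_quot (moebius A s) = klein_prod (map ?act upsilon_num) (7 * s) / klein_prod (map ?act upsilon_den) (7 * s)"
  by (rule klein_quot_transform[OF conj7_SL2Z[OF AS] uhp_7[OF s] moebius_conj7[OF AS]]) simp
 also have "... = (epi (of_real (phase 2)) * epi (of_real (phase 2)) * epi (of_real (phase 3))) * klein_prod upsilon_num (7 * s) /
   ((epi (of_real (phase 1)) * epi (of_real (phase 1)) * epi (of_real (phase 1))) * klein_prod upsilon_den (7 * s))"
  using klein[of 1] klein[of 2] klein[of 3] by (simp add: klein_prod_def mult_ac)
 finally show ?thesis unfolding phases klein_quot_def by simp
qed

lemma Gamma_2_7_entries: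
 assumes A: "A : Gamma_2_7"
 obtains m b c d where "m11 A = 1 + 14 * m" "m12 A = 2 * b" "m21 A = 14 * c" "m22 A = 1 + 14 * d" "even (d - m)"
proof -
 have mod_14: "[x = y] (mod 14)" if "[x = y] (mod 2)" "[x = y] (mod 7)" for x y :: int
  using coprime_cong_mult[OF that] by simp
 obtain m where m: "m11 A = 1 + 14 * m" using A mod_14 cong_1_obtain by (force simp: Gamma1_iff Gamma_principal_iff)
 obtain d where d: "m22 A = 1 + 14 * d" using A mod_14 cong_1_obtain by (force simp: Gamma1_iff Gamma_principal_iff)
 obtain b where b: "m12 A = 2 * b" using A by (auto simp: Gamma_principal_iff cong_0_iff)
 have "14 dvd m21 A" using A mod_14[of "m21 A" 0] by (simp add: Gamma1_iff Gamma_principal_iff cong_0_iff)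
 then obtain c where c: "m21 A = 14 * c" by blast
 have "m + d + 14 * (m * d) - 2 * (b * c) = 0" using A unfolding Gamma1_iff SL2Z_iff Int_iff m d b c by (simp add: algebra_simps)
 hence "even (d - m)" by presburger
 with m b c d show ?thesis by (rule that)
qed

lemma torsion_quot_invariant:
 assumes A: "A : Gamma_2_7" and s: "s : uhp"
 shows "torsion_quot e f (moebius A s) = torsion_quot e f s"
proof -
 have AS: "A : SL2Z" "7 dvd m21 A" using A Gamma1_subset Gamma1_7_dvd by auto
 obtain m b c d where ent: "m11 A = 1 + 14 * m" "m12 A = 2 * b" "m21 A = 14 * c" "m22 A = 1 + 14 * d" "even (d - m)"
  using Gamma_2_7_entries[OF A] by metis
 let ?act = "char_act (conj7 A)"
 define phase where "phase k e f = shift_phase (of_int k / 7 + of_int e / 2) (of_int f / 2) (2 * k * m + 7 * e * m + f * c) (2 * k * b + 7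
  * e * b + 7 * f * d)" for k e f
 have klein: "(case ?act (of_int k / 7 + of_int e / 2, of_int f / 2) of (u, v) => klein u v (7 * s)) =
   epi (of_real (phase k e f)) * klein (of_int k / 7 + of_int e / 2) (of_int f / 2) (7 * s)" for k e f
  unfolding phase_def by (rule klein_char_act[OF uhp_7[OF s]]) (simp add: char_act_def conj7_def ent field_simps)
 obtain q where q: "d = m + 2 * q" using ent(5) by (metis dvd_def diff_eq_eq add.commute)
 have "phase 3 0 0 + phase 2 e f = phase 2 0 0 + phase 3 e f +
   of_int (2 * (- m * (7 * e * b + 7 * f * d) - b * (7 * e * m + f * c) - e * b - f * q))"
  by (simp add: phase_def shift_phase_def q field_simps)
 from epi_of_real_eqI[OF this] have phases: "epi (of_real (phase 3 0 0)) * epi (of_real (phase 2 e f))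
  = epi (of_real (phase 2 0 0)) * epi (of_real (phase 3 e f))"
  unfolding of_real_add epi_add .
 have "torsion_quot e f (moebius A s) = klein_prod (map ?act (torsion_num e f)) (7 * s) / klein_prod (map ?act (torsion_den e f)) (7 * s)"
  by (rule klein_quot_transform[OF conj7_SL2Z[OF AS] uhp_7[OF s] moebius_conj7[OF AS]]) simp
 also have "... = (epi (of_real (phase 3 0 0)) * epi (of_real (phase 2 e f))) * klein_prod (torsion_num e f) (7 * s) /
   ((epi (of_real (phase 2 0 0)) * epi (of_real (phase 3 e f))) * klein_prod (torsion_den e f) (7 * s))"
  using klein[of 3 0 0] klein[of 2 0 0] klein[of 2 e f] klein[of 3 e f] by (simp add: klein_prod_def mult_ac)
 finally show ?thesis unfolding phases klein_quot_def by simp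
qed

lemma upsilon_in_A0: "upsilon : A0 (Gamma1 7)" unfolding generators_eq_mero_of
 by (rule A0I[where N = 7])
  (use Gamma1_subset Gamma_principal_subset_Gamma1[of 7] klein_quot_holomorphic[OF nonint_upsilon(2)] upsilon_invariant
   klein_quot_cusp_q_asymp[OF nonint_upsilon] in auto)

lemma torsion_quot_in_A0: "mero_of (%t. k * torsion_quot a b t) : A0 Gamma_2_7"
proof (rule A0I[where N = 14])
 show "EX r c. q_asymp (%t. k * torsion_quot a b (moebius A t)) r c" if "A : SL2Z" for A
  using klein_quot_cusp_q_asymp[OF nonint_torsion _ that] q_asymp_cmult by fastforce
qed (use Gamma_2_7_subset Gamma_14_subset torsion_quot_holomorphic torsion_quot_invariant in auto)

lemma g1_in_A0: "g1 : A0 Gamma_2_7" and g0_in_A0: "g0 : A0 Gamma_2_7"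
 unfolding generators_eq_mero_of by (rule torsion_quot_in_A0)+

subsection \<open>Orders at the cusps\<close>

lemma klein_ord_rational:
 assumes "N > 0"
 shows "klein_ord (of_int k / of_int N) = of_int (k mod N * (k mod N - N)) / (2 * of_int N ^ 2)"
proof -
 have "real_of_int k = of_int N * of_int (k div N) + of_int (k mod N)" by (metis mult_div_mod_eq of_int_add of_int_mult)
 hence "of_int k / of_int N - of_int (k mod N) / of_int N = real_of_int (k div N)" using assms by (simp add: field_simps)
 hence frac: "frac (of_int k / of_int N) = of_int (k mod N) / real_of_int N" using assms by (auto simp: frac_unique_iff)
 show ?thesis unfolding klein_ord_def frac using assms by (simp add: field_simps power2_eq_square)
qed

lemma klein_ord_sevenths: "klein_ord (of_int k / 7) = of_int (k mod 7 * (k mod 7 - 7)) / 98"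
 using klein_ord_rational[of 7 k] by simp

lemma klein_ord_fourteenths: "klein_ord (of_int k / 14) = of_int (k mod 14 * (k mod 14 - 14)) / 392"
 using klein_ord_rational[of 14 k] by simp

lemma mero_asymp_slashI:
 assumes A: "A : SL2Z" and x: "!!t. t : uhp ==> reg_at x t" "!!t. t : uhp ==> mero_fun x t = c * f t"
  and f: "q_asymp (%t. f (moebius A t)) r k"
 shows "mero_asymp (slash A x) r (c * k)"
proof (rule mero_asympI[OF q_asymp_cmult[OF f, of c]])
 show "\<forall>\<^sub>F t in at_cusp. reg_at (slash A x) t & mero_fun (slash A x) t = c * f (moebius A t)"
  using eventually_uhp_at_cusp by eventually_elim (simp add: reg_at_slash(1)[OF A] mero_fun_slash[OF A] moebius_in_uhp[OF A] x)
qed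

lemma upsilon_asymp:
 assumes A: "A : SL2Z" "7 dvd m21 A"
 shows "EX k. k ~= 0 & mero_asymp (slash A upsilon)
   (7 * (2 * klein_ord (of_int (2 * m11 A) / 7) + klein_ord (of_int (3 * m11 A) / 7) - 3 * klein_ord (of_int (m11 A) / 7))) k"
proof -
 obtain k where "k ~= 0" "q_asymp (%t. upsilon_quot (moebius A t))
   (7 * (klein_ords (map (char_act (conj7 A)) upsilon_num) - klein_ords (map (char_act (conj7 A)) upsilon_den))) k"
  using klein_quot_q_asymp_conj7[OF A nonint_upsilon] by auto
 with mero_asymp_slashI[OF A(1) reg_at_upsilon, of 1 upsilon_quot] show ?thesis
  by (auto simp: mero_fun_upsilon klein_ords_def char_act_def conj7_def)
qed

lemma torsion_quot_asymp:
 assumes A: "A : SL2Z" "7 dvd m21 A" and c: "c ~= 0"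
  and x: "!!t. t : uhp ==> reg_at x t" "!!t. t : uhp ==> mero_fun x t = c * torsion_quot a b t"
 defines "ord k == klein_ord (of_int (2 * k * m11 A + 7 * (a * m11 A + b * (m21 A div 7))) / 14)"
  and "ord0 k == klein_ord (of_int (k * m11 A) / 7)"
 shows "EX k. k ~= 0 & mero_asymp (slash A x) (7 * (ord0 3 + ord 2 - ord0 2 - ord 3)) k"
proof -
 obtain k where k: "k ~= 0" "q_asymp (%t. torsion_quot a b (moebius A t))
   (7 * (klein_ords (map (char_act (conj7 A)) (torsion_num a b)) - klein_ords (map (char_act (conj7 A)) (torsion_den a b)))) k"
  using klein_quot_q_asymp_conj7[OF A nonint_torsion, of a b] by auto
 have ord: "klein_ord ((of_int k / 7 + of_int a / 2) * of_int (m11 A) + of_int b / 2 * of_int (m21 A div 7)) = ord k" for k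
  unfolding ord_def by (rule arg_cong[of _ _ klein_ord]) (simp add: field_simps)
 have ord0: "klein_ord (of_int k / 7 * of_int (m11 A)) = ord0 k" for k by (simp add: ord0_def)
 have "klein_ords (map (char_act (conj7 A)) (torsion_num a b)) = ord0 3 + ord 2"
  "klein_ords (map (char_act (conj7 A)) (torsion_den a b)) = ord0 2 + ord 3"
  using ord[of 2] ord[of 3] ord0[of 2] ord0[of 3] by (simp_all add: klein_ords_def char_act_def conj7_def)
 hence "mero_asymp (slash A x) (7 * (ord0 3 + ord 2 - ord0 2 - ord 3)) (c * k)"
  using mero_asymp_slashI[OF A(1) x k(2)] by (simp add: algebra_simps)
 thus ?thesis using k(1) c by (intro exI[of _ "c * k"]) simp
qed

lemma mat_1_nth: "m11 (mat 1) = 1" "m12 (mat 1) = 0" "m21 (mat 1) = 0" "m22 (mat 1) = 1" by (simp_all add: mat_def)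

lemma
 shows upsilon_asymp_infinity: "EX k. k ~= 0 & mero_asymp upsilon (- 1) k"
  and g1_asymp_infinity: "EX k. k ~= 0 & mero_asymp g1 0 k"
  and g0_asymp_infinity: "EX k. k ~= 0 & mero_asymp g0 (- 1 / 2) k"
proof -
 have infinity: "mat 1 : SL2Z" "7 dvd m21 (mat 1)" by (simp_all add: mat_1_SL2Z mat_1_nth)
 note ords = mat_1_nth klein_ord_sevenths klein_ord_fourteenths
 show "EX k. k ~= 0 & mero_asymp upsilon (- 1) k" using upsilon_asymp[OF infinity] unfolding ords by simp
 show "EX k. k ~= 0 & mero_asymp g1 0 k"
  using torsion_quot_asymp[OF infinity _ reg_at_g1 mero_fun_g1] unfolding ords by simp
 show "EX k. k ~= 0 & mero_asymp g0 (- 1 / 2) k"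
  using torsion_quot_asymp[OF infinity _ reg_at_g0 mero_fun_g0] unfolding ords by simp
qed

lemma upsilon_finite_off_Gamma0:
 assumes A: "A : SL2Z" "~ 7 dvd m21 A"
 shows "finite_at_cusp (slash A upsilon)"
proof -
 obtain B b where B: "B : SL2Z" "7 dvd m11 B" "!!t. 7 * moebius A t = moebius B (of_real (1 / 7) * t + of_real (of_int b / 7))"
  using moebius_7[OF A] by blast
 obtain a where a: "m11 B = 7 * a" using B(2) by blast
 have "klein_ord (of_int k / 7 * of_int (7 * a)) = 0" for k using klein_ord_sevenths[of "k * (7 * a)"] by simp
 from this[of 1] this[of 2] this[of 3] have "klein_ords (map (char_act B) upsilon_num) = 0" "klein_ords (map (char_act B) upsilon_den) = 0"
  by (simp_all add: klein_ords_def char_act_def a)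
 with klein_quot_q_asymp[OF nonint_upsilon _ B(1) _ B(3)] obtain k where "q_asymp (%t. upsilon_quot (moebius A t)) 0 k" by auto
 from mero_asymp_slashI[OF A(1) reg_at_upsilon _ this, of 1] show ?thesis by (auto simp: mero_fun_upsilon finite_at_cusp_def)
qed

lemma SL2Z_mod_7:
 assumes "A : SL2Z" "7 dvd m21 A"
 shows "[m11 A * m22 A = 1] (mod 7)"
proof -
 have "m11 A * m22 A - 1 = m12 A * m21 A" using assms(1) by (simp add: SL2Z_iff)
 thus ?thesis using assms(2) by (simp add: cong_iff_dvd_diff)
qed

lemma A0_Gamma1_7_fixed:
 assumes A: "A : SL2Z" "7 dvd m21 A" and j: "m11 A mod 7 = 1 | m11 A mod 7 = 6" and x: "x : A0 (Gamma1 7)"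
 shows "slash A x = x"
proof -
 have fixed: "slash B x = x" if "B : SL2Z" "7 dvd m21 B" "m11 B mod 7 = 1" for B proof -
  have m11: "[m11 B = 1] (mod 7)" using that(3) by (simp add: cong_def)
  have "[m22 B = m11 B * m22 B] (mod 7)" using cong_mult[OF cong_sym[OF m11] cong_refl, of "m22 B"] by simp
  hence "[m22 B = 1] (mod 7)" by (rule cong_trans[OF _ SL2Z_mod_7[OF that(1,2)]])
  hence "B : Gamma1 7" using that m11 by (simp add: Gamma1_iff cong_0_iff)
  thus ?thesis using x by (simp add: A0_altdef[OF Gamma1_subset])
 qed
 show ?thesis using j proof
  assume "m11 A mod 7 = 6"
  hence "m11 (- A) mod 7 = 1" by simp presburger
  moreover have "- A : SL2Z" using A(1) by (simp add: SL2Z_iff)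
  ultimately have "slash (- A) x = x" using A(2) by (intro fixed) auto
  thus ?thesis by (simp add: slash_uminus_mat)
 qed (rule fixed[OF A])
qed

lemma upsilon_cusps:
 assumes A: "A : SL2Z"
 shows "finite_at_cusp (slash A upsilon) | (ALL x:A0 (Gamma1 7). slash A x = x)"
proof (cases "7 dvd m21 A")
 case True
 define j where "j = m11 A mod 7"
 have "j ~= 0" using SL2Z_mod_7[OF A True] by (auto simp: j_def cong_def mod_mult_left_eq[of "m11 A", symmetric])
 moreover have "0 <= j" "j < 7" by (auto simp: j_def)
 ultimately consider "j = 1 | j = 6" | "j = 2 | j = 3 | j = 4 | j = 5" by force
 thus ?thesis proof cases
  case 1
  thus ?thesis using A0_Gamma1_7_fixed[OF A True] by (simp add: j_def)
 next
  case 2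
  define ord where "ord k = real_of_int (k * j mod 7 * (k * j mod 7 - 7)) / 98" for k
  have "klein_ord (of_int (k * m11 A) / 7) = ord k" for k unfolding klein_ord_sevenths ord_def j_def by (simp add: mod_mult_right_eq)
  from this[of 1] this[of 2] this[of 3] obtain k where "mero_asymp (slash A upsilon) (7 * (2 * ord 2 + ord 3 - 3 * ord 1)) k"
   using upsilon_asymp[OF A True] by auto
  moreover have "0 <= 7 * (2 * ord 2 + ord 3 - 3 * ord 1)" using 2 by (auto simp: ord_def)
  ultimately show ?thesis using mero_asymp_weaken by (auto simp: finite_at_cusp_def)
 qed
qed (use upsilon_finite_off_Gamma0[OF A] in blast)

lemma hauptmodul_upsilon: "EX k. hauptmodul (Gamma1 7) 7 upsilon k"
proof -
 obtain k where "k ~= 0" "mero_asymp upsilon (- 1) k" using upsilon_asymp_infinity by blast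
 moreover have "mat2 1 1 0 1 : Gamma1 7" by (simp add: Gamma1_iff SL2Z_iff)
 ultimately have "hauptmodul (Gamma1 7) 7 upsilon k" by unfold_locales
  (use Gamma1_subset Gamma_principal_subset_Gamma1 upsilon_in_A0 upsilon_cusps reg_at_upsilon in auto)
 thus ?thesis by blast
qed

theorem A0_Gamma1_7: "A0 (Gamma1 7) = C_adjoin {upsilon}" using hauptmodul_upsilon hauptmodul.A0_eq_adjoin by blast

subsection \<open>The stabilizer of the generators\<close>

lemma mero_asymp_exponent_unique: "mero_asymp x r c ==> c ~= 0 ==> mero_asymp x s d ==> d ~= 0 ==> r = s"
 unfolding mero_asymp_def using q_asymp_exponent_unique by blast

lemma g1_stabilizer_even:
 assumes A: "A : Gamma1 7" "slash A g1 = g1"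
 shows "even (m21 A)"
proof (rule ccontr)
 assume odd: "odd (m21 A)"
 have AS: "A : SL2Z" "7 dvd m21 A" using A Gamma1_subset Gamma1_7_dvd by auto
 obtain m where m: "m11 A = 1 + 7 * m" using A(1) cong_1_obtain by (auto simp: Gamma1_iff)
 obtain c0 where c0: "m21 A = 7 * c0" using AS(2) by (rule dvdE)
 hence "odd c0" using odd by simp
 then obtain c where "c0 = 2 * c + 1" by (rule oddE)
 hence c: "m21 A div 7 = 2 * c + 1" using c0 by simp
 have ord: "klein_ord (of_int (2 * k * m11 A + 7 * (0 * m11 A + 1 * (m21 A div 7))) / 14) = klein_ord (of_int (2 * k + 7) / 14)" for k
  proof -
  have "2 * k * m11 A + 7 * (0 * m11 A + 1 * (m21 A div 7)) = 2 * k + 7 + 14 * (k * m + c)" unfolding m c by (simp add: algebra_simps)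
  thus ?thesis unfolding klein_ord_fourteenths by (simp only: mod_mult_self2)
 qed
 have ord0: "klein_ord (of_int (k * m11 A) / 7) = klein_ord (of_int k / 7)" for k proof -
  have "k * m11 A = k + 7 * (k * m)" unfolding m by (simp add: algebra_simps)
  thus ?thesis unfolding klein_ord_sevenths by (simp only: mod_mult_self2)
 qed
 obtain k where "k ~= 0" "mero_asymp (slash A g1) (- 1 / 2) k"
  using torsion_quot_asymp[OF AS _ reg_at_g1 mero_fun_g1] unfolding ord ord0 unfolding klein_ord_sevenths klein_ord_fourteenths by auto
 moreover obtain l where "l ~= 0" "mero_asymp g1 0 l" using g1_asymp_infinity by blast
 ultimately have "(- 1 / 2 :: real) = 0" using mero_asymp_exponent_unique A(2) by metis
 thus False by simp
qed

lemma SL2Z_odd_diagonal: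
 assumes "A : SL2Z" "even (m21 A)"
 shows "odd (m11 A)" "odd (m22 A)"
proof -
 have "m11 A * m22 A = 1 + m12 A * m21 A" using assms(1) by (simp add: SL2Z_iff)
 hence "odd (m11 A * m22 A)" using assms(2) by simp
 thus "odd (m11 A)" "odd (m22 A)" by simp_all
qed

lemma Gamma_2_7_iff: "A : Gamma_2_7 \<longleftrightarrow> A : Gamma1 7 & even (m12 A) & even (m21 A)"
 using SL2Z_odd_diagonal[of A] by (auto simp: Gamma_principal_iff Gamma1_iff cong_0_iff cong_def[of _ 1] odd_iff_mod_2_eq_one)

lemma g0_translation: "slash (mat2 1 1 0 1) g0 ~= g0"
proof
 have T: "mat2 1 1 0 1 : SL2Z" by (simp add: SL2Z_iff)
 assume "slash (mat2 1 1 0 1) g0 = g0"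
 hence per: "mero_fun g0 (t + 1) = mero_fun g0 t" if "t : uhp" for t using mero_fun_slash[OF T that, of g0]
  by (simp add: moebius_translation)
 obtain k where "k ~= 0" "mero_asymp g0 (- 1 / 2) k" using g0_asymp_infinity by blast
 hence "(- 1 / 2 :: real) : \<int>" using q_asymp_integral_exponent[of "mero_fun g0"] per unfolding mero_asymp_def by blast
 thus False using half_not_Int Ints_minus by fastforce
qed

lemma Gamma_2_7_stabilizer:
 assumes A: "A : Gamma1 7" and fixed: "slash A g1 = g1" "slash A g0 = g0"
 shows "A : Gamma_2_7"
proof -
 have c: "even (m21 A)" by (rule g1_stabilizer_even[OF A fixed(1)])
 moreover have "even (m12 A)" proof (rule ccontr)
  assume odd: "odd (m12 A)"
  define T where "T = mat2 1 1 0 1"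
  have T: "T : SL2Z" by (simp add: T_def SL2Z_iff)
  define B where "B = A ** SL2_inv T"
  have AS: "A : SL2Z" using A Gamma1_subset by blast
  have B: "B : SL2Z" unfolding B_def by (intro SL2Z_mult AS SL2_inv_SL2Z T)
  have ent: "m11 B = m11 A" "m12 B = m12 A - m11 A" "m21 B = m21 A" "m22 B = m22 A - m21 A" by (simp_all add: B_def T_def mult_nth)
  have "[m22 A - m21 A = 1 - 0] (mod 7)" using A by (intro cong_diff) (simp_all add: Gamma1_iff)
  hence "B : Gamma_2_7" using A B c odd SL2Z_odd_diagonal(1)[OF AS c] unfolding Gamma_2_7_iff Gamma1_iff ent by simp
  hence "slash B g0 = g0" using g0_in_A0 by (auto simp: A0_altdef[OF Gamma_2_7_subset])
  moreover have "B ** T = A" by (simp add: B_def matrix_mul_assoc[symmetric] SL2_inv_mult T)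
  ultimately have "slash T g0 = g0" using slash_slash[OF B T, of g0] fixed(2) by simp
  thus False using g0_translation by (simp add: T_def)
 qed
 ultimately show ?thesis using A unfolding Gamma_2_7_iff by simp
qed

section \<open>The function field of \<open>\<Gamma>(2) \<inter> \<Gamma>\<^sub>1(7)\<close>\<close>

subsection \<open>Primitive elements over a larger group\<close>

lemma coeff_linear_mult: "coeff ([:a, b:] * q) k = a * coeff q k + (case k of 0 => 0 | Suc j => b * coeff q j)"
 by (cases k) (simp_all add: mult_pCons_left)

lemma coeff_prod_linear_slash:
 assumes A: "A : SL2Z" and "finite S"
 shows "coeff (PROD t:S. [:- slash A t, 1:]) k = slash A (coeff (PROD t:S. [:- t, 1:]) k)" using assms(2)
proof (induction S arbitrary: k rule: finite_induct)
 case empty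
 show ?case by (cases k) (simp_all add: slash_0 slash_1 A)
next
 case (insert t S)
 show ?case unfolding prod.insert[OF insert(1,2)] coeff_linear_mult insert(3)
  by (cases k) (simp_all add: slash_add slash_mult slash_minus slash_diff slash_0 A)
qed

lemma coeff_prod_linear_mem:
 assumes F: "C_subfield F" and "finite S" "S <= F"
 shows "coeff (PROD t:S. [:- t, 1:]) k : F" using assms(2,3)
proof (induction S arbitrary: k rule: finite_induct)
 case empty
 show ?case by (cases k) (simp_all add: C_subfield_closed[OF F])
next
 case (insert t S)
 hence "t : F" "!!j. coeff (PROD t:S. [:- t, 1:]) j : F" by auto
 thus ?case unfolding prod.insert[OF insert(1,2)] coeff_linear_mult by (cases k) (auto intro!: C_subfield_closed[OF F])
qed

lemma linear_cofactor_coeff_mem: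
 assumes F: "C_subfield F" and x: "x : F" and P: "!!k. coeff ([:- x, 1:] * R) k : F"
 shows "coeff R k : F"
proof (induction "degree R + 1 - k" arbitrary: k)
 case 0
 thus ?case by (simp add: coeff_eq_0 C_subfield_0[OF F])
next
 case (Suc n)
 have "coeff R (Suc k) : F" using Suc by (intro Suc.hyps(1)) simp
 hence "coeff ([:- x, 1:] * R) (Suc k) + x * coeff R (Suc k) : F" using x P by (intro C_subfield_add C_subfield_mult F)
 thus ?case by (simp add: coeff_linear_mult)
qed

locale primitive_element =
 fixes H G :: "(int^2^2) set" and N :: int and \<theta> :: mero
 assumes H: "H <= SL2Z" "mat 1 : H" "!!A B. A : H ==> B : H ==> A ** B : H" "!!A. A : H ==> SL2_inv A : H"
  and G: "G <= H" "N > 0" "Gamma_principal N <= G"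
  and \<theta>: "\<theta> : A0 G" and stabilizer: "!!A. A : H ==> slash A \<theta> = \<theta> ==> A : G"
begin

lemma A0_H_iff: "x : A0 H \<longleftrightarrow> x : A0 {} & (ALL A:H. slash A x = x)"
 by (auto simp: A0_altdef[OF H(1)] A0_altdef[of "{}"])

lemma A0_empty_subfield: "C_subfield (A0 {})" by (rule A0_subfield) simp

lemma A0_G_fixed: "x : A0 G ==> A : G ==> slash A x = x" using H(1) G(1) by (auto simp: A0_altdef)

lemma A0_G_slash: "x : A0 G ==> A : H ==> slash A x : A0 {}" using H(1) G(1) by (auto simp: A0_altdef slash_slash SL2Z_mult subset_iff)

definition conjugates :: "mero set" where
 "conjugates = (%A. slash A \<theta>) ` H"

definition transport :: "mero => mero => mero" where
 "transport f t = slash (SOME A. A : H & slash A \<theta> = t) f"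

lemma finite_conjugates: "finite conjugates"
proof -
 have "has_level N \<theta>" using A0_G_fixed[OF \<theta>] G(3) by (auto simp: has_level_def)
 from finite_orbit[OF G(2) this] show ?thesis unfolding conjugates_def using H(1) by (meson finite_subset image_mono)
qed

lemma primitive_element_in_conjugates: "\<theta> : conjugates" unfolding conjugates_def by (rule image_eqI[of _ _ "mat 1"]) (simp_all add: H(2))

lemma slash_determined_by_conjugate:
 assumes f: "f : A0 G" and A: "A : H" and B: "B : H" and eq: "slash A \<theta> = slash B \<theta>"
 shows "slash A f = slash B f"
proof -
 define C where "C = A ** SL2_inv B"
 have C: "C : H" unfolding C_def by (intro H A B)
 hence S: "A : SL2Z" "B : SL2Z" "C : SL2Z" using A B H(1) by blast+
 have "slash C \<theta> = slash (SL2_inv B) (slash B \<theta>)" using slash_slash[OF S(1) SL2_inv_SL2Z[OF S(2)], of \<theta>] eq by (simp add: C_def)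
 also have "... = \<theta>" using slash_slash[OF S(2) SL2_inv_SL2Z[OF S(2)], of \<theta>] SL2_inv_mult(2)[OF S(2)] by simp
 finally have "C : G" by (rule stabilizer[OF C])
 hence "slash B (slash C f) = slash B f" using A0_G_fixed[OF f] by simp
 moreover have "C ** B = A" using SL2_inv_mult(1)[OF S(2)] by (simp add: C_def matrix_mul_assoc[symmetric])
 ultimately show ?thesis using slash_slash[OF S(3,2), of f] by simp
qed

lemma transport_slash:
 assumes "f : A0 G" "A : H"
 shows "transport f (slash A \<theta>) = slash A f"
proof -
 have "(SOME B. B : H & slash B \<theta> = slash A \<theta>) : H & slash (SOME B. B : H & slash B \<theta> = slash A \<theta>) \<theta> = slash A \<theta>"
  by (rule someI[of _ A]) (simp add: assms)
 thus ?thesis unfolding transport_def using slash_determined_by_conjugate[OF assms(1) _ assms(2)] by blast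
qed

lemma transport_equivariant:
 assumes f: "f : A0 G" and B: "B : H" and "t : conjugates"
 shows "transport f (slash B t) = slash B (transport f t)"
proof -
 obtain A where A: "A : H" "t = slash A \<theta>" using assms(3) by (auto simp: conjugates_def)
 have "slash B t = slash (A ** B) \<theta>" "slash B (slash A f) = slash (A ** B) f" using A B H(1) slash_slash[of A B]
  by (simp_all add: subset_iff)
 thus ?thesis using transport_slash[OF f A(1)] transport_slash[OF f H(3)[OF A(1) B]] A(2) by simp
qed

lemma transport_mem:
 assumes "f : A0 G" "t : conjugates"
 shows "transport f t : A0 {}"
 using assms transport_slash A0_G_slash by (auto simp: conjugates_def)

lemma conjugates_permuted:
 assumes B: "B : H"
 shows "slash B ` conjugates = conjugates" "inj_on (slash B) conjugates"
proof -
 have BS: "B : SL2Z" using B H(1) by blast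
 show inj: "inj_on (slash B) conjugates" by (auto intro!: inj_onI simp: slash_inj[OF BS])
 have "slash B (slash A \<theta>) : conjugates" if "A : H" for A
  unfolding conjugates_def by (rule image_eqI[of _ _ "A ** B"]) (use slash_slash[of A B \<theta>] H(3)[OF that B] subsetD[OF H(1) that] BS in simp_all)
 hence "slash B ` conjugates <= conjugates" by (auto simp: conjugates_def)
 thus "slash B ` conjugates = conjugates" using endo_inj_surj[OF finite_conjugates _ inj] by blast
qed

lemma conjugates_subset: "conjugates <= A0 {}" unfolding conjugates_def using A0_G_slash[OF \<theta>] by blast

lemma trace_mem:
 assumes f: "f : A0 G"
 shows "(SUM t:conjugates. transport f t * t ^ j) : A0 H" unfolding A0_H_iff
proof (intro conjI ballI)
 show "(SUM t:conjugates. transport f t * t ^ j) : A0 {}"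
  by (intro C_subfield_sum C_subfield_mult C_subfield_power A0_empty_subfield transport_mem[OF f] subsetD[OF conjugates_subset])
 fix B assume B: "B : H"
 hence BS: "B : SL2Z" using H(1) by blast
 have "slash B (SUM t:conjugates. transport f t * t ^ j) = (SUM t:conjugates. transport f (slash B t) * slash B t ^ j)"
  unfolding slash_sum[OF BS] using transport_equivariant[OF f B] by (intro sum.cong) (auto simp: slash_mult slash_power BS)
 also have "... = (SUM t:slash B ` conjugates. transport f t * t ^ j)" by (simp add: sum.reindex[OF conjugates_permuted(2)[OF B]])
 finally show "slash B (SUM t:conjugates. transport f t * t ^ j) = (SUM t:conjugates. transport f t * t ^ j)"
  unfolding conjugates_permuted(1)[OF B] .
qed

lemma coeff_conjugate_polynomial_mem: "coeff (PROD t:conjugates. [:- t, 1:]) k : A0 H" unfolding A0_H_iff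
proof (intro conjI ballI)
 show "coeff (PROD t:conjugates. [:- t, 1:]) k : A0 {}" by (rule coeff_prod_linear_mem[OF A0_empty_subfield finite_conjugates conjugates_subset])
 fix B assume B: "B : H"
 hence BS: "B : SL2Z" using H(1) by blast
 have "slash B (coeff (PROD t:conjugates. [:- t, 1:]) k) = coeff (PROD t:conjugates. [:- slash B t, 1:]) k"
  by (rule coeff_prod_linear_slash[OF BS finite_conjugates, symmetric])
 also have "(PROD t:conjugates. [:- slash B t, 1:]) = (PROD t:slash B ` conjugates. [:- t, 1:])"
  by (simp add: prod.reindex[OF conjugates_permuted(2)[OF B]])
 finally show "slash B (coeff (PROD t:conjugates. [:- t, 1:]) k) = coeff (PROD t:conjugates. [:- t, 1:]) k"
  unfolding conjugates_permuted(1)[OF B] .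
qed

text \<open>Lagrange interpolation of \<open>\<theta> \<mapsto> f\<close> over the conjugates of \<open>\<theta>\<close>.\<close>
lemma interpolation:
 assumes F: "C_subfield F" "A0 H <= F" "\<theta> : F" and f: "f : A0 G"
 shows "f * (PROD t:conjugates - {\<theta>}. \<theta> - t) : F"
proof -
 define R where "R = (PROD t:conjugates - {\<theta>}. [:- t, 1:])"
 have "(PROD t:conjugates. [:- t, 1:]) = [:- \<theta>, 1:] * R"
  unfolding R_def using finite_conjugates primitive_element_in_conjugates by (rule prod.remove)
 hence "coeff ([:- \<theta>, 1:] * R) k : F" for k using coeff_conjugate_polynomial_mem[of k] F(2) by auto
 hence R: "coeff R k : F" for k by (rule linear_cofactor_coeff_mem[OF F(1,3)])
 have poly_R: "poly R x = (PROD t:conjugates - {\<theta>}. x - t)" for x by (simp add: R_def poly_prod)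
 have "(SUM t:conjugates. transport f t * poly R t) = (SUM t:{\<theta>}. transport f t * poly R t)"
  using finite_conjugates primitive_element_in_conjugates by (intro sum.mono_neutral_right) (auto simp: poly_R intro!: prod_zero)
 also have "... = f * poly R \<theta>" using transport_slash[OF f H(2)] by simp
 finally have "f * poly R \<theta> = (SUM t:conjugates. transport f t * (SUM j<=degree R. coeff R j * t ^ j))" by (simp add: poly_altdef)
 also have "... = (SUM j<=degree R. coeff R j * (SUM t:conjugates. transport f t * t ^ j))"
  unfolding sum_distrib_left by (subst sum.swap) (simp add: mult_ac)
 also have "... : F" by (intro C_subfield_sum C_subfield_mult F(1) R subsetD[OF F(2)] trace_mem f)
 finally show ?thesis unfolding poly_R .
qed

lemma A0_G_subset:
 assumes F: "C_subfield F" "A0 H <= F" "\<theta> : F"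
 shows "A0 G <= F"
proof
 fix f assume f: "f : A0 G"
 define D where "D = (PROD t:conjugates - {\<theta>}. \<theta> - t)"
 have "1 : A0 G" using C_subfield_1[OF A0_subfield] G(1) H(1) by simp
 hence "f * D : F" "1 * D : F" unfolding D_def using f by (blast intro: interpolation[OF F])+
 hence "f * D / (1 * D) : F" by (rule C_subfield_divide[OF F(1)])
 moreover have "D ~= 0" unfolding D_def using finite_conjugates by (auto simp: prod_zero_iff)
 ultimately show "f : F" by simp
qed

end

lemma separating_combination:
 assumes "finite P"
 shows "EX l. ALL p:P. fst p + mero_const l * snd p = x + mero_const l * y --> p = (x, y)"
proof -
 define bad where "bad p = {l. fst p + mero_const l * snd p = x + mero_const l * y}" for p
 have "finite (bad p)" if p: "p ~= (x, y)" for p proof -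
  have "l = l'" if "l : bad p" "l' : bad p" for l l' proof (rule ccontr)
   assume "l ~= l'"
   moreover have "(mero_const l - mero_const l') * (snd p - y) = 0" using that unfolding bad_def mem_Collect_eq by algebra
   ultimately have "snd p = y" by (simp add: mero_const_eq_iff)
   moreover from this have "fst p = x" using that(1) unfolding bad_def mem_Collect_eq by simp
   ultimately show False using p by (simp add: prod_eq_iff)
  qed
  hence "EX a. bad p <= {a}" by blast
  thus ?thesis by (meson finite.emptyI finite.insertI finite_subset)
 qed
 hence "finite (UN p:P - {(x, y)}. bad p)" using assms by auto
 then obtain l where "l ~: (UN p:P - {(x, y)}. bad p)" using ex_new_if_finite[OF infinite_UNIV_char_0] by blast
 thus ?thesis by (intro exI[of _ l]) (auto simp: bad_def)
qed

lemma Gamma1_mult: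
 assumes A: "A : Gamma1 N" and B: "B : Gamma1 N"
 shows "A ** B : Gamma1 N"
proof -
 have "[m11 A * m11 B + m12 A * m21 B = 1 * 1 + m12 A * 0] (mod N)" "[m21 A * m11 B + m22 A * m21 B = 0 * m11 B + m22 A * 0] (mod N)"
  "[m21 A * m12 B + m22 A * m22 B = 0 * m12 B + 1 * 1] (mod N)"
  using assms by (intro cong_add cong_mult cong_refl; simp add: Gamma1_iff)+
 thus ?thesis using assms by (simp add: Gamma1_iff SL2Z_mult mult_nth)
qed

lemma A0_Gamma_2_7_subset: "A0 Gamma_2_7 <= C_adjoin {upsilon, g1, g0}"
proof -
 note A0_field = A0_subfield[OF Gamma_2_7_subset]
 have level: "has_level 14 x" if "x : A0 Gamma_2_7" for x
  using that Gamma_14_subset by (auto simp: has_level_def A0_altdef[OF Gamma_2_7_subset])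
 define P where "P = (%A. (slash A g1, slash A g0)) ` SL2Z"
 have "P <= (%A. slash A g1) ` SL2Z \<times> (%A. slash A g0) ` SL2Z" by (auto simp: P_def)
 hence "finite P" using finite_orbit[of 14, OF _ level[OF g1_in_A0]] finite_orbit[of 14, OF _ level[OF g0_in_A0]]
  by (meson finite_SigmaI finite_subset zero_less_numeral)
 then obtain l where l: "ALL p:P. fst p + mero_const l * snd p = g1 + mero_const l * g0 --> p = (g1, g0)" using separating_combination
  by blast
 define \<theta> where "\<theta> = g1 + mero_const l * g0"
 have stabilizer: "A : Gamma_2_7" if A: "A : Gamma1 7" and fixed: "slash A \<theta> = \<theta>" for A proof -
  have AS: "A : SL2Z" using A Gamma1_subset by blast
  have "slash A g1 + mero_const l * slash A g0 = g1 + mero_const l * g0" using fixed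
   by (simp add: \<theta>_def slash_add slash_mult slash_const AS)
  moreover have "(slash A g1, slash A g0) : P" using AS by (simp add: P_def)
  ultimately have "(slash A g1, slash A g0) = (g1, g0)" using l by force
  thus ?thesis using Gamma_2_7_stabilizer[OF A] by simp
 qed
 have "\<theta> : A0 Gamma_2_7" unfolding \<theta>_def by (intro C_subfield_add C_subfield_mult C_subfield_const A0_field g1_in_A0 g0_in_A0)
 then interpret primitive_element "Gamma1 7" Gamma_2_7 14 \<theta>
  by unfold_locales (use Gamma1_subset Gamma_14_subset stabilizer Gamma1_mult mat_1_SL2Z in \<open>auto simp: Gamma1_iff mat_1_nth SL2_inv_SL2Z cong_0_iff\<close>)
 note F = C_subfield_hull[of "{upsilon, g1, g0}"]
 have gens: "upsilon : C_adjoin {upsilon, g1, g0}" "g1 : C_adjoin {upsilon, g1, g0}" "g0 : C_adjoin {upsilon, g1, g0}"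
  using C_adjoin_subset[of "{upsilon, g1, g0}"] by auto
 show ?thesis proof (rule A0_G_subset[OF F])
  show "A0 (Gamma1 7) <= C_adjoin {upsilon, g1, g0}" unfolding A0_Gamma1_7 by (rule C_adjoin_minimal[OF _ F]) (use gens in auto)
  show "\<theta> : C_adjoin {upsilon, g1, g0}" unfolding \<theta>_def by (intro C_subfield_add C_subfield_mult C_subfield_const F gens)
 qed
qed

subsection \<open>Relations between the generators\<close>

lemma torsion_quot_nonzero: "t : uhp ==> torsion_quot a b t ~= 0" by (rule klein_quot_nonzero[OF nonint_torsion])

lemma upsilon_neq_0: "upsilon ~= 0" and g1_neq_0: "g1 ~= 0" and g0_neq_0: "g0 ~= 0"
proof -
 have i: "\<i> : uhp" by (simp add: uhp_def)
 have zero: "mero_fun 0 \<i> = 0" using mero_fun_const[OF i, of 0] by (simp add: mero_const_0)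
 show "upsilon ~= 0" "g1 ~= 0" "g0 ~= 0"
  using mero_fun_upsilon[OF i] mero_fun_g1[OF i] mero_fun_g0[OF i] klein_quot_nonzero[OF nonint_upsilon i]
   torsion_quot_nonzero[OF i, of 0 1] torsion_quot_nonzero[OF i, of 1 0] zero by auto
qed

lemma g1_neq_g0: "g1 ~= g0"
proof
 assume "g1 = g0"
 moreover obtain k where "k ~= 0" "mero_asymp g1 0 k" using g1_asymp_infinity by blast
 moreover obtain l where "l ~= 0" "mero_asymp g0 (- 1 / 2) l" using g0_asymp_infinity by blast
 ultimately have "(0 :: real) = - 1 / 2" using mero_asymp_exponent_unique by metis
 thus False by simp
qed

lemma
 assumes t: "t : uhp"
 shows mero_fun_g2: "mero_fun g2 t = g2_fun t" and reg_at_g2: "reg_at g2 t"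
proof -
 define f where "f t = ((upsilon_quot t - 1) ^ 2) / (upsilon_quot t * (epi (1 / 14) * torsion_quot 0 1 t) * torsion_quot 1 0 t)" for t
 have nz: "upsilon_quot s ~= 0" "torsion_quot 0 1 s ~= 0" "torsion_quot 1 0 s ~= 0" if "s : uhp" for s
  by (intro klein_quot_nonzero[OF nonint_upsilon that] torsion_quot_nonzero[OF that])+
 have hol: "f holomorphic_on uhp" unfolding f_def
  by (intro holomorphic_intros klein_quot_holomorphic nonint_upsilon nonint_torsion) (use nz in auto)
 have eq: "g2_fun s = f s" if "s : uhp" for s
  using root_relations(3)[OF that] nz[OF that] by (simp add: f_def generators_eq_klein_quot that field_simps)
 show "mero_fun g2 t = g2_fun t" "reg_at g2 t" unfolding g2_def
  using mero_fun_mero_of_cong[OF eq hol t] reg_at_mero_of_cong[OF eq hol t] eq[OF t] by auto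
qed

lemma mero_root_relations:
 "upsilon * g1 ^ 3 + upsilon * g1 ^ 2 - (upsilon ^ 2 - 1) * g1 + (upsilon - 1) ^ 2 = 0"
 "upsilon * g0 ^ 3 + upsilon * g0 ^ 2 - (upsilon ^ 2 - 1) * g0 + (upsilon - 1) ^ 2 = 0"
 "upsilon * (g1 * g2 * g0) = - ((upsilon - 1) ^ 2)"
proof -
 have "mero_fun upsilon t = upsilon_fun t" "mero_fun g1 t = g1_fun t" "mero_fun g0 t = g0_fun t" "mero_fun 1 t = 1" "reg_at 1 t" if
  "t : uhp" for t
  using that mero_fun_const[OF that, of 1] reg_at_const[OF that, of 1]
  by (simp_all add: mero_fun_upsilon mero_fun_g1 mero_fun_g0 generators_eq_klein_quot mero_const_1)
 note fun_values = this mero_fun_g2 reg_at_upsilon reg_at_g1 reg_at_g0 reg_at_g2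
 note arith = mero_fun_add mero_fun_mult mero_fun_diff mero_fun_power
 show "upsilon * g1 ^ 3 + upsilon * g1 ^ 2 - (upsilon ^ 2 - 1) * g1 + (upsilon - 1) ^ 2 = 0"
  by (rule mero_eq_0I) (simp add: fun_values arith root_relations(1))
 show "upsilon * g0 ^ 3 + upsilon * g0 ^ 2 - (upsilon ^ 2 - 1) * g0 + (upsilon - 1) ^ 2 = 0"
  by (rule mero_eq_0I) (simp add: fun_values arith root_relations(2))
 have "upsilon * (g1 * g2 * g0) + (upsilon - 1) ^ 2 = 0"
  by (rule mero_eq_0I) (use root_relations(3) upsilon_nonzero in \<open>simp add: fun_values arith\<close>)
 thus "upsilon * (g1 * g2 * g0) = - ((upsilon - 1) ^ 2)" by (simp add: eq_neg_iff_add_eq_0)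
qed

lemma third_root:
 fixes u a b c :: "'a :: field"
 assumes "u * a ^ 3 + u * a ^ 2 - (u ^ 2 - 1) * a + (u - 1) ^ 2 = 0"
  "u * b ^ 3 + u * b ^ 2 - (u ^ 2 - 1) * b + (u - 1) ^ 2 = 0"
  "u * (a * c * b) = - ((u - 1) ^ 2)" "a ~= b" "u ~= 0" "a ~= 0" "b ~= 0"
 shows "b = - 1 - a - c" "u * (a * c * (1 + a + c)) = (u - 1) ^ 2"
  "u * (a * c - (a + c) - (a + c) ^ 2) = - (u ^ 2 - 1)"
proof -
 have "(a - b) * (u * (a ^ 2 + a * b + b ^ 2) + u * (a + b) - (u ^ 2 - 1)) = 0" using assms(1,2) by algebra
 hence quadratic: "u * (a ^ 2 + a * b + b ^ 2) + u * (a + b) - (u ^ 2 - 1) = 0" using assms(4) by simp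
 have "u * a * b * (- 1 - a - b) = - ((u - 1) ^ 2)" using quadratic assms(1) by algebra
 hence "u * a * b * (c - (- 1 - a - b)) = 0" using assms(3) by algebra
 hence c: "c = - 1 - a - b" using assms(5-7) by simp
 show "b = - 1 - a - c" unfolding c by simp
 show "u * (a * c * (1 + a + c)) = (u - 1) ^ 2" using assms(3) unfolding c by algebra
 show "u * (a * c - (a + c) - (a + c) ^ 2) = - (u ^ 2 - 1)" using quadratic unfolding c by algebra
qed

lemma g0_eq: "g0 = - 1 - g1 - g2"
 and roots_product: "upsilon * (g1 * g2 * (1 + g1 + g2)) = (upsilon - 1) ^ 2"
 and roots_second_symmetric: "upsilon * (g1 * g2 - (g1 + g2) - (g1 + g2) ^ 2) = - (upsilon ^ 2 - 1)"
 using third_root[OF mero_root_relations g1_neq_g0 upsilon_neq_0 g1_neq_0 g0_neq_0] by blast+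

lemma upsilon_eq: "upsilon = (g1 * g2 * (1 + g1 + g2) + 2 + (g1 + g2) + (g1 + g2) ^ 2 - g1 * g2) / 2"
proof -
 have two_nz: "(2 :: mero) ~= 0" using mero_const_eq_0_iff[of 2] by (simp add: mero_const_numeral)
 have "upsilon * (2 * upsilon) = upsilon * (g1 * g2 * (1 + g1 + g2) + 2 + (g1 + g2) + (g1 + g2) ^ 2 - g1 * g2)"
  using roots_product roots_second_symmetric by algebra
 hence "2 * upsilon = g1 * g2 * (1 + g1 + g2) + 2 + (g1 + g2) + (g1 + g2) ^ 2 - g1 * g2" using upsilon_neq_0 mult_left_cancel by blast
 thus ?thesis using two_nz by (simp add: eq_divide_eq mult.commute)
qed

lemma plane_equation:
 "(g1 + g2) * (g1 + g2 + 2) * g1\<^sup>2 * g2\<^sup>2 + 2 * (g1 + g2 + 1) * (g1 + g2 + 2) * g1 * g2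
  - (g1 + g2)\<^sup>2 * (g1 + g2 + 1)\<^sup>2 = 0"
proof -
 have "upsilon ^ 2 * ((g1 + g2) * (g1 + g2 + 2) * g1\<^sup>2 * g2\<^sup>2 + 2 * (g1 + g2 + 1) * (g1 + g2 + 2) * g1 * g2
  - (g1 + g2)\<^sup>2 * (g1 + g2 + 1)\<^sup>2) = 0" using roots_product roots_second_symmetric by algebra
 thus ?thesis using upsilon_neq_0 by simp
qed

lemma upsilon_in_adjoin_g: "upsilon : C_adjoin {g1, g2}" and g0_in_adjoin_g: "g0 : C_adjoin {g1, g2}"
proof -
 have gens: "g1 : C_adjoin {g1, g2}" "g2 : C_adjoin {g1, g2}" using C_adjoin_subset[of "{g1, g2}"] by auto
 show "upsilon : C_adjoin {g1, g2}" by (subst upsilon_eq) (intro C_subfield_closed[OF C_subfield_hull] gens)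
 show "g0 : C_adjoin {g1, g2}" by (subst g0_eq) (intro C_subfield_closed[OF C_subfield_hull] gens)
qed

theorem adjoin_upsilon_g_eq: "C_adjoin {upsilon, g1, g2} = C_adjoin {g1, g2}"
proof
 show "C_adjoin {upsilon, g1, g2} <= C_adjoin {g1, g2}"
  by (rule C_adjoin_minimal[OF _ C_subfield_hull]) (use upsilon_in_adjoin_g C_adjoin_subset[of "{g1, g2}"] in auto)
 show "C_adjoin {g1, g2} <= C_adjoin {upsilon, g1, g2}"
  by (rule C_adjoin_minimal[OF _ C_subfield_hull]) (use C_adjoin_subset[of "{upsilon, g1, g2}"] in auto)
qed

theorem A0_Gamma_2_7: "A0 Gamma_2_7 = C_adjoin {upsilon, g1, g2}"
proof
 have "C_adjoin {upsilon, g1, g0} <= C_adjoin {g1, g2}"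
  by (rule C_adjoin_minimal[OF _ C_subfield_hull]) (use upsilon_in_adjoin_g g0_in_adjoin_g C_adjoin_subset[of "{g1, g2}"] in auto)
 thus "A0 Gamma_2_7 <= C_adjoin {upsilon, g1, g2}" using A0_Gamma_2_7_subset by (simp add: adjoin_upsilon_g_eq)
 have "g2 = - 1 - g1 - g0" by (simp add: g0_eq)
 also have "... : A0 Gamma_2_7" by (intro C_subfield_closed[OF A0_subfield[OF Gamma_2_7_subset]] g1_in_A0 g0_in_A0)
 finally show "C_adjoin {upsilon, g1, g2} <= A0 Gamma_2_7" unfolding adjoin_upsilon_g_eq
  by (intro C_adjoin_minimal A0_subfield Gamma_2_7_subset) (use g1_in_A0 in auto)
qed

section \<open>Places of function fields\<close>

subsection \<open>Evaluation of polynomials\<close>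

definition eval1 :: "complex poly => mero => mero" where
 "eval1 p t = poly (map_poly mero_const p) t"

lemma eval1_pCons [simp]: "eval1 (pCons a p) t = mero_const a + t * eval1 p t" by (simp add: eval1_def map_poly_pCons mero_const_0)

lemma eval1_0 [simp]: "eval1 0 t = 0" by (simp add: eval1_def)

lemma eval1_1 [simp]: "eval1 1 t = 1" by (simp add: one_pCons mero_const_1)

lemma eval1_add: "eval1 (p + q) t = eval1 p t + eval1 q t"
proof -
 have "map_poly mero_const (p + q) = map_poly mero_const p + map_poly mero_const q"
  by (rule poly_eqI) (simp add: coeff_map_poly mero_const_0 mero_const_add)
 thus ?thesis by (simp add: eval1_def)
qed

lemma eval1_smult: "eval1 (smult a p) t = mero_const a * eval1 p t" by (induction p) (simp_all add: mero_const_mult algebra_simps)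

lemma eval1_mult: "eval1 (p * q) t = eval1 p t * eval1 q t"
 by (induction p) (simp_all add: eval1_add eval1_smult mero_const_0 algebra_simps)

lemma eval1_minus: "eval1 (- p) t = - eval1 p t" by (induction p) (simp_all add: mero_const_minus)

lemma eval1_diff: "eval1 (p - q) t = eval1 p t - eval1 q t" using eval1_add[of p "- q" t] by (simp add: eval1_minus)

lemma eval1_power: "eval1 (p ^ k) t = eval1 p t ^ k" by (induction k) (simp_all add: eval1_mult)

lemma eval1_sum: "eval1 (SUM i:I. p i) t = (SUM i:I. eval1 (p i) t)" by (induction I rule: infinite_finite_induct) (simp_all add: eval1_add)

lemma eval1_monom: "eval1 (monom a k) t = mero_const a * t ^ k"
 by (induction k) (simp_all add: monom_0 monom_Suc mero_const_0 algebra_simps)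

lemma eval1_numeral: "eval1 (numeral k) t = numeral k" by (simp add: numeral_poly mero_const_numeral)

lemma eval1_pcompose: "eval1 (pcompose p q) t = eval1 p (eval1 q t)" by (induction p) (simp_all add: pcompose_pCons eval1_add eval1_mult)

lemma eval1_altdef:
 assumes "degree p <= N"
 shows "eval1 p t = (SUM i<=N. mero_const (coeff p i) * t ^ i)"
proof -
 have "p = (SUM i<=N. monom (coeff p i) i)" using assms by (intro poly_eqI) (auto simp: coeff_sum coeff_eq_0)
 hence "eval1 p t = eval1 (SUM i<=N. monom (coeff p i) i) t" by simp
 thus ?thesis by (simp add: eval1_sum eval1_monom)
qed

lemmas eval1_simps = eval1_add eval1_mult eval1_minus eval1_diff eval1_power eval1_smult eval1_numeral

lemma eval1_linear_mult: "eval1 ([:- c, 1:] * q) t = (t - mero_const c) * eval1 q t"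
 by (simp only: eval1_mult) (simp add: mero_const_minus mero_const_1)

lemma complex_poly_induct [case_names const root]:
 fixes p :: "complex poly"
 assumes const: "!!a. P [:a:]" and root: "!!c q. q ~= 0 ==> P q ==> P ([:- c, 1:] * q)"
 shows "P p"
proof (induction "degree p" arbitrary: p rule: less_induct)
 case less
 show ?case proof (cases "degree p = 0")
  case True
  thus ?thesis using const by (metis degree_eq_zeroE)
 next
  case False
  then obtain c where "poly p c = 0" using fundamental_theorem_of_algebra[of p] by (auto simp: constant_degree)
  then obtain q where q: "p = [:- c, 1:] * q" by (auto simp: poly_eq_0_iff_dvd dvd_def)
  hence "q ~= 0" using False by auto
  moreover from this have "degree q < degree p" unfolding q by (subst degree_mult_eq) auto
  ultimately show ?thesis using root less unfolding q by blast
 qed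
qed

lemma eval1_eq_0:
 assumes t: "t ~: range mero_const" and "eval1 p t = 0"
 shows "p = 0" using assms(2)
proof (induction p rule: complex_poly_induct)
 case (const a)
 thus ?case by (simp add: mero_const_eq_0_iff)
next
 case (root c q)
 moreover have "t - mero_const c ~= 0" using t by auto
 ultimately show ?case unfolding eval1_linear_mult by simp
qed

subsection \<open>Valuation rings\<close>

definition max_ideal :: "mero set => mero set" where
 "max_ideal R = R - place_units R"

locale valuation_ring =
 fixes F R :: "mero set"
 assumes F: "C_subfield F" and R: "R : places F"
begin

abbreviation "\<mm> == max_ideal R"

lemma const_mem: "mero_const c : R" and mem_F: "a : R ==> a : F" using R by (auto simp: places_def)

lemma add_mem: "a : R ==> b : R ==> a + b : R" and diff_mem: "a : R ==> b : R ==> a - b : R" and mult_mem: "a : R ==> b : R ==> a * b : R"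
 using R by (auto simp: places_def)

lemma zero_mem: "0 : R" and one_mem: "1 : R" using const_mem[of 0] const_mem[of 1] by (auto simp: mero_const_0 mero_const_1)

lemma minus_mem: "a : R ==> - a : R" using diff_mem[of 0 a] zero_mem by simp

lemma power_mem: "a : R ==> a ^ k : R" by (induction k) (auto intro: mult_mem one_mem)

lemma sum_mem: "(!!i. i : I ==> f i : R) ==> (SUM i:I. f i) : R"
 by (induction I rule: infinite_finite_induct) (auto intro: add_mem zero_mem)

lemma prod_mem: "(!!i. i : I ==> f i : R) ==> (PROD i:I. f i) : R"
 by (induction I rule: infinite_finite_induct) (auto intro: mult_mem one_mem)

lemma eval1_mem: "a : R ==> eval1 p a : R" by (induction p) (auto intro: add_mem mult_mem zero_mem const_mem)

lemma maximal_iff: "a : \<mm> \<longleftrightarrow> a : R & (a = 0 | inverse a ~: R)" by (auto simp: max_ideal_def place_units_def)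

lemma maximal_mem: "a : \<mm> ==> a : R" by (simp add: maximal_iff)

lemma inverse_maximal: "a : F ==> a ~: R ==> inverse a : \<mm>" using R zero_mem by (auto simp: places_def maximal_iff)

lemma maximal_mult_left:
 assumes "a : \<mm>" "b : R"
 shows "a * b : \<mm>"
proof -
 have "inverse a : R" if "inverse (a * b) : R" "a * b ~= 0" using mult_mem[OF assms(2) that(1)] that(2) by (simp add: field_simps)
 thus ?thesis using assms mult_mem by (auto simp: maximal_iff)
qed

lemma maximal_mult_right: "a : R ==> b : \<mm> ==> a * b : \<mm>" using maximal_mult_left[of b a] by (simp add: mult.commute)

lemma zero_maximal: "0 : \<mm>" by (simp add: maximal_iff zero_mem)

lemma maximal_add:
 assumes a: "a : \<mm>" and b: "b : \<mm>"
 shows "a + b : \<mm>"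
proof (cases "a = 0 | b = 0")
 case False
 have quot: "a / b : F" using assms by (intro C_subfield_divide F mem_F maximal_mem)
 show ?thesis proof (cases "a / b : R")
  case True
  have "b * (1 + a / b) : \<mm>" by (intro maximal_mult_left add_mem one_mem b True)
  thus ?thesis using False by (simp add: field_simps)
 next
  case notin: False
  have "a * (1 + inverse (a / b)) : \<mm>" by (intro maximal_mult_left add_mem one_mem a maximal_mem inverse_maximal quot notin)
  thus ?thesis using False by (simp add: field_simps)
 qed
qed (use assms in auto)

lemma maximal_minus: "a : \<mm> ==> - a : \<mm>" using maximal_mult_left[of a "- 1"] one_mem minus_mem by auto

lemma maximal_diff: "a : \<mm> ==> b : \<mm> ==> a - b : \<mm>" using maximal_add[of a "- b"] maximal_minus by simp

lemma maximal_sum: "(!!i. i : I ==> f i : \<mm>) ==> (SUM i:I. f i) : \<mm>"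
 by (induction I rule: infinite_finite_induct) (simp_all add: zero_maximal maximal_add)

lemma const_not_maximal: "c ~= 0 ==> mero_const c ~: \<mm>"
 using const_mem[of "inverse c"] by (simp add: maximal_iff mero_const_eq_0_iff mero_const_inverse)

lemma one_not_maximal: "1 ~: \<mm>" using const_not_maximal[of 1] by (simp add: mero_const_1)

lemma add_not_maximal: "u ~: \<mm> ==> a : \<mm> ==> u + a ~: \<mm>" using maximal_diff[of "u + a" a] by auto

lemma maximal_prime:
 assumes "a * b : \<mm>" "a : R" "b : R"
 shows "a : \<mm> | b : \<mm>"
proof (rule ccontr)
 assume "~ ?thesis"
 hence inv: "a ~= 0" "b ~= 0" "inverse a : R" "inverse b : R" using assms by (auto simp: maximal_iff)
 have "a * b * (inverse a * inverse b) : \<mm>" by (intro maximal_mult_left mult_mem assms inv)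
 thus False using inv one_not_maximal by (simp add: field_simps)
qed

lemma power_maximal: "a : \<mm> ==> k > 0 ==> a ^ k : \<mm>"
 by (cases k) (auto intro: maximal_mult_left power_mem maximal_mem)

lemma root_closed:
 assumes a: "a : F" "a ^ k : R" "k > 0"
 shows "a : R"
proof (rule ccontr)
 assume "a ~: R"
 hence "a ~= 0" using zero_mem by auto
 have "inverse a ^ k * a ^ k : \<mm>" using inverse_maximal[OF a(1) \<open>a ~: R\<close>] a by (intro maximal_mult_left power_maximal)
 hence "1 : \<mm>" using \<open>a ~= 0\<close> by (simp flip: power_mult_distrib)
 thus False using one_not_maximal by simp
qed

lemma maximal_poly_root:
 assumes a: "a : R" and "p ~= 0" "eval1 p a : \<mm>"
 shows "EX c. poly p c = 0 & a - mero_const c : \<mm>" using assms(2,3)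
proof (induction p rule: complex_poly_induct)
 case (const k)
 thus ?case using const_not_maximal[of k] by auto
next
 case (root c q)
 have "(a - mero_const c) * eval1 q a : \<mm>" using root.prems(2) unfolding eval1_linear_mult .
 hence "a - mero_const c : \<mm> | eval1 q a : \<mm>" by (intro maximal_prime diff_mem eval1_mem a const_mem)
 thus ?case using root.IH[OF root.hyps] by (auto intro: exI[of _ c])
qed

end

subsection \<open>Existence of places\<close>

definition C_subalgebra :: "mero set => bool" where
 "C_subalgebra S \<longleftrightarrow> range mero_const <= S & (ALL a:S. ALL b:S. a + b : S & a - b : S & a * b : S)"

lemma
 assumes S: "C_subalgebra S"
 shows subalgebra_const: "mero_const c : S" and subalgebra_add: "a : S ==> b : S ==> a + b : S"
  and subalgebra_diff: "a : S ==> b : S ==> a - b : S" and subalgebra_mult: "a : S ==> b : S ==> a * b : S"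
  and subalgebra_0: "0 : S" and subalgebra_1: "1 : S" and subalgebra_power: "a : S ==> a ^ k : S"
proof -
 show const: "mero_const c : S" for c using S by (auto simp: C_subalgebra_def)
 show "a : S ==> b : S ==> a + b : S" "a : S ==> b : S ==> a - b : S" using S by (auto simp: C_subalgebra_def)
 show mult: "a : S ==> b : S ==> a * b : S" for a b using S by (auto simp: C_subalgebra_def)
 show "0 : S" and one: "1 : S" using const[of 0] const[of 1] by (auto simp: mero_const_0 mero_const_1)
 show "a : S ==> a ^ k : S" by (induction k) (auto intro: one mult)
qed

lemma subalgebra_sum: "C_subalgebra S ==> (!!i. i : I ==> f i : S) ==> (SUM i:I. f i) : S"
 by (induction I rule: infinite_finite_induct) (auto intro: subalgebra_add subalgebra_0)

definition poly_over :: "mero set => mero poly => bool" where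
 "poly_over M p \<longleftrightarrow> (ALL i. coeff p i : M)"

lemma
 assumes M: "C_subalgebra M"
 shows poly_over_add: "poly_over M p ==> poly_over M q ==> poly_over M (p + q)"
  and poly_over_diff: "poly_over M p ==> poly_over M q ==> poly_over M (p - q)"
  and poly_over_mult: "poly_over M p ==> poly_over M q ==> poly_over M (p * q)"
  and poly_over_const: "a : M ==> poly_over M [:a:]" and poly_over_X: "poly_over M [:0, 1:]"
  and poly_over_monom: "a : M ==> poly_over M (monom a k)" and poly_over_smult: "a : M ==> poly_over M p ==> poly_over M (smult a p)"
 by (auto simp: poly_over_def coeff_mult coeff_pCons split: nat.split
  intro!: subalgebra_sum[OF M] subalgebra_add[OF M] subalgebra_diff[OF M] subalgebra_mult[OF M] subalgebra_0[OF M] subalgebra_1[OF M])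

lemma poly_over_sum: "C_subalgebra M ==> (!!i. i : I ==> poly_over M (f i)) ==> poly_over M (SUM i:I. f i)"
 by (auto simp: poly_over_def coeff_sum intro!: subalgebra_sum)

definition adjoin_element :: "mero set => mero => mero set" where
 "adjoin_element M e = {poly p e | p. poly_over M p}"

lemma
 assumes M: "C_subalgebra M"
 shows adjoin_element_subalgebra: "C_subalgebra (adjoin_element M e)" and subset_adjoin_element: "M <= adjoin_element M e"
  and adjoin_element_mem: "e : adjoin_element M e"
proof -
 show subset: "M <= adjoin_element M e" proof
  fix a assume "a : M"
  thus "a : adjoin_element M e" unfolding adjoin_element_def using poly_over_const[OF M, of a] by (intro CollectI exI[of _ "[:a:]"]) simp
 qed
 show "e : adjoin_element M e" unfolding adjoin_element_def using poly_over_X[OF M] by (intro CollectI exI[of _ "[:0, 1:]"]) simp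
 have "a + b : adjoin_element M e & a - b : adjoin_element M e & a * b : adjoin_element M e"
  if ab: "a : adjoin_element M e" "b : adjoin_element M e" for a b proof -
  obtain p q where pq: "poly_over M p" "a = poly p e" "poly_over M q" "b = poly q e" using ab unfolding adjoin_element_def by blast
  hence "a + b = poly (p + q) e" "a - b = poly (p - q) e" "a * b = poly (p * q) e" by simp_all
  thus ?thesis using poly_over_add[OF M pq(1,3)] poly_over_diff[OF M pq(1,3)] poly_over_mult[OF M pq(1,3)]
   unfolding adjoin_element_def by blast
 qed
 moreover have "range mero_const <= adjoin_element M e" using subset subalgebra_const[OF M] by blast
 ultimately show "C_subalgebra (adjoin_element M e)" by (simp add: C_subalgebra_def)
qed

lemma adjoin_element_subset_field:
 assumes "C_subfield F" "M <= F" "e : F"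
 shows "adjoin_element M e <= F"
proof
 fix a assume "a : adjoin_element M e"
 then obtain p where p: "poly_over M p" "a = poly p e" unfolding adjoin_element_def by blast
 hence "(SUM i<=degree p. coeff p i * e ^ i) : F" using assms
  by (intro C_subfield_sum C_subfield_mult C_subfield_power) (auto simp: poly_over_def)
 thus "a : F" using p by (simp add: poly_altdef)
qed

lemma subalgebra_Union_chain:
 assumes "C ~= {}" "!!S. S : C ==> C_subalgebra S" "!!S T. S : C ==> T : C ==> S <= T | T <= S"
 shows "C_subalgebra (\<Union>C)"
proof -
 have common: "EX S:C. a : S & b : S" if "a : \<Union>C" "b : \<Union>C" for a b using that assms(3) by blast
 have "a + b : \<Union>C & a - b : \<Union>C & a * b : \<Union>C" if "a : \<Union>C" "b : \<Union>C" for a b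
  using common[OF that] assms(2) by (meson UnionI subalgebra_add subalgebra_diff subalgebra_mult)
 moreover have "range mero_const <= \<Union>C" using assms(1,2) unfolding C_subalgebra_def by blast
 ultimately show ?thesis by (simp add: C_subalgebra_def)
qed

locale maximal_avoiding_inverse =
 fixes F M :: "mero set" and t :: mero
 assumes F: "C_subfield F" and M: "C_subalgebra M" "M <= F" and t: "t : M" "inverse t ~: M"
  and maximal: "!!N. C_subalgebra N ==> N <= F ==> inverse t ~: N ==> M <= N ==> N = M"
begin

lemma t_nonzero: "t ~= 0" using t by (cases "t = 0") simp_all

text \<open>Polynomials over \<open>M\<close> that witness \<open>1/t \<in> M[e]\<close>.\<close>
definition relation :: "mero => mero poly => bool" where
 "relation e p \<longleftrightarrow> poly_over M p & poly p e = inverse t"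

lemma relation_exists:
 assumes "e : F" "e ~: M"
 shows "EX p. relation e p"
proof -
 have "inverse t : adjoin_element M e"
  using maximal[OF adjoin_element_subalgebra[OF M(1)] adjoin_element_subset_field[OF F M(2) assms(1)]] subset_adjoin_element[OF M(1)]
   adjoin_element_mem[OF M(1)] assms(2) by blast
 thus ?thesis unfolding adjoin_element_def relation_def by force
qed

lemma one_minus_power:
 assumes a: "a : M"
 shows "EX b:M. (1 - t * a) ^ k = 1 - t * b"
proof (induction k)
 case 0
 show ?case using subalgebra_0[OF M(1)] by force
next
 case (Suc k)
 then obtain b where b: "b : M" "(1 - t * a) ^ k = 1 - t * b" by blast
 have "(1 - t * a) ^ Suc k = 1 - t * (a + b - t * a * b)" unfolding power_Suc b(2) by (simp add: algebra_simps)
 moreover have "a + b - t * a * b : M" using a b(1) t(1) by (intro subalgebra_add subalgebra_diff subalgebra_mult M)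
 ultimately show ?case by blast
qed

lemma one_minus_unit:
 assumes a: "a : M"
 shows "1 - t * a ~= 0" "inverse (1 - t * a) : M"
proof -
 show nz: "1 - t * a ~= 0" proof
  assume "1 - t * a = 0"
  hence "inverse t = a" using t_nonzero by (simp add: field_simps)
  thus False using a t by simp
 qed
 define y where "y = 1 - t * a"
 have y: "y : M" "y ~= 0" using nz a t(1) by (auto simp: y_def intro!: subalgebra_diff subalgebra_mult subalgebra_1 M)
 show "inverse (1 - t * a) : M" proof (rule ccontr)
  assume "inverse (1 - t * a) ~: M"
  moreover have "inverse y : F" using y(1) M(2) by (intro C_subfield_inverse F) auto
  ultimately obtain p where p: "poly_over M p" "poly p (inverse y) = inverse t" using relation_exists[of "inverse y"]
   by (auto simp: y_def relation_def)
  have "inverse t * y ^ degree p = (SUM i<=degree p. coeff p i * y ^ (degree p - i))"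
   unfolding p(2)[symmetric] poly_altdef sum_distrib_right using y(2)
   by (intro sum.cong) (auto simp: power_diff field_simps power_inverse)
  also have "... : M" using p(1) y(1) by (intro subalgebra_sum subalgebra_mult subalgebra_power M) (auto simp: poly_over_def)
  finally have "inverse t * y ^ degree p : M" .
  moreover obtain b where b: "b : M" "y ^ degree p = 1 - t * b" using one_minus_power[OF a] unfolding y_def by blast
  moreover have "inverse t = inverse t * y ^ degree p + b" unfolding b(2) using t_nonzero by (simp add: field_simps)
  ultimately show False using subalgebra_add[OF M(1)] t(2) by metis
 qed
qed

lemma relation_degree_pos:
 assumes "relation e p"
 shows "degree p > 0"
proof (rule ccontr)
 assume "~ degree p > 0"
 then obtain a where "p = [:a:]" by (metis degree_eq_zeroE not_gr_zero)
 hence "inverse t = coeff p 0" using assms by (simp add: relation_def)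
 thus False using assms t(2) by (metis relation_def poly_over_def)
qed

text \<open>A relation for \<open>1/e\<close> of degree at most \<open>k\<close> expresses \<open>e^k\<close> by lower powers.\<close>
lemma power_from_inverse_relation:
 assumes e: "e ~= 0" and q: "relation (inverse e) q" "degree q <= k"
 obtains s where "poly_over M s" "!!i. i >= k ==> coeff s i = 0" "e ^ k = t * poly s e"
proof -
 define u where "u = 1 - t * coeff q 0"
 have qM: "coeff q i : M" for i using q(1) by (simp add: relation_def poly_over_def)
 have u: "u ~= 0" "inverse u : M" using one_minus_unit[OF qM] by (simp_all add: u_def)
 define s where "s = (SUM i:{1..degree q}. monom (inverse u * coeff q i) (k - i))"
 have "poly_over M s" unfolding s_def by (intro poly_over_sum poly_over_monom subalgebra_mult M u qM)
 moreover have "coeff s i = 0" if "i >= k" for i unfolding s_def coeff_sum using that relation_degree_pos[OF q(1)] q(2)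
  by (intro sum.neutral) auto
 moreover have "e ^ k = t * poly s e" proof -
  define tail where "tail = (SUM i:{1..degree q}. coeff q i * inverse e ^ i)"
  have "inverse t = poly q (inverse e)" using q(1) by (simp add: relation_def)
  also have "... = coeff q 0 + tail" unfolding poly_altdef tail_def by (simp add: atMost_atLeast0 sum.atLeast_Suc_atMost)
  finally have "u = t * tail" using t_nonzero unfolding u_def by (simp add: field_simps)
  moreover have "poly s e = inverse u * tail * e ^ k"
   unfolding s_def tail_def poly_sum sum_distrib_left sum_distrib_right poly_monom
   using e q(2) by (intro sum.cong) (auto simp: power_diff field_simps power_inverse)
  ultimately have "t * poly s e = inverse u * u * e ^ k" by (simp only: mult_ac)
  thus ?thesis using u by simp
 qed
 ultimately show ?thesis by (rule that)
qed

lemma relation_degree_less: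
 assumes e: "e ~= 0" and p: "relation e p" and q: "relation (inverse e) q" and minimal: "!!p'. relation e p' ==> degree p <= degree p'"
 shows "degree p < degree q"
proof (rule ccontr)
 define k where "k = degree p"
 assume "~ degree p < degree q"
 hence "degree q <= k" by (simp add: k_def)
 then obtain s where s: "poly_over M s" "!!i. i >= k ==> coeff s i = 0" "e ^ k = t * poly s e"
  using power_from_inverse_relation[OF e q] by blast
 define p' where "p' = p - monom (coeff p k) k + smult (coeff p k * t) s"
 have pM: "poly_over M p" "coeff p k : M" using p by (simp_all add: relation_def poly_over_def)
 have "poly_over M p'" unfolding p'_def by (intro poly_over_add poly_over_diff poly_over_monom poly_over_smult subalgebra_mult M pM s t)
 moreover have "poly p' e = inverse t" using s(3) p by (simp add: p'_def relation_def poly_monom algebra_simps)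
 ultimately have "k <= degree p'" using minimal by (simp add: relation_def k_def)
 moreover have "coeff p' i = 0" if "i >= k" for i using that s(2) by (cases "i = k") (auto simp: p'_def k_def intro: coeff_eq_0)
 hence "degree p' <= k - 1" using relation_degree_pos[OF p] by (intro degree_le) (auto simp: k_def)
 ultimately show False using relation_degree_pos[OF p] by (simp add: k_def)
qed

lemma mem_or_inverse_mem:
 assumes e: "e : F"
 shows "e : M | inverse e : M"
proof (rule ccontr)
 assume no: "~ ?thesis"
 hence e0: "e ~= 0" using subalgebra_0[OF M(1)] by auto
 have "EX p. relation e p" "EX q. relation (inverse e) q" using relation_exists no e C_subfield_inverse[OF F] by auto
 then obtain p q where p: "relation e p" "!!p'. relation e p' ==> degree p <= degree p'"
  and q: "relation (inverse e) q" "!!q'. relation (inverse e) q' ==> degree q <= degree q'"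
  using ex_has_least_nat[of "relation e" _ degree] ex_has_least_nat[of "relation (inverse e)" _ degree] by metis
 have "degree p < degree q" by (rule relation_degree_less[OF e0 p(1) q(1) p(2)])
 moreover have "degree q < degree p" by (rule relation_degree_less[of "inverse e"]) (use e0 p q in auto)
 ultimately show False by simp
qed

lemma place: "M : places F" "t : max_ideal M"
proof -
 have "t ~: range mero_const" using t subalgebra_const[OF M(1)] by (auto simp: mero_const_inverse[symmetric])
 moreover have "inverse t : F" using t M(2) by (intro C_subfield_inverse F) auto
 ultimately show "M : places F" using M t mem_or_inverse_mem by (auto simp: places_def C_subalgebra_def)
 show "t : max_ideal M" using t by (auto simp: max_ideal_def place_units_def)
qed

end

lemma exists_place:
 assumes F: "C_subfield F" and S: "C_subalgebra S" "S <= F" and t: "t : S" "inverse t ~: S"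
 obtains R where "R : places F" "S <= R" "t : max_ideal R"
proof -
 define \<A> where "\<A> = {M. C_subalgebra M & S <= M & M <= F & inverse t ~: M}"
 have "EX M:\<A>. ALL X:\<A>. M <= X --> X = M" proof (rule subset_Zorn_nonempty)
  have "S : \<A>" using S t by (simp add: \<A>_def)
  thus "\<A> ~= {}" by blast
  fix C assume C: "C ~= {}" "subset.chain \<A> C"
  have in_A: "X : \<A>" if "X : C" for X using C(2) that by (auto simp: subset.chain_def)
  have "C_subalgebra (\<Union>C)" by (rule subalgebra_Union_chain) (use C in \<open>auto simp: subset.chain_def \<A>_def\<close>)
  moreover have "S <= X" "X <= F" "inverse t ~: X" if "X : C" for X using in_A[OF that] by (simp_all add: \<A>_def)
  hence "S <= \<Union>C" "\<Union>C <= F" "inverse t ~: \<Union>C" using C(1) by blast+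
  ultimately show "\<Union>C : \<A>" by (simp add: \<A>_def)
 qed
 then obtain M where M: "M : \<A>" and max: "!!X. X : \<A> ==> M <= X ==> X = M" by blast
 have S_M: "S <= M" using M by (simp add: \<A>_def)
 have "N = M" if "C_subalgebra N" "N <= F" "inverse t ~: N" "M <= N" for N using max[of N] M that unfolding \<A>_def by blast
 then interpret maximal_avoiding_inverse F M t by unfold_locales (use F M t(1) in \<open>auto simp: \<A>_def\<close>)
 show ?thesis by (rule that[OF place(1) S_M place(2)])
qed

lemma inverse_not_polynomial:
 assumes "t ~: range mero_const"
 shows "inverse t ~: range (%p. eval1 p t)"
proof
 assume "inverse t : range (%p. eval1 p t)"
 then obtain p where p: "inverse t = eval1 p t" by blast
 have "t ~= 0" using assms mero_const_0 by (metis rangeI)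
 hence "eval1 (pCons (- 1) p) t = 0" by (simp add: p[symmetric] mero_const_minus mero_const_1)
 hence "pCons (- 1) p = 0" by (rule eval1_eq_0[OF assms])
 thus False by simp
qed

lemma place_over:
 assumes F: "C_subfield F" and t: "t : F" "t ~: range mero_const"
 obtains R where "R : places F" "t : max_ideal R"
proof -
 define S where "S = range (%p. eval1 p t)"
 have "mero_const c : S" for c unfolding S_def by (rule range_eqI[of _ _ "[:c:]"]) simp
 moreover have "a + b : S & a - b : S & a * b : S" if ab: "a : S" "b : S" for a b proof -
  obtain p q where "a = eval1 p t" "b = eval1 q t" using ab unfolding S_def by blast
  hence "a + b = eval1 (p + q) t" "a - b = eval1 (p - q) t" "a * b = eval1 (p * q) t" by (simp_all add: eval1_simps)
  thus ?thesis unfolding S_def by blast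
 qed
 ultimately have "C_subalgebra S" by (auto simp: C_subalgebra_def)
 moreover have "eval1 p t : F" for p by (induction p) (auto intro!: C_subfield_closed[OF F] t)
 hence "S <= F" unfolding S_def by blast
 moreover have "t : S" unfolding S_def by (rule range_eqI[of _ _ "[:0, 1:]"]) (simp add: mero_const_0 mero_const_1)
 moreover have "inverse t ~: S" unfolding S_def by (rule inverse_not_polynomial[OF t(2)])
 ultimately obtain R where "R : places F" "t : max_ideal R" using exists_place[OF F] by metis
 thus ?thesis by (rule that)
qed

section \<open>Function fields of degree at most \<open>n\<close> over \<open>\<complex>(x)\<close>\<close>

definition unif :: "mero set => mero" where
 "unif R = (SOME t. uniformizer R t)"

locale curve =
 fixes F :: "mero set" and x :: mero and n :: nat
 assumes F: "C_subfield F" and x: "x : F" and trans: "x ~: range mero_const"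
  and dep: "!!f. (!!i. i <= n ==> f i : F) ==> EX q. (EX i<=n. q i ~= 0) & (SUM i<=n. eval1 (q i) x * f i) = 0"
begin

subsection \<open>Linear dependence over polynomials in a parameter\<close>

text \<open>Local parameters at the points of the projective line.\<close>
definition params :: "mero set" where
 "params = insert (inverse x) (range (%c. x - mero_const c))"

lemma x_nonzero: "x ~= 0" using trans mero_const_0 by (metis rangeI)

lemma params_nonzero: "t : params ==> t ~= 0" using trans x_nonzero by (auto simp: params_def)

lemma params_mem_F: "t : params ==> t : F" by (auto simp: params_def intro!: C_subfield_closed[OF F] x)

lemma dependence_over_polynomials:
 fixes f :: "'b => mero"
 assumes I: "finite I" "card I > n" and f: "!!i. i : I ==> f i : F"
 shows "EX q. (EX i:I. q i ~= 0) & (SUM i:I. eval1 (q i) x * f i) = 0"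
proof -
 obtain J where J: "J <= I" "card J = Suc n" using I obtain_subset_with_card_n[of "Suc n" I] by (metis Suc_leI)
 have "finite J" using J I finite_subset by blast
 then obtain h where "bij_betw h {0..<card J} J" using ex_bij_betw_nat_finite by blast
 hence h: "bij_betw h {..n} J" using J by (simp add: atLeast0LessThan lessThan_Suc_atMost)
 hence h_mem: "h i : J" if "i <= n" for i using that by (auto simp: bij_betw_def)
 obtain q where q: "EX i<=n. q i ~= 0" "(SUM i<=n. eval1 (q i) x * f (h i)) = 0" using dep[of "%i. f (h i)"] h_mem J f by blast
 define Q where "Q i = (if i : J then q (inv_into {..n} h i) else 0)" for i
 have Q_h: "Q (h i) = q i" if "i <= n" for i using that h h_mem by (simp add: Q_def bij_betw_def inv_into_f_f)
 have "(SUM i:I. eval1 (Q i) x * f i) = (SUM i:J. eval1 (Q i) x * f i)"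
  by (rule sum.mono_neutral_right) (use I J in \<open>auto simp: Q_def\<close>)
 also have "... = (SUM i<=n. eval1 (Q (h i)) x * f (h i))" by (rule sum.reindex_bij_betw[OF h, symmetric])
 also have "... = 0" using q(2) by (simp add: Q_h)
 finally have "(SUM i:I. eval1 (Q i) x * f i) = 0" .
 moreover have "EX i:I. Q i ~= 0" using q(1) Q_h h_mem J(1) by (metis subsetD)
 ultimately show ?thesis by blast
qed

lemma change_of_parameter:
 assumes t: "t : params" and N: "degree q <= N"
 shows "EX p. eval1 p t = t ^ N * eval1 q x"
proof (cases "t = inverse x")
 case False
 then obtain c where c: "t = x - mero_const c" using t by (auto simp: params_def)
 have "eval1 (monom 1 N * pcompose q [:c, 1:]) t = t ^ N * eval1 q x" by (simp add: eval1_mult eval1_monom eval1_pcompose c mero_const_1)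
 thus ?thesis by blast
next
 case True
 have "t ^ N * eval1 q x = (SUM j<=N. mero_const (coeff q j) * (x ^ j * t ^ N))"
  by (simp add: eval1_altdef[OF N] sum_distrib_left mult_ac)
 also have "... = (SUM j<=N. mero_const (coeff q j) * t ^ (N - j))"
  using x_nonzero by (intro sum.cong) (auto simp: True power_diff field_simps power_inverse)
 also have "... = (SUM j<=N. mero_const (coeff q (N - j)) * t ^ j)"
  by (rule sum.reindex_bij_witness[of _ "%j. N - j" "%j. N - j"]) auto
 also have "... = eval1 (SUM j<=N. monom (coeff q (N - j)) j) t" by (simp add: eval1_sum eval1_monom)
 finally show ?thesis by (auto intro: sym)
qed

lemma common_power_of_X:
 fixes T :: "'b => complex poly"
 assumes "EX i:I. T i ~= 0"
 obtains k S where "!!i. i : I ==> T i = monom 1 k * S i" "EX i:I. coeff (S i) 0 ~= 0"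
proof -
 define k where "k = (LEAST k. EX i:I. coeff (T i) k ~= 0)"
 have "EX k. EX i:I. coeff (T i) k ~= 0" using assms by (metis leading_coeff_0_iff)
 hence k: "EX i:I. coeff (T i) k ~= 0" unfolding k_def by (rule LeastI_ex)
 have less: "coeff (T i) j = 0" if "j < k" "i : I" for i j using not_less_Least[OF that(1)[unfolded k_def]] that(2) by blast
 show ?thesis proof (rule that[of k "%i. poly_shift k (T i)"])
  show "T i = monom 1 k * poly_shift k (T i)" if "i : I" for i
   using less that by (intro poly_eqI) (auto simp: coeff_monom_mult coeff_poly_shift)
  show "EX i:I. coeff (poly_shift k (T i)) 0 ~= 0" using k by (simp add: coeff_poly_shift)
 qed
qed

lemma dependence_in_parameter:
 fixes f :: "'b => mero"
 assumes t: "t : params" and I: "finite I" "card I > n" and f: "!!i. i : I ==> f i : F"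
 obtains \<rho> s where "EX i:I. \<rho> i ~= 0" "(SUM i:I. (mero_const (\<rho> i) + t * eval1 (s i) t) * f i) = 0"
proof -
 obtain q where q: "EX i:I. q i ~= 0" "(SUM i:I. eval1 (q i) x * f i) = 0"
  using dependence_over_polynomials[of I f] I f by blast
 define N where "N = (SUM i:I. degree (q i))"
 have "degree (q i) <= N" if "i : I" for i unfolding N_def using that I(1) by (intro member_le_sum) auto
 hence "ALL i. EX p. i : I --> eval1 p t = t ^ N * eval1 (q i) x" using change_of_parameter[OF t] by auto
 from choice[OF this] obtain T where T: "!!i. i : I ==> eval1 (T i) t = t ^ N * eval1 (q i) x" by blast
 have "T i ~= 0" if "q i ~= 0" "i : I" for i proof
  assume "T i = 0"
  hence "eval1 (q i) x = 0" using T[OF that(2)] params_nonzero[OF t] by simp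
  thus False using eval1_eq_0[OF trans] that(1) by blast
 qed
 hence "EX i:I. T i ~= 0" using q(1) by blast
 then obtain k S where S: "!!i. i : I ==> T i = monom 1 k * S i" "EX i:I. coeff (S i) 0 ~= 0"
  using common_power_of_X[of I T] by blast
 have S_eq: "S i = pCons (coeff (S i) 0) (poly_shift 1 (S i))" for i
  by (intro poly_eqI) (auto simp: coeff_pCons coeff_poly_shift split: nat.split)
 have "t ^ k * (SUM i:I. eval1 (S i) t * f i) = (SUM i:I. eval1 (T i) t * f i)"
  unfolding sum_distrib_left by (intro sum.cong) (auto simp: S(1) eval1_mult eval1_monom mero_const_1)
 also have "... = t ^ N * (SUM i:I. eval1 (q i) x * f i)" unfolding sum_distrib_left by (intro sum.cong) (auto simp: T)
 finally have "(SUM i:I. eval1 (S i) t * f i) = 0" using q(2) params_nonzero[OF t] by simp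
 moreover have "eval1 (S i) t = mero_const (coeff (S i) 0) + t * eval1 (poly_shift 1 (S i)) t" for i
  using arg_cong[OF S_eq, of "%p. eval1 p t" i] by (simp only: eval1_pCons)
 ultimately have "(SUM i:I. (mero_const (coeff (S i) 0) + t * eval1 (poly_shift 1 (S i)) t) * f i) = 0" by simp
 thus ?thesis by (rule that[OF S(2)])
qed

end

subsection \<open>Places are discrete valuations\<close>

locale curve_place = curve F x n + valuation_ring F R for F x n R
begin

lemma card_atMost_gt: "n < card {..n}" by simp

text \<open>The leading coefficient of a relation for \<open>f\<close> over \<open>\<complex>[x]\<close> lies in the ideal if \<open>1/f\<close> does.\<close>
lemma leading_coefficient_maximal:
 assumes xR: "x : R" and f: "f : F" "f ~: R"
 shows "EX p. p ~= 0 & eval1 p x : \<mm>"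
proof -
 define h where "h = inverse f"
 have h: "h : \<mm>" "f ~= 0" using inverse_maximal[OF f] zero_mem f(2) by (auto simp: h_def)
 obtain q where q: "EX i<=n. q i ~= 0" "(SUM i<=n. eval1 (q i) x * f ^ i) = 0" using dep[of "%i. f ^ i"] C_subfield_power[OF F f(1)]
  by blast
 define d where "d = Max {i. i <= n & q i ~= 0}"
 have "d : {i. i <= n & q i ~= 0}" unfolding d_def using q(1) by (intro Max_in) auto
 hence d: "d <= n" "q d ~= 0" by auto
 have above: "q i = 0" if "d < i" "i <= n" for i proof (rule ccontr)
  assume "q i ~= 0"
  hence "i <= d" unfolding d_def using that(2) by (intro Max_ge) auto
  thus False using that(1) by simp
 qed
 have "0 = (SUM i<=n. eval1 (q i) x * f ^ i) * h ^ d" using q(2) by simp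
 also have "(SUM i<=n. eval1 (q i) x * f ^ i) = (SUM i<=d. eval1 (q i) x * f ^ i)"
  by (rule sum.mono_neutral_right) (use d above in auto)
 also have "... * h ^ d = (SUM i<=d. eval1 (q i) x * h ^ (d - i))" unfolding sum_distrib_right h_def using h(2)
  by (intro sum.cong) (auto simp: power_diff field_simps power_inverse)
 also have "... = eval1 (q d) x + (SUM i<d. eval1 (q i) x * h ^ (d - i))" by (simp add: lessThan_Suc_atMost[symmetric])
 finally have "eval1 (q d) x = - (SUM i<d. eval1 (q i) x * h ^ (d - i))" by (simp add: eq_neg_iff_add_eq_0)
 also have "... : \<mm>" by (intro maximal_minus maximal_sum maximal_mult_right eval1_mem xR power_maximal h(1)) simp
 finally show ?thesis using d(2) by blast
qed

lemma exists_param: obtains t where "t : params" "t : \<mm>"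
proof (cases "x : R")
 case False
 thus ?thesis using that inverse_maximal[OF x] by (auto simp: params_def)
next
 case True
 obtain f where "f : F" "f ~: R" using R by (auto simp: places_def)
 then obtain p where "p ~= 0" "eval1 p x : \<mm>" using leading_coefficient_maximal[OF True] by blast
 then obtain c where "x - mero_const c : \<mm>" using maximal_poly_root[OF True] by blast
 thus ?thesis using that by (auto simp: params_def)
qed

lemma residue:
 assumes f: "f : R"
 shows "EX c. f - mero_const c : \<mm>"
proof -
 obtain t where t: "t : params" "t : \<mm>" by (rule exists_param)
 obtain \<rho> s where \<rho>: "EX i:{..n}. \<rho> i ~= 0" "(SUM i:{..n}. (mero_const (\<rho> i) + t * eval1 (s i) t) * f ^ i) = 0"
  by (rule dependence_in_parameter[OF t(1) finite_atMost card_atMost_gt C_subfield_power[OF F mem_F[OF f]]])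
 define p where "p = (SUM i<=n. monom (\<rho> i) i)"
 have "coeff p i = \<rho> i" if "i <= n" for i using that by (simp add: p_def coeff_sum)
 hence "p ~= 0" using \<rho>(1) by (metis atMost_iff coeff_0)
 moreover have "eval1 p f : \<mm>" proof -
  have "eval1 p f = (SUM i<=n. (mero_const (\<rho> i) + t * eval1 (s i) t) * f ^ i) - (SUM i<=n. t * (eval1 (s i) t * f ^ i))"
   by (simp add: p_def eval1_sum eval1_monom algebra_simps flip: sum_subtractf)
  also have "... = - (SUM i<=n. t * (eval1 (s i) t * f ^ i))" using \<rho>(2) by simp
  also have "... : \<mm>" by (intro maximal_minus maximal_sum maximal_mult_left mult_mem eval1_mem power_mem t maximal_mem f)
  finally show ?thesis .
 qed
 ultimately show ?thesis using maximal_poly_root[OF f] by blast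
qed

text \<open>A strictly decreasing chain of \<open>n + 1\<close> principal ideals containing \<open>t\<close> would be linearly independent.\<close>
lemma no_long_chain:
 assumes t: "t : params" and a: "!!i. i <= n ==> a i : R" "!!i. i <= n ==> a i ~= 0"
  and chain: "!!i j. i < j ==> j <= n ==> a j / a i : \<mm>" and t_div: "!!i. i <= n ==> t / a i : \<mm>"
 shows False
proof -
 have aF: "a i : F" if "i : {..n}" for i using a(1) mem_F that by simp
 obtain \<rho> s where \<rho>: "EX i:{..n}. \<rho> i ~= 0" "(SUM i:{..n}. (mero_const (\<rho> i) + t * eval1 (s i) t) * a i) = 0"
  by (rule dependence_in_parameter[OF t finite_atMost card_atMost_gt aF])
 have "t / a 0 * a 0 : \<mm>" using t_div a by (intro maximal_mult_left) auto
 hence tR: "t : R" using a(2)[of 0] by (simp add: maximal_iff)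
 define k where "k = (LEAST i. i <= n & \<rho> i ~= 0)"
 have k: "k <= n & \<rho> k ~= 0" unfolding k_def by (rule LeastI_ex[of "%i. i <= n & \<rho> i ~= 0"]) (use \<rho>(1) in auto)
 have below: "\<rho> i = 0" if "i < k" for i using not_less_Least[OF that[unfolded k_def]] that k by simp
 define A where "A = (SUM i:{..n} - {k}. mero_const (\<rho> i) * (a i / a k))"
 define B where "B = (SUM i<=n. eval1 (s i) t * a i * (t / a k))"
 have "(SUM i<=n. mero_const (\<rho> i) * (a i / a k)) + B = (SUM i<=n. (mero_const (\<rho> i) + t * eval1 (s i) t) * a i) / a k"
  unfolding B_def sum_divide_distrib sum.distrib[symmetric] by (intro sum.cong) (auto simp: algebra_simps add_divide_distrib)
 hence "(SUM i<=n. mero_const (\<rho> i) * (a i / a k)) + B = 0" using \<rho>(2) by simp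
 moreover have "(SUM i<=n. mero_const (\<rho> i) * (a i / a k)) = mero_const (\<rho> k) + A"
  unfolding A_def using k a(2)[of k] by (subst sum.remove[of _ k]) auto
 ultimately have "mero_const (\<rho> k) = - (A + B)" by (simp only: eq_neg_iff_add_eq_0 add.assoc)
 moreover have "mero_const (\<rho> i) * (a i / a k) : \<mm>" if "i : {..n} - {k}" for i
  using that below[of i] maximal_mult_right[OF const_mem chain[of k i]] zero_maximal by (cases "i < k") (auto simp: mero_const_0)
 hence "A : \<mm>" unfolding A_def by (rule maximal_sum)
 moreover have "B : \<mm>" unfolding B_def using k by (intro maximal_sum maximal_mult_right t_div mult_mem eval1_mem tR a(1)) auto
 ultimately have "mero_const (\<rho> k) : \<mm>" by (simp only: maximal_minus maximal_add)
 thus False using const_not_maximal k by blast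
qed

lemma not_uniformizer_step:
 assumes y: "y : \<mm>" "y ~= 0" "~ uniformizer R y"
 shows "EX z. z : \<mm> - {0} & y / z : \<mm>"
proof -
 have "(%a. y * a) ` R <= \<mm>" using y(1) maximal_mult_left by blast
 moreover have "\<mm> ~= (%a. y * a) ` R" using y(3) by (auto simp: uniformizer_def max_ideal_def)
 ultimately obtain z where z: "z : \<mm>" "z ~: (%a. y * a) ` R" by blast
 have "z ~= 0" using z(2) zero_mem by (auto simp: image_iff)
 have "z = y * (z / y)" using y(2) by simp
 hence "z / y ~: R" using z(2) by blast
 hence "inverse (z / y) : \<mm>" using z(1) y(1) by (intro inverse_maximal C_subfield_divide F mem_F maximal_mem)
 thus ?thesis using z(1) \<open>z ~= 0\<close> by (intro exI[of _ z]) auto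
qed

lemma ex_uniformizer: "EX t. uniformizer R t"
proof (rule ccontr)
 assume "~ ?thesis"
 then obtain g where g: "!!y. y : \<mm> - {0} ==> g y : \<mm> - {0} & y / g y : \<mm>" using not_uniformizer_step by (metis Diff_iff singletonI)
 obtain t where t: "t : params" "t : \<mm>" by (rule exists_param)
 define b where "b i = (g ^^ i) t" for i
 have b: "b i : \<mm> - {0}" for i unfolding b_def using g t params_nonzero[OF t(1)] by (induction i) auto
 have step: "b i / b (Suc i) : \<mm>" for i using g[OF b[of i]] by (simp add: b_def)
 have ratio: "b i / b j : \<mm>" if "i < j" for i j using that proof (induction j)
  case (Suc j)
  show ?case proof (cases "i = j")
   case False
   hence "b i / b j * (b j / b (Suc j)) : \<mm>" using Suc step[of j] by (intro maximal_mult_left) (auto simp: maximal_iff)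
   thus ?thesis using b[of j] by simp
  qed (use step in simp)
 qed simp
 have bR: "b i : R" "b i ~= 0" for i using b[of i] by (auto simp: maximal_iff)
 show False proof (rule no_long_chain[OF t(1), of "%i. b (Suc n - i)"])
  show "t / b (Suc n - i) : \<mm>" if "i <= n" for i using ratio[of 0 "Suc n - i"] that by (simp add: b_def)
 qed (use bR ratio in auto)
qed

abbreviation "\<pi> == unif R"

lemma unif_uniformizer: "uniformizer R \<pi>" unfolding unif_def by (rule someI_ex[OF ex_uniformizer])

lemma maximal_eq_image: "uniformizer R t ==> \<mm> = (%a. t * a) ` R" by (simp add: uniformizer_def max_ideal_def)

lemma
 assumes t: "uniformizer R t"
 shows uniformizer_maximal: "t : \<mm>" and uniformizer_nonzero: "t ~= 0"
proof -
 show "t : \<mm>" unfolding maximal_eq_image[OF t] using one_mem by (intro image_eqI[of _ _ 1]) auto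
 show "t ~= 0" proof
  assume "t = 0"
  hence "\<mm> <= {0}" unfolding maximal_eq_image[OF t] by auto
  moreover obtain s where "s : params" "s : \<mm>" by (rule exists_param)
  ultimately show False using params_nonzero by blast
 qed
qed

lemma unif_maximal: "\<pi> : \<mm>" and unif_nonzero: "\<pi> ~= 0" and unif_mem: "\<pi> : R" and unif_mem_F: "\<pi> : F"
 using uniformizer_maximal[OF unif_uniformizer] uniformizer_nonzero[OF unif_uniformizer] maximal_mem mem_F by blast+

lemma maximal_iff_divide: "a : \<mm> \<longleftrightarrow> a / \<pi> : R"
proof
 assume "a : \<mm>"
 thus "a / \<pi> : R" unfolding maximal_eq_image[OF unif_uniformizer] using unif_nonzero by auto
next
 assume "a / \<pi> : R"
 hence "\<pi> * (a / \<pi>) : \<mm>" by (intro maximal_mult_left unif_maximal)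
 thus "a : \<mm>" using unif_nonzero by simp
qed

lemma units_iff: "u : place_units R \<longleftrightarrow> u : R & u ~: \<mm>" by (auto simp: max_ideal_def place_units_def)

lemma unit_mem: "u : place_units R ==> u : R" and unit_nonzero: "u : place_units R ==> u ~= 0"
 and unit_inverse: "u : place_units R ==> inverse u : place_units R" by (auto simp: place_units_def)

lemma unit_mult: "u : place_units R ==> v : place_units R ==> u * v : place_units R" by (auto simp: place_units_def intro: mult_mem)

lemma unit_1: "1 : place_units R" by (simp add: place_units_def one_mem)

lemma unit_power: "u : place_units R ==> u ^ j : place_units R" by (induction j) (auto intro: unit_1 unit_mult)

lemma unit_power_int: "u : place_units R ==> u powi k : place_units R"
 by (cases "k >= 0") (auto simp: power_int_def intro!: unit_power unit_inverse)

lemma finite_order: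
 assumes "f : R" "f / \<pi> ^ K ~: R"
 shows "EX k<K. EX u:place_units R. f = \<pi> ^ k * u" using assms
proof (induction K)
 case (Suc K)
 show ?case proof (cases "f / \<pi> ^ K : R")
  case True
  have "f / \<pi> ^ K ~: \<mm>" using Suc.prems unif_nonzero by (subst maximal_iff_divide) (simp add: field_simps)
  hence "f / \<pi> ^ K : place_units R" using True units_iff by blast
  moreover have "f = \<pi> ^ K * (f / \<pi> ^ K)" using unif_nonzero by simp
  ultimately show ?thesis by blast
 next
  case False
  thus ?thesis using Suc by (meson less_Suc_eq)
 qed
qed simp

lemma param_order_bounded:
 assumes "t : params"
 shows "t / \<pi> ^ Suc n ~: R"
proof
 assume tR: "t / \<pi> ^ Suc n : R"
 show False proof (rule no_long_chain[OF assms, of "%i. \<pi> ^ i"])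
  show "t / \<pi> ^ i : \<mm>" if "i <= n" for i proof -
   have "\<pi> ^ (Suc n - i) * (t / \<pi> ^ Suc n) : \<mm>" using tR that by (intro maximal_mult_left power_maximal unif_maximal) auto
   thus ?thesis using that unif_nonzero by (simp add: power_diff field_simps)
  qed
  show "\<pi> ^ j / \<pi> ^ i : \<mm>" if "i < j" for i j using power_maximal[OF unif_maximal, of "j - i"] unif_nonzero that by (simp add: power_diff)
 qed (use unif_nonzero unif_mem power_mem in auto)
qed

lemma eval1_param_form:
 assumes t: "t : \<mm>" and "p ~= 0"
 shows "EX j. EX u:place_units R. eval1 p t = t ^ j * u" using assms(2)
proof (induction p)
 case (pCons a p)
 show ?case proof (cases "a = 0")
  case True
  then obtain j u where u: "u : place_units R" "eval1 p t = t ^ j * u" using pCons by auto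
  have "eval1 (pCons a p) t = t ^ Suc j * u" using True u(2) by (simp add: mero_const_0)
  thus ?thesis using u(1) by blast
 next
  case False
  have "t * eval1 p t : \<mm>" using t by (intro maximal_mult_left eval1_mem maximal_mem)
  hence "mero_const a + t * eval1 p t : place_units R"
   unfolding units_iff using add_not_maximal[OF const_not_maximal[OF False]] add_mem[OF const_mem maximal_mem] by blast
  thus ?thesis by (intro exI[of _ 0] bexI[of _ "mero_const a + t * eval1 p t"]) auto
 qed
qed simp

lemma divides_polynomial:
 assumes t: "t : params" "t : \<mm>" and f: "f : R" "f ~= 0"
 shows "EX p g. p ~= 0 & g : R & eval1 p t = f * g"
proof -
 obtain \<rho> s where \<rho>: "EX i:{..n}. \<rho> i ~= 0" "(SUM i:{..n}. (mero_const (\<rho> i) + t * eval1 (s i) t) * f ^ i) = 0"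
  by (rule dependence_in_parameter[OF t(1) finite_atMost card_atMost_gt C_subfield_power[OF F mem_F[OF f(1)]]])
 define T where "T i = pCons (\<rho> i) (s i)" for i
 have T0: "(SUM i<=n. eval1 (T i) t * f ^ i) = 0" using \<rho>(2) by (simp add: T_def)
 define k where "k = (LEAST i. i <= n & T i ~= 0)"
 have k: "k <= n & T k ~= 0" unfolding k_def
  by (rule LeastI_ex[of "%i. i <= n & T i ~= 0"]) (use \<rho>(1) in \<open>auto simp: T_def\<close>)
 have below: "T i = 0" if "i < k" for i using not_less_Least[OF that[unfolded k_def]] that k by simp
 define g where "g = - (SUM i:{Suc k..n}. eval1 (T i) t * f ^ (i - k - 1))"
 have "0 = (SUM i:{k..n}. eval1 (T i) t * f ^ i)" unfolding T0[symmetric] by (rule sum.mono_neutral_right) (use below in auto)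
 also have "... = f ^ k * (SUM i:{k..n}. eval1 (T i) t * f ^ (i - k))"
  unfolding sum_distrib_left by (intro sum.cong) (auto simp: power_diff f(2) field_simps)
 finally have "0 = (SUM i:{k..n}. eval1 (T i) t * f ^ (i - k))" using f(2) by simp
 also have "... = eval1 (T k) t + (SUM i:{Suc k..n}. eval1 (T i) t * f ^ (i - k))" using k by (simp add: sum.atLeast_Suc_atMost)
 also have "(SUM i:{Suc k..n}. eval1 (T i) t * f ^ (i - k)) = - (f * g)"
  unfolding g_def mult_minus_right minus_minus sum_distrib_left by (intro sum.cong) (auto simp: power_eq_if[of f "_ - k"])
 finally have "eval1 (T k) t = f * g" by simp
 moreover have "g : R" unfolding g_def by (intro minus_mem sum_mem mult_mem eval1_mem power_mem maximal_mem t f)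
 ultimately show ?thesis using k by blast
qed

lemma order_of_integral_element:
 assumes f: "f : R" "f ~= 0"
 shows "EX k. EX u:place_units R. f = \<pi> ^ k * u"
proof (rule ccontr)
 assume "~ ?thesis"
 hence div: "f / \<pi> ^ K : R" for K using finite_order[OF f(1)] by blast
 obtain t where t: "t : params" "t : \<mm>" by (rule exists_param)
 obtain e v where v: "v : place_units R" "t = \<pi> ^ e * v" using finite_order[OF maximal_mem[OF t(2)] param_order_bounded[OF t(1)]] by blast
 obtain p g where g: "p ~= 0" "g : R" "eval1 p t = f * g" using divides_polynomial[OF t f] by blast
 obtain j u where u: "u : place_units R" "eval1 p t = t ^ j * u" using eval1_param_form[OF t(2) g(1)] by blast
 have fg: "f * g = \<pi> ^ (e * j) * (v ^ j * u)" using g(3) u(2) v(2) by (simp add: power_mult_distrib power_mult mult_ac)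
 have "f / \<pi> ^ Suc (e * j) * g * inverse (v ^ j * u) = (f * g) / (\<pi> ^ (e * j) * (v ^ j * u)) * inverse \<pi>" by (simp add: field_simps)
 also have "... = inverse \<pi>" unfolding fg using unif_nonzero unit_nonzero[OF u(1)] unit_nonzero[OF v(1)] by simp
 finally have "f / \<pi> ^ Suc (e * j) * g * inverse (v ^ j * u) = inverse \<pi>" .
 moreover have "f / \<pi> ^ Suc (e * j) * g * inverse (v ^ j * u) : R" by (intro mult_mem div g unit_mem unit_inverse unit_mult unit_power u v)
 ultimately show False using unif_maximal unif_nonzero by (simp add: maximal_iff)
qed

lemma order_form:
 assumes f: "f : F" "f ~= 0"
 shows "EX k. EX u:place_units R. f = \<pi> powi k * u"
proof (cases "f : R")
 case True
 then obtain k u where "u : place_units R" "f = \<pi> ^ k * u" using order_of_integral_element f by blast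
 thus ?thesis by (intro exI[of _ "int k"] bexI[of _ u]) auto
next
 case False
 hence "inverse f : R" using inverse_maximal[OF f(1)] maximal_mem by blast
 then obtain k u where u: "u : place_units R" "inverse f = \<pi> ^ k * u" using order_of_integral_element[of "inverse f"] f by auto
 have "f = inverse (\<pi> ^ k * u)" using u(2) by (metis inverse_inverse_eq)
 hence "f = \<pi> powi (- int k) * inverse u" by (simp add: power_int_minus)
 thus ?thesis using unit_inverse[OF u(1)] by blast
qed

lemma power_int_unif_mem_iff:
 assumes u: "u : place_units R"
 shows "\<pi> powi k * u : R \<longleftrightarrow> k >= 0"
proof
 assume "k >= 0"
 thus "\<pi> powi k * u : R" using unit_mem[OF u] power_mem[OF unif_mem] by (auto simp: power_int_def intro: mult_mem)
next
 assume mem: "\<pi> powi k * u : R"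
 show "k >= 0" proof (rule ccontr)
  assume k: "~ k >= 0"
  have "\<pi> ^ nat (- k) * (\<pi> powi k * u * inverse u) : \<mm>"
   using k by (intro maximal_mult_left power_maximal unif_maximal mult_mem mem unit_mem unit_inverse u) simp
  moreover have "\<pi> ^ nat (- k) * (\<pi> powi k * u * inverse u) = 1"
   using k unif_nonzero unit_nonzero[OF u] by (simp add: power_int_def power_inverse field_simps)
  ultimately show False using one_not_maximal by simp
 qed
qed

lemma place_ord_eq:
 assumes u: "u : place_units R"
 shows "place_ord R (\<pi> powi k * u) = k" unfolding place_ord_def
proof (rule the_equality)
 show "EX t u'. uniformizer R t & u' : place_units R & \<pi> powi k * u = t powi k * u'" using unif_uniformizer u by blast
next
 fix j assume "EX t u'. uniformizer R t & u' : place_units R & \<pi> powi k * u = t powi j * u'"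
 then obtain t u' where t: "uniformizer R t" "u' : place_units R" "\<pi> powi k * u = t powi j * u'" by blast
 obtain v where v: "v : R" "t = \<pi> * v" using uniformizer_maximal[OF t(1)] unfolding maximal_eq_image[OF unif_uniformizer] by blast
 obtain v' where v': "v' : R" "\<pi> = t * v'" using unif_maximal unfolding maximal_eq_image[OF t(1)] by blast
 have "\<pi> * (v * v') = \<pi>" using v v' by (metis mult.assoc)
 hence "v * v' = 1" using unif_nonzero by simp
 hence v_unit: "v : place_units R" using v v' uniformizer_nonzero[OF t(1)] by (auto simp: place_units_def inverse_unique)
 define w where "w = v powi j * u' * inverse u"
 have w: "w : place_units R" unfolding w_def by (intro unit_mult unit_power_int unit_inverse v_unit t u)
 have "\<pi> powi k = \<pi> powi j * w" using t(3) unit_nonzero[OF u] unfolding v(2) w_def by (simp add: power_int_mult_distrib field_simps)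
 hence "\<pi> powi (k - j) * inverse w = 1" "\<pi> powi (j - k) * w = 1" using unif_nonzero unit_nonzero[OF w]
  by (auto simp: power_int_diff field_simps)
 hence "k - j >= 0" "j - k >= 0"
  using power_int_unif_mem_iff[OF unit_inverse[OF w], of "k - j"] power_int_unif_mem_iff[OF w, of "j - k"] one_mem by auto
 thus "j = k" by simp
qed

abbreviation ord where "ord == place_ord R"

lemma ord_form:
 assumes "f : F" "f ~= 0"
 obtains u where "u : place_units R" "f = \<pi> powi ord f * u"
 using order_form[OF assms] place_ord_eq by metis

lemma ord_mult:
 assumes "f : F" "f ~= 0" "g : F" "g ~= 0"
 shows "ord (f * g) = ord f + ord g"
proof -
 obtain u where u: "u : place_units R" "f = \<pi> powi ord f * u" using ord_form assms by blast
 obtain v where v: "v : place_units R" "g = \<pi> powi ord g * v" using ord_form assms by blast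
 have "f * g = \<pi> powi (ord f + ord g) * (u * v)" by (subst u(2), subst v(2)) (simp add: power_int_add unif_nonzero)
 thus ?thesis using place_ord_eq[OF unit_mult[OF u(1) v(1)]] by metis
qed

lemma ord_ge_iff:
 assumes "f : F" "f ~= 0"
 shows "k <= ord f \<longleftrightarrow> f * \<pi> powi (- k) : R"
proof -
 obtain u where u: "u : place_units R" "f = \<pi> powi ord f * u" using ord_form assms by blast
 have "f * \<pi> powi (- k) = \<pi> powi (ord f - k) * u" by (subst u(2)) (simp add: power_int_diff power_int_minus field_simps unif_nonzero)
 thus ?thesis using power_int_unif_mem_iff[OF u(1), of "ord f - k"] by simp
qed

lemma ord_nonneg: "f : F ==> f ~= 0 ==> 0 <= ord f \<longleftrightarrow> f : R" using ord_ge_iff[of f 0] by simp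

lemma ord_pos: "f : F ==> f ~= 0 ==> 0 < ord f \<longleftrightarrow> f : \<mm>"
 using ord_ge_iff[of f 1] maximal_iff_divide[of f] by (simp add: power_int_minus divide_inverse int_one_le_iff_zero_less)

lemma ord_unit: "f : R ==> f ~: \<mm> ==> ord f = 0" using place_ord_eq[of f 0] units_iff by auto

lemma ord_1: "ord 1 = 0" by (rule ord_unit[OF one_mem one_not_maximal])

lemma ord_power: "f : F ==> f ~= 0 ==> ord (f ^ k) = int k * ord f"
 by (induction k) (simp_all add: ord_1 ord_mult C_subfield_power[OF F] algebra_simps)

lemma ord_inverse:
 assumes "f : F" "f ~= 0"
 shows "ord (inverse f) = - ord f"
 using ord_mult[of f "inverse f"] assms C_subfield_inverse[OF F] ord_1 by simp

lemma ord_divide: "f : F ==> f ~= 0 ==> g : F ==> g ~= 0 ==> ord (f / g) = ord f - ord g"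
 by (simp add: divide_inverse ord_mult ord_inverse C_subfield_inverse[OF F])

lemma ord_prod: "finite I ==> (!!i. i : I ==> f i : F & f i ~= 0) ==> ord (PROD i:I. f i) = (SUM i:I. ord (f i))"
 by (induction I rule: finite_induct) (simp_all add: ord_1 ord_mult C_subfield_prod[OF F])

lemma ord_unif: "ord \<pi> = 1" using place_ord_eq[OF unit_1, of 1] by simp

lemma dominant_term_nonzero:
 assumes I: "finite I" "i0 : I" and f: "!!i. i : I ==> f i : F & f i ~= 0" and t: "t : F" "t : \<mm>" and \<rho>0: "\<rho> i0 ~= 0"
  and dominant: "!!i. i : I - {i0} ==> ord (f i) > ord (f i0) | \<rho> i = 0 & ord t + ord (f i) > ord (f i0)"
 shows "(SUM i:I. (mero_const (\<rho> i) + t * eval1 (s i) t) * f i) ~= 0"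
proof
 assume sum0: "(SUM i:I. (mero_const (\<rho> i) + t * eval1 (s i) t) * f i) = 0"
 define T where "T i = (mero_const (\<rho> i) + t * eval1 (s i) t) * (f i / f i0)" for i
 have tail: "t * eval1 (s i) t : \<mm>" for i by (intro maximal_mult_left eval1_mem maximal_mem t)
 have coeff: "mero_const (\<rho> i) + t * eval1 (s i) t : R" for i by (intro add_mem const_mem maximal_mem tail)
 have T: "T i : \<mm>" if i: "i : I - {i0}" for i proof (cases "\<rho> i = 0 & ord t + ord (f i) > ord (f i0)")
  case True
  show ?thesis proof (cases "t = 0")
   case False
   hence "ord (t * (f i / f i0)) > 0" using True False i f I(2) t(1) by (simp add: ord_mult ord_divide C_subfield_mult[OF F])
   hence "t * (f i / f i0) : \<mm>" using ord_pos[of "t * (f i / f i0)"] False i f I(2) t(1)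
    by (simp add: C_subfield_mult[OF F] C_subfield_divide[OF F])
   hence "eval1 (s i) t * (t * (f i / f i0)) : \<mm>" by (rule maximal_mult_right[OF eval1_mem[OF maximal_mem[OF t(2)]]])
   thus ?thesis using True by (simp add: T_def mero_const_0 mult_ac)
  qed (use True zero_maximal in \<open>simp add: T_def mero_const_0\<close>)
 next
  case False
  hence "ord (f i / f i0) > 0" using dominant[OF i] i f I(2) by (auto simp: ord_divide)
  hence "f i / f i0 : \<mm>" using ord_pos[of "f i / f i0"] i f I(2) by (simp add: C_subfield_divide[OF F])
  thus ?thesis unfolding T_def by (rule maximal_mult_right[OF coeff])
 qed
 have "(SUM i:I. T i) = (SUM i:I. (mero_const (\<rho> i) + t * eval1 (s i) t) * f i) / f i0" unfolding sum_divide_distrib T_def by simp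
 hence "T i0 + (SUM i:I - {i0}. T i) = 0" using sum0 sum.remove[OF I, of T] by simp
 hence "T i0 = - (SUM i:I - {i0}. T i)" by (rule eq_neg_iff_add_eq_0[THEN iffD2])
 also have "... : \<mm>" by (intro maximal_minus maximal_sum T)
 finally have "mero_const (\<rho> i0) + t * eval1 (s i0) t : \<mm>" using f[OF I(2)] by (simp add: T_def)
 thus False using add_not_maximal[OF const_not_maximal[OF \<rho>0] tail] by blast
qed

lemma shifted_ratio_unit:
 assumes y: "y : F" "y ~: R"
 shows "y / (mero_const s + y) : R" "y / (mero_const s + y) ~: \<mm>"
proof -
 define v where "v = 1 + mero_const s * inverse y"
 have inv: "mero_const s * inverse y : \<mm>" by (intro maximal_mult_right const_mem inverse_maximal y)
 have "v : place_units R" unfolding units_iff v_def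
  using add_not_maximal[OF one_not_maximal inv] add_mem[OF one_mem maximal_mem[OF inv]] by blast
 moreover have "y / (mero_const s + y) = inverse v" using y(2) zero_mem by (cases "y = 0") (simp_all add: v_def field_simps)
 ultimately show "y / (mero_const s + y) : R" "y / (mero_const s + y) ~: \<mm>" using unit_inverse[of v] by (simp_all add: units_iff)
qed

lemma inverse_shift_mem:
 assumes "y : R" "mero_const s + y ~: \<mm>"
 shows "inverse (mero_const s + y) : R"
 using add_mem[OF const_mem[of s] assms(1)] assms(2) maximal_iff by blast

lemma finite_shifts_maximal: "finite {s. mero_const s + y : \<mm>}"
proof -
 have "s = s'" if "mero_const s + y : \<mm>" "mero_const s' + y : \<mm>" for s s' proof (rule ccontr)
  assume "s ~= s'"
  moreover have "mero_const (s - s') : \<mm>" using maximal_diff[OF that] by (simp add: mero_const_diff)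
  ultimately show False using const_not_maximal[of "s - s'"] by simp
 qed
 hence "EX s0. {s. mero_const s + y : \<mm>} <= {s0}" by blast
 thus ?thesis using finite_subset by blast
qed

end

subsection \<open>Approximation and the fundamental inequality\<close>

context curve
begin

lemma curve_place: "R : places F ==> curve_place F x n R" by (intro curve_place.intro curve_axioms valuation_ring.intro F)

lemma place_maximal:
 assumes R: "R : places F" and R0: "R0 : places F" and sub: "R0 <= R"
 shows "R <= R0"
proof
 interpret R: curve_place F x n R by (rule curve_place[OF R])
 interpret R0: curve_place F x n R0 by (rule curve_place[OF R0])
 fix a assume a: "a : R"
 show "a : R0" proof (rule ccontr)
  assume "a ~: R0"
  hence "a ~= 0" using R0.zero_mem by auto
  have "inverse a : R0.\<mm>" using R.mem_F[OF a] \<open>a ~: R0\<close> by (intro R0.inverse_maximal)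
  hence "inverse a / R0.\<pi> : R0" by (simp add: R0.maximal_iff_divide)
  hence "inverse a / R0.\<pi> * a : R" using a sub by (intro R.mult_mem) auto
  hence "inverse R0.\<pi> : R" using \<open>a ~= 0\<close> by (simp add: field_simps)
  hence unif_powers: "R0.\<pi> powi k : R" for k
   using R.power_mem[of "inverse R0.\<pi>"] R.power_mem[of R0.\<pi>] R0.unif_mem sub by (auto simp: power_int_def)
  have "f : R" if f: "f : F" for f proof (cases "f = 0")
   case False
   obtain u where u: "u : place_units R0" "f = R0.\<pi> powi (place_ord R0 f) * u" using R0.ord_form[OF f False] by blast
   have "R0.\<pi> powi (place_ord R0 f) * u : R" using unif_powers R0.unit_mem[OF u(1)] sub by (intro R.mult_mem) auto
   thus ?thesis using u(2) by simp
  qed (use R.zero_mem in simp)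
  thus False using R by (auto simp: places_def)
 qed
qed

lemma distinct_places:
 assumes R: "R : places F" "R0 : places F" "R ~= R0"
 obtains y where "y : F" "y : max_ideal R" "y ~: R0"
proof -
 interpret R: curve_place F x n R by (rule curve_place[OF R(1)])
 interpret R0: curve_place F x n R0 by (rule curve_place[OF R(2)])
 obtain a where a: "a : R0" "a ~: R" using place_maximal[OF R(1,2)] R(3) by blast
 obtain b where b: "b : R" "b ~: R0" using place_maximal[OF R(2,1)] R(3) by blast
 have F_mem: "a : F" "b : F" using a(1) b(1) R.mem_F R0.mem_F by auto
 have "inverse a * b : R.\<mm>" by (intro R.maximal_mult_left R.inverse_maximal F_mem a b)
 moreover have "inverse a * b ~: R0" proof
  assume "inverse a * b : R0"
  hence "a * (inverse a * b) : R0" by (rule R0.mult_mem[OF a(1)])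
  moreover have "a ~= 0" using a(2) R.zero_mem by auto
  ultimately show False using b(2) by (simp add: mult.assoc[symmetric])
 qed
 moreover have "inverse a * b : F" by (intro C_subfield_mult C_subfield_inverse F F_mem)
 ultimately show ?thesis using that by blast
qed

lemma separate_two:
 assumes S: "finite S" "S <= places F" and R: "R : places F" "R0 : places F" "R ~= R0"
 shows "EX w:F. (ALL R':S. w : R') & w : R0 & w ~: max_ideal R0 & w : max_ideal R"
proof -
 interpret R: curve_place F x n R by (rule curve_place[OF R(1)])
 interpret R0: curve_place F x n R0 by (rule curve_place[OF R(2)])
 obtain y where y: "y : F" "y : R.\<mm>" "y ~: R0" using distinct_places[OF R] .
 define bad where "bad = insert 0 (UN R':S. {s. mero_const s + y : max_ideal R'})"
 have "finite {s. mero_const s + y : max_ideal R'}" if "R' : S" for R'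
  using curve_place.finite_shifts_maximal[OF curve_place[of R']] that S(2) by blast
 hence "finite bad" unfolding bad_def using S(1) by simp
 then obtain s where s: "s ~: bad" using ex_new_if_finite[OF infinite_UNIV_char_0] by blast
 define w where "w = y / (mero_const s + y)"
 have "w : R'" if R': "R' : S" for R' proof -
  interpret R': curve_place F x n R' by (rule curve_place) (use R' S in auto)
  show ?thesis proof (cases "y : R'")
   case True
   have "y * inverse (mero_const s + y) : R'" by (intro R'.mult_mem R'.inverse_shift_mem True) (use s R' in \<open>auto simp: bad_def\<close>)
   thus ?thesis by (simp add: w_def divide_inverse)
  qed (use R'.shifted_ratio_unit[OF y(1)] in \<open>simp add: w_def\<close>)
 qed
 moreover have "mero_const s + y ~: R.\<mm>" using s by (intro R.add_not_maximal R.const_not_maximal y(2)) (auto simp: bad_def)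
 hence "y * inverse (mero_const s + y) : R.\<mm>" by (intro R.maximal_mult_left R.inverse_shift_mem R.maximal_mem y(2))
 hence "w : R.\<mm>" by (simp add: w_def divide_inverse)
 moreover have "w : F" unfolding w_def by (intro C_subfield_closed[OF F] y(1))
 ultimately show ?thesis using R0.shifted_ratio_unit[OF y(1,3), of s] w_def by blast
qed

lemma separate:
 assumes S: "finite S" "S <= places F" and R0: "R0 : S"
 shows "EX z:F. z : R0 & z ~: max_ideal R0 & (ALL R:S - {R0}. z : max_ideal R)"
proof -
 have "ALL R:S - {R0}. EX w. w : F & (ALL R':S. w : R') & w : R0 & w ~: max_ideal R0 & w : max_ideal R"
  using separate_two[OF S, of _ R0] S R0 by blast
 from bchoice[OF this] obtain w where w: "ALL R:S - {R0}. w R : F & (ALL R':S. w R : R') & w R : R0 & w R ~: max_ideal R0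
  & w R : max_ideal R"
  by blast
 interpret R0: curve_place F x n R0 by (rule curve_place) (use S R0 in auto)
 define z where "z T = (PROD R:T. w R)" for T
 have mem: "z T : R'" if T: "T <= S - {R0}" and R': "R' : S" for T R' proof -
  interpret R': curve_place F x n R' by (rule curve_place) (use S R' in auto)
  show ?thesis unfolding z_def using T w R' by (intro R'.prod_mem) blast
 qed
 have "z T ~: max_ideal R0" if T: "T <= S - {R0}" for T using T proof (induction T rule: infinite_finite_induct)
  case (insert R T)
  hence "w R ~: max_ideal R0" "w R : R0" using w by auto
  moreover have "z T ~: max_ideal R0" "z T : R0" using insert mem[of T R0] R0 by auto
  ultimately have "w R * z T ~: max_ideal R0" using R0.maximal_prime[of "w R" "z T"] by blast
  thus ?case using insert by (simp add: z_def)
 qed (use R0.one_not_maximal in \<open>auto simp: z_def\<close>)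
 hence "z (S - {R0}) ~: max_ideal R0" "z (S - {R0}) : R0" "z (S - {R0}) : F" using mem[of "S - {R0}" R0] R0 R0.mem_F by auto
 moreover have "z (S - {R0}) : max_ideal R" if R: "R : S - {R0}" for R proof -
  interpret R: curve_place F x n R by (rule curve_place) (use S R in auto)
  have "z (S - {R0}) = w R * z (S - {R0} - {R})" unfolding z_def using S R by (intro prod.remove) auto
  moreover have "w R * z (S - {R0} - {R}) : max_ideal R" using w R mem[of "S - {R0} - {R}" R] by (intro R.maximal_mult_left) auto
  ultimately show ?thesis by simp
 qed
 ultimately show ?thesis by blast
qed

lemma approximation:
 assumes S: "finite S" "S <= places F" and R0: "R0 : S"
 shows "EX f:F. f ~= 0 & place_ord R0 f = int j & (ALL R:S - {R0}. place_ord R f >= K)"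
proof -
 interpret R0: curve_place F x n R0 by (rule curve_place) (use S R0 in auto)
 obtain z where z: "z : F" "z : R0" "z ~: max_ideal R0" "ALL R:S - {R0}. z : max_ideal R" using separate[OF S R0] by blast
 have z0: "z ~= 0" using z(3) R0.zero_maximal by auto
 define N where "N = (SUM R:S. nat \<bar>K - int j * place_ord R R0.\<pi>\<bar>)"
 define f where "f = R0.\<pi> ^ j * z ^ N"
 have f: "f : F" "f ~= 0" using z(1) z0 R0.unif_mem_F R0.unif_nonzero
  by (auto simp: f_def intro!: C_subfield_mult[OF F] C_subfield_power[OF F])
 have ord_f: "place_ord R f = int j * place_ord R R0.\<pi> + int N * place_ord R z" if "R : S" for R proof -
  interpret curve_place F x n R by (rule curve_place) (use S that in auto)
  show ?thesis using z(1) z0 R0.unif_mem_F R0.unif_nonzero by (simp add: f_def ord_mult ord_power C_subfield_power[OF F])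
 qed
 have "place_ord R0 f = int j" unfolding ord_f[OF R0] R0.ord_unit[OF z(2,3)] R0.ord_unif by simp
 moreover have "place_ord R f >= K" if R_S: "R : S - {R0}" for R proof -
  interpret curve_place F x n R by (rule curve_place) (use S R_S in auto)
  have "nat \<bar>K - int j * ord R0.\<pi>\<bar> <= N" unfolding N_def using R_S S(1) by (intro member_le_sum) auto
  hence "\<bar>K - int j * ord R0.\<pi>\<bar> <= int N" by (simp add: nat_le_iff)
  moreover have "z : \<mm>" using z(4) R_S by blast
  hence "ord z >= 1" using ord_pos[OF z(1) z0] by simp
  hence "int N * 1 <= int N * ord z" by (intro mult_left_mono) auto
  moreover have "ord f = int j * ord R0.\<pi> + int N * ord z" using ord_f R_S by blast
  ultimately show ?thesis by linarith
 qed
 ultimately show ?thesis using f by blast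
qed

theorem fundamental_inequality:
 assumes t: "t : params" and S: "finite S" "S <= places F" "!!R. R : S ==> t : max_ideal R"
 shows "(SUM R:S. place_ord R t) <= int n"
proof (rule ccontr)
 assume big: "~ ?thesis"
 have tF: "t : F" "t ~= 0" using t params_mem_F params_nonzero by auto
 have pos: "place_ord R t > 0" if "R : S" for R using curve_place.ord_pos[OF curve_place tF] S that by blast
 define I where "I = (SIGMA R:S. {..<nat (place_ord R t)})"
 have I: "finite I" unfolding I_def using S by auto
 have "card I = (SUM R:S. nat (place_ord R t))" unfolding I_def using S by (subst card_SigmaI) auto
 hence "int (card I) = (SUM R:S. place_ord R t)" using pos by (simp add: order_less_imp_le)
 hence card_I: "card I > n" using big by simp
 define K where "K = (SUM R:S. place_ord R t)"
 have K: "place_ord R t <= K" if "R : S" for R unfolding K_def using that S pos by (intro member_le_sum) (auto simp: order_less_imp_le)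
 have "ALL i:I. EX f:F. f ~= 0 & place_ord (fst i) f = int (snd i) & (ALL R:S - {fst i}. place_ord R f >= K)"
  using approximation[OF S(1,2)] by (auto simp: I_def)
 then obtain f where f: "!!i. i : I ==> f i : F & f i ~= 0 & place_ord (fst i) (f i) = int (snd i)
  & (ALL R:S - {fst i}. place_ord R (f i) >= K)" by metis
 hence f_F: "!!i. i : I ==> f i : F & f i ~= 0" by blast
 obtain \<rho> s where \<rho>: "EX i:I. \<rho> i ~= 0" "(SUM i:I. (mero_const (\<rho> i) + t * eval1 (s i) t) * f i) = 0"
  by (rule dependence_in_parameter[OF t I card_I, of f]) (use f_F in blast)
 obtain R0 j1 where i1: "(R0, j1) : I" "\<rho> (R0, j1) ~= 0" using \<rho>(1) by force
 define j0 where "j0 = (LEAST j. (R0, j) : I & \<rho> (R0, j) ~= 0)"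
 have j0: "(R0, j0) : I" "\<rho> (R0, j0) ~= 0" unfolding j0_def using LeastI[of "%j. (R0, j) : I & \<rho> (R0, j) ~= 0" j1] i1 by auto
 have R0: "R0 : S" "int j0 < place_ord R0 t" using j0(1) by (auto simp: I_def)
 interpret curve_place F x n R0 by (rule curve_place) (use R0 S in auto)
 have "(SUM i:I. (mero_const (\<rho> i) + t * eval1 (s i) t) * f i) ~= 0" proof (rule dominant_term_nonzero[of I "(R0, j0)" f t \<rho> s])
  fix i assume i: "i : I - {(R0, j0)}"
  have ord_f0: "ord (f (R0, j0)) = int j0" using f[OF j0(1)] by simp
  show "ord (f i) > ord (f (R0, j0)) | \<rho> i = 0 & ord t + ord (f i) > ord (f (R0, j0))" proof (cases "fst i = R0")
   case True
   define j where "j = snd i"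
   have i_eq: "i = (R0, j)" using True by (simp add: j_def prod_eq_iff)
   have "ord (f i) = int j" using f[of i] i by (simp add: i_eq)
   moreover have "j ~= j0" using i i_eq by auto
   moreover have "\<rho> i = 0" if "j < j0"
    using not_less_Least[of j "%j. (R0, j) : I & \<rho> (R0, j) ~= 0"] that i unfolding i_eq j0_def by blast
   ultimately show ?thesis using ord_f0 R0(2) by (cases "j < j0") auto
  next
   case False
   hence "K <= ord (f i)" using f[of i] i R0(1) by blast
   thus ?thesis using ord_f0 R0(2) K[OF R0(1)] by linarith
  qed
 qed (use I j0 f_F tF S(3)[OF R0(1)] in blast)+
 thus False using \<rho>(2) by contradiction
qed

lemma finite_fibre:
 assumes t: "t : params"
 shows "finite {R : places F. t : max_ideal R}"
proof (rule ccontr)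
 assume "infinite {R : places F. t : max_ideal R}"
 then obtain S where S: "S <= {R : places F. t : max_ideal R}" "finite S" "card S = Suc n" using infinite_arbitrarily_large by blast
 have "place_ord R t >= 1" if "R : S" for R using curve_place.ord_pos[OF curve_place params_mem_F[OF t] params_nonzero[OF t], of R] S that
  by fastforce
 hence "(SUM R:S. 1) <= (SUM R:S. place_ord R t)" by (intro sum_mono)
 moreover have "(SUM R:S. place_ord R t) <= int n" using S by (intro fundamental_inequality[OF t]) auto
 ultimately show False using S by simp
qed

end

section \<open>Riemann--Roch spaces\<close>

definition finite_basis :: "mero set => mero set => bool" where
 "finite_basis B V \<longleftrightarrow> finite B & mero.independent B & mero.span B = V"

lemma finite_basis_dim: "finite_basis B V ==> mero.dim V = card B" by (rule mero.dim_eq_card) (auto simp: finite_basis_def mero.span_span)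

context curve
begin

subsection \<open>Finite dimensionality\<close>

lemma valuation_ring: "R : places F ==> valuation_ring F R" by (rule valuation_ring.intro[OF F])

lemma RR_space_iff: "f : RR_space F D \<longleftrightarrow> f : F & (ALL R:places F. f * unif R powi D R : R)"
proof (cases "f = 0")
 case True
 thus ?thesis using C_subfield_0[OF F] valuation_ring.zero_mem[OF valuation_ring] by (simp add: RR_space_def)
next
 case False
 have "place_ord R f >= - D R \<longleftrightarrow> f * unif R powi D R : R" if "R : places F" "f : F" for R
  using curve_place.ord_ge_iff[OF curve_place[OF that(1)] that(2) False, of "- D R"] by simp
 thus ?thesis using False by (auto simp: RR_space_def)
qed

lemma RR_subspace: "mero.subspace (RR_space F D)"
proof (rule mero.subspaceI)
 show "0 : RR_space F D" using C_subfield_0[OF F] by (simp add: RR_space_def)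
 fix f g assume fg: "f : RR_space F D" "g : RR_space F D"
 have "(f + g) * unif R powi D R : R" if "R : places F" for R
  unfolding distrib_right using fg that by (intro valuation_ring.add_mem[OF valuation_ring[OF that]]) (auto simp: RR_space_iff)
 thus "f + g : RR_space F D" using fg C_subfield_add[OF F] by (auto simp: RR_space_iff)
next
 fix c f assume f: "f : RR_space F D"
 have "mero_scale c f * unif R powi D R : R" if "R : places F" for R
  unfolding mero_scale_def mult.assoc
  by (rule valuation_ring.mult_mem[OF valuation_ring[OF that] valuation_ring.const_mem[OF valuation_ring[OF that]]])
   (use f that in \<open>simp add: RR_space_iff\<close>)
 thus "mero_scale c f : RR_space F D" using f C_subfield_mult[OF F C_subfield_const[OF F]] by (auto simp: RR_space_iff mero_scale_def)
qed

lemma RR_mono: "(!!R. R : places F ==> D R <= D' R) ==> RR_space F D <= RR_space F D'" by (fastforce simp: RR_space_def)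

lemma RR_codim_le_1:
 assumes P: "P : places F" and D': "D' = D(P := D P + 1)"
  and f: "f : RR_space F D'" and g: "g : RR_space F D'" "g ~: RR_space F D"
 shows "EX c. f - mero_scale c g : RR_space F D"
proof -
 interpret curve_place F x n P by (rule curve_place[OF P])
 define lead where "lead h = h * \<pi> powi (D P + 1)" for h
 have lead_mem: "lead h : P" if "h : RR_space F D'" for h proof -
  have "h * \<pi> powi D' P : P" using that P unfolding RR_space_iff by blast
  thus ?thesis by (simp add: lead_def D')
 qed
 have lead_maximal: "h : RR_space F D" if h: "h : RR_space F D'" "lead h : \<mm>" for h proof -
  have "h * \<pi> powi D P : P" using h(2) unif_nonzero unfolding maximal_iff_divide lead_def by (simp add: power_int_add)
  moreover have "h * unif R powi D R : R" if "R : places F" "R ~= P" for R proof -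
   have "h * unif R powi D' R : R" using h(1) that(1) by (simp add: RR_space_iff)
   thus ?thesis using that(2) by (simp add: D')
  qed
  ultimately show ?thesis using h(1) unfolding RR_space_iff by metis
 qed
 have "lead g ~: \<mm>" using lead_maximal g by blast
 hence inv: "inverse (lead g) : P" "lead g ~= 0" using lead_mem[OF g(1)] maximal_iff by blast+
 obtain c where c: "lead f * inverse (lead g) - mero_const c : \<mm>" using residue[OF mult_mem[OF lead_mem[OF f] inv(1)]] by blast
 have "(lead f * inverse (lead g) - mero_const c) * lead g : \<mm>" by (intro maximal_mult_left c lead_mem g)
 also have "(lead f * inverse (lead g) - mero_const c) * lead g = lead f - mero_const c * lead g"
  using inv(2) by (simp add: left_diff_distrib mult.assoc)
 also have "... = lead (f - mero_scale c g)" by (simp add: lead_def mero_scale_def left_diff_distrib mult.assoc)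
 finally show ?thesis using lead_maximal[OF mero.subspace_diff[OF RR_subspace f mero.subspace_scale[OF RR_subspace g(1)]]] by blast
qed

lemma RR_basis_step:
 assumes P: "P : places F" and B: "finite_basis B (RR_space F D)"
 shows "EX B'. finite_basis B' (RR_space F (D(P := D P + 1))) & card B' <= Suc (card B)"
proof -
 define D' where "D' = D(P := D P + 1)"
 have sub: "RR_space F D <= RR_space F D'" by (rule RR_mono) (auto simp: D'_def)
 show ?thesis proof (cases "RR_space F D' <= RR_space F D")
  case True
  thus ?thesis using B sub D'_def by (intro exI[of _ B]) auto
 next
  case False
  then obtain g where g: "g : RR_space F D'" "g ~: RR_space F D" by blast
  have fin: "finite B" "mero.independent B" "mero.span B = RR_space F D" using B by (auto simp: finite_basis_def)
  have "mero.independent (insert g B)" using fin g by (intro mero.independent_insertI) auto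
  moreover have "mero.span (insert g B) = RR_space F D'" proof
   have "B <= RR_space F D'" using mero.span_superset[of B] fin(3) sub by blast
   thus "mero.span (insert g B) <= RR_space F D'" using g by (intro mero.span_minimal RR_subspace) auto
   show "RR_space F D' <= mero.span (insert g B)" using RR_codim_le_1[OF P D'_def _ g] by (auto simp: mero.span_breakdown_eq fin(3))
  qed
  ultimately have "finite_basis (insert g B) (RR_space F D')" using fin by (simp add: finite_basis_def)
  moreover have "card (insert g B) <= Suc (card B)" by (rule card_insert_le_m1) simp_all
  ultimately show ?thesis unfolding D'_def by blast
 qed
qed

lemma RR_basis_raise:
 assumes P: "P : places F" and B: "finite_basis B (RR_space F D)"
 shows "EX B'. finite_basis B' (RR_space F (D(P := D P + int k))) & card B' <= card B + k"
proof (induction k)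
 case 0
 show ?case using B by auto
next
 case (Suc k)
 then obtain B' where B': "finite_basis B' (RR_space F (D(P := D P + int k)))" "card B' <= card B + k" by blast
 have "(D(P := D P + int k))(P := (D(P := D P + int k)) P + 1) = D(P := D P + int (Suc k))" by auto
 with RR_basis_step[OF P B'(1)] obtain B'' where
  "finite_basis B'' (RR_space F (D(P := D P + int (Suc k))))" "card B'' <= Suc (card B')" by metis
 moreover from this B'(2) have "card B'' <= card B + Suc k" by simp
 ultimately show ?case by blast
qed

lemma RR_basis_chain:
 assumes "finite T" "T <= places F"
  and "!!R. R ~: T ==> D R = D' R" "!!R. R : T ==> D R <= D' R" "finite_basis B (RR_space F D)"
 shows "EX B'. finite_basis B' (RR_space F D') & int (card B') <= int (card B) + (SUM R:T. D' R - D R)" using assms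
proof (induction T arbitrary: D B rule: finite_induct)
 case empty
 hence "D = D'" by auto
 thus ?case using empty by auto
next
 case (insert P T)
 define D1 where "D1 = D(P := D' P)"
 have D1: "D1 = D(P := D P + int (nat (D' P - D P)))" using insert.prems(3)[of P] by (simp add: D1_def)
 have "P : places F" using insert.prems(1) by simp
 from RR_basis_raise[OF this insert.prems(4), of "nat (D' P - D P)", folded D1]
 obtain B1 where B1: "finite_basis B1 (RR_space F D1)" "card B1 <= card B + nat (D' P - D P)" by blast
 have "EX B'. finite_basis B' (RR_space F D') & int (card B') <= int (card B1) + (SUM R:T. D' R - D1 R)"
  by (rule insert.IH[OF _ _ _ B1(1)]) (use insert.prems insert.hyps in \<open>auto simp: D1_def\<close>)
 moreover have "(SUM R:T. D' R - D1 R) = (SUM R:T. D' R - D R)" using insert.hyps by (intro sum.cong) (auto simp: D1_def)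
 moreover have "int (card B1) <= int (card B) + (D' P - D P)" using B1(2) insert.prems(3)[of P] by simp
 ultimately show ?case using insert.hyps by (force intro: order_trans)
qed

lemma regular_imp_const:
 assumes f: "f : F" "!!R. R : places F ==> f : R"
 shows "f : range mero_const"
proof (rule ccontr)
 assume no: "f ~: range mero_const"
 have "inverse f ~: range mero_const" proof
  assume "inverse f : range mero_const"
  then obtain c where "inverse f = mero_const c" by blast
  hence "f = mero_const (inverse c)" by (metis inverse_inverse_eq mero_const_inverse)
  thus False using no by blast
 qed
 then obtain Q where Q: "Q : places F" "inverse f : max_ideal Q" using place_over[OF F C_subfield_inverse[OF F f(1)]] by blast
 interpret valuation_ring F Q by (rule valuation_ring[OF Q(1)])
 have "f ~= 0" using no mero_const_0 by (metis rangeI)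
 thus False using maximal_mult_left[OF Q(2) f(2)[OF Q(1)]] one_not_maximal by simp
qed

lemma RR_zero_divisor: "finite_basis {1} (RR_space F (%_. 0))"
proof -
 have "RR_space F (%_. 0) = range mero_const"
  using regular_imp_const C_subfield_const[OF F] valuation_ring.const_mem[OF valuation_ring] by (auto simp: RR_space_iff)
 moreover have "mero.span {1} = range mero_const" by (simp add: mero.span_singleton mero_scale_def)
 ultimately show ?thesis by (simp add: finite_basis_def)
qed

lemma RR_basis:
 assumes D: "D : divisors F"
 obtains B where "finite_basis B (RR_space F D)" "card B = RR_dim F D"
proof -
 define D' where "D' R = max 0 (D R)" for R
 have "EX B'. finite_basis B' (RR_space F D') & int (card B') <= int (card {1::mero}) + (SUM R | D R ~= 0. D' R - 0)"
  by (rule RR_basis_chain[OF _ _ _ _ RR_zero_divisor]) (use D in \<open>auto simp: divisors_def D'_def\<close>)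
 then obtain B' where "finite_basis B' (RR_space F D')" by blast
 hence B': "finite B'" "mero.span B' = RR_space F D'" by (auto simp: finite_basis_def)
 have sub: "RR_space F D <= RR_space F D'" by (rule RR_mono) (simp add: D'_def)
 obtain B where B: "B <= RR_space F D" "mero.independent B" "RR_space F D <= mero.span B" using mero.basis_exists by metis
 have "finite B" using mero.independent_span_bound[OF B'(1) B(2)] B(1) sub B'(2) by blast
 moreover have "mero.span B = RR_space F D" using B mero.span_minimal[OF B(1) RR_subspace] by blast
 ultimately have basis: "finite_basis B (RR_space F D)" using B by (simp add: finite_basis_def)
 thus ?thesis using that finite_basis_dim[OF basis] by (simp add: RR_dim_def)
qed

lemma RR_dim_mono:
 assumes D: "D : divisors F" "D' : divisors F" "!!R. D R <= D' R"
 shows "int (RR_dim F D') <= int (RR_dim F D) + div_degree D' - div_degree D"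
proof -
 define T where "T = {R. D R ~= 0} \<union> {R. D' R ~= 0}"
 have T: "finite T" "T <= places F" using D by (auto simp: T_def divisors_def)
 obtain B where B: "finite_basis B (RR_space F D)" "card B = RR_dim F D" using RR_basis[OF D(1)] by blast
 have "EX B'. finite_basis B' (RR_space F D') & int (card B') <= int (card B) + (SUM R:T. D' R - D R)"
  by (rule RR_basis_chain[OF T _ _ B(1)]) (use D(3) in \<open>auto simp: T_def\<close>)
 then obtain B' where B': "finite_basis B' (RR_space F D')" "int (card B') <= int (card B) + (SUM R:T. D' R - D R)" by blast
 have "div_degree D = (SUM R:T. D R)" "div_degree D' = (SUM R:T. D' R)"
  unfolding div_degree_def using T by (intro sum.mono_neutral_left; auto simp: T_def)+
 thus ?thesis using B'(2) B(2) finite_basis_dim[OF B'(1)] by (simp add: RR_dim_def sum_subtractf)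
qed

lemma RR_dim_ge_card:
 assumes D: "D : divisors F" and A: "mero.independent A" "finite A" and H: "H ~= 0" and mem: "!!a. a : A ==> a / H : RR_space F D"
 shows "card A <= RR_dim F D"
proof -
 obtain B where B: "finite_basis B (RR_space F D)" "card B = RR_dim F D" using RR_basis[OF D] by blast
 define HB where "HB = (%b. H * b) ` B"
 have "mero.span B <= {b. H * b : mero.span HB}" proof (rule mero.span_minimal)
  show "B <= {b. H * b : mero.span HB}" by (auto simp: HB_def intro!: mero.span_base)
  have "mero_scale c (H * a) = H * mero_scale c a" for c a by (simp add: mero_scale_def mult_ac)
  thus "mero.subspace {b. H * b : mero.span HB}"
   by (intro mero.subspaceI) (auto simp: distrib_left mero.span_zero mero.span_add dest: mero.span_scale)
 qed
 hence "H * (a / H) : mero.span HB" if "a : A" for a using mem[OF that] B(1) by (auto simp: finite_basis_def)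
 hence "A <= mero.span HB" using H by auto
 hence "card A <= card HB" using mero.independent_span_bound[of HB A] A B(1) by (auto simp: finite_basis_def HB_def)
 also have "... <= card B" unfolding HB_def using B(1) by (intro card_image_le) (auto simp: finite_basis_def)
 finally show ?thesis by (simp add: B(2))
qed

subsection \<open>Riemann's inequality\<close>

definition zeros :: "mero => mero set => int" where
 "zeros t R = (if R : places F then max 0 (place_ord R t) else 0)"

lemma zeros_support:
 assumes t: "t : params"
 shows "{R. zeros t R ~= 0} <= {R : places F. t : max_ideal R}"
proof
 fix R assume "R : {R. zeros t R ~= 0}"
 hence "R : places F" "0 < place_ord R t" by (auto simp: zeros_def split: if_splits)
 thus "R : {R : places F. t : max_ideal R}" using curve_place.ord_pos[OF curve_place params_mem_F[OF t] params_nonzero[OF t]] by simp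
qed

lemma sum_zeros_le:
 assumes t: "t : params" and S: "finite S" "S <= places F"
 shows "(SUM R:S. zeros t R) <= int n"
proof -
 define S' where "S' = {R : S. t : max_ideal R}"
 have "(SUM R:S. zeros t R) = (SUM R:S'. zeros t R)" by (rule sum.mono_neutral_right) (use S zeros_support[OF t] in \<open>auto simp: S'_def\<close>)
 also have "... = (SUM R:S'. place_ord R t)"
  using curve_place.ord_pos[OF curve_place params_mem_F[OF t] params_nonzero[OF t]] S(2)
  by (intro sum.cong) (auto simp: S'_def zeros_def subset_iff intro: max_absorb2 less_imp_le)
 also have "... <= int n" by (rule fundamental_inequality[OF t]) (use S in \<open>auto simp: S'_def\<close>)
 finally show ?thesis .
qed

text \<open>The divisor of zeros of \<open>(\<Prod>t\<in>P. t)^N\<close>, with each parameter counted separately.\<close>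
definition param_divisor :: "mero set => nat => mero set => int" where
 "param_divisor P N R = int N * (SUM t:P. zeros t R)"

lemma
 assumes P: "finite P" "P <= params"
 shows param_divisor: "param_divisor P N : divisors F" and degree_param_divisor:
  "div_degree (param_divisor P N) <= int n * int (N * card P)"
proof -
 define S where "S = (UN t:P. {R : places F. t : max_ideal R})"
 have S: "finite S" "S <= places F" using P finite_fibre by (auto simp: S_def)
 have "zeros t R = 0" if "t : P" "R ~: S" for t R using zeros_support[of t] that P(2) unfolding S_def by blast
 hence support: "{R. param_divisor P N R ~= 0} <= S" by (auto simp: param_divisor_def intro: sum.neutral ccontr)
 thus "param_divisor P N : divisors F" using S finite_subset by (auto simp: divisors_def)
 have "div_degree (param_divisor P N) = (SUM R:S. param_divisor P N R)" unfolding div_degree_def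
  by (rule sum.mono_neutral_left) (use support S in auto)
 also have "... = int N * (SUM t:P. SUM R:S. zeros t R)" unfolding param_divisor_def sum_distrib_left[symmetric] by (subst sum.swap) simp
 also have "... <= int N * (SUM t:P. int n)" using P by (intro mult_left_mono sum_mono sum_zeros_le S) auto
 finally show "div_degree (param_divisor P N) <= int n * int (N * card P)" by (simp add: algebra_simps)
qed

lemma divisor_le_param_divisor:
 assumes D: "D : divisors F"
 obtains P N where "finite P" "P <= params" "inverse x : P" "!!R. D R <= param_divisor P N R"
proof -
 define T where "T = {R. D R ~= 0}"
 have T: "finite T" "T <= places F" using D by (auto simp: T_def divisors_def)
 have "ALL R:T. EX t. t : params & t : max_ideal R" using curve_place.exists_param[OF curve_place] T(2) by (metis subsetD)
 from bchoice[OF this] obtain \<tau> where \<tau>: "ALL R:T. \<tau> R : params & \<tau> R : max_ideal R" ..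
 define P where "P = insert (inverse x) (\<tau> ` T)"
 define N where "N = nat (SUM R:T. \<bar>D R\<bar>)"
 have P: "finite P" "P <= params" "inverse x : P" using T \<tau> by (auto simp: P_def params_def)
 moreover have "D R <= param_divisor P N R" for R proof (cases "R : T")
  case False
  thus ?thesis by (auto simp: T_def param_divisor_def zeros_def intro!: mult_nonneg_nonneg sum_nonneg)
 next
  case True
  hence "\<tau> R : params" "\<tau> R : max_ideal R" "R : places F" using \<tau> T(2) by auto
  hence "1 <= zeros (\<tau> R) R" using curve_place.ord_pos[OF curve_place params_mem_F params_nonzero] by (force simp: zeros_def)
  also have "... <= (SUM t:P. zeros t R)" using True P(1) by (intro member_le_sum) (auto simp: P_def zeros_def)
  finally have "int N * 1 <= param_divisor P N R" unfolding param_divisor_def by (intro mult_left_mono) auto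
  moreover have "\<bar>D R\<bar> <= (SUM R:T. \<bar>D R\<bar>)" using True T by (intro member_le_sum) auto
  ultimately show ?thesis by (simp add: N_def)
 qed
 ultimately show ?thesis by (rule that)
qed

lemma ord_shift_at_pole:
 assumes pole: "R : places F" "x ~: R"
 shows "place_ord R (x - mero_const c) = - place_ord R (inverse x)" "place_ord R (inverse x) > 0"
proof -
 interpret curve_place F x n R by (rule curve_place[OF pole(1)])
 have inv: "inverse x : \<mm>" by (rule inverse_maximal[OF x pole(2)])
 show "ord (inverse x) > 0" using ord_pos[of "inverse x"] inv x_nonzero C_subfield_inverse[OF F x] by simp
 define v where "v = 1 + mero_const (- c) * inverse x"
 have tail: "mero_const (- c) * inverse x : \<mm>" by (rule maximal_mult_right[OF const_mem inv])
 have v: "v : R" "v ~: \<mm>" unfolding v_def by (intro add_mem one_mem maximal_mem[OF tail] add_not_maximal[OF one_not_maximal tail])+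
 have "x - mero_const c = x * v" using x_nonzero by (simp add: v_def field_simps mero_const_minus)
 thus "ord (x - mero_const c) = - ord (inverse x)"
  using ord_mult[OF x x_nonzero mem_F[OF v(1)]] ord_unit[OF v] ord_inverse[OF x x_nonzero] v zero_maximal by auto
qed

lemma quotient_mem_RR_space:
 assumes P: "finite P" "P <= params" "inverse x : P" and a: "a : F" "a ~= 0"
  and regular: "ALL R:places F. (x : R --> a : R) & (x ~: R --> a / x ^ (N * card P) : R)"
 defines "Q == P - {inverse x}"
 shows "a / (PROD t:Q. t ^ N) : RR_space F (param_divisor P N)"
proof -
 have Q: "finite Q" "Q <= params" "Q <= range (%c. x - mero_const c)" using P by (auto simp: Q_def params_def)
 have QF: "t ^ N : F & t ^ N ~= 0" if "t : Q" for t using that Q(2) params_mem_F params_nonzero by (auto intro: C_subfield_power[OF F])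
 define H where "H = (PROD t:Q. t ^ N)"
 have H: "H : F" "H ~= 0" using QF Q(1) by (auto simp: H_def intro!: C_subfield_prod[OF F])
 have "- param_divisor P N R <= place_ord R (a / H)" if R: "R : places F" for R proof -
  interpret curve_place F x n R by (rule curve_place[OF R])
  have "ord H = (SUM t:Q. ord (t ^ N))" unfolding H_def using Q(1) QF by (rule ord_prod)
  also have "... = int N * (SUM t:Q. ord t)"
   unfolding sum_distrib_left using Q(2) params_mem_F params_nonzero by (intro sum.cong) (auto simp: ord_power)
  finally have ord_H: "ord H = int N * (SUM t:Q. ord t)" .
  have zeros_P: "(SUM t:P. zeros t R) = zeros (inverse x) R + (SUM t:Q. zeros t R)" unfolding Q_def by (rule sum.remove[OF P(1,3)])
  have "ord H - param_divisor P N R <= ord a" proof (cases "x : R")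
   case True
   have "(SUM t:Q. ord t) <= (SUM t:Q. zeros t R)" by (intro sum_mono) (simp add: zeros_def R)
   moreover have "0 <= zeros (inverse x) R" by (simp add: zeros_def)
   ultimately have "ord H <= param_divisor P N R" unfolding ord_H param_divisor_def zeros_P by (intro mult_left_mono) auto
   moreover have "0 <= ord a" using regular R True ord_nonneg[OF a] by blast
   ultimately show ?thesis by linarith
  next
   case False
   define k where "k = ord (inverse x)"
   have "ord t = - k" if "t : Q" for t using that Q(3) ord_shift_at_pole(1)[OF R False] by (auto simp: k_def)
   hence "ord H = - (int N * int (card Q) * k)" unfolding ord_H by simp
   moreover have "0 <= (SUM t:Q. zeros t R)" by (intro sum_nonneg) (simp add: zeros_def)
   hence "k <= (SUM t:P. zeros t R)" unfolding zeros_P using ord_shift_at_pole(2)[OF R False] by (simp add: zeros_def R k_def)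
   hence "int N * k <= param_divisor P N R" unfolding param_divisor_def by (intro mult_left_mono) auto
   moreover have "a / x ^ (N * card P) : R" using regular R False by blast
   hence "0 <= ord a + int (N * card P) * k" using ord_nonneg[of "a / x ^ (N * card P)"] a x x_nonzero
    by (simp add: C_subfield_divide[OF F] C_subfield_power[OF F] ord_divide ord_power ord_inverse k_def)
   moreover have "card P = Suc (card Q)" unfolding Q_def using P by (metis card_Suc_Diff1)
   hence "int (N * card P) * k = int N * int (card Q) * k + int N * k" by (simp add: algebra_simps)
   ultimately show ?thesis by linarith
  qed
  thus ?thesis using ord_divide[OF a H] by simp
 qed
 thus ?thesis unfolding H_def[symmetric] RR_space_def using C_subfield_divide[OF F a(1) H(1)] by blast
qed

theorem genus_bound:
 fixes g :: nat
 assumes A: "!!M. EX A. finite A & mero.independent A & int n * int M + 1 - int g <= int (card A) &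
   (ALL a:A. a : F & (ALL R:places F. (x : R --> a : R) & (x ~: R --> a / x ^ M : R)))"
  and D: "D : divisors F"
 shows "div_degree D - int (RR_dim F D) + 1 <= int g"
proof -
 obtain P N where P: "finite P" "P <= params" "inverse x : P" and le: "!!R. D R <= param_divisor P N R"
  using divisor_le_param_divisor[OF D] by metis
 note D1 = param_divisor[OF P(1,2), of N]
 obtain A where A: "finite A" "mero.independent A" "int n * int (N * card P) + 1 - int g <= int (card A)"
  "ALL a:A. a : F & (ALL R:places F. (x : R --> a : R) & (x ~: R --> a / x ^ (N * card P) : R))" using A[of "N * card P"] by blast
 define H where "H = (PROD t:P - {inverse x}. t ^ N)"
 have "t ~= 0" if "t : P" for t using that P(2) params_nonzero by blast
 hence "H ~= 0" using P(1) by (auto simp: H_def)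
 moreover have "a / H : RR_space F (param_divisor P N)" if a: "a : A" for a proof -
  have "a ~= 0" using a A(2) mero.dependent_zero by blast
  thus ?thesis unfolding H_def using A(4) a by (intro quotient_mem_RR_space P) auto
 qed
 ultimately have "card A <= RR_dim F (param_divisor P N)" by (intro RR_dim_ge_card[OF D1 A(2,1)])
 thus ?thesis using RR_dim_mono[OF D D1 le] degree_param_divisor[OF P(1,2), of N] A(3) by linarith
qed

end

section \<open>A superelliptic curve\<close>

subsection \<open>Preliminaries\<close>

text \<open>One step of fraction-free Gaussian elimination on the last coordinate.\<close>
lemma dependent_vectors:
 fixes V :: "'b => nat => 'a :: idom"
 assumes "finite I" "card I = Suc n"
 shows "EX c. (EX i:I. c i ~= 0) & (ALL j<n. (SUM i:I. c i * V i j) = 0)" using assms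
proof (induction n arbitrary: I V)
 case 0
 then obtain i where "i : I" by (metis card.empty ex_in_conv nat.distinct(1))
 thus ?case by (intro exI[of _ "%_. 1"]) auto
next
 case (Suc n)
 have "EX k p. k : I & p ~= 0 & (ALL i:I. V i n * (p - V k n) = 0)" proof (cases "EX k:I. V k n ~= 0")
  case True
  then obtain k where "k : I" "V k n ~= 0" by blast
  thus ?thesis by (intro exI[of _ k] exI[of _ "V k n"]) simp
 next
  case False
  obtain k where "k : I" using Suc.prems by (metis card.empty ex_in_conv nat.distinct(1))
  thus ?thesis using False by (intro exI[of _ k] exI[of _ 1]) simp
 qed
 then obtain k p where k: "k : I" "p ~= 0" "!!i. i : I ==> V i n * (p - V k n) = 0" by blast
 have "finite (I - {k})" "card (I - {k}) = Suc n" using Suc.prems k(1) by auto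
 from Suc.IH[OF this, of "%i j. p * V i j - V i n * V k j"]
 obtain c where c: "EX i:I - {k}. c i ~= 0" "ALL j<n. (SUM i:I - {k}. c i * (p * V i j - V i n * V k j)) = 0" by blast
 define b where "b i = (if i = k then - (SUM i:I - {k}. c i * V i n) else c i * p)" for i
 have sum_b: "(SUM i:I. b i * V i j) = (SUM i:I - {k}. c i * (p * V i j - V i n * V k j))" for j proof -
  have "(SUM i:I. b i * V i j) = b k * V k j + (SUM i:I - {k}. b i * V i j)" using Suc.prems k(1) by (intro sum.remove) auto
  also have "(SUM i:I - {k}. b i * V i j) = (SUM i:I - {k}. c i * p * V i j)" by (rule sum.cong) (auto simp: b_def)
  also have "b k * V k j = - (SUM i:I - {k}. c i * V i n * V k j)" by (simp add: b_def sum_distrib_right)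
  finally show ?thesis by (simp add: sum_subtractf algebra_simps)
 qed
 have "p * V i n - V i n * V k n = 0" if "i : I" for i using k(3)[OF that] by (simp add: algebra_simps)
 hence "(SUM i:I - {k}. c i * (p * V i n - V i n * V k n)) = 0" by (intro sum.neutral) simp
 hence "(SUM i:I. b i * V i j) = 0" if "j < Suc n" for j using that c(2) unfolding sum_b by (cases "j = n") auto
 moreover have "EX i:I. b i ~= 0" using c(1) k(2) by (auto simp: b_def)
 ultimately show ?case by blast
qed

lemma independent_family:
 assumes I: "finite I" and c: "!!c. (SUM i:I. mero_const (c i) * h i) = 0 ==> (ALL i:I. c i = 0)"
 shows "inj_on h I" "mero.independent (h ` I)"
proof -
 show inj: "inj_on h I" proof (rule inj_onI, rule ccontr)
  fix i j assume ij: "i : I" "j : I" "h i = h j" "i ~= j"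
  define u where "u k = (if k = i then 1 else if k = j then - 1 else 0 :: complex)" for k
  have "(SUM k:I. mero_const (u k) * h k) = (SUM k:{i, j}. mero_const (u k) * h k)"
   using I ij by (intro sum.mono_neutral_right) (auto simp: u_def mero_const_0)
  also have "... = 0" using ij by (simp add: u_def mero_const_1 mero_const_minus)
  finally have "u i = 0" using c ij by blast
  thus False by (simp add: u_def)
 qed
 show "mero.independent (h ` I)" proof
  assume "mero.dependent (h ` I)"
  then obtain u where u: "EX v:h ` I. u v ~= 0" "(SUM v:h ` I. mero_scale (u v) v) = 0" using mero.dependent_finite[of "h ` I"] I by auto
  have "(SUM i:I. mero_const (u (h i)) * h i) = 0" using u(2) by (simp add: sum.reindex[OF inj] mero_scale_def)
  from c[OF this] show False using u(1) by auto
 qed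
qed

lemma C_subfield_eval1: "C_subfield F ==> t : F ==> eval1 p t : F" by (induction p) (auto intro!: C_subfield_closed)

context curve
begin

lemma eval1_mem_F: "eval1 p x : F" by (rule C_subfield_eval1[OF F x])

lemma eval1_nonzero: "p ~= 0 ==> eval1 p x ~= 0" using eval1_eq_0[OF trans] by blast

lemma shift_not_const: "x - mero_const c ~: range mero_const"
proof
 assume "x - mero_const c : range mero_const"
 then obtain k where "x - mero_const c = mero_const k" by blast
 hence "x = mero_const (k + c)" by (simp add: mero_const_add algebra_simps)
 thus False using trans by blast
qed

lemma inverse_not_const: "inverse x ~: range mero_const"
proof
 assume "inverse x : range mero_const"
 then obtain c where "inverse x = mero_const c" by blast
 hence "x = mero_const (inverse c)" by (metis inverse_inverse_eq mero_const_inverse)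
 thus False using trans by blast
qed

end

context curve_place
begin

lemma eval1_at_infinity:
 assumes pole: "x ~: R" and p: "p ~= 0"
 shows "eval1 p x / x ^ degree p : R" "eval1 p x / x ^ degree p ~: \<mm>"
proof -
 define k where "k = degree p"
 define B where "B = (SUM i<k. mero_const (coeff p i) * inverse x ^ (k - i))"
 have "eval1 p x / x ^ k = (SUM i<=k. mero_const (coeff p i) * inverse x ^ (k - i))"
  unfolding eval1_altdef[of p k, unfolded k_def[symmetric], OF order_refl] sum_divide_distrib
  using x_nonzero by (intro sum.cong) (auto simp: power_diff field_simps power_inverse)
 also have "... = mero_const (lead_coeff p) + B" by (simp add: B_def k_def lessThan_Suc_atMost[symmetric])
 finally have lead: "eval1 p x / x ^ degree p = mero_const (lead_coeff p) + B" by (simp only: k_def)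
 have B: "B : \<mm>" unfolding B_def by (intro maximal_sum maximal_mult_right const_mem power_maximal inverse_maximal x pole) simp
 show "eval1 p x / x ^ degree p : R" unfolding lead by (intro add_mem const_mem maximal_mem B)
 show "eval1 p x / x ^ degree p ~: \<mm>" unfolding lead using p by (intro add_not_maximal const_not_maximal B) simp
qed

lemma ord_at_infinity:
 assumes "x ~: R" "p ~= 0"
 shows "ord (eval1 p x) = int (degree p) * ord x"
proof -
 have "ord (eval1 p x / x ^ degree p) = 0" using eval1_at_infinity[OF assms] by (intro ord_unit)
 thus ?thesis using x_nonzero x by (simp add: ord_divide ord_power eval1_mem_F eval1_nonzero[OF assms(2)] C_subfield_power[OF F])
qed

lemma ord_at_point:
 assumes c: "x - mero_const c : \<mm>" and p: "p ~= 0"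
 shows "ord (eval1 p x) = int (order c p) * ord (x - mero_const c)"
proof -
 define l where "l = x - mero_const c"
 have l: "l : F" "l ~= 0" using x trans by (auto simp: l_def intro!: C_subfield_closed[OF F])
 have "l + mero_const c : R" using c by (intro add_mem const_mem maximal_mem) (simp add: l_def)
 hence xR: "x : R" by (simp add: l_def)
 obtain q where q: "p = [:- c, 1:] ^ order c p * q" "~ [:- c, 1:] dvd q" using order_decomp[OF p] by blast
 have q0: "poly q c ~= 0" "q ~= 0" using q by (auto simp: poly_eq_0_iff_dvd)
 have "eval1 q x ~: \<mm>" proof
  assume "eval1 q x : \<mm>"
  then obtain d where d: "poly q d = 0" "x - mero_const d : \<mm>" using maximal_poly_root[OF xR q0(2)] by blast
  have "mero_const (d - c) : \<mm>" using maximal_diff[OF c d(2)] by (simp add: mero_const_diff)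
  thus False using const_not_maximal[of "d - c"] d(1) q0(1) by auto
 qed
 hence "ord (eval1 q x) = 0" using eval1_mem[OF xR] by (intro ord_unit)
 moreover have "eval1 p x = l ^ order c p * eval1 q x" by (subst q(1)) (simp add: eval1_mult eval1_power l_def mero_const_minus mero_const_1)
 ultimately show ?thesis using l by (simp add: ord_mult ord_power eval1_mem_F eval1_nonzero[OF q0(2)] C_subfield_power[OF F] flip: l_def)
qed

end

subsection \<open>The function field\<close>

locale superelliptic =
 fixes x y w :: mero and f g :: "complex poly"
 assumes trans: "x ~: range mero_const"
  and y_square: "y ^ 2 = eval1 g x * w" and w_square: "w ^ 2 = eval1 f x * y" and y_mult_w: "y * w = eval1 (f * g) x"
  and degree_f: "degree f = 3" and degree_g: "degree g = 2" and squarefree: "rsquarefree (f * g)"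
begin

abbreviation e where "e p == eval1 p x"

definition lincomb where "lincomb a b c = e a + e b * y + e c * w"

definition K where "K = C_adjoin {x, y, w}"

definition norm_poly where "norm_poly a b c = a ^ 3 + b ^ 3 * f * g ^ 2 + c ^ 3 * f ^ 2 * g - 3 * a * b * c * f * g"

lemma f_nonzero: "f ~= 0" and g_nonzero: "g ~= 0" using degree_f degree_g by auto

lemma dominant_degree_nonzero:
 fixes p q r s :: "complex poly"
 assumes "p ~= 0" "q = 0 | degree q < degree p" "r = 0 | degree r < degree p" "s = 0 | degree s < degree p"
 shows "p + q + r - s ~= 0"
proof -
 have "coeff (p + q + r - s) (degree p) = lead_coeff p" using assms(2-4) by (auto simp: coeff_eq_0)
 thus ?thesis using assms(1) by (metis coeff_0 leading_coeff_0_iff)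
qed

text \<open>The degrees of the three cubes are distinct modulo 3, so one of them dominates.\<close>
lemma norm_poly_nonzero:
 assumes "a ~= 0 | b ~= 0 | c ~= 0"
 shows "norm_poly a b c ~= 0"
proof -
 define A B C E where "A = a ^ 3" and "B = b ^ 3 * f * g ^ 2" and "C = c ^ 3 * f ^ 2 * g" and "E = 3 * a * b * c * f * g"
 note nz = f_nonzero g_nonzero
 have zero: "A = 0 \<longleftrightarrow> a = 0" "B = 0 \<longleftrightarrow> b = 0" "C = 0 \<longleftrightarrow> c = 0" "E = 0 \<longleftrightarrow> a = 0 | b = 0 | c = 0"
  using nz by (auto simp: A_def B_def C_def E_def)
 have "degree (3 :: complex poly) = 0" by (simp add: numeral_poly)
 hence degs: "A ~= 0 ==> degree A = 3 * degree a" "B ~= 0 ==> degree B = 3 * degree b + 7" "C ~= 0 ==> degree C = 3 * degree c + 8"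
  "E ~= 0 ==> degree E = degree a + degree b + degree c + 5"
  by (auto simp: A_def B_def C_def E_def degree_mult_eq degree_power_eq nz degree_f degree_g)
 have norm: "norm_poly a b c = A + B + C - E" by (simp add: norm_poly_def A_def B_def C_def E_def)
 have mod_3: "3 * m ~= 3 * n + (7 :: nat)" "3 * m ~= 3 * n + (8 :: nat)" "3 * m + 7 ~= 3 * n + (8 :: nat)" for m n by presburger+
 have "A ~= 0 | B ~= 0 | C ~= 0" using assms zero by blast
 moreover have "degree A ~= degree B | A = 0 | B = 0" "degree A ~= degree C | A = 0 | C = 0" "degree B ~= degree C | B = 0 | C = 0"
  using degs(1-3) mod_3 by metis+
 ultimately consider "A ~= 0" "B = 0 | degree B < degree A" "C = 0 | degree C < degree A"
  | "B ~= 0" "A = 0 | degree A < degree B" "C = 0 | degree C < degree B"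
  | "C ~= 0" "A = 0 | degree A < degree C" "B = 0 | degree B < degree C"
  by atomize_elim (cases "A = 0"; cases "B = 0"; cases "C = 0"; simp; arith)
 thus ?thesis proof cases
  case 1
  hence "E = 0 | degree E < degree A" using zero degs by auto
  thus ?thesis unfolding norm using 1 by (intro dominant_degree_nonzero)
 next
  case 2
  hence "E = 0 | degree E < degree B" using zero degs by auto
  hence "B + A + C - E ~= 0" using 2 by (intro dominant_degree_nonzero)
  thus ?thesis by (simp add: norm add_ac)
 next
  case 3
  hence "E = 0 | degree E < degree C" using zero degs by auto
  hence "C + A + B - E ~= 0" using 3 by (intro dominant_degree_nonzero)
  thus ?thesis by (simp add: norm add_ac)
 qed
qed

lemma lincomb_mult:
 "lincomb a b c * lincomb a' b' c' = lincomb (a * a' + (b * c' + c * b') * (f * g)) (a * b' + b * a' + c * c' * f) (a * c' + c * a' + b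
  * b' * g)"
proof -
 have "lincomb a b c * lincomb a' b' c' = e a * e a' + (e a * e b' + e b * e a') * y + (e a * e c' + e c * e a') * w
   + e b * e b' * y ^ 2 + e c * e c' * w ^ 2 + (e b * e c' + e c * e b') * (y
    * w)" by (simp add: lincomb_def algebra_simps power2_eq_square)
 thus ?thesis unfolding y_square w_square y_mult_w by (simp add: lincomb_def eval1_simps algebra_simps)
qed

lemma lincomb_conjugate: "lincomb a b c * lincomb (a ^ 2 - b * c * f * g) (c ^ 2 * f - a * b) (b ^ 2 * g - a * c) = e (norm_poly a b c)"
proof -
 have "a * (a ^ 2 - b * c * f * g) + (b * (b ^ 2 * g - a * c) + c * (c ^ 2 * f - a * b)) * (f * g) = norm_poly a b c"
  by (simp add: norm_poly_def algebra_simps power2_eq_square power3_eq_cube)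
 moreover have "a * (c ^ 2 * f - a * b) + b * (a ^ 2 - b * c * f * g) + c * (b ^ 2 * g - a * c) * f = 0"
  "a * (b ^ 2 * g - a * c) + c * (a ^ 2 - b * c * f * g) + b * (c ^ 2 * f - a * b) * g = 0"
  by (simp_all add: algebra_simps power2_eq_square)
 ultimately show ?thesis unfolding lincomb_mult by (simp add: lincomb_def)
qed

lemma lincomb_add: "lincomb a b c + lincomb a' b' c' = lincomb (a + a') (b + b') (c + c')"
 and lincomb_scale: "e d * lincomb a b c = lincomb (d * a) (d * b) (d * c)"
 and lincomb_minus: "- lincomb a b c = lincomb (- a) (- b) (- c)" by (simp_all add: lincomb_def eval1_simps algebra_simps)

lemma e_eq_0_iff: "e p = 0 \<longleftrightarrow> p = 0" using eval1_eq_0[OF trans, of p] by auto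

lemma lincomb_eq_0: "lincomb a b c = 0 ==> a = 0 & b = 0 & c = 0"
 using lincomb_conjugate[of a b c] norm_poly_nonzero[of a b c] e_eq_0_iff by auto

lemma lincomb_eq: "lincomb a b c = lincomb a' b' c' ==> a = a' & b = b' & c = c'"
 using lincomb_eq_0[of "a - a'" "b - b'" "c - c'"] by (simp add: lincomb_def eval1_simps algebra_simps)

lemma K_field: "C_subfield K" unfolding K_def by (rule C_subfield_hull)

lemma x_mem_K: "x : K" and y_mem_K: "y : K" and w_mem_K: "w : K" using C_adjoin_subset[of "{x, y, w}"] by (auto simp: K_def)

lemma e_mem_K: "e p : K" by (rule C_subfield_eval1[OF K_field x_mem_K])

lemma lincomb_mem_K: "lincomb a b c : K" unfolding lincomb_def by (intro C_subfield_add C_subfield_mult K_field e_mem_K y_mem_K w_mem_K)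

definition fractions where "fractions = {lincomb a b c / e d | a b c d. d ~= 0}"

lemma fractionI: "d ~= 0 ==> lincomb a b c / e d : fractions" unfolding fractions_def by blast

lemma lincomb_mem_fractions: "lincomb a b c : fractions" using fractionI[of 1 a b c] by simp

lemma
 assumes h: "h : fractions" and h': "h' : fractions"
 shows fractions_add: "h + h' : fractions" and fractions_mult: "h * h' : fractions"
proof -
 obtain a b c d where hd: "h = lincomb a b c / e d" "d ~= 0" using h unfolding fractions_def by blast
 obtain a' b' c' d' where hd': "h' = lincomb a' b' c' / e d'" "d' ~= 0" using h' unfolding fractions_def by blast
 have dd: "d * d' ~= 0" and nz: "e d ~= 0" "e d' ~= 0" using hd hd' e_eq_0_iff by auto
 have "h + h' = (e d' * lincomb a b c + e d * lincomb a' b' c') / e (d * d')" using nz by (simp add: hd hd' eval1_mult field_simps)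
 also have "... : fractions" unfolding lincomb_scale lincomb_add by (rule fractionI[OF dd])
 finally show "h + h' : fractions" .
 have "h * h' = (lincomb a b c * lincomb a' b' c') / e (d * d')" using nz by (simp add: hd hd' eval1_mult field_simps)
 also have "... : fractions" unfolding lincomb_mult by (rule fractionI[OF dd])
 finally show "h * h' : fractions" .
qed

lemma
 assumes h: "h : fractions"
 shows fractions_minus: "- h : fractions" and fractions_inverse: "inverse h : fractions"
proof -
 obtain a b c d where hd: "h = lincomb a b c / e d" "d ~= 0" using h unfolding fractions_def by blast
 have "- h = (- lincomb a b c) / e d" by (simp add: hd(1))
 also have "... : fractions" unfolding lincomb_minus by (rule fractionI[OF hd(2)])
 finally show "- h : fractions" .
 show "inverse h : fractions" proof (cases "a = 0 & b = 0 & c = 0")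
  case True
  hence "inverse h = lincomb 0 0 0" by (simp add: hd(1) lincomb_def)
  thus ?thesis by (simp only: lincomb_mem_fractions)
 next
  case False
  hence norm: "norm_poly a b c ~= 0" using norm_poly_nonzero by blast
  define r where "r = lincomb (a ^ 2 - b * c * f * g) (c ^ 2 * f - a * b) (b ^ 2 * g - a * c)"
  have conj: "lincomb a b c * r = e (norm_poly a b c)" unfolding r_def by (rule lincomb_conjugate)
  hence "lincomb a b c * r ~= 0" using norm e_eq_0_iff by simp
  hence "r ~= 0" by simp
  hence "inverse h = e d * r / (lincomb a b c * r)" by (simp add: hd(1))
  also have "... = e d * r / e (norm_poly a b c)" by (simp only: conj)
  also have "... : fractions" unfolding r_def lincomb_scale by (rule fractionI[OF norm])
  finally show ?thesis .
 qed
qed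

lemma K_lincomb:
 assumes "h : K"
 obtains a b c d where "d ~= 0" "h = lincomb a b c / e d"
proof -
 have "mero_const k = lincomb [:k:] 0 0" for k by (simp add: lincomb_def)
 hence "range mero_const <= fractions" using lincomb_mem_fractions by auto
 hence "C_subfield fractions" unfolding C_subfield_def by (simp add: fractions_add fractions_mult fractions_minus fractions_inverse)
 moreover have "x = lincomb [:0, 1:] 0 0" "y = lincomb 0 1 0" "w = lincomb 0 0 1" by (simp_all add: lincomb_def mero_const_0 mero_const_1)
 hence "x : fractions" "y : fractions" "w : fractions" by (metis lincomb_mem_fractions)+
 ultimately have "K <= fractions" unfolding K_def by (intro C_adjoin_minimal) auto
 thus ?thesis using that assms unfolding fractions_def by blast
qed

sublocale curve K x 3
proof
 fix h :: "nat => mero" assume h: "!!i. i <= 3 ==> h i : K"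
 have "EX a b c d. d ~= 0 & h i = lincomb a b c / e d" if "i <= 3" for i by (rule K_lincomb[OF h[OF that]]) (intro exI conjI)
 hence "ALL i. EX a b c d. i <= 3 --> d ~= 0 & h i = lincomb a b c / e d" by metis
 then obtain a b c d where "ALL i<=3. d i ~= 0 & h i = lincomb (a i) (b i) (c i) / e (d i)" by metis
 hence h_eq: "d i ~= 0" "h i = lincomb (a i) (b i) (c i) / e (d i)" if "i <= 3" for i using that by blast+
 define V where "V i j = (if j = 0 then a i else if j = 1 then b i else c i)" for i j :: nat
 obtain k where k: "EX i:{..3}. k i ~= 0" "ALL j<3. (SUM i:{..3}. k i * V i j) = 0"
  using dependent_vectors[of "{..3::nat}" 3 V] by auto
 have coords: "(SUM i<=3. k i * a i) = 0" "(SUM i<=3. k i * b i) = 0" "(SUM i<=3. k i * c i) = 0"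
  using k(2)[rule_format, of 0] k(2)[rule_format, of 1] k(2)[rule_format, of 2] by (simp_all add: V_def)
 have "(SUM i<=3. e (k i * d i) * h i) = (SUM i<=3. e (k i) * lincomb (a i) (b i) (c i))"
  using h_eq e_eq_0_iff by (intro sum.cong) (auto simp: eval1_mult)
 also have "... = e (SUM i<=3. k i * a i) + e (SUM i<=3. k i * b i) * y + e (SUM i<=3. k i * c i) * w"
  by (simp add: lincomb_def eval1_sum eval1_mult sum.distrib sum_distrib_right distrib_left mult.assoc)
 also have "... = 0" by (simp add: coords)
 finally have "(SUM i<=3. e (k i * d i) * h i) = 0" .
 moreover obtain i where "i <= 3" "k i ~= 0" using k(1) by auto
 hence "EX i<=3. k i * d i ~= 0" using h_eq(1) by auto
 ultimately show "EX q. (EX i<=3. q i ~= 0) & (SUM i<=3. e (q i) * h i) = 0" by (intro exI[of _ "%i. k i * d i"]) simp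
qed (rule K_field x_mem_K trans)+

end

subsection \<open>The cyclic automorphism\<close>

definition omega :: complex where
 "omega = (SOME z. z ^ 2 + z + 1 = 0)"

lemma omega: "omega ^ 2 + omega + 1 = 0"
proof -
 obtain z where "poly [:1, 1, 1 :: complex:] z = 0"
  using fundamental_theorem_of_algebra[of "[:1, 1, 1 :: complex:]"] by (auto simp: constant_degree)
 hence "EX z::complex. z ^ 2 + z + 1 = 0" by (intro exI[of _ z]) (simp add: power2_eq_square algebra_simps)
 thus ?thesis unfolding omega_def by (rule someI_ex)
qed

lemma omega_sq: "omega ^ 2 = - 1 - omega" using omega by (simp add: eq_diff_eq eq_neg_iff_add_eq_0 add.assoc)

lemma omega_mult: "omega * omega = - 1 - omega" using omega_sq by (simp add: power2_eq_square)

lemma omega_cube: "omega * omega ^ 2 = 1" "omega ^ 2 * omega = 1" "omega ^ 2 * omega ^ 2 = omega"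
 unfolding omega_sq by (simp_all add: algebra_simps omega_mult)

lemma omega_powers: "omega ^ 3 = 1" "omega ^ 4 = omega" "omega ^ 6 = 1"
proof -
 show cube: "omega ^ 3 = 1" using omega_cube(1) by (simp add: eval_nat_numeral)
 have "omega ^ 4 = omega * omega ^ 3" "omega ^ 6 = omega ^ 3 * omega ^ 3" by (simp_all add: eval_nat_numeral mult_ac)
 thus "omega ^ 4 = omega" "omega ^ 6 = 1" unfolding cube by simp_all
qed

lemma mero_omega_mult: "mero_const omega * mero_const omega = - 1 - mero_const omega"
 using arg_cong[OF omega_mult, of mero_const] by (simp add: mero_const_mult mero_const_diff mero_const_minus mero_const_1)

lemma mero_omega_square: "mero_const (omega ^ 2) = - 1 - mero_const omega"
 using arg_cong[OF omega_sq, of mero_const] by (simp add: mero_const_diff mero_const_minus mero_const_1)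

lemma mero_third: "mero_scale (1 / 3) (3 * k) = k"
 by (simp add: mero_scale_def mult.assoc[symmetric] mero_const_numeral[symmetric] mero_const_mult[symmetric] mero_const_1)

context superelliptic
begin

definition galois :: "mero => mero" where
 "galois h = (THE s. EX a b c d. d ~= 0 & h = lincomb a b c / e d & s = lincomb a (smult omega b) (smult (omega ^ 2) c) / e d)"

lemma galois_eq:
 assumes d: "d ~= 0"
 shows "galois (lincomb a b c / e d) = lincomb a (smult omega b) (smult (omega ^ 2) c) / e d" unfolding galois_def
proof (rule the_equality)
 show "EX a' b' c' d'. d' ~= 0 & lincomb a b c / e d = lincomb a' b' c' / e d' &
   lincomb a (smult omega b) (smult (omega ^ 2) c) / e d = lincomb a' (smult omega b') (smult (omega ^ 2) c') / e d'" using d by blast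
next
 fix s assume "EX a' b' c' d'. d' ~= 0 & lincomb a b c / e d = lincomb a' b' c' / e d'
  & s = lincomb a' (smult omega b') (smult (omega ^ 2) c') / e d'"
 then obtain a' b' c' d' where s: "d' ~= 0" "lincomb a b c / e d = lincomb a' b' c' / e d'"
  "s = lincomb a' (smult omega b') (smult (omega ^ 2) c') / e d'" by blast
 have nz: "e d ~= 0" "e d' ~= 0" using d s(1) e_eq_0_iff by auto
 have "e d' * lincomb a b c = e d * lincomb a' b' c'" using s(2) nz by (simp add: field_simps)
 hence "d' * a = d * a' & d' * b = d * b' & d' * c = d * c'" unfolding lincomb_scale by (rule lincomb_eq)
 hence "e d' * lincomb a (smult omega b) (smult (omega ^ 2) c) = e d * lincomb a' (smult omega b') (smult (omega ^ 2) c')"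
  unfolding lincomb_scale by (metis mult_smult_right)
 thus "s = lincomb a (smult omega b) (smult (omega ^ 2) c) / e d" using nz by (simp add: s(3) field_simps)
qed

lemma galois_lincomb: "galois (lincomb a b c) = lincomb a (smult omega b) (smult (omega ^ 2) c)" using galois_eq[of 1 a b c] by simp

lemma galois_e: "galois (e p) = e p" using galois_lincomb[of p 0 0] by (simp add: lincomb_def)

lemma galois_mem_K: "h : K ==> galois h : K" by (elim K_lincomb) (auto simp: galois_eq intro!: C_subfield_divide[OF K_field] lincomb_mem_K e_mem_K)

lemma galois_add:
 assumes "h : K" "h' : K"
 shows "galois (h + h') = galois h + galois h'"
proof -
 obtain a b c d where h: "d ~= 0" "h = lincomb a b c / e d" using assms(1) by (rule K_lincomb)
 obtain a' b' c' d' where h': "d' ~= 0" "h' = lincomb a' b' c' / e d'" using assms(2) by (rule K_lincomb)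
 have nz: "e d ~= 0" "e d' ~= 0" "d * d' ~= 0" using h h' e_eq_0_iff by auto
 have add: "r / e d + r' / e d' = (e d' * r + e d * r') / e (d * d')" for r r' using nz by (simp add: eval1_mult field_simps)
 show ?thesis unfolding h(2) h'(2) galois_eq[OF h(1)] galois_eq[OF h'(1)] add lincomb_scale lincomb_add galois_eq[OF nz(3)]
  by (simp add: smult_add_right)
qed

lemma galois_mult:
 assumes "h : K" "h' : K"
 shows "galois (h * h') = galois h * galois h'"
proof -
 obtain a b c d where h: "d ~= 0" "h = lincomb a b c / e d" using assms(1) by (rule K_lincomb)
 obtain a' b' c' d' where h': "d' ~= 0" "h' = lincomb a' b' c' / e d'" using assms(2) by (rule K_lincomb)
 have nz: "d * d' ~= 0" using h h' by auto
 have mult: "r / e d * (r' / e d') = (r * r') / e (d * d')" for r r' by (simp add: eval1_mult)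
 have "omega * omega = omega ^ 2" by (simp add: power2_eq_square)
 thus ?thesis unfolding h(2) h'(2) galois_eq[OF h(1)] galois_eq[OF h'(1)] mult lincomb_mult galois_eq[OF nz]
  by (simp add: smult_add_right omega_cube omega_powers)
qed

lemma galois_const: "galois (mero_const c) = mero_const c" and galois_x: "galois x = x"
 using galois_e[of "[:c:]"] galois_e[of "[:0, 1:]"] by (simp_all add: mero_const_0 mero_const_1)

lemma galois_0: "galois 0 = 0" and galois_1: "galois 1 = 1" using galois_const[of 0] galois_const[of 1]
 by (simp_all add: mero_const_0 mero_const_1)

lemma galois_inverse:
 assumes "h : K"
 shows "galois (inverse h) = inverse (galois h)"
proof (cases "h = 0")
 case False
 have "galois h * galois (inverse h) = 1" using galois_mult[OF assms C_subfield_inverse[OF K_field assms]] False by (simp add: galois_1)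
 thus ?thesis by (simp add: inverse_unique)
qed (simp add: galois_0)

lemma galois_diff:
 assumes "h : K" "h' : K"
 shows "galois (h - h') = galois h - galois h'"
proof -
 have "galois (h - h' + h') = galois (h - h') + galois h'" using assms by (intro galois_add C_subfield_closed[OF K_field])
 thus ?thesis by simp
qed

lemma galois_cubed:
 assumes "h : K"
 shows "galois (galois (galois h)) = h"
proof -
 obtain a b c d where h: "d ~= 0" "h = lincomb a b c / e d" using assms(1) by (rule K_lincomb)
 have "omega * (omega * omega) = 1" "omega ^ 2 * (omega ^ 2 * omega ^ 2) = 1"
  unfolding omega_cube(3) using omega_cube by (simp_all add: power2_eq_square)
 thus ?thesis unfolding h(2) galois_eq[OF h(1)] smult_smult by (simp only: smult_1_left)
qed

lemma galois_place:
 assumes R: "R : places K"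
 shows "{h : K. galois h : R} : places K"
proof -
 interpret valuation_ring K R by (rule valuation_ring[OF R])
 define Q where "Q = {h : K. galois h : R}"
 have "range mero_const <= Q" using C_subfield_const[OF K_field] const_mem by (auto simp: Q_def galois_const)
 moreover have "x : Q | inverse x : Q"
  using x_mem_K galois_inverse[OF x_mem_K] C_subfield_inverse[OF K_field x_mem_K] inverse_maximal[OF x_mem_K]
  by (auto simp: Q_def galois_x maximal_iff)
 hence "range mero_const ~= Q" using trans inverse_not_const by blast
 moreover have "Q ~= K" proof
  assume "Q = K"
  hence "galois (galois h) : Q" if "h : K" for h using that galois_mem_K by blast
  hence "galois (galois (galois h)) : R" if "h : K" for h using that by (simp add: Q_def)
  hence "h : R" if "h : K" for h using that galois_cubed by metis
  thus False using R by (auto simp: places_def)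
 qed
 moreover have "h + h' : Q & h - h' : Q & h * h' : Q" if "h : Q" "h' : Q" for h h'
  using that galois_add galois_diff galois_mult C_subfield_add[OF K_field] C_subfield_diff[OF K_field] C_subfield_mult[OF K_field]
   add_mem diff_mem mult_mem by (simp add: Q_def)
 moreover have "h : Q | inverse h : Q" if "h : K" for h
  using that galois_inverse[OF that] C_subfield_inverse[OF K_field that] inverse_maximal[OF galois_mem_K[OF that]]
   by (auto simp: Q_def maximal_iff)
 moreover have "Q <= K" by (auto simp: Q_def)
 ultimately have "Q : places K" unfolding places_def by blast
 thus ?thesis by (simp add: Q_def)
qed

subsection \<open>Orders at infinity\<close>

lemma y_cube: "y ^ 3 = e (f * g ^ 2)" and w_cube: "w ^ 3 = e (f ^ 2 * g)"
proof -
 have "y ^ 3 = y ^ 2 * y" "w ^ 3 = w ^ 2 * w" by (simp_all add: power2_eq_square power3_eq_cube)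
 hence "y ^ 3 = e g * (y * w)" "w ^ 3 = e f * (y * w)" unfolding y_square w_square by (simp_all add: mult_ac)
 thus "y ^ 3 = e (f * g ^ 2)" "w ^ 3 = e (f ^ 2 * g)" unfolding y_mult_w by (simp_all add: eval1_simps power2_eq_square mult_ac)
qed

lemma y_nonzero: "y ~= 0" and w_nonzero: "w ~= 0" using y_mult_w e_eq_0_iff[of "f * g"] f_nonzero g_nonzero by auto

lemma y_cube_nonzero: "f * g ^ 2 ~= 0" and w_cube_nonzero: "f ^ 2 * g ~= 0" using f_nonzero g_nonzero by auto

lemma degree_y_cube: "degree (f * g ^ 2) = 7" and degree_w_cube: "degree (f ^ 2 * g) = 8"
 using degree_f degree_g f_nonzero g_nonzero by (simp_all add: degree_mult_eq degree_power_eq)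

lemma order_y_cube: "order c (f * g ^ 2) <= 2" and order_w_cube: "order c (f ^ 2 * g) <= 2"
proof -
 have "order c (f * g) = 0 | order c (f * g) = 1" using squarefree unfolding rsquarefree_def by blast
 hence "order c (f * g) <= 1" by linarith
 hence "order c f + order c g <= 1" using f_nonzero g_nonzero by (simp add: order_mult)
 moreover have "order c (f * g ^ 2) = order c f + 2 * order c g" "order c (f ^ 2 * g) = 2 * order c f + order c g"
  using f_nonzero g_nonzero by (simp_all add: order_mult power2_eq_square)
 ultimately show "order c (f * g ^ 2) <= 2" "order c (f ^ 2 * g) <= 2" by linarith+
qed

lemma inverse_x_param: "inverse x : params" by (simp add: params_def)

lemma ord_infinity:
 assumes pole: "R : places K" "x ~: R"
 shows "place_ord R x = - 3" "place_ord R y = - 7" "place_ord R w = - 8"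
proof -
 interpret R: curve_place K x 3 R by (rule curve_place[OF pole(1)])
 have "R.ord x < 0" using R.ord_nonneg[OF x_mem_K x_nonzero] pole(2) by linarith
 moreover have "(SUM R:{R}. place_ord R (inverse x)) <= int 3"
  by (rule fundamental_inequality[OF inverse_x_param]) (simp_all add: pole R.inverse_maximal[OF x_mem_K pole(2)])
 hence "- R.ord x <= 3" using R.ord_inverse[OF x_mem_K x_nonzero] by simp
 moreover have y: "3 * R.ord y = 7 * R.ord x"
  using R.ord_power[OF y_mem_K y_nonzero, of 3] R.ord_at_infinity[OF pole(2) y_cube_nonzero] unfolding y_cube degree_y_cube by simp
 ultimately show "R.ord x = - 3" by presburger
 moreover have w: "3 * R.ord w = 8 * R.ord x"
  using R.ord_power[OF w_mem_K w_nonzero, of 3] R.ord_at_infinity[OF pole(2) w_cube_nonzero] unfolding w_cube degree_w_cube by simp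
 ultimately show "R.ord y = - 7" "R.ord w = - 8" using y w by simp_all
qed

lemma infinity_unique:
 assumes pole: "R : places K" "x ~: R" and pole': "R' : places K" "x ~: R'"
 shows "R = R'"
proof (rule ccontr)
 assume "R ~= R'"
 have "inverse x : max_ideal S & place_ord S (inverse x) = 3" if "S : places K" "x ~: S" for S proof -
  interpret S: curve_place K x 3 S by (rule curve_place[OF that(1)])
  show ?thesis using S.inverse_maximal[OF x_mem_K that(2)] S.ord_inverse[OF x_mem_K x_nonzero] ord_infinity(1)[OF that] by simp
 qed
 moreover from this have "(SUM R:{R, R'}. place_ord R (inverse x)) <= int 3"
  using pole pole' by (intro fundamental_inequality[OF inverse_x_param]) auto
 ultimately show False using pole pole' \<open>R ~= R'\<close> by simp
qed

subsection \<open>The space of functions with a pole of order at most 6\<close>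

lemma no_pole_at_root:
 assumes d: "d ~= 0" "poly d c = 0" and q: "poly q c ~= 0"
  and s: "s : K" "s ^ 3 = e p" "p ~= 0" "order c p <= 2" and regular: "!!R. R : places K ==> x : R ==> e q / e d * s : R"
 shows False
proof -
 have lK: "x - mero_const c : K" by (intro C_subfield_diff C_subfield_const K_field x_mem_K)
 have l0: "x - mero_const c ~= 0" using trans by auto
 obtain R where R: "R : places K" "x - mero_const c : max_ideal R" using place_over[OF K_field lK shift_not_const] by blast
 interpret R: curve_place K x 3 R by (rule curve_place[OF R(1)])
 define v where "v = R.ord (x - mero_const c)"
 have v: "v > 0" unfolding v_def using R.ord_pos[OF lK l0] R(2) by blast
 have "x - mero_const c + mero_const c : R" by (intro R.add_mem R.const_mem R.maximal_mem R(2))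
 hence xR: "x : R" by simp
 have "q ~= 0" using q by auto
 have "s ^ 3 ~= 0" using s(2,3) e_eq_0_iff by simp
 hence nz: "e q ~= 0" "e d ~= 0" "s ~= 0" using \<open>q ~= 0\<close> d(1) e_eq_0_iff by auto
 have "R.ord (e q / e d * s) = R.ord (e q) - R.ord (e d) + R.ord s"
  using nz e_mem_K s(1) by (simp add: R.ord_mult R.ord_divide C_subfield_divide[OF K_field] del: times_divide_eq_left)
 moreover have "0 <= R.ord (e q / e d * s)"
  using R.ord_nonneg[of "e q / e d * s"] regular[OF R(1) xR] nz
   by (simp add: C_subfield_mult[OF K_field] C_subfield_divide[OF K_field] e_mem_K s(1))
 moreover have "R.ord (e q) = 0" using R.ord_at_point[OF R(2) \<open>q ~= 0\<close>] q order_root[of q c] by simp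
 moreover have "3 * R.ord s = int (order c p) * v"
  using R.ord_power[OF s(1) nz(3), of 3] R.ord_at_point[OF R(2) s(3)] unfolding s(2) v_def by simp
 moreover have "int (order c p) * v <= 2 * v" using s(4) v by (intro mult_right_mono) auto
 moreover have "order c d >= 1" using d order_root[of d c] by simp
 hence "1 * v <= int (order c d) * v" using v by (intro mult_right_mono) auto
 hence "R.ord (e d) >= 1 * v" using R.ord_at_point[OF R(2) d(1)] by (simp add: v_def)
 ultimately show False using v by linarith
qed

lemma polynomial_part:
 assumes "d ~= 0" and s: "s : K" "s ^ 3 = e p" "p ~= 0" "!!c. order c p <= 2"
  and "!!R. R : places K ==> x : R ==> e q / e d * s : R"
 shows "EX r. e q / e d = e r" using assms(1,6)
proof (induction d arbitrary: q rule: complex_poly_induct)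
 case (const k)
 have "e q / e [:k:] = e (smult (inverse k) q)" by (simp add: eval1_smult mero_const_inverse divide_inverse mult.commute)
 thus ?case by blast
next
 case (root c d)
 have "poly q c = 0" using no_pole_at_root[OF root.prems(1) _ _ s(1-3) s(4) root.prems(2), of c] by auto
 then obtain q' where q': "q = [:- c, 1:] * q'" by (auto simp: poly_eq_0_iff_dvd dvd_def)
 have "x - mero_const c ~= 0" using trans by auto
 hence eq: "e q / e ([:- c, 1:] * d) = e q' / e d" unfolding q' eval1_linear_mult by simp
 show ?case unfolding eq by (rule root.IH[OF root.hyps]) (use root.prems(2) in \<open>unfold eq\<close>)
qed

definition six :: "mero set => mero set" where
 "six P = RR_space K (%R. if R = P then 6 else 0)"

lemma six_iff:
 assumes P: "P : places K" "x ~: P"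
 shows "h : six P \<longleftrightarrow> h : K & (ALL R:places K. R ~= P --> h : R) & h / x ^ 2 : P"
proof (cases "h : K & h ~= 0")
 case False
 have "0 : R" if "R : places K" for R using valuation_ring.zero_mem[OF valuation_ring[OF that]] .
 thus ?thesis using False P(1) C_subfield_0[OF K_field] by (auto simp: six_def RR_space_def)
next
 case True
 interpret P: curve_place K x 3 P by (rule curve_place[OF P(1)])
 have quot: "h / x ^ 2 : K" "h / x ^ 2 ~= 0" using True x_nonzero by (auto intro: C_subfield_divide C_subfield_power K_field x_mem_K)
 have "P.ord (h / x ^ 2) = P.ord h + 6"
  using True x_nonzero ord_infinity(1)[OF P] by (simp add: P.ord_divide P.ord_power C_subfield_power[OF K_field] x_mem_K)
 hence "- 6 <= P.ord h \<longleftrightarrow> h / x ^ 2 : P" using P.ord_nonneg[OF quot] by linarith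
 moreover have "0 <= place_ord R h \<longleftrightarrow> h : R" if "R : places K" for R
  using curve_place.ord_nonneg[OF curve_place[OF that]] True by blast
 ultimately show ?thesis using True P(1) by (auto simp: six_def RR_space_def)
qed

lemma six_subspace: "mero.subspace (six P)" unfolding six_def by (rule RR_subspace)

lemma galois_six:
 assumes P: "P : places K" "x ~: P" and k: "k : six P"
 shows "galois k : six P"
proof -
 have kK: "k : K" and k_P: "k / x ^ 2 : P" and k_R: "!!R. R : places K ==> R ~= P ==> k : R" using k by (auto simp: six_iff[OF P])
 have x2: "x ^ 2 : K" by (intro C_subfield_power K_field x_mem_K)
 have "galois k : R" if R: "R : places K" "R ~= P" for R proof -
  have "x : R" using infinity_unique[OF R(1) _ P] R(2) by blast
  hence "x : {h : K. galois h : R}" using x_mem_K by (simp add: galois_x)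
  hence "{h : K. galois h : R} ~= P" using P(2) by metis
  hence "k : {h : K. galois h : R}" by (rule k_R[OF galois_place[OF R(1)]])
  thus ?thesis by simp
 qed
 moreover have "galois k / x ^ 2 : P" proof -
  have "x ~: {h : K. galois h : P}" using P(2) by (simp add: galois_x)
  hence "{h : K. galois h : P} = P" using infinity_unique[OF galois_place[OF P(1)] _ P] by blast
  hence "galois (k / x ^ 2) : P" using k_P by blast
  moreover have "galois (x ^ 2) = x ^ 2" using galois_e[of "[:0, 1:] ^ 2"] by (simp add: eval1_simps mero_const_0 mero_const_1)
  ultimately show ?thesis using galois_mult[OF kK C_subfield_inverse[OF K_field x2]] galois_inverse[OF x2] by (simp add: divide_inverse)
 qed
 ultimately show ?thesis using galois_mem_K[OF kK] by (simp add: six_iff[OF P])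
qed

text \<open>The eigencomponents of \<open>h\<close> are averages of \<open>h\<close>, \<open>galois h\<close> and \<open>galois (galois h)\<close>.\<close>
lemma six_components:
 assumes P: "P : places K" "x ~: P" and h: "lincomb a b c / e d : six P" and d: "d ~= 0"
 shows "e a / e d : six P" "e b / e d * y : six P" "e c / e d * w : six P"
proof -
 define A B C z where "A = e a / e d" and "B = e b / e d * y" and "C = e c / e d * w" and "z = mero_const omega"
 have z: "z * z = - 1 - z" by (simp add: z_def mero_omega_mult)
 have split: "lincomb a' b' c' / e d = e a' / e d + e b' / e d * y + e c' / e d * w" for a' b' c'
  by (simp add: lincomb_def add_divide_distrib)
 define h0 h1 h2 where "h0 = lincomb a b c / e d" and "h1 = galois h0" and "h2 = galois h1"
 have h1: "h1 = lincomb a (smult omega b) (smult (omega ^ 2) c) / e d" unfolding h1_def h0_def by (rule galois_eq[OF d])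
 have "smult omega (smult omega b) = smult (omega ^ 2) b" "smult (omega ^ 2) (smult (omega ^ 2) c) = smult omega c"
  by (simp add: power2_eq_square, simp only: smult_smult omega_cube)
 hence h2: "h2 = lincomb a (smult (omega ^ 2) b) (smult omega c) / e d" unfolding h2_def h1 galois_eq[OF d] by (simp only:)
 have components: "h0 = A + B + C" "h1 = A + z * B + (- 1 - z) * C" "h2 = A + (- 1 - z) * B + z * C"
  unfolding h1 h2 h0_def split A_def B_def C_def z_def by (simp_all add: eval1_smult mero_omega_square mult.assoc)
 have mem: "h0 : six P" "h1 : six P" "h2 : six P" using h galois_six[OF P] by (auto simp: h0_def h1_def h2_def)
 have z_mem: "z * k : six P" if "k : six P" for k using mero.subspace_scale[OF six_subspace that, of omega]
  by (simp add: mero_scale_def z_def)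
 have third: "k : six P" if "3 * k : six P" for k using mero.subspace_scale[OF six_subspace that, of "1 / 3"] by (simp only: mero_third)
 note closed = mero.subspace_add[OF six_subspace] mero.subspace_neg[OF six_subspace] mero.subspace_diff[OF six_subspace] z_mem
 have "3 * A = h0 + h1 + h2" unfolding components by algebra
 also have "... : six P" by (intro closed mem)
 finally show "e a / e d : six P" unfolding A_def by (rule third)
 have "3 * B = h0 + (- h1 - z * h1) + z * h2" unfolding components using z by algebra
 also have "... : six P" by (intro closed mem)
 finally show "e b / e d * y : six P" unfolding B_def by (rule third)
 have "3 * C = h0 + z * h1 + (- h2 - z * h2)" unfolding components using z by algebra
 also have "... : six P" by (intro closed mem)
 finally show "e c / e d * w : six P" unfolding C_def by (rule third)
qed

lemma six_component_polynomial:
 assumes P: "P : places K" "x ~: P" and d: "d ~= 0" and s: "s : K" "s ^ 3 = e p" "p ~= 0" "!!c. order c p <= 2"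
  and mem: "e q / e d * s : six P"
 obtains r where "e q / e d = e r" "r = 0 | place_ord P s - 3 * int (degree r) >= - 6"
proof -
 interpret P: curve_place K x 3 P by (rule curve_place[OF P(1)])
 have regular: "e q / e d * s : R" if "R : places K" "x : R" for R proof -
  have "R ~= P" using that(2) P(2) by blast
  thus ?thesis using mem that(1) by (simp add: six_iff[OF P])
 qed
 have "EX r. e q / e d = e r" by (rule polynomial_part[OF d s regular])
 then obtain r where r: "e q / e d = e r" ..
 have "place_ord P s - 3 * int (degree r) >= - 6" if "r ~= 0" proof -
  have "s ^ 3 ~= 0" using s(2,3) e_eq_0_iff by simp
  hence s0: "s ~= 0" by auto
  have r0: "e r ~= 0" using that e_eq_0_iff by simp
  have "e r * s : six P" using mem by (simp only: r)
  moreover have "e r * s ~= 0" using s0 r0 by simp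
  ultimately have "- 6 <= P.ord (e r * s)" using P(1) unfolding six_def RR_space_def by fastforce
  also have "P.ord (e r * s) = P.ord (e r) + P.ord s" by (rule P.ord_mult[OF e_mem_K r0 s(1) s0])
  also have "P.ord (e r) = int (degree r) * (- 3)" unfolding P.ord_at_infinity[OF P(2) that] ord_infinity(1)[OF P] ..
  finally show ?thesis by simp
 qed
 hence "r = 0 | place_ord P s - 3 * int (degree r) >= - 6" by blast
 thus ?thesis by (rule that[OF r])
qed

lemma six_subset_span:
 assumes P: "P : places K" "x ~: P"
 shows "six P <= mero.span {1, x, x ^ 2}"
proof
 fix h assume h: "h : six P"
 hence "h : K" by (simp add: six_iff[OF P])
 then obtain a b c d where d: "d ~= 0" and h_eq: "h = lincomb a b c / e d" by (rule K_lincomb)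
 note mem = six_components[OF P h[unfolded h_eq] d]
 obtain r where r: "e a / e d = e r" "r = 0 | place_ord P 1 - 3 * int (degree r) >= - 6"
  by (rule six_component_polynomial[OF P d, of 1 1 a]) (use mem(1) C_subfield_1[OF K_field] in \<open>auto simp: order_1_eq_0\<close>)
 obtain r1 where r1: "e b / e d = e r1" "r1 = 0 | place_ord P y - 3 * int (degree r1) >= - 6"
  by (rule six_component_polynomial[OF P d y_mem_K y_cube y_cube_nonzero order_y_cube mem(2)])
 obtain r2 where r2: "e c / e d = e r2" "r2 = 0 | place_ord P w - 3 * int (degree r2) >= - 6"
  by (rule six_component_polynomial[OF P d w_mem_K w_cube w_cube_nonzero order_w_cube mem(3)])
 have "r1 = 0" "r2 = 0" using r1(2) r2(2) ord_infinity(2,3)[OF P] by auto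
 hence components: "e b / e d = 0" "e c / e d = 0" using r1(1) r2(1) by simp_all
 have "h = e a / e d + e b / e d * y + e c / e d * w" by (simp add: h_eq lincomb_def add_divide_distrib)
 hence "h = e r" unfolding components r(1) by simp
 moreover have "degree r <= 2" using r(2) curve_place.ord_1[OF curve_place[OF P(1)]] by auto
 hence "e r = mero_scale (coeff r 0) 1 + mero_scale (coeff r 1) x + mero_scale (coeff r 2) (x ^ 2)"
  by (simp add: eval1_altdef numeral_2_eq_2 mero_scale_def)
 ultimately have "h = mero_scale (coeff r 0) 1 + mero_scale (coeff r 1) x + mero_scale (coeff r 2) (x ^ 2)" by simp
 also have "... : mero.span {1, x, x ^ 2}" by (intro mero.span_add mero.span_scale mero.span_base) auto
 finally show "h : mero.span {1, x, x ^ 2}" .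
qed

subsection \<open>The genus\<close>

text \<open>The functions \<open>x^i\<close>, \<open>x^i y\<close>, \<open>x^i w\<close> with poles of order at most \<open>3 M\<close> at infinity.\<close>
definition basis_elem :: "nat => mero" where
 "basis_elem k = (if k = 0 then 1 else if k = 1 then y else w)"

definition basis_cube :: "nat => complex poly" where
 "basis_cube k = (if k = 0 then 1 else if k = 1 then f * g ^ 2 else f ^ 2 * g)"

definition exponents :: "nat => nat => nat set" where
 "exponents M k = (if k = 0 then {..M} else {..<M - 2})"

definition monomials :: "nat => (nat \<times> nat) set" where
 "monomials M = (SIGMA k:{0, 1, 2}. exponents M k)"

definition monomial :: "nat \<times> nat => mero" where
 "monomial = (%(k, i). x ^ i * basis_elem k)"

lemma finite_exponents: "finite (exponents M k)" by (simp add: exponents_def)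

lemma finite_monomials: "finite (monomials M)" unfolding monomials_def using finite_exponents by auto

lemma card_monomials: "int 3 * int M + 1 - int 4 <= int (card (monomials M))"
proof -
 have "card (monomials M) = (SUM k:{0, 1, 2}. card (exponents M k))" unfolding monomials_def using finite_exponents
  by (subst card_SigmaI) auto
 also have "... = M + 1 + 2 * (M - 2)" by (simp add: exponents_def)
 finally show ?thesis by simp
qed

lemma basis_elem: "basis_elem k : K" "basis_elem k ^ 3 = e (basis_cube k)" "basis_cube k ~= 0"
 using C_subfield_1[OF K_field] y_mem_K w_mem_K y_cube w_cube y_cube_nonzero w_cube_nonzero by (auto simp: basis_elem_def basis_cube_def)

lemma monomials_independent:
 assumes zero: "(SUM i:monomials M. mero_const (c i) * monomial i) = 0"
 shows "ALL i:monomials M. c i = 0"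
proof -
 define p where "p k = (SUM i:exponents M k. monom (c (k, i)) i)" for k
 have "(SUM i:monomials M. mero_const (c i) * monomial i) = (SUM k:{0, 1, 2}. SUM i:exponents M k. mero_const (c (k, i)) * monomial (k, i))"
  unfolding monomials_def using finite_exponents by (subst sum.Sigma) (auto intro!: sum.cong)
 also have "... = (SUM k:{0, 1, 2}. e (p k) * basis_elem k)"
  by (intro sum.cong refl) (simp add: p_def monomial_def eval1_sum eval1_monom sum_distrib_right mult.assoc)
 also have "... = lincomb (p 0) (p 1) (p 2)" by (simp add: lincomb_def basis_elem_def add.assoc)
 finally have "lincomb (p 0) (p 1) (p 2) = 0" using zero by simp
 from lincomb_eq_0[OF this] have p0: "p k = 0" if "k : {0, 1, 2}" for k using that by auto
 have "c (k, i) = 0" if "k : {0, 1, 2}" "i : exponents M k" for k i proof -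
  have "coeff (p k) i = c (k, i)" using that(2) finite_exponents by (simp add: p_def coeff_sum)
  thus ?thesis using p0[OF that(1)] by simp
 qed
 thus ?thesis by (auto simp: monomials_def)
qed

lemma monomial_mem_K: "monomial i : K"
 using basis_elem(1) x_mem_K by (cases i) (simp add: monomial_def C_subfield_mult[OF K_field] C_subfield_power[OF K_field])

lemma monomial_regular:
 assumes R: "R : places K" and ki: "(k, i) : monomials M"
 shows "x : R ==> monomial (k, i) : R" "x ~: R ==> monomial (k, i) / x ^ M : R"
proof -
 interpret R: curve_place K x 3 R by (rule curve_place[OF R])
 show "monomial (k, i) : R" if xR: "x : R" proof -
  have "basis_elem k : R" by (rule R.root_closed[of _ 3]) (use basis_elem R.eval1_mem[OF xR] in auto)
  thus ?thesis using R.power_mem[OF xR] by (simp add: monomial_def R.mult_mem)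
 qed
 show "monomial (k, i) / x ^ M : R" if pole: "x ~: R" proof (rule R.root_closed[of _ 3])
  show "monomial (k, i) / x ^ M : K" by (intro C_subfield_divide C_subfield_power K_field monomial_mem_K x_mem_K)
  define j where "j = 3 * M - 3 * i - degree (basis_cube k)"
  have "3 * i + degree (basis_cube k) <= 3 * M"
   using ki degree_y_cube degree_w_cube by (auto simp: monomials_def exponents_def basis_cube_def split: if_splits)
  hence "3 * M = 3 * i + degree (basis_cube k) + j" by (simp add: j_def)
  hence denominator: "x ^ (3 * M) = x ^ (3 * i) * x ^ degree (basis_cube k) * x ^ j" by (metis power_add)
  have "(monomial (k, i) / x ^ M) ^ 3 = x ^ (3 * i) * e (basis_cube k) / x ^ (3 * M)"
   by (simp add: monomial_def power_divide power_mult_distrib basis_elem power_mult[symmetric] mult.commute)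
  also have "... = e (basis_cube k) / x ^ degree (basis_cube k) * inverse x ^ j"
   unfolding denominator using x_nonzero by (simp add: field_simps power_inverse)
  also have "... : R"
   by (intro R.mult_mem R.eval1_at_infinity(1) pole basis_elem R.power_mem R.maximal_mem R.inverse_maximal x_mem_K)
  finally show "(monomial (k, i) / x ^ M) ^ 3 : R" .
 qed simp
qed

lemma many_functions:
 "EX A. finite A & mero.independent A & int 3 * int M + 1 - int 4 <= int (card A) &
   (ALL a:A. a : K & (ALL R:places K. (x : R --> a : R) & (x ~: R --> a / x ^ M : R)))"
proof (intro exI[of _ "monomial ` monomials M"] conjI)
 note independent = independent_family[OF finite_monomials[of M] monomials_independent]
 show "finite (monomial ` monomials M)" using finite_monomials by simp
 show "mero.independent (monomial ` monomials M)" by (rule independent(2))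
 show "int 3 * int M + 1 - int 4 <= int (card (monomial ` monomials M))" using card_monomials card_image[OF independent(1)] by simp
 show "ALL a:monomial ` monomials M. a : K & (ALL R:places K. (x : R --> a : R) & (x ~: R --> a / x ^ M : R))"
  using monomial_mem_K monomial_regular by force
qed

theorem genus_four: "has_genus K 4"
proof -
 have bound: "div_degree D - int (RR_dim K D) + 1 <= int 4" if "D : divisors K" for D by (rule genus_bound[OF many_functions that])
 obtain P where P: "P : places K" "inverse x : max_ideal P"
  using place_over[OF K_field C_subfield_inverse[OF K_field x_mem_K] inverse_not_const] by blast
 interpret P: curve_place K x 3 P by (rule curve_place[OF P(1)])
 have pole: "x ~: P" using P(2) x_nonzero P.maximal_iff by simp
 define D where "D = (%R. if R = P then 6 else 0 :: int)"
 have support: "{R. D R ~= 0} = {P}" by (auto simp: D_def)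
 have D: "D : divisors K" using P(1) by (simp add: divisors_def support)
 have degree: "div_degree D = 6" unfolding div_degree_def support by (simp add: D_def)
 obtain B where B: "finite_basis B (six P)" "card B = RR_dim K D" using RR_basis[OF D] by (auto simp: six_def D_def)
 have "B <= mero.span {1, x, x ^ 2}" using mero.span_superset[of B] B(1) six_subset_span[OF P(1) pole] by (auto simp: finite_basis_def)
 hence "card B <= card {1, x, x ^ 2}" using mero.independent_span_bound[of "{1, x, x ^ 2}" B] B(1) by (simp add: finite_basis_def)
 also have "... <= 3" by (simp add: card_insert_if)
 finally have "div_degree D - int (RR_dim K D) + 1 >= 4" using B(2) degree by simp
 hence "div_degree D - int (RR_dim K D) + 1 = int 4" using bound[OF D] by simp
 thus ?thesis using D bound unfolding has_genus_def by blast
qed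

end

section \<open>The genus of the modular curve\<close>

subsection \<open>A bicubic curve\<close>

lemma const_if_cube_const:
 assumes "v ^ 3 = mero_const k"
 shows "v : range mero_const"
proof (rule ccontr)
 assume "v ~: range mero_const"
 moreover have "eval1 [:- k, 0, 0, 1:] v = 0"
  using assms by (simp add: mero_const_0 mero_const_1 mero_const_minus power3_eq_cube mult.assoc)
 ultimately have "[:- k, 0, 0, 1:] = 0" by (rule eval1_eq_0)
 thus False by simp
qed

lemma complex_cube_root:
 assumes "k ~= 0"
 obtains c :: complex where "k * c ^ 3 = 1"
proof -
 have "EX c. poly [:- 1, 0, 0, k:] c = 0" using assms by (intro fundamental_theorem_of_algebra) (simp add: constant_degree)
 then obtain c where "poly [:- 1, 0, 0, k:] c = 0" by blast
 hence "k * c ^ 3 = 1" by (simp add: power3_eq_cube mult_ac)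
 thus ?thesis by (rule that)
qed

lemma rsquarefree_mult:
 fixes f g :: "'a :: field_char_0 poly"
 assumes "rsquarefree f" "rsquarefree g" "!!a. poly f a = 0 ==> poly g a ~= 0"
 shows "rsquarefree (f * g)"
 using assms unfolding rsquarefree_roots by (auto simp: pderiv_mult)

text \<open>Moving the point \<open>u = c\<close> to infinity lowers the degree of one of the two cubics to 2.\<close>
locale bicubic =
 fixes u v :: mero and k0 k3 c :: complex
 assumes equation: "v ^ 3 * (u ^ 3 - mero_const k0) = mero_const k3 * u ^ 3 - 1"
  and cube_root: "k3 * c ^ 3 = 1" and k0_nonzero: "k0 ~= 0" and k0_mult_k3: "k0 * k3 ~= 1"
  and u_not_const: "u ~: range mero_const"
begin

definition x where "x = inverse (u - mero_const c)"

definition f where "f = [:1, 3 * c, 3 * c ^ 2, c ^ 3 - k0:]"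

definition g where "g = [:1, 3 * c, 3 * c ^ 2:]"

definition y where "y = eval1 f x * v ^ 2"

definition w where "w = mero_const k3 * eval1 f x * v"

lemma c_nonzero: "c ~= 0" and k3_nonzero: "k3 ~= 0" using cube_root by auto

lemma c_cube: "c ^ 3 ~= k0" using cube_root k0_mult_k3 by (auto simp: mult.commute)

lemma poly_f: "poly f a = (c * a + 1) ^ 3 - k0 * a ^ 3" and poly_g: "poly g a = (c * a + 1) ^ 3 - c ^ 3 * a ^ 3"
 by (simp_all add: f_def g_def power2_eq_square power3_eq_cube algebra_simps)

lemma rsquarefree_f: "rsquarefree f"
 unfolding rsquarefree_roots
proof (intro allI notI, elim conjE)
 fix a assume root: "poly f a = 0" "poly (pderiv f) a = 0"
 have "a * poly (pderiv f) a - 3 * poly f a = - 3 * (c * a + 1) ^ 2"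
  by (simp add: f_def pderiv_pCons power2_eq_square power3_eq_cube algebra_simps)
 hence "c * a + 1 = 0" using root by simp
 moreover from this have "a = 0" using root(1) k0_nonzero by (simp add: poly_f)
 ultimately show False by simp
qed

lemma rsquarefree_g: "rsquarefree g"
 unfolding rsquarefree_roots
proof (intro allI notI, elim conjE)
 fix a assume "poly g a = 0" "poly (pderiv g) a = 0"
 moreover have "4 * (c * poly g a) = (1 + 2 * (c * a)) * poly (pderiv g) a + c"
  by (simp add: g_def pderiv_pCons power2_eq_square algebra_simps)
 ultimately show False using c_nonzero by simp
qed

lemma rsquarefree_f_g: "rsquarefree (f * g)"
proof (rule rsquarefree_mult[OF rsquarefree_f rsquarefree_g], rule notI)
 fix a assume root: "poly f a = 0" "poly g a = 0"
 have "poly g a - poly f a = (k0 - c ^ 3) * a ^ 3" by (simp add: poly_f poly_g algebra_simps)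
 hence "a = 0" using root c_cube by simp
 thus False using root(2) by (simp add: poly_g)
qed

lemma shift_nonzero: "u - mero_const c ~= 0" using u_not_const by auto

lemma u_eq: "u = mero_const c + inverse x" by (simp add: x_def)

lemma x_not_const: "x ~: range mero_const"
proof
 assume "x : range mero_const"
 then obtain k where "x = mero_const k" by blast
 hence "mero_const c + inverse x = mero_const (c + inverse k)" by (simp only: mero_const_add mero_const_inverse)
 hence "u = mero_const (c + inverse k)" by (rule trans[OF u_eq])
 thus False using u_not_const by blast
qed

lemma v_cube: "v ^ 3 * eval1 f x = mero_const k3 * eval1 g x"
proof -
 define C K0 K3 where "C = mero_const c" and "K0 = mero_const k0" and "K3 = mero_const k3"
 note const_simps = mero_const_diff mero_const_mult mero_const_power mero_const_1 mero_const_numeral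
 have C: "K3 * C ^ 3 = 1" using arg_cong[OF cube_root, of mero_const] by (simp add: K3_def C_def const_simps)
 have "x * (u - C) = 1" using shift_nonzero by (simp add: x_def C_def)
 hence xu: "x * u = C * x + 1" by algebra
 have f: "eval1 f x = (C * x + 1) ^ 3 - K0 * x ^ 3" by (simp only: f_def eval1_pCons eval1_0 C_def K0_def const_simps) algebra
 have g: "eval1 g x = (C * x + 1) ^ 3 - C ^ 3 * x ^ 3" by (simp only: g_def eval1_pCons eval1_0 C_def const_simps) algebra
 have "v ^ 3 * eval1 f x = x ^ 3 * (v ^ 3 * (u ^ 3 - K0))" unfolding f xu[symmetric] by algebra
 also have "... = K3 * (x * u) ^ 3 - x ^ 3" unfolding K0_def K3_def equation by algebra
 also have "... = K3 * (x * u) ^ 3 - (K3 * C ^ 3) * x ^ 3" unfolding C by simp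
 also have "... = K3 * eval1 g x" unfolding g xu by algebra
 finally show ?thesis by (simp only: K3_def)
qed

lemma superelliptic: "superelliptic x y w (smult (k3 ^ 2) f) g"
proof
 have scaled: "eval1 (smult (k3 ^ 2) f) x = mero_const k3 ^ 2 * eval1 f x" by (simp add: eval1_smult mero_const_power)
 show "x ~: range mero_const" by (rule x_not_const)
 have "y ^ 2 = eval1 f x * v * (v ^ 3 * eval1 f x)" unfolding y_def by algebra
 also have "... = eval1 g x * w" unfolding v_cube w_def by algebra
 finally show "y ^ 2 = eval1 g x * w" .
 show "w ^ 2 = eval1 (smult (k3 ^ 2) f) x * y" unfolding scaled y_def w_def by algebra
 have "y * w = mero_const k3 * eval1 f x * (v ^ 3 * eval1 f x)" unfolding y_def w_def by algebra
 also have "... = eval1 (smult (k3 ^ 2) f * g) x" unfolding v_cube eval1_mult scaled by algebra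
 finally show "y * w = eval1 (smult (k3 ^ 2) f * g) x" .
 show "degree (smult (k3 ^ 2) f) = 3" "degree g = 2" using k3_nonzero c_nonzero c_cube by (simp_all add: f_def g_def)
 show "rsquarefree (smult (k3 ^ 2) f * g)" using rsquarefree_f_g k3_nonzero by (simp add: rsquarefree_roots pderiv_smult)
qed

lemma adjoin_x_y_w: "C_adjoin {x, y, w} = C_adjoin {u, v}"
proof
 note closed = C_subfield_closed[OF C_subfield_hull] C_subfield_eval1[OF C_subfield_hull]
 show "C_adjoin {x, y, w} <= C_adjoin {u, v}" proof (rule C_adjoin_minimal[OF _ C_subfield_hull])
  have "u : C_adjoin {u, v}" "v : C_adjoin {u, v}" using C_adjoin_subset[of "{u, v}"] by auto
  thus "{x, y, w} <= C_adjoin {u, v}" unfolding y_def w_def x_def by (intro insert_subsetI empty_subsetI closed)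
 qed
 show "C_adjoin {u, v} <= C_adjoin {x, y, w}" proof (rule C_adjoin_minimal[OF _ C_subfield_hull])
  have gens: "x : C_adjoin {x, y, w}" "w : C_adjoin {x, y, w}" using C_adjoin_subset[of "{x, y, w}"] by auto
  have "f ~= 0" by (simp add: f_def)
  hence "eval1 f x ~= 0" using eval1_eq_0[OF x_not_const] by blast
  hence "v = w / (mero_const k3 * eval1 f x)" using k3_nonzero by (simp add: w_def mero_const_eq_0_iff)
  also have "... : C_adjoin {x, y, w}" by (intro closed gens)
  finally have "v : C_adjoin {x, y, w}" .
  have "u = mero_const c + inverse x" by (rule u_eq)
  also have "... : C_adjoin {x, y, w}" by (intro closed gens)
  finally have "u : C_adjoin {x, y, w}" .
  thus "{u, v} <= C_adjoin {x, y, w}" using \<open>v : C_adjoin {x, y, w}\<close> by simp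
 qed
qed

theorem genus: "has_genus (C_adjoin {u, v}) 4"
 using superelliptic.genus_four[OF superelliptic] unfolding superelliptic.K_def[OF superelliptic] adjoin_x_y_w .

end

subsection \<open>Lagrange resolvents\<close>

lemma upsilon_not_const: "upsilon ~= mero_const c"
 using hauptmodul_upsilon hauptmodul.hauptmodul_not_const by blast

lemma upsilon_minus_const: "upsilon - mero_const c ~= 0" using upsilon_not_const by simp

text \<open>For the roots \<open>g1\<close>, \<open>g2\<close>, \<open>-1 - g1 - g2\<close> of \<open>U (T^3 + T^2) - (U^2 - 1) T + (U - 1)^2\<close>.\<close>
lemma resolvent_identity:
 fixes U P1 P2 g1 g2 z :: mero
 assumes z: "z * z = - 1 - z"
  and product: "U * (g1 * g2 * (1 + g1 + g2)) = (U - 1) ^ 2"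
  and second: "U * (g1 * g2 - (g1 + g2) - (g1 + g2) ^ 2) = - (U ^ 2 - 1)"
  and P1: "P1 = g1 * g2 + z * (g2 * (- 1 - g1 - g2)) + (- 1 - z) * ((- 1 - g1 - g2) * g1)"
  and P2: "P2 = g1 * g2 + (- 1 - z) * (g2 * (- 1 - g1 - g2)) + z * ((- 1 - g1 - g2) * g1)"
 shows "(U * P1) * (U * P2) = (U - 1) ^ 2 * (U ^ 2 - U + 1)"
  "(U * P1) ^ 3 + (U * P2) ^ 3 = (U - 1) ^ 3 * (- 2 * U ^ 3 + 30 * U ^ 2 - 24 * U - 2)"
proof -
 define s where "s = g1 * g2 - (g1 + g2) - (g1 + g2) ^ 2"
 define t where "t = - (g1 * g2 * (1 + g1 + g2))"
 have s: "U * s = - (U ^ 2 - 1)" and t: "U * t = - ((U - 1) ^ 2)" using second product by (simp_all add: s_def t_def)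
 have mult: "P1 * P2 = s ^ 2 + 3 * t" unfolding P1 P2 s_def t_def using z by algebra
 have "P1 + P2 = 3 * (g1 * g2) - s" unfolding P1 P2 s_def by algebra
 hence "P1 ^ 3 + P2 ^ 3 = (3 * (g1 * g2) - s) ^ 3 - 3 * (s ^ 2 + 3 * t) * (3 * (g1 * g2) - s)" using mult by algebra
 also have "... = 2 * s ^ 3 + 9 * s * t + 27 * t ^ 2" unfolding s_def t_def by algebra
 finally have cubes: "P1 ^ 3 + P2 ^ 3 = 2 * s ^ 3 + 9 * s * t + 27 * t ^ 2" .
 show "(U * P1) * (U * P2) = (U - 1) ^ 2 * (U ^ 2 - U + 1)"
  "(U * P1) ^ 3 + (U * P2) ^ 3 = (U - 1) ^ 3 * (- 2 * U ^ 3 + 30 * U ^ 2 - 24 * U - 2)" using mult cubes s t by algebra+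
qed

abbreviation zeta :: mero where "zeta == mero_const omega"

definition resolvent :: "mero => mero" where
 "resolvent z = g1 * g2 + z * (g2 * g0) + (- 1 - z) * (g0 * g1)"

definition scaled_resolvent :: "mero => mero" where
 "scaled_resolvent z = upsilon * resolvent z / (upsilon - 1)"

definition bicubic_u where "bicubic_u = scaled_resolvent zeta / (upsilon + zeta)"

definition bicubic_v where "bicubic_v = scaled_resolvent zeta / (upsilon - 1 - zeta)"

definition bicubic_0 :: complex where "bicubic_0 = - 4 - 6 * omega"

definition bicubic_3 :: complex where "bicubic_3 = 2 + 6 * omega"

lemma bicubic_coeffs_mult: "bicubic_0 * bicubic_3 = 28" unfolding bicubic_0_def bicubic_3_def using omega_mult by algebra

lemma
 shows upsilon_minus_1: "upsilon - 1 ~= 0" and upsilon_plus_zeta: "upsilon + zeta ~= 0"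
  and upsilon_minus_1_zeta: "upsilon - 1 - zeta ~= 0"
 using upsilon_minus_const[of 1] upsilon_minus_const[of "- omega"] upsilon_minus_const[of "1 + omega"]
 by (simp_all add: mero_const_1 mero_const_minus mero_const_add algebra_simps)

lemma scaled_resolvents_mult: "scaled_resolvent zeta * scaled_resolvent (- 1 - zeta) = (upsilon + zeta) * (upsilon - 1 - zeta)"
 and scaled_resolvents_cubes: "scaled_resolvent zeta ^ 3 + scaled_resolvent (- 1 - zeta) ^ 3
   = mero_const bicubic_3 * (upsilon - 1 - zeta) ^ 3 + mero_const bicubic_0 * (upsilon + zeta) ^ 3"
proof -
 define P Q where "P = resolvent zeta" and "Q = resolvent (- 1 - zeta)"
 have P: "P = g1 * g2 + zeta * (g2 * (- 1 - g1 - g2)) + (- 1 - zeta) * ((- 1 - g1 - g2) * g1)"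
  and Q: "Q = g1 * g2 + (- 1 - zeta) * (g2 * (- 1 - g1 - g2)) + zeta * ((- 1 - g1 - g2) * g1)"
  by (simp_all add: P_def Q_def resolvent_def g0_eq)
 note identity = resolvent_identity[OF mero_omega_mult roots_product roots_second_symmetric P Q]
 have "scaled_resolvent zeta * scaled_resolvent (- 1 - zeta) = (upsilon * P) * (upsilon * Q) / (upsilon - 1) ^ 2"
  by (simp add: scaled_resolvent_def P_def Q_def power2_eq_square)
 also have "... = upsilon ^ 2 - upsilon + 1" unfolding identity using upsilon_minus_1 by simp
 also have "... = (upsilon + zeta) * (upsilon - 1 - zeta)" using mero_omega_mult by algebra
 finally show "scaled_resolvent zeta * scaled_resolvent (- 1 - zeta) = (upsilon + zeta) * (upsilon - 1 - zeta)" .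
 have coeffs: "mero_const bicubic_0 = - 4 - 6 * zeta" "mero_const bicubic_3 = 2 + 6 * zeta"
  by (simp_all add: bicubic_0_def bicubic_3_def mero_const_diff mero_const_add mero_const_mult mero_const_minus mero_const_numeral)
 have "scaled_resolvent zeta ^ 3 + scaled_resolvent (- 1 - zeta) ^ 3 = ((upsilon * P) ^ 3 + (upsilon * Q) ^ 3) / (upsilon - 1) ^ 3"
  by (simp add: scaled_resolvent_def P_def Q_def power_divide add_divide_distrib)
 also have "... = - 2 * upsilon ^ 3 + 30 * upsilon ^ 2 - 24 * upsilon - 2" unfolding identity using upsilon_minus_1 by simp
 also have "... = mero_const bicubic_3 * (upsilon - 1 - zeta) ^ 3 + mero_const bicubic_0 * (upsilon + zeta) ^ 3"
  unfolding coeffs using mero_omega_mult by algebra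
 finally show "scaled_resolvent zeta ^ 3 + scaled_resolvent (- 1 - zeta) ^ 3 = \<dots>" .
qed

lemma bicubic_u_mult: "bicubic_u * (upsilon + zeta) = scaled_resolvent zeta"
 and bicubic_v_mult: "bicubic_v * (upsilon - 1 - zeta) = scaled_resolvent zeta"
 using upsilon_plus_zeta upsilon_minus_1_zeta by (simp_all add: bicubic_u_def bicubic_v_def)

lemma scaled_resolvent_nonzero: "scaled_resolvent zeta ~= 0"
 using scaled_resolvents_mult upsilon_plus_zeta upsilon_minus_1_zeta by auto

lemma bicubic_equation: "bicubic_v ^ 3 * (bicubic_u ^ 3 - mero_const bicubic_0) = mero_const bicubic_3 * bicubic_u ^ 3 - 1"
proof -
 define a b A B K0 K3 where "a = scaled_resolvent zeta" and "b = scaled_resolvent (- 1 - zeta)" and "A = upsilon + zeta"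
  and "B = upsilon - 1 - zeta" and "K0 = mero_const bicubic_0" and "K3 = mero_const bicubic_3"
 have mult: "a * b = A * B" and cubes: "a ^ 3 + b ^ 3 = K3 * B ^ 3 + K0 * A ^ 3"
  using scaled_resolvents_mult scaled_resolvents_cubes by (simp_all only: a_def b_def A_def B_def K0_def K3_def)
 have u: "bicubic_u * A = a" and v: "bicubic_v * B = a" using bicubic_u_mult bicubic_v_mult by (simp_all only: a_def A_def B_def)
 have "a ^ 3 * (a ^ 3 + b ^ 3) = a ^ 3 * a ^ 3 + (A * B) ^ 3" unfolding mult[symmetric] by algebra
 hence "a ^ 3 * a ^ 3 - a ^ 3 * (K0 * A ^ 3) = K3 * B ^ 3 * a ^ 3 - (A * B) ^ 3" unfolding cubes by algebra
 moreover have "(A * B) ^ 3 * (bicubic_v ^ 3 * (bicubic_u ^ 3 - K0)) = (bicubic_v * B) ^ 3 * ((bicubic_u * A) ^ 3 - K0 * A ^ 3)"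
  "(A * B) ^ 3 * (K3 * bicubic_u ^ 3 - 1) = K3 * B ^ 3 * (bicubic_u * A) ^ 3 - (A * B) ^ 3" by algebra+
 ultimately have "(A * B) ^ 3 * (bicubic_v ^ 3 * (bicubic_u ^ 3 - K0)) = (A * B) ^ 3 * (K3 * bicubic_u ^ 3 - 1)"
  by (simp only: u v right_diff_distrib)
 moreover have "(A * B) ^ 3 ~= 0" using upsilon_plus_zeta upsilon_minus_1_zeta by (simp add: A_def B_def)
 ultimately show ?thesis unfolding K0_def K3_def by (metis mult_left_cancel)
qed

lemma bicubic_u_neq_v: "bicubic_u ~= bicubic_v"
proof
 assume "bicubic_u = bicubic_v"
 hence "bicubic_u * (upsilon + zeta) = bicubic_u * (upsilon - 1 - zeta)" unfolding bicubic_u_mult using bicubic_v_mult by simp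
 moreover have "bicubic_u ~= 0" using bicubic_u_mult scaled_resolvent_nonzero by auto
 ultimately have "upsilon + zeta = upsilon - 1 - zeta" by simp
 hence zero: "1 + 2 * zeta = 0" by algebra
 have "(1 + 2 * zeta) * (1 + 2 * zeta) = - 3" using mero_omega_mult by algebra
 hence "(3 :: mero) = 0" unfolding zero by simp
 thus False using mero_const_eq_0_iff[of 3] by (simp add: mero_const_numeral)
qed

lemma upsilon_bicubic: "upsilon = - (bicubic_v * (1 + zeta) + bicubic_u * zeta) / (bicubic_u - bicubic_v)"
proof -
 have "bicubic_u * (upsilon + zeta) = bicubic_v * (upsilon - 1 - zeta)" unfolding bicubic_u_mult bicubic_v_mult ..
 hence "upsilon * (bicubic_u - bicubic_v) = - (bicubic_v * (1 + zeta) + bicubic_u * zeta)" by algebra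
 thus ?thesis using bicubic_u_neq_v by (simp add: eq_divide_eq)
qed

lemma bicubic_u_not_const: "bicubic_u ~: range mero_const"
proof
 assume "bicubic_u : range mero_const"
 then obtain k where k: "bicubic_u = mero_const k" by blast
 have eq: "bicubic_v ^ 3 * mero_const (k ^ 3 - bicubic_0) = mero_const (bicubic_3 * k ^ 3 - 1)"
  using bicubic_equation unfolding k by (simp add: mero_const_diff mero_const_mult mero_const_power mero_const_1)
 have "k ^ 3 - bicubic_0 ~= 0" proof
  assume zero: "k ^ 3 - bicubic_0 = 0"
  have "mero_const (bicubic_3 * k ^ 3 - 1) = 0" using eq unfolding zero by (simp add: mero_const_0)
  hence "bicubic_3 * k ^ 3 - 1 = 0" by (simp only: mero_const_eq_0_iff)
  moreover have "k ^ 3 = bicubic_0" using zero by simp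
  ultimately show False using bicubic_coeffs_mult by (simp add: mult.commute)
 qed
 hence "bicubic_v ^ 3 = mero_const ((bicubic_3 * k ^ 3 - 1) / (k ^ 3 - bicubic_0))"
  using eq by (simp add: mero_const_divide eq_divide_eq mero_const_eq_0_iff)
 then obtain l where l: "bicubic_v = mero_const l" using const_if_cube_const by blast
 have "upsilon = mero_const (- (l * (1 + omega) + k * omega) / (k - l))"
  by (subst upsilon_bicubic) (simp add: k l mero_const_divide mero_const_minus mero_const_add mero_const_mult mero_const_diff mero_const_1)
 thus False using upsilon_not_const by blast
qed

lemma roots_from_resolvents:
 defines "s == - (upsilon ^ 2 - 1) / upsilon" and "t == - ((upsilon - 1) ^ 2) / upsilon"
 shows "g1 = t / ((s + (- 1 - zeta) * resolvent zeta + zeta * resolvent (- 1 - zeta)) / 3)"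
  "g2 = t / ((s + zeta * resolvent zeta + (- 1 - zeta) * resolvent (- 1 - zeta)) / 3)"
proof -
 have "upsilon * (g1 * g2 + g2 * g0 + g0 * g1) = - (upsilon ^ 2 - 1)"
  using roots_second_symmetric unfolding g0_eq by algebra
 hence s: "s = g1 * g2 + g2 * g0 + g0 * g1" unfolding s_def using upsilon_neq_0 by (metis nonzero_mult_div_cancel_left)
 have "upsilon * (g1 * g2 * g0) = - ((upsilon - 1) ^ 2)" using roots_product unfolding g0_eq by algebra
 hence t: "t = g1 * g2 * g0" unfolding t_def using upsilon_neq_0 by (metis nonzero_mult_div_cancel_left)
 have "t ~= 0" using upsilon_minus_1 upsilon_neq_0 by (simp add: t_def)
 hence nz: "g1 ~= 0" "g2 ~= 0" "g0 ~= 0" unfolding t by auto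
 have three: "(3 :: mero) ~= 0" using mero_const_eq_0_iff[of 3] by (simp add: mero_const_numeral)
 have "s + (- 1 - zeta) * resolvent zeta + zeta * resolvent (- 1 - zeta) = g2 * g0 * 3"
  "s + zeta * resolvent zeta + (- 1 - zeta) * resolvent (- 1 - zeta) = g0 * g1 * 3"
  unfolding s resolvent_def using mero_omega_mult by algebra+
 thus "g1 = t / ((s + (- 1 - zeta) * resolvent zeta + zeta * resolvent (- 1 - zeta)) / 3)"
  "g2 = t / ((s + zeta * resolvent zeta + (- 1 - zeta) * resolvent (- 1 - zeta)) / 3)"
  using nz three by (simp_all add: t)
qed

lemma adjoin_bicubic: "C_adjoin {upsilon, g1, g2} = C_adjoin {bicubic_u, bicubic_v}"
proof
 show "C_adjoin {bicubic_u, bicubic_v} <= C_adjoin {upsilon, g1, g2}" proof (rule C_adjoin_minimal[OF _ C_subfield_hull])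
  have "upsilon : C_adjoin {upsilon, g1, g2}" "g1 : C_adjoin {upsilon, g1, g2}" "g2 : C_adjoin {upsilon, g1, g2}"
   using C_adjoin_subset[of "{upsilon, g1, g2}"] by auto
  thus "{bicubic_u, bicubic_v} <= C_adjoin {upsilon, g1, g2}"
   unfolding bicubic_u_def bicubic_v_def scaled_resolvent_def resolvent_def g0_eq
   by (intro insert_subsetI empty_subsetI C_subfield_closed[OF C_subfield_hull])
 qed
 define K where "K = C_adjoin {bicubic_u, bicubic_v}"
 have K_field: "C_subfield K" and gens: "bicubic_u : K" "bicubic_v : K"
  using C_subfield_hull C_adjoin_subset[of "{bicubic_u, bicubic_v}"] by (auto simp: K_def)
 note closed = C_subfield_closed[OF K_field]
 have upsilon: "upsilon : K" by (subst upsilon_bicubic) (intro closed gens)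
 have "bicubic_u * (upsilon + zeta) : K" by (intro closed gens upsilon)
 hence a: "scaled_resolvent zeta : K" by (simp only: bicubic_u_mult)
 have "scaled_resolvent (- 1 - zeta) = (upsilon + zeta) * (upsilon - 1 - zeta) / scaled_resolvent zeta"
  using scaled_resolvents_mult scaled_resolvent_nonzero by (simp add: eq_divide_eq mult.commute)
 also have "... : K" by (intro closed upsilon a)
 finally have b: "scaled_resolvent (- 1 - zeta) : K" .
 have "resolvent z = scaled_resolvent z * (upsilon - 1) / upsilon" for z
  using upsilon_minus_1 upsilon_neq_0 by (simp add: scaled_resolvent_def)
 hence resolvents: "resolvent zeta : K" "resolvent (- 1 - zeta) : K" by (simp only: closed upsilon a b)+
 have "g1 : K" "g2 : K" by (subst roots_from_resolvents, intro closed upsilon resolvents)+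
 thus "C_adjoin {upsilon, g1, g2} <= C_adjoin {bicubic_u, bicubic_v}"
  using upsilon by (intro C_adjoin_minimal C_subfield_hull) (simp add: K_def)
qed

theorem genus_function_field: "has_genus (C_adjoin {upsilon, g1, g2}) 4"
proof -
 have nz: "bicubic_0 ~= 0" "bicubic_3 ~= 0" using bicubic_coeffs_mult by auto
 obtain c where "bicubic_3 * c ^ 3 = 1" by (rule complex_cube_root[OF nz(2)])
 then interpret bicubic bicubic_u bicubic_v bicubic_0 bicubic_3 c
  by unfold_locales (simp_all add: bicubic_equation nz bicubic_coeffs_mult bicubic_u_not_const)
 show ?thesis unfolding adjoin_bicubic by (rule genus)
qed

section \<open>The plane model\<close>

lemma eval2_pCons [simp]: "eval2 (pCons a p) s t = eval1 a s + t * eval2 p s t" by (simp add: eval2_def map_poly_pCons flip: eval1_def)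

lemma eval2_0 [simp]: "eval2 0 s t = 0" by (simp add: eval2_def)

lemma eval2_add: "eval2 (p + q) s t = eval2 p s t + eval2 q s t"
proof -
 have "map_poly (%r. eval1 r s) (p + q) = map_poly (%r. eval1 r s) p + map_poly (%r. eval1 r s) q"
  by (rule poly_eqI) (simp add: coeff_map_poly eval1_add)
 thus ?thesis by (simp add: eval2_def flip: eval1_def)
qed

lemma eval2_smult: "eval2 (smult a p) s t = eval1 a s * eval2 p s t" by (induction p) (simp_all add: eval1_mult algebra_simps)

lemma eval2_mult: "eval2 (p * q) s t = eval2 p s t * eval2 q s t" by (induction p) (simp_all add: eval2_add eval2_smult algebra_simps)

lemma eval2_minus: "eval2 (- p) s t = - eval2 p s t" by (induction p) (simp_all add: eval1_minus)

lemma eval2_diff: "eval2 (p - q) s t = eval2 p s t - eval2 q s t" using eval2_add[of p "- q" s t] by (simp add: eval2_minus)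

lemma eval2_base: "eval2 Z1 s t = s" "eval2 Z2 s t = t" "eval2 1 s t = 1" "eval2 (numeral k) s t = numeral k"
 by (simp_all add: Z1_def Z2_def one_pCons numeral_poly mero_const_0 mero_const_1 mero_const_numeral)

abbreviation model :: "complex poly poly" where
 "model == (Z1 + Z2) * (Z1 + Z2 + 2) * Z1\<^sup>2 * Z2\<^sup>2
    + 2 * (Z1 + Z2 + 1) * (Z1 + Z2 + 2) * Z1 * Z2
    - (Z1 + Z2)\<^sup>2 * (Z1 + Z2 + 1)\<^sup>2"

lemma eval2_model: "eval2 model g1 g2 = 0" using plane_equation by (simp add: eval2_add eval2_diff eval2_mult eval2_base power2_eq_square)

lemma model_expand:
 "model = [:[:0, 0, -1, -2, -1:], [:0, 2, 0, -2:], [:-1, 0, -2, 2, 1:], [:-2, -2, 2, 2:], [:-1, 0, 1:]:]"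
 by (simp add: Z1_def Z2_def power2_eq_square numeral_poly one_pCons)

definition specialize :: "'a :: comm_ring_1 => 'a poly poly => 'a poly" where
 "specialize c p = map_poly (%r. poly r c) p"

lemma coeff_specialize: "coeff (specialize c p) k = poly (coeff p k) c" by (simp add: specialize_def coeff_map_poly)

lemma specialize_mult: "specialize c (p * q) = specialize c p * specialize c q"
 by (rule poly_eqI) (simp add: coeff_specialize coeff_mult poly_sum)

lemma constant_factor_unit:
 fixes p q :: "complex poly poly"
 assumes factor: "p = [:r:] * q" and "p ~= 0" and no_common_root: "!!c. EX k. poly (coeff p k) c ~= 0"
 shows "[:r:] dvd 1"
proof -
 have "poly r c ~= 0" for c using no_common_root[of c] by (auto simp: factor)
 hence "degree r = 0" using fundamental_theorem_of_algebra[of r] by (auto simp: constant_degree)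
 then obtain k where k: "r = [:k:]" by (metis degree_eq_zeroE)
 have "k ~= 0" using assms(2) by (auto simp: factor k)
 hence "[:r:] * [:[:1 / k:]:] = 1" by (simp add: k one_pCons)
 thus ?thesis by (metis dvdI)
qed

text \<open>Eisenstein's criterion at \<open>c\<close> for the reciprocal polynomial.\<close>
lemma specialize_const_factor:
 fixes a b :: "'a :: idom poly poly"
 assumes const: "specialize c (a * b) = [:k:]" "k ~= 0" and simple: "poly (pderiv (lead_coeff (a * b))) c ~= 0"
 shows "degree a = 0 | degree b = 0"
proof (rule ccontr)
 assume "~ (degree a = 0 | degree b = 0)"
 hence pos: "degree a > 0" "degree b > 0" by auto
 have product: "specialize c a * specialize c b = [:k:]" using const(1) by (simp only: specialize_mult)
 hence "specialize c a ~= 0" "specialize c b ~= 0" using const(2) by auto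
 hence "degree (specialize c a) + degree (specialize c b) = 0" using product by (metis degree_mult_eq degree_pCons_0)
 hence "coeff (specialize c a) (degree a) = 0" "coeff (specialize c b) (degree b) = 0" using pos by (simp_all add: coeff_eq_0)
 hence "poly (lead_coeff a) c = 0" "poly (lead_coeff b) c = 0" by (simp_all add: coeff_specialize)
 thus False using simple by (simp add: lead_coeff_mult pderiv_mult)
qed

text \<open>
  At \<open>Z1 = 1\<close> the polynomial becomes the constant \<open>-4\<close> while its leading coefficient \<open>Z1\<^sup>2 - 1\<close> has a
  simple zero there.
\<close>
lemma model_irreducible: "irreducible model"
proof (rule irreducibleI)
 define p where "p = model"
 have p_eq: "p = [:[:0, 0, -1, -2, -1:], [:0, 2, 0, -2:], [:-1, 0, -2, 2, 1:], [:-2, -2, 2, 2:], [:-1, 0, 1:]:]"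
  unfolding p_def by (rule model_expand)
 have coeffs: "coeff p 0 = [:0, 0, -1, -2, -1:]" "coeff p 2 = [:-1, 0, -2, 2, 1:]" "coeff p 4 = [:-1, 0, 1:]"
  by (simp_all add: p_eq numeral_eq_Suc)
 have degree: "degree p = 4" by (simp add: p_eq)
 hence nz: "p ~= 0" by auto
 thus "model ~= 0" unfolding p_def .
 show "~ model dvd 1" proof
  assume "model dvd 1"
  then obtain q where q: "p * q = 1" unfolding p_def by (metis dvdE)
  hence "q ~= 0" by auto
  hence "degree p + degree q = 0" using degree_mult_eq[OF nz, of q] by (simp add: q)
  thus False using degree by simp
 qed
 have no_common_root: "EX k. poly (coeff p k) c ~= 0" for c proof (rule ccontr)
  assume "~ ?thesis"
  hence zero: "poly (coeff p k) c = 0" for k by blast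
  have "c * c = 1" using zero[of 4] by (simp add: coeffs)
  hence "c = 1 | c = - 1" using square_eq_1_iff[of c] by (simp add: power2_eq_square)
  thus False using zero[of 0] zero[of 2] by (auto simp: coeffs)
 qed
 have unit: "a dvd 1" if "p = a * b" "degree a = 0" for a b
  using that constant_factor_unit[OF _ nz no_common_root] by (metis degree_eq_zeroE)
 fix a b assume "model = a * b"
 hence ab: "p = a * b" by (simp only: p_def)
 have "specialize 1 p = [:-4:]" by (simp add: p_eq specialize_def map_poly_pCons)
 moreover have "poly (pderiv (lead_coeff p)) 1 ~= 0" by (simp add: degree coeffs pderiv_pCons)
 ultimately have "degree a = 0 | degree b = 0" unfolding ab by (intro specialize_const_factor[of 1 a b "- 4"]) simp_all
 thus "a dvd 1 | b dvd 1" using unit[of a b] unit[of b a] ab by (auto simp: mult.commute)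
qed

theorem proposition6p5:
  shows "A0 (Gamma_principal 2 \<inter> Gamma1 7) = C_adjoin {upsilon, g1, g2} \<and>
    C_adjoin {upsilon, g1, g2} = C_adjoin {g1, g2} \<and>
    plane_model (A0 (Gamma_principal 2 \<inter> Gamma1 7)) g1 g2
      ((Z1 + Z2) * (Z1 + Z2 + 2) * Z1\<^sup>2 * Z2\<^sup>2
        + 2 * (Z1 + Z2 + 1) * (Z1 + Z2 + 2) * Z1 * Z2
        - (Z1 + Z2)\<^sup>2 * (Z1 + Z2 + 1)\<^sup>2) \<and>
    has_genus (A0 (Gamma_principal 2 \<inter> Gamma1 7)) 4"
proof (intro conjI)
 show "A0 Gamma_2_7 = C_adjoin {upsilon, g1, g2}" by (rule A0_Gamma_2_7)
 show "C_adjoin {upsilon, g1, g2} = C_adjoin {g1, g2}" by (rule adjoin_upsilon_g_eq)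
 show "plane_model (A0 Gamma_2_7) g1 g2 model" unfolding plane_model_def A0_Gamma_2_7 adjoin_upsilon_g_eq
  by (intro conjI model_irreducible eval2_model refl)
 show "has_genus (A0 Gamma_2_7) 4" unfolding A0_Gamma_2_7 by (rule genus_function_field)
qed

end
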